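(* Let $R$ be a commutative ring. The fibers of the map $\mathrm{disc}:\mathrm{Quad}(R)\to\mathrm{Disc}(R)$ have a unique action of the group $\mathrm{AS}(R)$ compatible with the inclusion of monoids $i:\mathrm{AS}(R)\hookrightarrow\mathrm{Quad}(R)$. Moreover, for a discriminant $d\in R$, the kernel of this action on the fiber $\mathrm{disc}^{-1}(dR^{\times 2})$ contains (the image in $\mathrm{AS}(R)$ of) $\mathrm{ann}_R(d)[4]$.
   Context: Notation: $R[4]=\{a\in R:4a=0\}$; $\wp(R)[4]=\{r+r^2:r\in R\}\cap R[4]$, which is an additive subgroup of $R[4]$; $\mathrm{AS}(R)=R[4]/\wp(R)[4]$ (the Artin-Schreier group); $\mathrm{ann}_R(d)[4]=\{a\in R: da=0,\ 4a=0\}$. A quadratic $R$-algebra is an associative $R$-algebra $S$ with $1$ that is locally free of rank $2$ as an $R$-module; it is commutative and has a unique standard involution $\sigma$ (an $R$-linear (anti-)automorphism with $\sigma^2=\mathrm{id}$ and $x\sigma(x)\in R$). $\mathrm{Quad}(R)$ is the set of isomorphism classes of quadratic $R$-algebras. $\mathrm{Disc}(R)$ is the set of isomorphism classes of discriminants over $R$: pairs $(d,L)$ with $L$ an invertible $R$-module and $d\in (L^\vee)^{\otimes 2}$ such that there is $\bar t\in L^\vee/2L^\vee$ with $\bar t\otimes\bar t=\bar d$ in $(L^\vee)^{\otimes 2}/4(L^\vee)^{\otimes 2}$; an isomorphism $(d,L)\to(d',L')$ is an isomorphism $f:L\to L'$ with $(f^\vee)^{\otimes 2}(d')=d$. When $L=R$,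 a discriminant is an element $d\in R$ that is a square modulo $4R$, and its isomorphism class is written $dR^{\times 2}$. The map $\mathrm{disc}$ sends $S$ to $(d(S),\bigwedge^2 S)$ with $d(S):(\bigwedge^2S)^{\otimes 2}\to R$, $(x\wedge y)\otimes(z\wedge w)\mapsto(x\sigma(y)-\sigma(x)y)(z\sigma(w)-\sigma(z)w)$. $\mathrm{Quad}(R)$ is a commutative monoid under the operation $*$ defined as follows. If $S=R\oplus Rx$, $T=R\oplus Ry$ are free with $x^2=tx-n$, $y^2=sy-m$, then $S*T=R\oplus Rw$ with $w^2=(st)w-(mt^2+ns^2-4nm)$. If $\phi:S\to S'=R\oplus Rx'$, $\psi:T\to T'=R\oplus Ry'$ are isomorphisms with $\phi(x)=ux'+r$, $\psi(y)=vy'+q$, there is an isomorphism $\phi*\psi:S*T\to S'*T'$, $w\mapsto uvw'+(qt+rs-2qr)$. In general $S*T$ is obtained by forming these products over an affine open cover of $\operatorname{Spec}R$ on which $S,T$ are free and gluing along the isomorphisms $\phi*\psi$ induced by the transition isomorphisms. The identity is the class of $R\times R$. The map $i:\mathrm{AS}(R)\to\mathrm{Quad}(R)$ sends the class of $n\in R[4]$ to the class of $R[x]/(x^2-x+n)$; it is an injective monoid homomorphism. An action of $\mathrm{AS}(R)$ on the fibers is compatible with $i$ if $a\cdot[S]=i(a)*[S]$ for all $a\in\mathrm{AS}(R)$ and all $[S]$ in the fiber. *)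

theory Defs
  imports "HOL-Algebra.QuotRing" "HOL-Algebra.UnivPoly" "HOL-Algebra.Group_Action"
begin

section \<open>Modules and algebras over a commutative ring\<close>

text \<open>Modules and algebras are records of type \<^typ>\<open>('a, 'b) module\<close>; for a mere module the fields
  \<open>mult\<close> and \<open>one\<close> are never looked at.  \<open>reg R\<close> is \<open>R\<close> as an algebra over itself.\<close>

definition reg :: "('a, 'r) ring_scheme \<Rightarrow> ('a, 'a) module"
  where "reg R = \<lparr>carrier = carrier R, mult = mult R, one = \<one>\<^bsub>R\<^esub>, zero = \<zero>\<^bsub>R\<^esub>,
    add = add R, smult = mult R\<rparr>"

definition mod_hom :: "('a, 'r) ring_scheme \<Rightarrow> ('a, 'b, 'm) module_scheme
    \<Rightarrow> ('a, 'c, 'n) module_scheme \<Rightarrow> ('b \<Rightarrow> 'c) set"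
  where "mod_hom R M N = {f \<in> carrier M \<rightarrow> carrier N.
    (\<forall>x\<in>carrier M. \<forall>y\<in>carrier M. f (x \<oplus>\<^bsub>M\<^esub> y) = f x \<oplus>\<^bsub>N\<^esub> f y) \<and>
    (\<forall>a\<in>carrier R. \<forall>x\<in>carrier M. f (a \<odot>\<^bsub>M\<^esub> x) = a \<odot>\<^bsub>N\<^esub> f x)}"

definition mod_iso :: "('a, 'r) ring_scheme \<Rightarrow> ('a, 'b, 'm) module_scheme
    \<Rightarrow> ('a, 'c, 'n) module_scheme \<Rightarrow> ('b \<Rightarrow> 'c) set"
  where "mod_iso R M N = {f \<in> mod_hom R M N. bij_betw f (carrier M) (carrier N)}"

definition alg_iso :: "('a, 'r) ring_scheme \<Rightarrow> ('a, 'b, 'm) module_scheme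
    \<Rightarrow> ('a, 'c, 'n) module_scheme \<Rightarrow> ('b \<Rightarrow> 'c) set"
  where "alg_iso R S T = ring_iso S T \<inter> mod_hom R S T"

text \<open>The library's locale \<^locale>\<open>algebra\<close> is restricted to commutative algebras.\<close>

locale assoc_algebra = module + ring M +
  assumes smult_mult_left: "\<lbrakk>a \<in> carrier R; x \<in> carrier M; y \<in> carrier M\<rbrakk>
      \<Longrightarrow> (a \<odot>\<^bsub>M\<^esub> x) \<otimes>\<^bsub>M\<^esub> y = a \<odot>\<^bsub>M\<^esub> (x \<otimes>\<^bsub>M\<^esub> y)"
    and smult_mult_right: "\<lbrakk>a \<in> carrier R; x \<in> carrier M; y \<in> carrier M\<rbrakk>
      \<Longrightarrow> x \<otimes>\<^bsub>M\<^esub> (a \<odot>\<^bsub>M\<^esub> y) = a \<odot>\<^bsub>M\<^esub> (x \<otimes>\<^bsub>M\<^esub> y)"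

definition mspan :: "('a, 'r) ring_scheme \<Rightarrow> ('a, 'b, 'm) module_scheme \<Rightarrow> 'b set \<Rightarrow> 'b set"
  where "mspan R M K = \<Inter>{H. submodule H R M \<and> K \<subseteq> H}"

definition multiples :: "('a, 'b, 'm) module_scheme \<Rightarrow> nat \<Rightarrow> 'b set"
  where "multiples M k = {[k] \<cdot>\<^bsub>M\<^esub> x | x. x \<in> carrier M}"

text \<open>The quotient by a submodule, or of an algebra by a two-sided ideal; it extends \<^const>\<open>FactRing\<close>
  by the induced scalar multiplication.\<close>

definition quot :: "('a, 'b, 'm) module_scheme \<Rightarrow> 'b set \<Rightarrow> ('a, 'b set) module"
  where "quot M H = \<lparr>carrier = a_rcosets\<^bsub>M\<^esub> H, mult = rcoset_mult M H, one = H +>\<^bsub>M\<^esub> \<one>\<^bsub>M\<^esub>,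
    zero = H, add = set_add M, smult = (\<lambda>a X. \<Union>x\<in>X. H +>\<^bsub>M\<^esub> (a \<odot>\<^bsub>M\<^esub> x))\<rparr>"

definition dual :: "('a, 'r) ring_scheme \<Rightarrow> ('a, 'b, 'm) module_scheme \<Rightarrow> ('a, 'b \<Rightarrow> 'a) module"
  where "dual R M = \<lparr>carrier = mod_hom R M (reg R) \<inter> extensional (carrier M),
    mult = undefined, one = undefined,
    zero = (\<lambda>x\<in>carrier M. \<zero>\<^bsub>R\<^esub>),
    add = (\<lambda>\<phi> \<psi>. \<lambda>x\<in>carrier M. \<phi> x \<oplus>\<^bsub>R\<^esub> \<psi> x),
    smult = (\<lambda>a \<phi>. \<lambda>x\<in>carrier M. a \<otimes>\<^bsub>R\<^esub> \<phi> x)\<rparr>"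

definition dual_map :: "('a, 'b, 'm) module_scheme \<Rightarrow> ('b \<Rightarrow> 'c) \<Rightarrow> ('c \<Rightarrow> 'a) \<Rightarrow> ('b \<Rightarrow> 'a)"
  where "dual_map M f \<phi> = (\<lambda>x\<in>carrier M. \<phi> (f x))"

subsection \<open>Tensor products\<close>

definition free_mod :: "('a, 'r) ring_scheme \<Rightarrow> 'i set \<Rightarrow> ('a, 'i \<Rightarrow> 'a) module"
  where "free_mod R B = \<lparr>carrier = {c. (\<forall>b. c b \<in> carrier R) \<and> finite {b. c b \<noteq> \<zero>\<^bsub>R\<^esub>} \<and>
      (\<forall>b. b \<notin> B \<longrightarrow> c b = \<zero>\<^bsub>R\<^esub>)},
    mult = undefined, one = undefined,
    zero = (\<lambda>_. \<zero>\<^bsub>R\<^esub>),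
    add = (\<lambda>c e b. c b \<oplus>\<^bsub>R\<^esub> e b),
    smult = (\<lambda>a c b. a \<otimes>\<^bsub>R\<^esub> c b)\<rparr>"

definition free_gen :: "('a, 'r) ring_scheme \<Rightarrow> 'i \<Rightarrow> 'i \<Rightarrow> 'a"
  where "free_gen R b = (\<lambda>b'. if b' = b then \<one>\<^bsub>R\<^esub> else \<zero>\<^bsub>R\<^esub>)"

definition tensor_rels :: "('a, 'r) ring_scheme \<Rightarrow> ('a, 'b, 'm) module_scheme
    \<Rightarrow> ('a, 'c, 'n) module_scheme \<Rightarrow> ('b \<times> 'c \<Rightarrow> 'a) set"
  where "tensor_rels R M N =
    (let F = free_mod R (carrier M \<times> carrier N); g = (\<lambda>x y. free_gen R (x, y)) in
      {g (x \<oplus>\<^bsub>M\<^esub> x') y \<ominus>\<^bsub>F\<^esub> (g x y \<oplus>\<^bsub>F\<^esub> g x' y) | x x' y.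
        x \<in> carrier M \<and> x' \<in> carrier M \<and> y \<in> carrier N} \<union>
      {g x (y \<oplus>\<^bsub>N\<^esub> y') \<ominus>\<^bsub>F\<^esub> (g x y \<oplus>\<^bsub>F\<^esub> g x y') | x y y'.
        x \<in> carrier M \<and> y \<in> carrier N \<and> y' \<in> carrier N} \<union>
      {g (a \<odot>\<^bsub>M\<^esub> x) y \<ominus>\<^bsub>F\<^esub> a \<odot>\<^bsub>F\<^esub> g x y | a x y.
        a \<in> carrier R \<and> x \<in> carrier M \<and> y \<in> carrier N} \<union>
      {g x (a \<odot>\<^bsub>N\<^esub> y) \<ominus>\<^bsub>F\<^esub> a \<odot>\<^bsub>F\<^esub> g x y | a x y.
        a \<in> carrier R \<and> x \<in> carrier M \<and> y \<in> carrier N})"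

definition tensor_kernel :: "('a, 'r) ring_scheme \<Rightarrow> ('a, 'b, 'm) module_scheme
    \<Rightarrow> ('a, 'c, 'n) module_scheme \<Rightarrow> ('b \<times> 'c \<Rightarrow> 'a) set"
  where "tensor_kernel R M N =
    mspan R (free_mod R (carrier M \<times> carrier N)) (tensor_rels R M N)"

definition tensor :: "('a, 'r) ring_scheme \<Rightarrow> ('a, 'b, 'm) module_scheme
    \<Rightarrow> ('a, 'c, 'n) module_scheme \<Rightarrow> ('a, ('b \<times> 'c \<Rightarrow> 'a) set) module"
  where "tensor R M N = quot (free_mod R (carrier M \<times> carrier N)) (tensor_kernel R M N)"

definition pure_tensor :: "('a, 'r) ring_scheme \<Rightarrow> ('a, 'b, 'm) module_scheme
    \<Rightarrow> ('a, 'c, 'n) module_scheme \<Rightarrow> 'b \<Rightarrow> 'c \<Rightarrow> ('b \<times> 'c \<Rightarrow> 'a) set"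
  where "pure_tensor R M N x y =
    tensor_kernel R M N +>\<^bsub>free_mod R (carrier M \<times> carrier N)\<^esub> free_gen R (x, y)"

text \<open>The linear map out of \<open>M \<otimes> N\<close> that sends \<open>x \<otimes> y\<close> to \<open>\<beta> x y\<close>, for bilinear \<open>\<beta>\<close> with values
  in \<open>Q\<close>.\<close>

definition tensor_lift :: "('a, 'r) ring_scheme \<Rightarrow> ('a, 'd, 'q) module_scheme
    \<Rightarrow> ('b \<Rightarrow> 'c \<Rightarrow> 'd) \<Rightarrow> ('b \<times> 'c \<Rightarrow> 'a) set \<Rightarrow> 'd"
  where "tensor_lift R Q \<beta> X =
    the_elem ((\<lambda>c. \<Oplus>\<^bsub>Q\<^esub>p \<in> {p. c p \<noteq> \<zero>\<^bsub>R\<^esub>}. c p \<odot>\<^bsub>Q\<^esub> \<beta> (fst p) (snd p)) ` X)"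

definition ext2_kernel :: "('a, 'r) ring_scheme \<Rightarrow> ('a, 'b, 'm) module_scheme
    \<Rightarrow> ('b \<times> 'b \<Rightarrow> 'a) set set"
  where "ext2_kernel R M = mspan R (tensor R M M) {pure_tensor R M M x x | x. x \<in> carrier M}"

definition ext2 :: "('a, 'r) ring_scheme \<Rightarrow> ('a, 'b, 'm) module_scheme
    \<Rightarrow> ('a, ('b \<times> 'b \<Rightarrow> 'a) set set) module"
  where "ext2 R M = quot (tensor R M M) (ext2_kernel R M)"

definition wedge :: "('a, 'r) ring_scheme \<Rightarrow> ('a, 'b, 'm) module_scheme
    \<Rightarrow> 'b \<Rightarrow> 'b \<Rightarrow> ('b \<times> 'b \<Rightarrow> 'a) set set"
  where "wedge R M x y = ext2_kernel R M +>\<^bsub>tensor R M M\<^esub> pure_tensor R M M x y"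

subsection \<open>Localization and local freeness\<close>

text \<open>\<open>frac R W M x s\<close> is the fraction \<open>x / s\<close> in \<open>W\<^sup>-\<^sup>1M\<close>, for a multiplicative set \<open>W\<close> of \<open>R\<close>.\<close>

definition frac :: "('a, 'r) ring_scheme \<Rightarrow> 'a set \<Rightarrow> ('a, 'b, 'm) module_scheme
    \<Rightarrow> 'b \<Rightarrow> 'a \<Rightarrow> ('b \<times> 'a) set"
  where "frac R W M x s = {(y, t). y \<in> carrier M \<and> t \<in> W \<and>
    (\<exists>u\<in>W. u \<odot>\<^bsub>M\<^esub> (t \<odot>\<^bsub>M\<^esub> x) = u \<odot>\<^bsub>M\<^esub> (s \<odot>\<^bsub>M\<^esub> y))}"

definition loc :: "('a, 'r) ring_scheme \<Rightarrow> 'a set \<Rightarrow> ('a, 'b, 'm) module_scheme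
    \<Rightarrow> (('a \<times> 'a) set, ('b \<times> 'a) set) module"
  where "loc R W M = \<lparr>carrier = {frac R W M x s | x s. x \<in> carrier M \<and> s \<in> W},
    mult = (\<lambda>X Y. \<Union>(x, s)\<in>X. \<Union>(y, t)\<in>Y. frac R W M (x \<otimes>\<^bsub>M\<^esub> y) (s \<otimes>\<^bsub>R\<^esub> t)),
    one = frac R W M \<one>\<^bsub>M\<^esub> \<one>\<^bsub>R\<^esub>,
    zero = frac R W M \<zero>\<^bsub>M\<^esub> \<one>\<^bsub>R\<^esub>,
    add = (\<lambda>X Y. \<Union>(x, s)\<in>X. \<Union>(y, t)\<in>Y.
      frac R W M (t \<odot>\<^bsub>M\<^esub> x \<oplus>\<^bsub>M\<^esub> s \<odot>\<^bsub>M\<^esub> y) (s \<otimes>\<^bsub>R\<^esub> t)),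
    smult = (\<lambda>A X. \<Union>(a, s)\<in>A. \<Union>(x, t)\<in>X. frac R W M (a \<odot>\<^bsub>M\<^esub> x) (s \<otimes>\<^bsub>R\<^esub> t))\<rparr>"

abbreviation loc_ring :: "('a, 'r) ring_scheme \<Rightarrow> 'a set
    \<Rightarrow> (('a \<times> 'a) set, ('a \<times> 'a) set) module"
  where "loc_ring R W \<equiv> loc R W (reg R)"

text \<open>The canonical map from a localization to the localization at a larger multiplicative set
  \<open>W\<close>.\<close>

definition loc_res :: "('a, 'r) ring_scheme \<Rightarrow> 'a set \<Rightarrow> ('a, 'b, 'm) module_scheme
    \<Rightarrow> ('b \<times> 'a) set \<Rightarrow> ('b \<times> 'a) set"
  where "loc_res R W M X = (\<Union>(x, s)\<in>X. frac R W M x s)"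

definition powers :: "('a, 'r) ring_scheme \<Rightarrow> 'a \<Rightarrow> 'a set"
  where "powers R f = {f [^]\<^bsub>R\<^esub> k | k::nat. True}"

text \<open>Covers of \<open>Spec R\<close> by principal open sets \<open>D(f)\<close>, \<open>f \<in> F\<close>; these are cofinal among all affine
  open covers.\<close>

definition principal_cover :: "('a, 'r) ring_scheme \<Rightarrow> 'a set \<Rightarrow> bool"
  where "principal_cover R F \<longleftrightarrow> finite F \<and> F \<subseteq> carrier R \<and> Idl\<^bsub>R\<^esub> F = carrier R"

definition free_of_rank :: "('a, 'r) ring_scheme \<Rightarrow> ('a, 'b, 'm) module_scheme \<Rightarrow> nat \<Rightarrow> bool"
  where "free_of_rank R M n \<longleftrightarrow> (\<exists>e\<in>{..<n} \<rightarrow> carrier M. \<forall>x\<in>carrier M.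
    \<exists>!c. c \<in> {..<n} \<rightarrow>\<^sub>E carrier R \<and> x = (\<Oplus>\<^bsub>M\<^esub>i \<in> {..<n}. c i \<odot>\<^bsub>M\<^esub> e i))"

definition locally_free :: "('a, 'r) ring_scheme \<Rightarrow> ('a, 'b, 'm) module_scheme \<Rightarrow> nat \<Rightarrow> bool"
  where "locally_free R M n \<longleftrightarrow> (\<exists>F. principal_cover R F \<and>
    (\<forall>f\<in>F. free_of_rank (loc_ring R (powers R f)) (loc R (powers R f) M) n))"

section \<open>Quadratic algebras\<close>

definition quadratic_algebra :: "('a, 'r) ring_scheme \<Rightarrow> ('a, 'b) module \<Rightarrow> bool"
  where "quadratic_algebra R S \<longleftrightarrow> assoc_algebra R S \<and> locally_free R S 2"

text \<open>An isomorphism class is represented by the set of its members with carrier in \<^typ>\<open>'a list\<close>.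
  This type is large enough: a locally free module of finite rank is a quotient of some \<open>R\<^sup>n\<close>, so
  choosing representatives embeds it into the lists of length \<open>n\<close> over \<open>R\<close>.  Classes of
  discriminants are represented in the same way.  A map that is defined on classes through a
  representative is written as a union over all representatives, since all of them yield the
  same class.\<close>

definition quad_class :: "('a, 'r) ring_scheme \<Rightarrow> ('a, 'b) module \<Rightarrow> ('a, 'a list) module set"
  where "quad_class R S = {T. quadratic_algebra R T \<and> alg_iso R S T \<noteq> {}}"

definition Quad :: "('a, 'r) ring_scheme \<Rightarrow> ('a, 'a list) module set set"
  where "Quad R = {quad_class R S | S :: ('a, 'a list) module. quadratic_algebra R S}"

definition standard_involution :: "('a, 'r) ring_scheme \<Rightarrow> ('a, 'b) module \<Rightarrow> ('b \<Rightarrow> 'b) \<Rightarrow> bool"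
  where "standard_involution R S \<sigma> \<longleftrightarrow> \<sigma> \<in> mod_hom R S S \<and> \<sigma> \<one>\<^bsub>S\<^esub> = \<one>\<^bsub>S\<^esub> \<and>
    (\<forall>x\<in>carrier S. \<forall>y\<in>carrier S. \<sigma> (x \<otimes>\<^bsub>S\<^esub> y) = \<sigma> y \<otimes>\<^bsub>S\<^esub> \<sigma> x) \<and>
    (\<forall>x\<in>carrier S. \<sigma> (\<sigma> x) = x) \<and>
    (\<forall>x\<in>carrier S. \<exists>r\<in>carrier R. x \<otimes>\<^bsub>S\<^esub> \<sigma> x = r \<odot>\<^bsub>S\<^esub> \<one>\<^bsub>S\<^esub>)"

definition std_inv :: "('a, 'r) ring_scheme \<Rightarrow> ('a, 'b) module \<Rightarrow> 'b \<Rightarrow> 'b"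
  where "std_inv R S = (THE \<sigma>. \<sigma> \<in> extensional (carrier S) \<and> standard_involution R S \<sigma>)"

subsection \<open>The product of quadratic algebras\<close>

text \<open>\<open>S = A \<oplus> Ax\<close> is free with \<open>x\<^sup>2 = tx - n\<close>.\<close>

definition quad_gen :: "('a, 'r) ring_scheme \<Rightarrow> ('a, 'b) module \<Rightarrow> 'b \<Rightarrow> 'a \<Rightarrow> 'a \<Rightarrow> bool"
  where "quad_gen A S x t n \<longleftrightarrow> x \<in> carrier S \<and> t \<in> carrier A \<and> n \<in> carrier A \<and>
    (\<forall>z\<in>carrier S. \<exists>!p. p \<in> carrier A \<times> carrier A \<and>
      z = fst p \<odot>\<^bsub>S\<^esub> \<one>\<^bsub>S\<^esub> \<oplus>\<^bsub>S\<^esub> snd p \<odot>\<^bsub>S\<^esub> x) \<and>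
    x \<otimes>\<^bsub>S\<^esub> x = t \<odot>\<^bsub>S\<^esub> x \<ominus>\<^bsub>S\<^esub> n \<odot>\<^bsub>S\<^esub> \<one>\<^bsub>S\<^esub>"

definition star_norm :: "('a, 'r) ring_scheme \<Rightarrow> 'a \<Rightarrow> 'a \<Rightarrow> 'a \<Rightarrow> 'a \<Rightarrow> 'a"
  where "star_norm A t n s m = (m \<otimes>\<^bsub>A\<^esub> (t \<otimes>\<^bsub>A\<^esub> t) \<oplus>\<^bsub>A\<^esub> n \<otimes>\<^bsub>A\<^esub> (s \<otimes>\<^bsub>A\<^esub> s))
    \<ominus>\<^bsub>A\<^esub> [(4::nat)] \<cdot>\<^bsub>A\<^esub> (n \<otimes>\<^bsub>A\<^esub> m)"

text \<open>\<open>U\<close> is obtained by gluing the local products \<open>S\<^sub>f * T\<^sub>f\<close>.  The isomorphism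
  \<open>S\<^sub>f * T\<^sub>f = R\<^sub>f \<oplus> R\<^sub>fw \<longrightarrow> U\<^sub>f\<close> is given by the image \<open>w f\<close> of the generator \<open>w\<close>.  On the overlap
  \<open>D(f) \<inter> D(g)\<close>, i.e. over the localization at \<open>{f\<^sup>ig\<^sup>j}\<close>, the identities of \<open>S\<close> and \<open>T\<close> take the form
  \<open>x f \<mapsto> a (x g) + r\<close> and \<open>y f \<mapsto> b (y g) + q\<close> in terms of the generators, and the two isomorphisms
  have to differ by the induced isomorphism \<open>w f \<mapsto> ab (w g) + (qt + rs - 2qr)\<close>, where \<open>t\<close> and \<open>s\<close>
  belong to \<open>x f\<close> and \<open>y f\<close>.\<close>

definition is_star :: "('a, 'r) ring_scheme \<Rightarrow> ('a, 'b) module \<Rightarrow> ('a, 'c) module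
    \<Rightarrow> ('a, 'd) module \<Rightarrow> bool"
  where "is_star R S T U \<longleftrightarrow> quadratic_algebra R U \<and>
    (\<exists>F x t n y s m w. principal_cover R F \<and>
      (\<forall>f\<in>F. let W = powers R f; A = loc_ring R W in
        quad_gen A (loc R W S) (x f) (t f) (n f) \<and>
        quad_gen A (loc R W T) (y f) (s f) (m f) \<and>
        quad_gen A (loc R W U) (w f) (s f \<otimes>\<^bsub>A\<^esub> t f) (star_norm A (t f) (n f) (s f) (m f))) \<and>
      (\<forall>f\<in>F. \<forall>g\<in>F. let W = powers R f <#>\<^bsub>R\<^esub> powers R g; A = loc_ring R W;
          S' = loc R W S; T' = loc R W T; U' = loc R W U;
          t' = loc_res R W (reg R) (t f); s' = loc_res R W (reg R) (s f) in
        \<forall>a\<in>carrier A. \<forall>r\<in>carrier A. \<forall>b\<in>carrier A. \<forall>q\<in>carrier A.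
          loc_res R W S (x f) = a \<odot>\<^bsub>S'\<^esub> loc_res R W S (x g) \<oplus>\<^bsub>S'\<^esub> r \<odot>\<^bsub>S'\<^esub> \<one>\<^bsub>S'\<^esub> \<longrightarrow>
          loc_res R W T (y f) = b \<odot>\<^bsub>T'\<^esub> loc_res R W T (y g) \<oplus>\<^bsub>T'\<^esub> q \<odot>\<^bsub>T'\<^esub> \<one>\<^bsub>T'\<^esub> \<longrightarrow>
          loc_res R W U (w f) = (a \<otimes>\<^bsub>A\<^esub> b) \<odot>\<^bsub>U'\<^esub> loc_res R W U (w g) \<oplus>\<^bsub>U'\<^esub>
            ((q \<otimes>\<^bsub>A\<^esub> t' \<oplus>\<^bsub>A\<^esub> r \<otimes>\<^bsub>A\<^esub> s') \<ominus>\<^bsub>A\<^esub> [(2::nat)] \<cdot>\<^bsub>A\<^esub> (q \<otimes>\<^bsub>A\<^esub> r)) \<odot>\<^bsub>U'\<^esub> \<one>\<^bsub>U'\<^esub>))"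

definition quad_star :: "('a, 'r) ring_scheme \<Rightarrow> ('a, 'a list) module set
    \<Rightarrow> ('a, 'a list) module set \<Rightarrow> ('a, 'a list) module set"
  where "quad_star R P Q = {U. \<exists>S\<in>P. \<exists>T\<in>Q. is_star R S T U}"

section \<open>Discriminants\<close>

text \<open>Evaluation of an element of \<open>(L\<^sup>\<or>)\<^sup>\<otimes>\<^sup>2\<close> as a bilinear form on \<open>L\<close>, and the map \<open>(f\<^sup>\<or>)\<^sup>\<otimes>\<^sup>2\<close>
  induced by \<open>f : L \<longrightarrow> L'\<close>.\<close>

type_synonym ('a, 'b) dual_sq = "(('b \<Rightarrow> 'a) \<times> ('b \<Rightarrow> 'a) \<Rightarrow> 'a) set"

definition dual_sq_eval :: "('a, 'r) ring_scheme \<Rightarrow> ('a, 'b) dual_sq \<Rightarrow> 'b \<Rightarrow> 'b \<Rightarrow> 'a"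
  where "dual_sq_eval R \<delta> x y = tensor_lift R (reg R) (\<lambda>\<phi> \<psi>. \<phi> x \<otimes>\<^bsub>R\<^esub> \<psi> y) \<delta>"

definition dual_sq_map :: "('a, 'r) ring_scheme \<Rightarrow> ('a, 'b) module \<Rightarrow> ('b \<Rightarrow> 'c)
    \<Rightarrow> ('a, 'c) dual_sq \<Rightarrow> ('a, 'b) dual_sq"
  where "dual_sq_map R L f \<delta> = tensor_lift R (tensor R (dual R L) (dual R L))
    (\<lambda>\<phi> \<psi>. pure_tensor R (dual R L) (dual R L) (dual_map L f \<phi>) (dual_map L f \<psi>)) \<delta>"

definition discriminant :: "('a, 'r) ring_scheme \<Rightarrow> ('a, 'b) dual_sq \<Rightarrow> ('a, 'b) module \<Rightarrow> bool"
  where "discriminant R \<delta> L \<longleftrightarrow> module R L \<and> locally_free R L 1 \<and>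
    (let D = dual R L; E = tensor R D D in
      \<delta> \<in> carrier E \<and>
      (\<exists>X\<in>carrier (quot D (multiples D 2)). \<exists>t\<in>X.
        multiples E 4 +>\<^bsub>E\<^esub> pure_tensor R D D t t = multiples E 4 +>\<^bsub>E\<^esub> \<delta>))"

definition disc_iso :: "('a, 'r) ring_scheme \<Rightarrow> ('a, 'b) dual_sq \<Rightarrow> ('a, 'b) module
    \<Rightarrow> ('a, 'c) dual_sq \<Rightarrow> ('a, 'c) module \<Rightarrow> ('b \<Rightarrow> 'c) set"
  where "disc_iso R \<delta> L \<delta>' L' = {f \<in> mod_iso R L L'. dual_sq_map R L f \<delta>' = \<delta>}"

definition disc_class :: "('a, 'r) ring_scheme \<Rightarrow> ('a, 'b) dual_sq \<Rightarrow> ('a, 'b) module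
    \<Rightarrow> (('a, 'a list) dual_sq \<times> ('a, 'a list) module) set"
  where "disc_class R \<delta> L = {(\<delta>', L'). discriminant R \<delta>' L' \<and> disc_iso R \<delta> L \<delta>' L' \<noteq> {}}"

definition Disc :: "('a, 'r) ring_scheme \<Rightarrow> (('a, 'a list) dual_sq \<times> ('a, 'a list) module) set set"
  where "Disc R = {disc_class R \<delta> L | \<delta> (L :: ('a, 'a list) module). discriminant R \<delta> L}"

text \<open>For an invertible module \<open>L\<close> the map \<^const>\<open>dual_sq_eval\<close> identifies \<open>(L\<^sup>\<or>)\<^sup>\<otimes>\<^sup>2\<close> with the bilinear
  forms on \<open>L\<close>, i.e. with the linear maps \<open>L\<^sup>\<otimes>\<^sup>2 \<longrightarrow> R\<close>.\<close>

definition disc_elem :: "('a, 'r) ring_scheme \<Rightarrow> ('a, 'b) module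
    \<Rightarrow> ('a, ('b \<times> 'b \<Rightarrow> 'a) set set) dual_sq"
  where "disc_elem R S = (let L = ext2 R S; \<sigma> = std_inv R S in
    THE \<delta>. \<delta> \<in> carrier (tensor R (dual R L) (dual R L)) \<and>
      (\<forall>x\<in>carrier S. \<forall>y\<in>carrier S. \<forall>z\<in>carrier S. \<forall>w\<in>carrier S.
        dual_sq_eval R \<delta> (wedge R S x y) (wedge R S z w) \<odot>\<^bsub>S\<^esub> \<one>\<^bsub>S\<^esub> =
          (x \<otimes>\<^bsub>S\<^esub> \<sigma> y \<ominus>\<^bsub>S\<^esub> \<sigma> x \<otimes>\<^bsub>S\<^esub> y) \<otimes>\<^bsub>S\<^esub> (z \<otimes>\<^bsub>S\<^esub> \<sigma> w \<ominus>\<^bsub>S\<^esub> \<sigma> z \<otimes>\<^bsub>S\<^esub> w)))"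

definition disc :: "('a, 'r) ring_scheme \<Rightarrow> ('a, 'a list) module set
    \<Rightarrow> (('a, 'a list) dual_sq \<times> ('a, 'a list) module) set"
  where "disc R P = (\<Union>S\<in>P. disc_class R (disc_elem R S) (ext2 R S))"

definition disc_fiber :: "('a, 'r) ring_scheme
    \<Rightarrow> (('a, 'a list) dual_sq \<times> ('a, 'a list) module) set \<Rightarrow> ('a, 'a list) module set set"
  where "disc_fiber R D = {P \<in> Quad R. disc R P = D}"

definition square_mod_4 :: "('a, 'r) ring_scheme \<Rightarrow> 'a \<Rightarrow> bool"
  where "square_mod_4 R d \<longleftrightarrow> d \<in> carrier R \<and>
    (\<exists>t\<in>carrier R. \<exists>r\<in>carrier R. d = t \<otimes>\<^bsub>R\<^esub> t \<oplus>\<^bsub>R\<^esub> [(4::nat)] \<cdot>\<^bsub>R\<^esub> r)"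

text \<open>The class \<open>dR\<^sup>\<times>\<^sup>2\<close>: an element \<open>d\<close> of \<open>R\<close> is identified with \<open>d (id \<otimes> id) \<in> (R\<^sup>\<or>)\<^sup>\<otimes>\<^sup>2\<close>.\<close>

definition scalar_disc_class :: "('a, 'r) ring_scheme \<Rightarrow> 'a
    \<Rightarrow> (('a, 'a list) dual_sq \<times> ('a, 'a list) module) set"
  where "scalar_disc_class R d = (let D = dual R (reg R); \<iota> = (\<lambda>x\<in>carrier R. x) in
    disc_class R (d \<odot>\<^bsub>tensor R D D\<^esub> pure_tensor R D D \<iota> \<iota>) (reg R))"

section \<open>The Artin--Schreier group\<close>

definition torsion4 :: "('a, 'r) ring_scheme \<Rightarrow> 'a set"
  where "torsion4 R = {a \<in> carrier R. [(4::nat)] \<cdot>\<^bsub>R\<^esub> a = \<zero>\<^bsub>R\<^esub>}"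

definition wp4 :: "('a, 'r) ring_scheme \<Rightarrow> 'a set"
  where "wp4 R = {r \<oplus>\<^bsub>R\<^esub> r \<otimes>\<^bsub>R\<^esub> r | r. r \<in> carrier R} \<inter> torsion4 R"

definition AS :: "('a, 'r) ring_scheme \<Rightarrow> 'a set monoid"
  where "AS R = (add_monoid R)\<lparr>carrier := torsion4 R\<rparr> Mod wp4 R"

definition ann4 :: "('a, 'r) ring_scheme \<Rightarrow> 'a \<Rightarrow> 'a set"
  where "ann4 R d = {a \<in> torsion4 R. d \<otimes>\<^bsub>R\<^esub> a = \<zero>\<^bsub>R\<^esub>}"

text \<open>\<open>R[x]/(x\<^sup>2 - x + n)\<close>\<close>

definition as_algebra :: "('a, 'r) ring_scheme \<Rightarrow> 'a \<Rightarrow> ('a, (nat \<Rightarrow> 'a) set) module"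
  where "as_algebra R n = (let P = UP R; x = monom P \<one>\<^bsub>R\<^esub> 1 in
    quot P (PIdl\<^bsub>P\<^esub> (x \<otimes>\<^bsub>P\<^esub> x \<ominus>\<^bsub>P\<^esub> x \<oplus>\<^bsub>P\<^esub> monom P n 0)))"

definition as_incl :: "('a, 'r) ring_scheme \<Rightarrow> 'a set \<Rightarrow> ('a, 'a list) module set"
  where "as_incl R A = (\<Union>n\<in>A. quad_class R (as_algebra R n))"

definition compatible_action :: "('a, 'r) ring_scheme
    \<Rightarrow> (('a, 'a list) dual_sq \<times> ('a, 'a list) module) set
    \<Rightarrow> ('a set \<Rightarrow> ('a, 'a list) module set \<Rightarrow> ('a, 'a list) module set) \<Rightarrow> bool"
  where "compatible_action R D \<rho> \<longleftrightarrow> group_action (AS R) (disc_fiber R D) \<rho> \<and>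
    (\<forall>A\<in>carrier (AS R). \<forall>P\<in>disc_fiber R D. \<rho> A P = quad_star R (as_incl R A) P)"

end

theory Submission imports Defs begin

text \<open>For a quadratic algebra \<open>S\<close> with standard involution \<open>\<sigma>\<close> and \<open>4n = 0\<close>, the multiplication
  \<open>u \<cdot> v = uv - n(u - \<sigma> u)(v - \<sigma> v)\<close> makes the module \<open>S\<close> into a quadratic algebra \<open>S\<^sub>n\<close> with the same
  involution and the same discriminant form, and \<open>(S\<^sub>m)\<^sub>n = S\<^sub>m\<^sub>+\<^sub>n\<close>, \<open>S\<^sub>0 = S\<close> hold on the nose. Locally
  \<open>S\<^sub>n\<close> is the product of \<open>S\<close> with \<open>R[y]/(y\<^sup>2 - y + n)\<close>, and the local isomorphisms glue, so the class of
  \<open>S\<^sub>n\<close> is \<open>i(n) * [S]\<close>. If the discriminant of \<open>S\<close> is a scalar \<open>d\<close>, then every product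
  \<open>(u - \<sigma> u)(v - \<sigma> v)\<close> lies in \<open>dR\<close>; hence \<open>S\<^sub>n = S\<close> as soon as \<open>dn = 0\<close>.\<close>

section \<open>Localization\<close>

text \<open>The obstacle is that \<open>is_star\<close> leaves the cover and all local generators
  open and that \<open>quad_star\<close> collects the products of all representatives. A class i(n)
  * [S] can be named only after every such product, for every cover and every choice of generators,
  has been compared with one global algebra; the twist is that algebra. The group law then becomes
  an equation between algebras on one module, so an action is obtained without associativity of * in
  general: the inverse of the twist by n is the twist by -n, and an algebra isomorphic to
  \<open>S\<^sub>n\<close> is itself a product, formed from its own twist by -n. The condition 4n =
  0 is what makes twists add up, because u - \<sigma> u is anti-invariant and taking its difference
  with its conjugate doubles it; in a product of two such elements the correction therefore carries
  4n. Representatives modulo r + r^2 are interchangeable because 1 + 2r has square 1 + 4(r + r^2) =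
  1 and so can be used to rescale the generator y.\<close>

lemma reg_simps [simp]:
  "carrier (reg R) = carrier R" "mult (reg R) = mult R" "one (reg R) = one R"
  "zero (reg R) = zero R" "add (reg R) = add R" "smult (reg R) = mult R"
  by (simp_all add: reg_def)

text \<open>Negation depends on carrier, addition and zero alone, so structures that agree in these
  share it: R and \<open>reg R\<close>, an algebra and its twists.\<close>

lemma a_inv_cong:
  "carrier M = carrier N \<Longrightarrow> add M = add N \<Longrightarrow> zero M = zero N \<Longrightarrow> a_inv M = a_inv N"
  by (auto simp: a_inv_def m_inv_def fun_eq_iff)

lemma (in cring) assoc_algebra_reg: "assoc_algebra R (reg R)"
proof (intro assoc_algebra.intro assoc_algebra_axioms.intro)
  have ab: "abelian_group (reg R)"
  proof (rule abelian_groupI)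
    fix x assume "x \<in> carrier (reg R)"
    then show "\<exists>y\<in>carrier (reg R). y \<oplus>\<^bsub>reg R\<^esub> x = \<zero>\<^bsub>reg R\<^esub>"
      by (auto intro!: bexI[of _ "\<ominus> x"] simp: l_neg)
  qed (simp_all add: a_ac)
  show "module R (reg R)"
    by (rule moduleI[OF is_cring ab]) (simp_all add: l_distr r_distr m_assoc)
  show "ring (reg R)"
    by (rule ringI[OF ab]) (auto intro!: monoidI simp: l_distr r_distr m_assoc)
qed (simp_all add: m_ac)

section \<open>Fractions with denominators in a multiplicative set\<close>

locale mult_set = cring R for R (structure) +
  fixes W
  assumes W_subset: "W \<subseteq> carrier R"
    and one_in_W [simp]: "\<one> \<in> W"
    and W_mult [simp]: "s \<in> W \<Longrightarrow> t \<in> W \<Longrightarrow> s \<otimes> t \<in> W"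
begin

lemma W_carrier [simp]: "s \<in> W \<Longrightarrow> s \<in> carrier R"
  using W_subset by blast

end

locale loc_module = module R M + mult_set R W for R (structure) and M (structure) and W
begin

abbreviation "fr \<equiv> frac R W M"
abbreviation "rf \<equiv> frac R W (reg R)"
abbreviation "LM \<equiv> loc R W M"
abbreviation "LR \<equiv> loc_ring R W"

lemma smult_swap: "a \<in> carrier R \<Longrightarrow> b \<in> carrier R \<Longrightarrow> x \<in> carrier M \<Longrightarrow>
    a \<odot>\<^bsub>M\<^esub> (b \<odot>\<^bsub>M\<^esub> x) = b \<odot>\<^bsub>M\<^esub> (a \<odot>\<^bsub>M\<^esub> x)"
  by (simp add: smult_assoc1[symmetric] m_ac)

lemmas sm = smult_assoc1[symmetric] m_ac

lemma frac_memI: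
  "y \<in> carrier M \<Longrightarrow> t \<in> W \<Longrightarrow> u \<in> W \<Longrightarrow> u \<odot>\<^bsub>M\<^esub> (t \<odot>\<^bsub>M\<^esub> x) = u \<odot>\<^bsub>M\<^esub> (s \<odot>\<^bsub>M\<^esub> y)
    \<Longrightarrow> (y, t) \<in> fr x s"
  unfolding frac_def by blast

lemma frac_self: "x \<in> carrier M \<Longrightarrow> s \<in> W \<Longrightarrow> (x, s) \<in> fr x s"
  by (rule frac_memI[of _ _ \<one>]) auto

text \<open>This contains the transitivity of the equivalence of pairs. Elements of W may be zero
  divisors, so the middle denominator has to enter the new witness along with the two given
  ones.\<close>

lemma frac_mem_eq:
  assumes x: "x \<in> carrier M" "s \<in> W" and y: "(y, t) \<in> fr x s"
  shows "fr y t = fr x s"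
proof -
  from y obtain u where y': "y \<in> carrier M" "t \<in> W" and u: "u \<in> W"
    and e: "u \<odot>\<^bsub>M\<^esub> (t \<odot>\<^bsub>M\<^esub> x) = u \<odot>\<^bsub>M\<^esub> (s \<odot>\<^bsub>M\<^esub> y)"
    unfolding frac_def by blast
  have *: "(z, r) \<in> fr x2 s2"
    if x1: "x1 \<in> carrier M" "s1 \<in> W" and x2: "x2 \<in> carrier M" "s2 \<in> W"
      and e: "u \<odot>\<^bsub>M\<^esub> (s1 \<odot>\<^bsub>M\<^esub> x2) = u \<odot>\<^bsub>M\<^esub> (s2 \<odot>\<^bsub>M\<^esub> x1)"
      and z: "(z, r) \<in> fr x1 s1" for x1 s1 x2 s2 z r
  proof -
    from z obtain v where z': "z \<in> carrier M" "r \<in> W" and v: "v \<in> W"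
      and e2: "v \<odot>\<^bsub>M\<^esub> (r \<odot>\<^bsub>M\<^esub> x1) = v \<odot>\<^bsub>M\<^esub> (s1 \<odot>\<^bsub>M\<^esub> z)"
      unfolding frac_def by blast
    have "(u \<otimes> v \<otimes> s1) \<odot>\<^bsub>M\<^esub> (r \<odot>\<^bsub>M\<^esub> x2) = (v \<otimes> r) \<odot>\<^bsub>M\<^esub> (u \<odot>\<^bsub>M\<^esub> (s1 \<odot>\<^bsub>M\<^esub> x2))"
      using x1 x2 z' v u by (simp add: sm)
    also have "\<dots> = (u \<otimes> s2) \<odot>\<^bsub>M\<^esub> (v \<odot>\<^bsub>M\<^esub> (r \<odot>\<^bsub>M\<^esub> x1))"
      unfolding e using x1 x2 z' v u by (simp add: sm)
    also have "\<dots> = (u \<otimes> v \<otimes> s1) \<odot>\<^bsub>M\<^esub> (s2 \<odot>\<^bsub>M\<^esub> z)"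
      unfolding e2 using x1 x2 z' v u by (simp add: sm)
    finally show ?thesis
      using z' u v x1 by (intro frac_memI[of _ _ "u \<otimes> v \<otimes> s1"]) auto
  qed
  show ?thesis
    using *[OF y' x e] *[OF x y' e[symmetric]] by auto
qed

lemma frac_eq_iff:
  assumes "x \<in> carrier M" "s \<in> W" "y \<in> carrier M" "t \<in> W"
  shows "fr x s = fr y t \<longleftrightarrow> (\<exists>u\<in>W. u \<odot>\<^bsub>M\<^esub> (t \<odot>\<^bsub>M\<^esub> x) = u \<odot>\<^bsub>M\<^esub> (s \<odot>\<^bsub>M\<^esub> y))"
proof
  assume "fr x s = fr y t"
  then have "(y, t) \<in> fr x s" using frac_self assms by auto
  then show "\<exists>u\<in>W. u \<odot>\<^bsub>M\<^esub> (t \<odot>\<^bsub>M\<^esub> x) = u \<odot>\<^bsub>M\<^esub> (s \<odot>\<^bsub>M\<^esub> y)" unfolding frac_def by blast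
next
  assume "\<exists>u\<in>W. u \<odot>\<^bsub>M\<^esub> (t \<odot>\<^bsub>M\<^esub> x) = u \<odot>\<^bsub>M\<^esub> (s \<odot>\<^bsub>M\<^esub> y)"
  then have "(y, t) \<in> fr x s" using assms by (auto intro: frac_memI)
  then show "fr x s = fr y t" using frac_mem_eq assms by blast
qed

lemma frac_eqI:
  assumes "x \<in> carrier M" "s \<in> W" "y \<in> carrier M" "t \<in> W" "t \<odot>\<^bsub>M\<^esub> x = s \<odot>\<^bsub>M\<^esub> y"
  shows "fr x s = fr y t"
  using assms by (subst frac_eq_iff) (auto intro!: bexI[of _ \<one>])

lemma frac_cancel:
  "x \<in> carrier M \<Longrightarrow> s \<in> W \<Longrightarrow> t \<in> W \<Longrightarrow> fr (t \<odot>\<^bsub>M\<^esub> x) (t \<otimes> s) = fr x s"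
  by (rule frac_eqI) (auto simp: sm)

lemma frac_eq_same_iff:
  assumes "x \<in> carrier M" "s \<in> W" "y \<in> carrier M"
  shows "fr x s = fr y s \<longleftrightarrow> (\<exists>u\<in>W. u \<odot>\<^bsub>M\<^esub> x = u \<odot>\<^bsub>M\<^esub> y)"
proof
  assume "fr x s = fr y s"
  then obtain u where "u \<in> W" "u \<odot>\<^bsub>M\<^esub> (s \<odot>\<^bsub>M\<^esub> x) = u \<odot>\<^bsub>M\<^esub> (s \<odot>\<^bsub>M\<^esub> y)"
    using assms frac_eq_iff by blast
  then show "\<exists>u\<in>W. u \<odot>\<^bsub>M\<^esub> x = u \<odot>\<^bsub>M\<^esub> y"
    using assms by (intro bexI[of _ "u \<otimes> s"]) (auto simp: smult_assoc1)
next
  assume "\<exists>u\<in>W. u \<odot>\<^bsub>M\<^esub> x = u \<odot>\<^bsub>M\<^esub> y"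
  then obtain u where "u \<in> W" "u \<odot>\<^bsub>M\<^esub> x = u \<odot>\<^bsub>M\<^esub> y" by blast
  then show "fr x s = fr y s"
    using assms by (subst frac_eq_iff) (auto intro!: bexI[of _ u] simp: smult_swap[of u s])
qed

lemma frac_closed [simp]: "x \<in> carrier M \<Longrightarrow> s \<in> W \<Longrightarrow> fr x s \<in> carrier LM"
  by (auto simp: loc_def)

lemma loc_cases:
  assumes "X \<in> carrier LM" obtains x s where "x \<in> carrier M" "s \<in> W" "X = fr x s"
  using assms by (auto simp: loc_def)

lemma frac_mem_carrier: "(y, t) \<in> fr x s \<Longrightarrow> y \<in> carrier M \<and> t \<in> W"
  unfolding frac_def by blast

text \<open>The operations of \<open>loc\<close> are unions over all representatives. Once the value
  is the same for all of them the union collapses, and each operation can be computed on one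
  representative.\<close>

lemma UN_frac:
  assumes "x \<in> carrier M" "s \<in> W"
    and "\<And>y t. y \<in> carrier M \<Longrightarrow> t \<in> W \<Longrightarrow> fr y t = fr x s \<Longrightarrow> h y t = h x s"
  shows "(\<Union>(y, t)\<in>fr x s. h y t) = h x s"
proof -
  have "h y t = h x s" if "(y, t) \<in> fr x s" for y t
    using frac_mem_carrier[OF that] frac_mem_eq[OF assms(1,2) that] by (intro assms(3)) auto
  then have "(\<Union>(y, t)\<in>fr x s. h y t) = (\<Union>p\<in>fr x s. h x s)" by (intro SUP_cong) auto
  then show ?thesis using frac_self[OF assms(1,2)] by auto
qed

lemma add_frac:
  assumes x: "x \<in> carrier M" "s \<in> W" and y: "y \<in> carrier M" "t \<in> W"
  shows "fr x s \<oplus>\<^bsub>LM\<^esub> fr y t = fr (t \<odot>\<^bsub>M\<^esub> x \<oplus>\<^bsub>M\<^esub> s \<odot>\<^bsub>M\<^esub> y) (s \<otimes> t)"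
proof -
  have *: "fr (t \<odot>\<^bsub>M\<^esub> x \<oplus>\<^bsub>M\<^esub> s \<odot>\<^bsub>M\<^esub> y) (s \<otimes> t) = fr (t' \<odot>\<^bsub>M\<^esub> x' \<oplus>\<^bsub>M\<^esub> s' \<odot>\<^bsub>M\<^esub> y') (s' \<otimes> t')"
    if x: "x \<in> carrier M" "s \<in> W" and y: "y \<in> carrier M" "t \<in> W"
      and x': "x' \<in> carrier M" "s' \<in> W" and y': "y' \<in> carrier M" "t' \<in> W"
      and e1: "fr x s = fr x' s'" and e2: "fr y t = fr y' t'" for x y x' y' s t s' t'
  proof -
    obtain u where u: "u \<in> W" "u \<odot>\<^bsub>M\<^esub> (s' \<odot>\<^bsub>M\<^esub> x) = u \<odot>\<^bsub>M\<^esub> (s \<odot>\<^bsub>M\<^esub> x')"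
      using e1 x x' frac_eq_iff by blast
    obtain v where v: "v \<in> W" "v \<odot>\<^bsub>M\<^esub> (t' \<odot>\<^bsub>M\<^esub> y) = v \<odot>\<^bsub>M\<^esub> (t \<odot>\<^bsub>M\<^esub> y')"
      using e2 y y' frac_eq_iff by blast
    have "(u \<otimes> v) \<odot>\<^bsub>M\<^esub> ((s' \<otimes> t') \<odot>\<^bsub>M\<^esub> (t \<odot>\<^bsub>M\<^esub> x \<oplus>\<^bsub>M\<^esub> s \<odot>\<^bsub>M\<^esub> y))
      = (v \<otimes> t \<otimes> t') \<odot>\<^bsub>M\<^esub> (u \<odot>\<^bsub>M\<^esub> (s' \<odot>\<^bsub>M\<^esub> x)) \<oplus>\<^bsub>M\<^esub> (u \<otimes> s \<otimes> s') \<odot>\<^bsub>M\<^esub> (v \<odot>\<^bsub>M\<^esub> (t' \<odot>\<^bsub>M\<^esub> y))"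
      using x y x' y' u(1) v(1) by (simp add: smult_r_distr sm)
    also have "\<dots> = (u \<otimes> v) \<odot>\<^bsub>M\<^esub> ((s \<otimes> t) \<odot>\<^bsub>M\<^esub> (t' \<odot>\<^bsub>M\<^esub> x' \<oplus>\<^bsub>M\<^esub> s' \<odot>\<^bsub>M\<^esub> y'))"
      unfolding u(2) v(2) using x y x' y' u(1) v(1) by (simp add: smult_r_distr sm)
    finally show ?thesis
      using x y x' y' u v by (subst frac_eq_iff) (auto intro!: bexI[of _ "u \<otimes> v"])
  qed
  have inner: "(\<Union>(y, t)\<in>fr y t. fr (t \<odot>\<^bsub>M\<^esub> x \<oplus>\<^bsub>M\<^esub> s \<odot>\<^bsub>M\<^esub> y) (s \<otimes> t)) = fr (t \<odot>\<^bsub>M\<^esub> x \<oplus>\<^bsub>M\<^esub> s \<odot>\<^bsub>M\<^esub> y) (s \<otimes> t)"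
    if "x \<in> carrier M" "s \<in> W" for x s
    by (rule UN_frac[OF y]) (rule *, simp_all add: that y)
  have "fr x s \<oplus>\<^bsub>LM\<^esub> fr y t = (\<Union>(x, s)\<in>fr x s. \<Union>(y, t)\<in>fr y t. fr (t \<odot>\<^bsub>M\<^esub> x \<oplus>\<^bsub>M\<^esub> s \<odot>\<^bsub>M\<^esub> y) (s \<otimes> t))"
    by (simp add: loc_def)
  also have "\<dots> = (\<Union>(y, t)\<in>fr y t. fr (t \<odot>\<^bsub>M\<^esub> x \<oplus>\<^bsub>M\<^esub> s \<odot>\<^bsub>M\<^esub> y) (s \<otimes> t))"
    by (rule UN_frac[OF x], subst inner, assumption, assumption, subst inner[OF x], rule *)
      (simp_all add: x y)
  also have "\<dots> = fr (t \<odot>\<^bsub>M\<^esub> x \<oplus>\<^bsub>M\<^esub> s \<odot>\<^bsub>M\<^esub> y) (s \<otimes> t)"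
    by (rule inner[OF x])
  finally show ?thesis .
qed

lemma add_frac_same:
  assumes "x \<in> carrier M" "s \<in> W" "y \<in> carrier M"
  shows "fr x s \<oplus>\<^bsub>LM\<^esub> fr y s = fr (x \<oplus>\<^bsub>M\<^esub> y) s"
  using assms by (simp add: add_frac smult_r_distr[symmetric] frac_cancel)

lemma zero_frac: "s \<in> W \<Longrightarrow> \<zero>\<^bsub>LM\<^esub> = fr \<zero>\<^bsub>M\<^esub> s"
  by (simp add: loc_def) (rule frac_eqI, auto)

text \<open>A common denominator turns the axioms for fractions into identities between
  numerators.\<close>

lemma common2:
  assumes "X \<in> carrier LM" "Y \<in> carrier LM"
  obtains x y s where "x \<in> carrier M" "y \<in> carrier M" "s \<in> W" "X = fr x s" "Y = fr y s"
proof -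
  obtain x s y t where "x \<in> carrier M" "s \<in> W" "X = fr x s" "y \<in> carrier M" "t \<in> W" "Y = fr y t"
    by (rule loc_cases[OF assms(1)], rule loc_cases[OF assms(2)])
  then show ?thesis
    using that[of "t \<odot>\<^bsub>M\<^esub> x" "s \<odot>\<^bsub>M\<^esub> y" "s \<otimes> t"] frac_cancel[of x s t] frac_cancel[of y t s]
    by (simp add: m_comm)
qed

lemma common3:
  assumes "X \<in> carrier LM" "Y \<in> carrier LM" "Z \<in> carrier LM"
  obtains x y z s where "x \<in> carrier M" "y \<in> carrier M" "z \<in> carrier M" "s \<in> W"
    "X = fr x s" "Y = fr y s" "Z = fr z s"
proof -
  obtain x y s z t where *: "x \<in> carrier M" "y \<in> carrier M" "s \<in> W" "X = fr x s" "Y = fr y s"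
    "z \<in> carrier M" "t \<in> W" "Z = fr z t"
    by (rule common2[OF assms(1,2)], rule loc_cases[OF assms(3)])
  then show ?thesis
    using that[of "t \<odot>\<^bsub>M\<^esub> x" "t \<odot>\<^bsub>M\<^esub> y" "s \<odot>\<^bsub>M\<^esub> z" "s \<otimes> t"]
      frac_cancel[of x s t] frac_cancel[of y s t] frac_cancel[of z t s]
    by (simp add: m_comm)
qed

lemma loc_abelian_group: "abelian_group LM"
proof (rule abelian_groupI)
  fix X Y assume "X \<in> carrier LM" "Y \<in> carrier LM"
  then obtain x y s where "x \<in> carrier M" "y \<in> carrier M" "s \<in> W" "X = fr x s" "Y = fr y s"
    by (rule common2)
  then show "X \<oplus>\<^bsub>LM\<^esub> Y \<in> carrier LM" "X \<oplus>\<^bsub>LM\<^esub> Y = Y \<oplus>\<^bsub>LM\<^esub> X"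
    by (simp_all add: add_frac_same M.a_comm)
next
  show "\<zero>\<^bsub>LM\<^esub> \<in> carrier LM" by (simp add: zero_frac[of \<one>])
next
  fix X Y Z assume "X \<in> carrier LM" "Y \<in> carrier LM" "Z \<in> carrier LM"
  then obtain x y z s where "x \<in> carrier M" "y \<in> carrier M" "z \<in> carrier M" "s \<in> W"
    "X = fr x s" "Y = fr y s" "Z = fr z s" by (rule common3)
  then show "X \<oplus>\<^bsub>LM\<^esub> Y \<oplus>\<^bsub>LM\<^esub> Z = X \<oplus>\<^bsub>LM\<^esub> (Y \<oplus>\<^bsub>LM\<^esub> Z)"
    by (simp add: add_frac_same M.a_assoc)
next
  fix X assume "X \<in> carrier LM"
  then obtain x s where x: "x \<in> carrier M" "s \<in> W" "X = fr x s" by (rule loc_cases)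
  then show "\<zero>\<^bsub>LM\<^esub> \<oplus>\<^bsub>LM\<^esub> X = X" by (simp add: zero_frac[of s] add_frac_same)
  show "\<exists>Y\<in>carrier LM. Y \<oplus>\<^bsub>LM\<^esub> X = \<zero>\<^bsub>LM\<^esub>"
    using x by (intro bexI[of _ "fr (\<ominus>\<^bsub>M\<^esub> x) s"]) (simp_all add: zero_frac[of s] add_frac_same M.l_neg)
qed

lemma minus_frac: 
  assumes "x \<in> carrier M" "s \<in> W" shows "\<ominus>\<^bsub>LM\<^esub> fr x s = fr (\<ominus>\<^bsub>M\<^esub> x) s"
proof -
  interpret L: abelian_group LM by (rule loc_abelian_group)
  show ?thesis
    using assms by (intro L.minus_equality) (simp_all add: add_frac_same M.l_neg zero_frac[of s])
qed

lemma diff_frac_same: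
  assumes "x \<in> carrier M" "s \<in> W" "y \<in> carrier M"
  shows "fr x s \<ominus>\<^bsub>LM\<^esub> fr y s = fr (x \<ominus>\<^bsub>M\<^esub> y) s"
  using assms by (simp add: a_minus_def minus_frac add_frac_same)

lemma frac_eq_zero_iff:
  assumes "x \<in> carrier M" "s \<in> W"
  shows "fr x s = \<zero>\<^bsub>LM\<^esub> \<longleftrightarrow> (\<exists>u\<in>W. u \<odot>\<^bsub>M\<^esub> x = \<zero>\<^bsub>M\<^esub>)"
  using assms by (simp add: zero_frac[of s] frac_eq_same_iff)

end

text \<open>The localized ring is by definition the localization of the module \<open>reg R\<close>,
  so the lemmas on fractions in M also compute with the scalars.\<close>

lemma (in mult_set) loc_module_reg: "loc_module R (reg R) W"
  using assoc_algebra_reg mult_set_axioms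
  by (simp add: loc_module_def assoc_algebra_def)

context loc_module
begin

interpretation Re: loc_module R "reg R" W
  using mult_set.loc_module_reg mult_set_axioms by blast

lemma smult_frac:
  assumes a: "a \<in> carrier R" "s \<in> W" and x: "x \<in> carrier M" "t \<in> W"
  shows "rf a s \<odot>\<^bsub>LM\<^esub> fr x t = fr (a \<odot>\<^bsub>M\<^esub> x) (s \<otimes> t)"
proof -
  have *: "fr (a \<odot>\<^bsub>M\<^esub> x) (s \<otimes> t) = fr (a' \<odot>\<^bsub>M\<^esub> x') (s' \<otimes> t')"
    if a: "a \<in> carrier R" "s \<in> W" and x: "x \<in> carrier M" "t \<in> W"
      and a': "a' \<in> carrier R" "s' \<in> W" and x': "x' \<in> carrier M" "t' \<in> W"
      and e1: "rf a s = rf a' s'" and e2: "fr x t = fr x' t'" for a x a' x' s t s' t'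
  proof -
    obtain u where u: "u \<in> W" "u \<otimes> (s' \<otimes> a) = u \<otimes> (s \<otimes> a')"
      using e1 a a' Re.frac_eq_iff by auto
    obtain v where v: "v \<in> W" "v \<odot>\<^bsub>M\<^esub> (t' \<odot>\<^bsub>M\<^esub> x) = v \<odot>\<^bsub>M\<^esub> (t \<odot>\<^bsub>M\<^esub> x')"
      using e2 x x' frac_eq_iff by blast
    have "(u \<otimes> v) \<odot>\<^bsub>M\<^esub> ((s' \<otimes> t') \<odot>\<^bsub>M\<^esub> (a \<odot>\<^bsub>M\<^esub> x)) = (u \<otimes> (s' \<otimes> a)) \<odot>\<^bsub>M\<^esub> (v \<odot>\<^bsub>M\<^esub> (t' \<odot>\<^bsub>M\<^esub> x))"
      using x a x' a' u(1) v(1) by (simp add: sm)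
    also have "\<dots> = (u \<otimes> v) \<odot>\<^bsub>M\<^esub> ((s \<otimes> t) \<odot>\<^bsub>M\<^esub> (a' \<odot>\<^bsub>M\<^esub> x'))"
      unfolding u(2) v(2) using x a x' a' u(1) v(1) by (simp add: sm)
    finally show ?thesis
      using x a x' a' u v by (subst frac_eq_iff) (auto intro!: bexI[of _ "u \<otimes> v"])
  qed
  have inner: "(\<Union>(x, t)\<in>fr x t. fr (a \<odot>\<^bsub>M\<^esub> x) (s \<otimes> t)) = fr (a \<odot>\<^bsub>M\<^esub> x) (s \<otimes> t)"
    if "a \<in> carrier R" "s \<in> W" for a s
    by (rule UN_frac[OF x]) (rule *, simp_all add: that x)
  have "rf a s \<odot>\<^bsub>LM\<^esub> fr x t = (\<Union>(a, s)\<in>rf a s. \<Union>(x, t)\<in>fr x t. fr (a \<odot>\<^bsub>M\<^esub> x) (s \<otimes> t))"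
    by (simp add: loc_def)
  also have "\<dots> = (\<Union>(x, t)\<in>fr x t. fr (a \<odot>\<^bsub>M\<^esub> x) (s \<otimes> t))"
  proof (rule Re.UN_frac)
    fix b r assume b: "b \<in> carrier (reg R)" "r \<in> W" and "rf b r = rf a s"
    then show "(\<Union>(x, t)\<in>fr x t. fr (b \<odot>\<^bsub>M\<^esub> x) (r \<otimes> t)) = (\<Union>(x, t)\<in>fr x t. fr (a \<odot>\<^bsub>M\<^esub> x) (s \<otimes> t))"
      using b a x by (simp add: inner) (rule *, simp_all)
  qed (simp_all add: a)
  also have "\<dots> = fr (a \<odot>\<^bsub>M\<^esub> x) (s \<otimes> t)"
    by (rule inner[OF a])
  finally show ?thesis .
qed

end

section \<open>Localized rings and algebras\<close>

locale loc_algebra = assoc_algebra R M + loc_module R M W for R (structure) and M (structure) and W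
begin

lemma mult_frac:
  assumes x: "x \<in> carrier M" "s \<in> W" and y: "y \<in> carrier M" "t \<in> W"
  shows "fr x s \<otimes>\<^bsub>LM\<^esub> fr y t = fr (x \<otimes>\<^bsub>M\<^esub> y) (s \<otimes> t)"
proof -
  have *: "fr (x \<otimes>\<^bsub>M\<^esub> y) (s \<otimes> t) = fr (x' \<otimes>\<^bsub>M\<^esub> y') (s' \<otimes> t')"
    if x: "x \<in> carrier M" "s \<in> W" and y: "y \<in> carrier M" "t \<in> W"
      and x': "x' \<in> carrier M" "s' \<in> W" and y': "y' \<in> carrier M" "t' \<in> W"
      and e1: "fr x s = fr x' s'" and e2: "fr y t = fr y' t'" for x y x' y' s t s' t'
  proof -
    obtain u where u: "u \<in> W" "u \<odot>\<^bsub>M\<^esub> (s' \<odot>\<^bsub>M\<^esub> x) = u \<odot>\<^bsub>M\<^esub> (s \<odot>\<^bsub>M\<^esub> x')"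
      using e1 x x' frac_eq_iff by blast
    obtain v where v: "v \<in> W" "v \<odot>\<^bsub>M\<^esub> (t' \<odot>\<^bsub>M\<^esub> y) = v \<odot>\<^bsub>M\<^esub> (t \<odot>\<^bsub>M\<^esub> y')"
      using e2 y y' frac_eq_iff by blast
    have "(u \<otimes> v) \<odot>\<^bsub>M\<^esub> ((s' \<otimes> t') \<odot>\<^bsub>M\<^esub> (x \<otimes>\<^bsub>M\<^esub> y))
      = (u \<odot>\<^bsub>M\<^esub> (s' \<odot>\<^bsub>M\<^esub> x)) \<otimes>\<^bsub>M\<^esub> (v \<odot>\<^bsub>M\<^esub> (t' \<odot>\<^bsub>M\<^esub> y))"
      using x y x' y' u(1) v(1) by (simp add: smult_mult_left smult_mult_right sm)
    also have "\<dots> = (u \<otimes> v) \<odot>\<^bsub>M\<^esub> ((s \<otimes> t) \<odot>\<^bsub>M\<^esub> (x' \<otimes>\<^bsub>M\<^esub> y'))"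
      unfolding u(2) v(2) using x y x' y' u(1) v(1)
      by (simp add: smult_mult_left smult_mult_right sm)
    finally show ?thesis
      using x y x' y' u v by (subst frac_eq_iff) (auto intro!: bexI[of _ "u \<otimes> v"])
  qed
  have inner: "(\<Union>(y, t)\<in>fr y t. fr (x \<otimes>\<^bsub>M\<^esub> y) (s \<otimes> t)) = fr (x \<otimes>\<^bsub>M\<^esub> y) (s \<otimes> t)"
    if "x \<in> carrier M" "s \<in> W" for x s
    by (rule UN_frac[OF y]) (rule *, simp_all add: that y)
  have "fr x s \<otimes>\<^bsub>LM\<^esub> fr y t = (\<Union>(x, s)\<in>fr x s. \<Union>(y, t)\<in>fr y t. fr (x \<otimes>\<^bsub>M\<^esub> y) (s \<otimes> t))"
    by (simp add: loc_def)
  also have "\<dots> = (\<Union>(y, t)\<in>fr y t. fr (x \<otimes>\<^bsub>M\<^esub> y) (s \<otimes> t))"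
    by (rule UN_frac[OF x], subst inner, assumption, assumption, subst inner[OF x], rule *)
      (simp_all add: x y)
  also have "\<dots> = fr (x \<otimes>\<^bsub>M\<^esub> y) (s \<otimes> t)"
    by (rule inner[OF x])
  finally show ?thesis .
qed

lemma one_frac: "\<one>\<^bsub>LM\<^esub> = fr \<one>\<^bsub>M\<^esub> \<one>"
  by (simp add: loc_def)

lemma loc_is_ring: "ring LM"
proof (rule ringI[OF loc_abelian_group])
  show "Group.monoid LM"
  proof (rule monoidI)
    fix X Y Z assume "X \<in> carrier LM" "Y \<in> carrier LM" "Z \<in> carrier LM"
    then obtain x y z s where "x \<in> carrier M" "y \<in> carrier M" "z \<in> carrier M" "s \<in> W"
      "X = fr x s" "Y = fr y s" "Z = fr z s" by (rule common3)
    then show "X \<otimes>\<^bsub>LM\<^esub> Y \<in> carrier LM" "X \<otimes>\<^bsub>LM\<^esub> Y \<otimes>\<^bsub>LM\<^esub> Z = X \<otimes>\<^bsub>LM\<^esub> (Y \<otimes>\<^bsub>LM\<^esub> Z)"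
      by (simp_all add: mult_frac m_assoc R.m_assoc)
  next
    fix X assume "X \<in> carrier LM"
    then obtain x s where x: "x \<in> carrier M" "s \<in> W" "X = fr x s" by (rule loc_cases)
    then show "\<one>\<^bsub>LM\<^esub> \<otimes>\<^bsub>LM\<^esub> X = X" "X \<otimes>\<^bsub>LM\<^esub> \<one>\<^bsub>LM\<^esub> = X"
      by (simp_all add: one_frac mult_frac)
  qed (simp add: one_frac)
next
  fix X Y Z assume "X \<in> carrier LM" "Y \<in> carrier LM" "Z \<in> carrier LM"
  then obtain x y z s where "x \<in> carrier M" "y \<in> carrier M" "z \<in> carrier M" "s \<in> W"
    "X = fr x s" "Y = fr y s" "Z = fr z s" by (rule common3)
  then show "(X \<oplus>\<^bsub>LM\<^esub> Y) \<otimes>\<^bsub>LM\<^esub> Z = X \<otimes>\<^bsub>LM\<^esub> Z \<oplus>\<^bsub>LM\<^esub> Y \<otimes>\<^bsub>LM\<^esub> Z"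
    "Z \<otimes>\<^bsub>LM\<^esub> (X \<oplus>\<^bsub>LM\<^esub> Y) = Z \<otimes>\<^bsub>LM\<^esub> X \<oplus>\<^bsub>LM\<^esub> Z \<otimes>\<^bsub>LM\<^esub> Y"
    by (simp_all add: mult_frac add_frac_same l_distr r_distr)
qed

end

lemma (in mult_set) loc_algebra_reg: "loc_algebra R (reg R) W"
  using assoc_algebra_reg loc_module_reg by (simp add: loc_algebra_def)

lemma (in mult_set) loc_ring_cring: "cring (loc_ring R W)"
proof -
  interpret Re: loc_algebra R "reg R" W by (rule loc_algebra_reg)
  interpret L: ring Re.LM by (rule Re.loc_is_ring)
  show ?thesis
  proof (rule cring.intro[OF Re.loc_is_ring], unfold_locales)
    fix X Y assume "X \<in> carrier Re.LM" "Y \<in> carrier Re.LM"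
    then obtain x y s where "x \<in> carrier (reg R)" "y \<in> carrier (reg R)" "s \<in> W"
      "X = Re.fr x s" "Y = Re.fr y s" by (rule Re.common2)
    then show "X \<otimes>\<^bsub>Re.LM\<^esub> Y = Y \<otimes>\<^bsub>Re.LM\<^esub> X" by (simp add: Re.mult_frac m_comm)
  qed
qed

context loc_module
begin

interpretation Re: loc_algebra R "reg R" W
  using mult_set.loc_algebra_reg mult_set_axioms by blast

lemma loc_is_module: "module LR LM"
proof (rule moduleI[OF loc_ring_cring loc_abelian_group])
  fix A X assume *: "A \<in> carrier LR" "X \<in> carrier LM"
  obtain a s where a: "a \<in> carrier R" "s \<in> W" "A = rf a s" by (rule Re.loc_cases[OF *(1)]) auto
  obtain x t where x: "x \<in> carrier M" "t \<in> W" "X = fr x t" using *(2) by (rule loc_cases)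
  from a x show "A \<odot>\<^bsub>LM\<^esub> X \<in> carrier LM" by (simp add: smult_frac)
next
  fix A B X assume *: "A \<in> carrier LR" "B \<in> carrier LR" "X \<in> carrier LM"
  obtain a b s where a: "a \<in> carrier R" "b \<in> carrier R" "s \<in> W" "A = rf a s" "B = rf b s"
    by (rule Re.common2[OF *(1,2)]) auto
  obtain x t where x: "x \<in> carrier M" "t \<in> W" "X = fr x t" using *(3) by (rule loc_cases)
  show "(A \<oplus>\<^bsub>LR\<^esub> B) \<odot>\<^bsub>LM\<^esub> X = A \<odot>\<^bsub>LM\<^esub> X \<oplus>\<^bsub>LM\<^esub> B \<odot>\<^bsub>LM\<^esub> X"
    "A \<otimes>\<^bsub>LR\<^esub> B \<odot>\<^bsub>LM\<^esub> X = A \<odot>\<^bsub>LM\<^esub> (B \<odot>\<^bsub>LM\<^esub> X)"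
    using a x by (simp_all add: smult_frac Re.add_frac_same add_frac_same Re.mult_frac smult_l_distr
      smult_assoc1 m_assoc)
next
  fix A X Y assume *: "A \<in> carrier LR" "X \<in> carrier LM" "Y \<in> carrier LM"
  obtain x y t where x: "x \<in> carrier M" "y \<in> carrier M" "t \<in> W" "X = fr x t" "Y = fr y t"
    using *(2,3) by (rule common2)
  obtain a s where a: "a \<in> carrier R" "s \<in> W" "A = rf a s" by (rule Re.loc_cases[OF *(1)]) auto
  show "A \<odot>\<^bsub>LM\<^esub> (X \<oplus>\<^bsub>LM\<^esub> Y) = A \<odot>\<^bsub>LM\<^esub> X \<oplus>\<^bsub>LM\<^esub> A \<odot>\<^bsub>LM\<^esub> Y"
    using a x by (simp add: smult_frac add_frac_same smult_r_distr)
next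
  fix X assume "X \<in> carrier LM"
  then obtain x t where x: "x \<in> carrier M" "t \<in> W" "X = fr x t" by (rule loc_cases)
  then show "\<one>\<^bsub>LR\<^esub> \<odot>\<^bsub>LM\<^esub> X = X" by (simp add: Re.one_frac smult_frac)
qed

end

context loc_algebra
begin

interpretation Re: loc_algebra R "reg R" W
  using mult_set.loc_algebra_reg mult_set_axioms by blast

lemma loc_assoc_algebra: "assoc_algebra LR LM"
proof (intro assoc_algebra.intro loc_is_module loc_is_ring assoc_algebra_axioms.intro)
  fix A X Y assume *: "A \<in> carrier LR" "X \<in> carrier LM" "Y \<in> carrier LM"
  obtain x y t where x: "x \<in> carrier M" "y \<in> carrier M" "t \<in> W" "X = fr x t" "Y = fr y t"
    using *(2,3) by (rule common2)
  obtain a s where a: "a \<in> carrier R" "s \<in> W" "A = rf a s" by (rule Re.loc_cases[OF *(1)]) auto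
  show "A \<odot>\<^bsub>LM\<^esub> X \<otimes>\<^bsub>LM\<^esub> Y = A \<odot>\<^bsub>LM\<^esub> (X \<otimes>\<^bsub>LM\<^esub> Y)"
    "X \<otimes>\<^bsub>LM\<^esub> (A \<odot>\<^bsub>LM\<^esub> Y) = A \<odot>\<^bsub>LM\<^esub> (X \<otimes>\<^bsub>LM\<^esub> Y)"
    using a x by (simp_all add: smult_frac mult_frac smult_mult_left smult_mult_right R.m_ac)
qed

end

section \<open>Free quadratic algebras in coordinates\<close>

text \<open>Coordinates in the candidate basis 1, x with the constant term first, so that x^2 = tx -
  n becomes \<open>lc S x (\<ominus> n) t\<close>.\<close>

definition lc :: "('a, 'b, 'm) module_scheme \<Rightarrow> 'b \<Rightarrow> 'a \<Rightarrow> 'a \<Rightarrow> 'b"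
  where "lc S x a b = a \<odot>\<^bsub>S\<^esub> \<one>\<^bsub>S\<^esub> \<oplus>\<^bsub>S\<^esub> b \<odot>\<^bsub>S\<^esub> x"

text \<open>Splits the unique existence in \<open>quad_gen\<close> into spanning and independence at
  zero, two conditions that can be localized and transported separately.\<close>

definition qbasis :: "('a, 'r) ring_scheme \<Rightarrow> ('a, 'b, 'm) module_scheme \<Rightarrow> 'b \<Rightarrow> bool"
  where "qbasis R S x \<longleftrightarrow> x \<in> carrier S \<and>
    (\<forall>z\<in>carrier S. \<exists>a\<in>carrier R. \<exists>b\<in>carrier R. z = lc S x a b) \<and>
    (\<forall>a\<in>carrier R. \<forall>b\<in>carrier R. lc S x a b = \<zero>\<^bsub>S\<^esub> \<longrightarrow> a = \<zero>\<^bsub>R\<^esub> \<and> b = \<zero>\<^bsub>R\<^esub>)"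

lemma (in abelian_group) diff_eq_zero_iff:
  assumes "x \<in> carrier G" "y \<in> carrier G" shows "x \<ominus> y = \<zero> \<longleftrightarrow> x = y"
proof
  assume "x \<ominus> y = \<zero>"
  then have "\<ominus> (\<ominus> y) = x" using assms by (intro minus_equality) (simp_all add: a_minus_def)
  then show "x = y" using assms by simp
qed (use assms in \<open>simp add: a_minus_def r_neg\<close>)

context assoc_algebra
begin

lemma lc_closed [simp]: "x \<in> carrier M \<Longrightarrow> a \<in> carrier R \<Longrightarrow> b \<in> carrier R \<Longrightarrow> lc M x a b \<in> carrier M"
  by (simp add: lc_def)

lemma lc_add:
  assumes "x \<in> carrier M" "a \<in> carrier R" "b \<in> carrier R" "c \<in> carrier R" "d \<in> carrier R"
  shows "lc M x a b \<oplus>\<^bsub>M\<^esub> lc M x c d = lc M x (a \<oplus> c) (b \<oplus> d)"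
  using assms by (simp add: lc_def smult_l_distr M.a_ac)

lemma lc_smult:
  assumes "x \<in> carrier M" "a \<in> carrier R" "b \<in> carrier R" "c \<in> carrier R"
  shows "c \<odot>\<^bsub>M\<^esub> lc M x a b = lc M x (c \<otimes> a) (c \<otimes> b)"
  using assms by (simp add: lc_def smult_r_distr smult_assoc1)

lemma lc_minus:
  assumes "x \<in> carrier M" "a \<in> carrier R" "b \<in> carrier R"
  shows "\<ominus>\<^bsub>M\<^esub> lc M x a b = lc M x (\<ominus> a) (\<ominus> b)"
  using assms by (simp add: lc_def smult_l_minus M.minus_add M.a_comm)

lemma lc_diff:
  assumes "x \<in> carrier M" "a \<in> carrier R" "b \<in> carrier R" "c \<in> carrier R" "d \<in> carrier R"
  shows "lc M x a b \<ominus>\<^bsub>M\<^esub> lc M x c d = lc M x (a \<ominus> c) (b \<ominus> d)"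
  using assms by (simp add: a_minus_def lc_minus lc_add)

lemma lc_zero: "x \<in> carrier M \<Longrightarrow> lc M x \<zero> \<zero> = \<zero>\<^bsub>M\<^esub>"
  by (simp add: lc_def)

lemma lc_const: "x \<in> carrier M \<Longrightarrow> a \<in> carrier R \<Longrightarrow> lc M x a \<zero> = a \<odot>\<^bsub>M\<^esub> \<one>\<^bsub>M\<^esub>"
  by (simp add: lc_def)

lemma lc_one: "x \<in> carrier M \<Longrightarrow> lc M x \<one> \<zero> = \<one>\<^bsub>M\<^esub>"
  by (simp add: lc_def)

lemma lc_lin: "x \<in> carrier M \<Longrightarrow> b \<in> carrier R \<Longrightarrow> lc M x \<zero> b = b \<odot>\<^bsub>M\<^esub> x"
  by (simp add: lc_def)

lemma lc_gen: "x \<in> carrier M \<Longrightarrow> lc M x \<zero> \<one> = x"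
  by (simp add: lc_def)

text \<open>Affine changes of generator compose in this way; every comparison of generators on an
  overlap reduces to it.\<close>

lemma lc_lc:
  assumes "x \<in> carrier M" "a \<in> carrier R" "b \<in> carrier R" "c \<in> carrier R" "d \<in> carrier R"
  shows "lc M (lc M x c d) a b = lc M x (a \<oplus> b \<otimes> c) (b \<otimes> d)"
  using assms by (simp add: lc_def smult_l_distr smult_r_distr smult_assoc1 M.a_assoc)

lemma lc_inj:
  assumes "qbasis R M x" "a \<in> carrier R" "b \<in> carrier R" "c \<in> carrier R" "d \<in> carrier R"
    and "lc M x a b = lc M x c d"
  shows "a = c" "b = d"
proof -
  have x: "x \<in> carrier M" using assms(1) by (simp add: qbasis_def)
  have "lc M x (a \<ominus> c) (b \<ominus> d) = \<zero>\<^bsub>M\<^esub>"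
    using assms x lc_diff[OF x assms(2-5)] by (simp add: M.r_neg a_minus_def)
  moreover have "a \<ominus> c \<in> carrier R" "b \<ominus> d \<in> carrier R" using assms by auto
  ultimately have "a \<ominus> c = \<zero> \<and> b \<ominus> d = \<zero>" using assms(1) unfolding qbasis_def by blast
  then show "a = c" "b = d" using assms(2-5) R.diff_eq_zero_iff by blast+
qed

lemma lc_cases:
  assumes "qbasis R M x" "z \<in> carrier M"
  obtains a b where "a \<in> carrier R" "b \<in> carrier R" "z = lc M x a b"
  using assms unfolding qbasis_def by blast

end

section \<open>Generators, traces and norms\<close>

locale quad_context = assoc_algebra R M
  for R :: "('a, 'r) ring_scheme" (structure) and M :: "('a, 'b) module" (structure)
begin

text \<open>Two expansions of one element differ by an expansion of zero, so unique coordinates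
  everywhere mean unique coordinates at zero.\<close>

lemma quad_gen_iff:
  "quad_gen R M x t n \<longleftrightarrow> qbasis R M x \<and> t \<in> carrier R \<and> n \<in> carrier R \<and>
    x \<otimes>\<^bsub>M\<^esub> x = lc M x (\<ominus> n) t"
proof -
  have e: "t \<odot>\<^bsub>M\<^esub> x \<ominus>\<^bsub>M\<^esub> n \<odot>\<^bsub>M\<^esub> \<one>\<^bsub>M\<^esub> = lc M x (\<ominus> n) t"
    if "x \<in> carrier M" "t \<in> carrier R" "n \<in> carrier R"
    using that by (simp add: lc_def a_minus_def smult_l_minus M.a_comm)
  have u: "(\<forall>z\<in>carrier M. \<exists>!p. p \<in> carrier R \<times> carrier R \<and> z = lc M x (fst p) (snd p)) \<longleftrightarrow> qbasis R M x"
    if x: "x \<in> carrier M"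
  proof
    assume L: "\<forall>z\<in>carrier M. \<exists>!p. p \<in> carrier R \<times> carrier R \<and> z = lc M x (fst p) (snd p)"
    have "a = \<zero> \<and> b = \<zero>" if ab: "a \<in> carrier R" "b \<in> carrier R" "lc M x a b = \<zero>\<^bsub>M\<^esub>" for a b
    proof -
      have "\<exists>!p. p \<in> carrier R \<times> carrier R \<and> \<zero>\<^bsub>M\<^esub> = lc M x (fst p) (snd p)" using L by simp
      then have "(a, b) = (\<zero>, \<zero>)" using ab lc_zero[OF x] by (elim ex1E) (metis SigmaI fst_conv snd_conv R.zero_closed)
      then show ?thesis by simp
    qed
    moreover have "\<exists>a\<in>carrier R. \<exists>b\<in>carrier R. z = lc M x a b" if "z \<in> carrier M" for z
      using L that by (metis SigmaE fst_conv snd_conv)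
    ultimately show "qbasis R M x" using x by (auto simp: qbasis_def)
  next
    assume q: "qbasis R M x"
    show "\<forall>z\<in>carrier M. \<exists>!p. p \<in> carrier R \<times> carrier R \<and> z = lc M x (fst p) (snd p)"
    proof
      fix z assume "z \<in> carrier M"
      then obtain a b where ab: "a \<in> carrier R" "b \<in> carrier R" "z = lc M x a b"
        using lc_cases[OF q] by blast
      show "\<exists>!p. p \<in> carrier R \<times> carrier R \<and> z = lc M x (fst p) (snd p)"
      proof (rule ex1I[of _ "(a, b)"])
        fix p assume p: "p \<in> carrier R \<times> carrier R \<and> z = lc M x (fst p) (snd p)"
        then have pc: "fst p \<in> carrier R" "snd p \<in> carrier R" by auto
        have "lc M x (fst p) (snd p) = lc M x a b" using p ab by simp
        from lc_inj[OF q pc ab(1,2) this] show "p = (a, b)" by (simp add: prod_eq_iff)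
      qed (use ab in simp)
    qed
  qed
  have *: "quad_gen R M x t n \<longleftrightarrow> x \<in> carrier M \<and> t \<in> carrier R \<and> n \<in> carrier R \<and>
    (\<forall>z\<in>carrier M. \<exists>!p. p \<in> carrier R \<times> carrier R \<and> z = lc M x (fst p) (snd p)) \<and>
    x \<otimes>\<^bsub>M\<^esub> x = t \<odot>\<^bsub>M\<^esub> x \<ominus>\<^bsub>M\<^esub> n \<odot>\<^bsub>M\<^esub> \<one>\<^bsub>M\<^esub>"
    unfolding quad_gen_def lc_def by simp
  show ?thesis
  proof (cases "x \<in> carrier M \<and> t \<in> carrier R \<and> n \<in> carrier R")
    case True
    then show ?thesis by (simp only: * u e simp_thms)
  next
    case False
    then show ?thesis unfolding * qbasis_def by blast
  qed
qed

lemma lc_mult: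
  assumes q: "x \<in> carrier M" "t \<in> carrier R" "n \<in> carrier R" "x \<otimes>\<^bsub>M\<^esub> x = lc M x (\<ominus> n) t"
    and c: "a \<in> carrier R" "b \<in> carrier R" "c \<in> carrier R" "d \<in> carrier R"
  shows "lc M x a b \<otimes>\<^bsub>M\<^esub> lc M x c d =
    lc M x (a \<otimes> c \<ominus> b \<otimes> d \<otimes> n) (a \<otimes> d \<oplus> b \<otimes> c \<oplus> b \<otimes> d \<otimes> t)"
proof -
  have "lc M x a b \<otimes>\<^bsub>M\<^esub> lc M x c d
    = (a \<otimes> c) \<odot>\<^bsub>M\<^esub> \<one>\<^bsub>M\<^esub> \<oplus>\<^bsub>M\<^esub> (a \<otimes> d) \<odot>\<^bsub>M\<^esub> x \<oplus>\<^bsub>M\<^esub> ((b \<otimes> c) \<odot>\<^bsub>M\<^esub> x \<oplus>\<^bsub>M\<^esub> (b \<otimes> d) \<odot>\<^bsub>M\<^esub> (x \<otimes>\<^bsub>M\<^esub> x))"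
    using q(1) c unfolding lc_def
    by (simp add: l_distr r_distr smult_mult_left smult_mult_right smult_r_distr
        smult_assoc1[symmetric] R.m_ac M.a_ac)
  also have "(a \<otimes> c) \<odot>\<^bsub>M\<^esub> \<one>\<^bsub>M\<^esub> \<oplus>\<^bsub>M\<^esub> (a \<otimes> d) \<odot>\<^bsub>M\<^esub> x = lc M x (a \<otimes> c) (a \<otimes> d)"
    by (simp add: lc_def)
  also have "(b \<otimes> c) \<odot>\<^bsub>M\<^esub> x = lc M x \<zero> (b \<otimes> c)"
    using q c by (simp add: lc_lin)
  finally show ?thesis
    using q(1-3) c unfolding q(4)
    by (simp add: lc_smult lc_add R.m_assoc R.r_minus a_minus_def R.a_assoc)
qed

text \<open>With x' = ux + r and \<sigma> x = t - x, the new trace and norm are x' + \<sigma> x' and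
  x' \<sigma> x' multiplied out. The factor u is a unit so that x can be recovered from x'.\<close>

lemma quad_gen_change:
  assumes q: "quad_gen R M x t n" and u: "u \<in> Units R" and r: "r \<in> carrier R"
  shows "quad_gen R M (lc M x r u) (u \<otimes> t \<oplus> (r \<oplus> r)) (u \<otimes> u \<otimes> n \<oplus> u \<otimes> r \<otimes> t \<oplus> r \<otimes> r)"
proof -
  have x: "x \<in> carrier M" and t: "t \<in> carrier R" "n \<in> carrier R" and qb: "qbasis R M x"
    and xx: "x \<otimes>\<^bsub>M\<^esub> x = lc M x (\<ominus> n) t"
    using q by (auto simp: quad_gen_iff qbasis_def)
  have uc: "u \<in> carrier R" using u by auto
  define v where "v = inv u"
  have v: "v \<in> carrier R" "u \<otimes> v = \<one>" using u by (simp_all add: v_def)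
  have "qbasis R M (lc M x r u)"
    unfolding qbasis_def
  proof (intro conjI ballI impI)
    fix z assume "z \<in> carrier M"
    then obtain a b where ab: "a \<in> carrier R" "b \<in> carrier R" "z = lc M x a b" by (rule lc_cases[OF qb])
    have "a \<ominus> b \<otimes> v \<otimes> r \<oplus> b \<otimes> v \<otimes> r = a" using ab v r by algebra
    moreover have "b \<otimes> v \<otimes> u = b" using ab v uc by (simp add: R.m_assoc R.m_comm[of v u])
    \<comment> \<open>In a + bx the generator is replaced by x = v(x' - r), where v is the inverse
      of u.\<close>
    ultimately have "z = lc M (lc M x r u) (a \<ominus> b \<otimes> v \<otimes> r) (b \<otimes> v)"
      using ab v r uc x by (simp add: lc_lc)
    then show "\<exists>a\<in>carrier R. \<exists>b\<in>carrier R. z = lc M (lc M x r u) a b"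
      using ab v r by blast
  next
    fix a b assume ab: "a \<in> carrier R" "b \<in> carrier R" and "lc M (lc M x r u) a b = \<zero>\<^bsub>M\<^esub>"
    then have "lc M x (a \<oplus> b \<otimes> r) (b \<otimes> u) = \<zero>\<^bsub>M\<^esub>" using x r uc by (simp add: lc_lc)
    then have *: "a \<oplus> b \<otimes> r = \<zero>" "b \<otimes> u = \<zero>" using qb ab r uc unfolding qbasis_def by auto
    have "b = b \<otimes> u \<otimes> v" using ab uc v by (simp add: R.m_assoc)
    then show "b = \<zero>" using * v by simp
    then show "a = \<zero>" using * ab r by simp
  qed (use x r uc in simp)
  moreover have "lc M x r u \<otimes>\<^bsub>M\<^esub> lc M x r u =
      lc M (lc M x r u) (\<ominus> (u \<otimes> u \<otimes> n \<oplus> u \<otimes> r \<otimes> t \<oplus> r \<otimes> r)) (u \<otimes> t \<oplus> (r \<oplus> r))"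
  proof -
    have "r \<otimes> r \<ominus> u \<otimes> u \<otimes> n = \<ominus> (u \<otimes> u \<otimes> n \<oplus> u \<otimes> r \<otimes> t \<oplus> r \<otimes> r) \<oplus> (u \<otimes> t \<oplus> (r \<oplus> r)) \<otimes> r"
      using t uc r by algebra
    moreover have "r \<otimes> u \<oplus> u \<otimes> r \<oplus> u \<otimes> u \<otimes> t = (u \<otimes> t \<oplus> (r \<oplus> r)) \<otimes> u"
      using t uc r by algebra
    ultimately show ?thesis
      using x t uc r by (simp add: lc_mult[OF x t xx] lc_lc)
  qed
  ultimately show ?thesis
    using t uc r by (simp add: quad_gen_iff)
qed

text \<open>The algebra is generated by one element over central scalars; in coordinates,
  \<open>lc_mult\<close> is symmetric in its two factors.\<close>

lemma quad_gen_comm: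
  assumes "quad_gen R M x t n" "y \<in> carrier M" "z \<in> carrier M"
  shows "y \<otimes>\<^bsub>M\<^esub> z = z \<otimes>\<^bsub>M\<^esub> y"
proof -
  have x: "x \<in> carrier M" and t: "t \<in> carrier R" "n \<in> carrier R" and qb: "qbasis R M x"
    and xx: "x \<otimes>\<^bsub>M\<^esub> x = lc M x (\<ominus> n) t"
    using assms(1) by (auto simp: quad_gen_iff qbasis_def)
  obtain a b where ab: "a \<in> carrier R" "b \<in> carrier R" "y = lc M x a b" using assms(2) by (rule lc_cases[OF qb])
  obtain c d where cd: "c \<in> carrier R" "d \<in> carrier R" "z = lc M x c d" using assms(3) by (rule lc_cases[OF qb])
  show ?thesis using ab cd x t by (simp add: lc_mult[OF x t xx] R.m_ac R.a_ac)
qed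

text \<open>The unit vector of a free algebra of rank 2 is unimodular, because \<open>e\<^sub>0 = 1 e\<^sub>0\<close>
  has a coordinate 1; hence it is part of a basis.\<close>

lemma free_of_rank_2_imp_quad_gen:
  assumes "free_of_rank R M 2"
  obtains x t n where "quad_gen R M x t n"
proof -
  obtain e where e: "e \<in> {..<2::nat} \<rightarrow> carrier M"
    and ex0: "\<forall>x\<in>carrier M.
      \<exists>!c. c \<in> {..<2::nat} \<rightarrow>\<^sub>E carrier R \<and> x = (\<Oplus>\<^bsub>M\<^esub>i \<in> {..<2}. c i \<odot>\<^bsub>M\<^esub> e i)"
    using assms unfolding free_of_rank_def by (elim bexE)
  note ex = bspec[OF ex0]
  define e0 e1 where "e0 = e 0" and "e1 = e 1"
  have ec: "e0 \<in> carrier M" "e1 \<in> carrier M" using e by (auto simp: e0_def e1_def)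
  define f where "f a b = a \<odot>\<^bsub>M\<^esub> e0 \<oplus>\<^bsub>M\<^esub> b \<odot>\<^bsub>M\<^esub> e1" for a b
  have two: "{..<2::nat} = {0, 1}" by auto
  have sum: "(\<Oplus>\<^bsub>M\<^esub>i \<in> {..<2}. c i \<odot>\<^bsub>M\<^esub> e i) = f (c 0) (c 1)" if "c 0 \<in> carrier R" "c 1 \<in> carrier R" for c
    unfolding two using that ec by (simp add: f_def e0_def e1_def)
  have span: "\<exists>a\<in>carrier R. \<exists>b\<in>carrier R. z = f a b" if z: "z \<in> carrier M" for z
  proof -
    obtain c where c: "c \<in> {..<2::nat} \<rightarrow>\<^sub>E carrier R" "z = (\<Oplus>\<^bsub>M\<^esub>i \<in> {..<2}. c i \<odot>\<^bsub>M\<^esub> e i)"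
      using ex[OF z] by blast
    have c01: "c 0 \<in> carrier R" "c 1 \<in> carrier R"
      using PiE_mem[OF c(1), of 0] PiE_mem[OF c(1), of 1] by simp_all
    then have "z = f (c 0) (c 1)" unfolding c(2) by (rule sum)
    then show ?thesis using c01 by blast
  qed
  have inj: "a = c \<and> b = d"
    if h: "a \<in> carrier R" "b \<in> carrier R" "c \<in> carrier R" "d \<in> carrier R" "f a b = f c d" for a b c d
  proof -
    \<comment> \<open>Pairs of scalars as extensional functions on {0, 1}, the form in which
      uniqueness of coordinates is given.\<close>
    define g where "g a b = (\<lambda>i\<in>{..<2::nat}. if i = 0 then a else b)" for a b :: 'a
    have g: "g a b \<in> {..<2} \<rightarrow>\<^sub>E carrier R" "(\<Oplus>\<^bsub>M\<^esub>i \<in> {..<2}. g a b i \<odot>\<^bsub>M\<^esub> e i) = f a b"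
      if "a \<in> carrier R" "b \<in> carrier R" for a b
    proof -
      show "g a b \<in> {..<2} \<rightarrow>\<^sub>E carrier R" using that by (auto simp: g_def)
      have "g a b 0 = a" "g a b 1 = b" by (simp_all add: g_def)
      then show "(\<Oplus>\<^bsub>M\<^esub>i \<in> {..<2}. g a b i \<odot>\<^bsub>M\<^esub> e i) = f a b" using that sum[of "g a b"] by simp
    qed
    have "f a b \<in> carrier M" using h ec by (simp add: f_def)
    from ex1E[OF ex[OF this]] have "g a b = g c d" using g[OF h(1,2)] g[OF h(3,4)] h(5) by metis
    from fun_cong[OF this, of 0] fun_cong[OF this, of 1] show ?thesis by (simp add: g_def)
  qed
  have add: "f a b \<oplus>\<^bsub>M\<^esub> f c d = f (a \<oplus> c) (b \<oplus> d)"
    if "a \<in> carrier R" "b \<in> carrier R" "c \<in> carrier R" "d \<in> carrier R" for a b c d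
    using that ec by (simp add: f_def smult_l_distr M.a_ac)
  have sc: "c \<odot>\<^bsub>M\<^esub> f a b = f (c \<otimes> a) (c \<otimes> b)"
    if "a \<in> carrier R" "b \<in> carrier R" "c \<in> carrier R" for a b c
    using that ec by (simp add: f_def smult_r_distr smult_assoc1)
  obtain a b where ab: "a \<in> carrier R" "b \<in> carrier R" "\<one>\<^bsub>M\<^esub> = f a b" using span by blast
  obtain p q where pq: "p \<in> carrier R" "q \<in> carrier R" "e0 \<otimes>\<^bsub>M\<^esub> e0 = f p q" using span ec by blast
  obtain p' q' where pq': "p' \<in> carrier R" "q' \<in> carrier R" "e1 \<otimes>\<^bsub>M\<^esub> e0 = f p' q'" using span ec by blast
  \<comment> \<open>In 1 e0 = e0 the unit is expanded as a e0 + b e1. Comparing the coordinates at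
    e0 yields 1 = ap + bp', that is, the unimodularity of (a, b).\<close>
  have "f \<one> \<zero> = \<one>\<^bsub>M\<^esub> \<otimes>\<^bsub>M\<^esub> e0" using ec by (simp add: f_def)
  also have "\<dots> = a \<odot>\<^bsub>M\<^esub> (e0 \<otimes>\<^bsub>M\<^esub> e0) \<oplus>\<^bsub>M\<^esub> b \<odot>\<^bsub>M\<^esub> (e1 \<otimes>\<^bsub>M\<^esub> e0)"
    unfolding ab(3) f_def using ab ec by (simp add: l_distr smult_mult_left)
  also have "\<dots> = f (a \<otimes> p \<oplus> b \<otimes> p') (a \<otimes> q \<oplus> b \<otimes> q')"
    using ab pq pq' by (simp add: sc add)
  finally have cd0: "f \<one> \<zero> = f (a \<otimes> p \<oplus> b \<otimes> p') (a \<otimes> q \<oplus> b \<otimes> q')" .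
  have cd: "\<one> = a \<otimes> p \<oplus> b \<otimes> p'"
    using inj[OF _ _ _ _ cd0] ab(1,2) pq(1,2) pq'(1,2) by simp
  \<comment> \<open>The row (-p', p) completes (a, b) to a matrix of determinant ap + bp' =
    1.\<close>
  define x where "x = f (\<ominus> p') p"
  have x: "x \<in> carrier M" using ec pq pq' by (simp add: x_def f_def)
  have lcx: "lc M x c d = f (c \<otimes> a \<ominus> d \<otimes> p') (c \<otimes> b \<oplus> d \<otimes> p)"
    if "c \<in> carrier R" "d \<in> carrier R" for c d
    using that ab pq pq' by (simp add: lc_def x_def sc add R.r_minus a_minus_def)
  have "qbasis R M x"
    unfolding qbasis_def
  proof (intro conjI ballI impI x)
    fix z assume "z \<in> carrier M"
    then obtain c d where z: "c \<in> carrier R" "d \<in> carrier R" "z = f c d" using span by blast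
    \<comment> \<open>Cramer's rule for this matrix: the adjugate gives the coordinates of z in the
      new basis. Independence below uses the same inverse.\<close>
    have "(c \<otimes> p \<oplus> d \<otimes> p') \<otimes> a \<ominus> (d \<otimes> a \<ominus> c \<otimes> b) \<otimes> p' = c \<otimes> (a \<otimes> p \<oplus> b \<otimes> p')"
      "(c \<otimes> p \<oplus> d \<otimes> p') \<otimes> b \<oplus> (d \<otimes> a \<ominus> c \<otimes> b) \<otimes> p = d \<otimes> (a \<otimes> p \<oplus> b \<otimes> p')"
      using z ab pq pq' by algebra+
    then have "z = lc M x (c \<otimes> p \<oplus> d \<otimes> p') (d \<otimes> a \<ominus> c \<otimes> b)"
      using z ab pq pq' by (simp add: lcx cd[symmetric])
    then show "\<exists>a\<in>carrier R. \<exists>b\<in>carrier R. z = lc M x a b" using z ab pq pq' by blast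
  next
    fix c d assume h: "c \<in> carrier R" "d \<in> carrier R" "lc M x c d = \<zero>\<^bsub>M\<^esub>"
    have "\<zero>\<^bsub>M\<^esub> = f \<zero> \<zero>" using ec by (simp add: f_def)
    then have *: "c \<otimes> a \<ominus> d \<otimes> p' = \<zero>" "c \<otimes> b \<oplus> d \<otimes> p = \<zero>"
      using inj[of "c \<otimes> a \<ominus> d \<otimes> p'" "c \<otimes> b \<oplus> d \<otimes> p" \<zero> \<zero>] h ab pq pq' by (auto simp: lcx)
    have "c \<otimes> (a \<otimes> p \<oplus> b \<otimes> p') = (c \<otimes> a \<ominus> d \<otimes> p') \<otimes> p \<oplus> (c \<otimes> b \<oplus> d \<otimes> p) \<otimes> p'"
      "d \<otimes> (a \<otimes> p \<oplus> b \<otimes> p') = (c \<otimes> b \<oplus> d \<otimes> p) \<otimes> a \<ominus> (c \<otimes> a \<ominus> d \<otimes> p') \<otimes> b"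
      using h ab pq pq' by algebra+
    then show "c = \<zero>" "d = \<zero>" using h ab pq pq' unfolding * cd[symmetric] by (simp_all add: a_minus_def)
  qed
  moreover from this obtain n t where "n \<in> carrier R" "t \<in> carrier R" "x \<otimes>\<^bsub>M\<^esub> x = lc M x n t"
    using lc_cases[of x "x \<otimes>\<^bsub>M\<^esub> x"] x by blast
  ultimately have "quad_gen R M x t (\<ominus> n)" by (simp add: quad_gen_iff)
  then show ?thesis by (rule that)
qed

lemma quad_gen_imp_free_of_rank_2:
  assumes "quad_gen R M x t n" shows "free_of_rank R M 2"
proof -
  have x: "x \<in> carrier M" and qb: "qbasis R M x"
    using assms by (auto simp: quad_gen_iff qbasis_def)
  define e where "e i = (if i = (0::nat) then \<one>\<^bsub>M\<^esub> else x)" for i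
  have two: "{..<2::nat} = {0, 1}" by auto
  have sum: "(\<Oplus>\<^bsub>M\<^esub>i \<in> {..<2}. c i \<odot>\<^bsub>M\<^esub> e i) = lc M x (c 0) (c 1)" if "c 0 \<in> carrier R" "c 1 \<in> carrier R" for c
    unfolding two using that x by (simp add: lc_def e_def)
  show ?thesis
    unfolding free_of_rank_def
  proof (intro bexI[of _ e] ballI)
    fix z assume "z \<in> carrier M"
    then obtain a b where ab: "a \<in> carrier R" "b \<in> carrier R" "z = lc M x a b" by (rule lc_cases[OF qb])
    let ?c = "\<lambda>i\<in>{..<2::nat}. if i = 0 then a else b"
    show "\<exists>!c. c \<in> {..<2} \<rightarrow>\<^sub>E carrier R \<and> z = (\<Oplus>\<^bsub>M\<^esub>i \<in> {..<2}. c i \<odot>\<^bsub>M\<^esub> e i)"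
    proof (rule ex1I[of _ ?c])
      show "?c \<in> {..<2} \<rightarrow>\<^sub>E carrier R \<and> z = (\<Oplus>\<^bsub>M\<^esub>i \<in> {..<2}. ?c i \<odot>\<^bsub>M\<^esub> e i)"
        using ab by (subst sum) auto
    next
      fix c assume c: "c \<in> {..<2} \<rightarrow>\<^sub>E carrier R \<and> z = (\<Oplus>\<^bsub>M\<^esub>i \<in> {..<2}. c i \<odot>\<^bsub>M\<^esub> e i)"
      then have cc: "c 0 \<in> carrier R" "c 1 \<in> carrier R"
        using PiE_mem[of c "{..<2}" "\<lambda>_. carrier R" 0] PiE_mem[of c "{..<2}" "\<lambda>_. carrier R" 1] by simp_all
      have "lc M x a b = lc M x (c 0) (c 1)"
        unfolding ab(3)[symmetric] sum[OF cc, symmetric] using c by (rule conjunct2)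
      then have "c 0 = a" "c 1 = b" using lc_inj[OF qb ab(1,2) cc] by auto
      show "c = ?c"
      proof (rule extensionalityI)
        show "c \<in> extensional {..<2}" using c by (auto simp: PiE_def)
        fix i :: nat assume "i \<in> {..<2}"
        then have "i = 0 \<or> i = 1" by auto
        then show "c i = ?c i" using \<open>c 0 = a\<close> \<open>c 1 = b\<close> by auto
      qed simp
    qed
  qed (use x in \<open>auto simp: e_def\<close>)
qed

end

lemma alg_isoI:
  assumes "assoc_algebra R S" "assoc_algebra R T" "f \<in> carrier S \<rightarrow> carrier T"
    and "\<And>x y. x \<in> carrier S \<Longrightarrow> y \<in> carrier S \<Longrightarrow> f (x \<otimes>\<^bsub>S\<^esub> y) = f x \<otimes>\<^bsub>T\<^esub> f y"
    and "\<And>x y. x \<in> carrier S \<Longrightarrow> y \<in> carrier S \<Longrightarrow> f (x \<oplus>\<^bsub>S\<^esub> y) = f x \<oplus>\<^bsub>T\<^esub> f y"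
    and "\<And>a x. a \<in> carrier R \<Longrightarrow> x \<in> carrier S \<Longrightarrow> f (a \<odot>\<^bsub>S\<^esub> x) = a \<odot>\<^bsub>T\<^esub> f x"
    and "f \<one>\<^bsub>S\<^esub> = \<one>\<^bsub>T\<^esub>"
    and "\<And>x. x \<in> carrier S \<Longrightarrow> f x = \<zero>\<^bsub>T\<^esub> \<Longrightarrow> x = \<zero>\<^bsub>S\<^esub>"
    and "\<And>y. y \<in> carrier T \<Longrightarrow> \<exists>x\<in>carrier S. f x = y"
  shows "f \<in> alg_iso R S T"
proof -
  interpret S: assoc_algebra R S by fact
  interpret T: assoc_algebra R T by fact
  have m: "f \<in> ring_hom S T" using assms by (auto simp: ring_hom_def)
  interpret h: ring_hom_ring S T f
    by (rule ring_hom_ringI2[OF S.ring_axioms T.ring_axioms m])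
  have "inj_on f (carrier S)"
  proof (rule inj_onI)
    fix x y assume xy: "x \<in> carrier S" "y \<in> carrier S" "f x = f y"
    then have "f (x \<ominus>\<^bsub>S\<^esub> y) = \<zero>\<^bsub>T\<^esub>" by (simp add: a_minus_def T.M.r_neg)
    then have "x \<ominus>\<^bsub>S\<^esub> y = \<zero>\<^bsub>S\<^esub>" using assms(8) xy by simp
    then show "x = y" using xy S.M.diff_eq_zero_iff by blast
  qed
  moreover have "f ` carrier S = carrier T" using assms(3,9) by (auto simp: image_iff)
  ultimately show ?thesis
    using m assms by (auto simp: alg_iso_def ring_iso_def mod_hom_def bij_betw_def)
qed

lemma alg_isoD:
  assumes "f \<in> alg_iso R S T"
  shows "x \<in> carrier S \<Longrightarrow> f x \<in> carrier T"
    "x \<in> carrier S \<Longrightarrow> y \<in> carrier S \<Longrightarrow> f (x \<otimes>\<^bsub>S\<^esub> y) = f x \<otimes>\<^bsub>T\<^esub> f y"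
    "x \<in> carrier S \<Longrightarrow> y \<in> carrier S \<Longrightarrow> f (x \<oplus>\<^bsub>S\<^esub> y) = f x \<oplus>\<^bsub>T\<^esub> f y"
    "a \<in> carrier R \<Longrightarrow> x \<in> carrier S \<Longrightarrow> f (a \<odot>\<^bsub>S\<^esub> x) = a \<odot>\<^bsub>T\<^esub> f x"
    "f \<one>\<^bsub>S\<^esub> = \<one>\<^bsub>T\<^esub>"
    "bij_betw f (carrier S) (carrier T)"
  using assms by (auto simp: alg_iso_def ring_iso_def ring_hom_def mod_hom_def)

text \<open>By \<open>lc_mult\<close> the whole product is determined by trace and norm of a
  generator, so matching coordinates is an isomorphism. The coordinate formula is recorded because
  gluing has to compare such isomorphisms on overlaps.\<close>

lemma quad_gen_iso:
  assumes alg: "assoc_algebra R S" "assoc_algebra R T"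
    and S: "quad_gen R S x t n" and T: "quad_gen R T y t n"
  obtains f where "f \<in> alg_iso R S T"
    "\<And>a b. a \<in> carrier R \<Longrightarrow> b \<in> carrier R \<Longrightarrow> f (lc S x a b) = lc T y a b"
proof -
  interpret S: quad_context R S by (rule quad_context.intro) fact
  interpret T: quad_context R T by (rule quad_context.intro) fact
  have x: "x \<in> carrier S" and t: "t \<in> carrier R" "n \<in> carrier R" and qx: "qbasis R S x"
    and xx: "x \<otimes>\<^bsub>S\<^esub> x = lc S x (\<ominus>\<^bsub>R\<^esub> n) t"
    using S by (auto simp: S.quad_gen_iff qbasis_def)
  have y: "y \<in> carrier T" and qy: "qbasis R T y" and yy: "y \<otimes>\<^bsub>T\<^esub> y = lc T y (\<ominus>\<^bsub>R\<^esub> n) t"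
    using T by (auto simp: T.quad_gen_iff qbasis_def)
  define f where "f z = (THE w. \<exists>a\<in>carrier R. \<exists>b\<in>carrier R. z = lc S x a b \<and> w = lc T y a b)" for z
  have f: "f (lc S x a b) = lc T y a b" if "a \<in> carrier R" "b \<in> carrier R" for a b
    unfolding f_def
  proof (rule the_equality)
    fix w assume "\<exists>a'\<in>carrier R. \<exists>b'\<in>carrier R. lc S x a b = lc S x a' b' \<and> w = lc T y a' b'"
    then show "w = lc T y a b" using S.lc_inj[OF qx that] by blast
  qed (use that in blast)
  have "f \<in> alg_iso R S T"
  proof (rule alg_isoI[OF alg])
    show "f \<in> carrier S \<rightarrow> carrier T" by (auto elim!: S.lc_cases[OF qx] simp: f y)
  next
    fix z w assume "z \<in> carrier S" "w \<in> carrier S"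
    then show "f (z \<otimes>\<^bsub>S\<^esub> w) = f z \<otimes>\<^bsub>T\<^esub> f w" "f (z \<oplus>\<^bsub>S\<^esub> w) = f z \<oplus>\<^bsub>T\<^esub> f w"
      by (auto elim!: S.lc_cases[OF qx]
          simp: f x y t S.lc_add T.lc_add S.lc_mult[OF x t xx] T.lc_mult[OF y t yy])
  next
    fix a z assume "a \<in> carrier R" "z \<in> carrier S"
    then show "f (a \<odot>\<^bsub>S\<^esub> z) = a \<odot>\<^bsub>T\<^esub> f z"
      by (auto elim!: S.lc_cases[OF qx] simp: f x y S.lc_smult T.lc_smult)
  next
    show "f \<one>\<^bsub>S\<^esub> = \<one>\<^bsub>T\<^esub>"
      using f[of "\<one>\<^bsub>R\<^esub>" "\<zero>\<^bsub>R\<^esub>"] by (simp add: S.lc_one T.lc_one x y)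
  next
    fix z assume z: "z \<in> carrier S" "f z = \<zero>\<^bsub>T\<^esub>"
    from z(1) obtain a b where ab: "a \<in> carrier R" "b \<in> carrier R" "z = lc S x a b"
      by (rule S.lc_cases[OF qx])
    then have "lc T y a b = \<zero>\<^bsub>T\<^esub>" using z(2) by (simp add: f)
    then have "a = \<zero>\<^bsub>R\<^esub>" "b = \<zero>\<^bsub>R\<^esub>" using qy ab unfolding qbasis_def by blast+
    then show "z = \<zero>\<^bsub>S\<^esub>" using ab S.lc_zero[OF x] by simp
  next
    fix w assume "w \<in> carrier T"
    then obtain a b where ab: "a \<in> carrier R" "b \<in> carrier R" "w = lc T y a b"
      by (rule T.lc_cases[OF qy])
    then show "\<exists>z\<in>carrier S. f z = w"
      by (intro bexI[of _ "lc S x a b"]) (simp_all add: f x)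
  qed
  then show ?thesis using f by (rule that)
qed

section \<open>Localized bases\<close>

text \<open>The basis property over the localized ring with all denominators cleared. As a condition
  on elements of S and R it is monotone in W, which is how a basis survives further
  localization.\<close>

definition local_basis :: "('a, 'r) ring_scheme \<Rightarrow> 'a set \<Rightarrow> ('a, 'b, 'm) module_scheme \<Rightarrow> 'b \<Rightarrow> bool"
  where "local_basis R W S e \<longleftrightarrow> e \<in> carrier S \<and>
    (\<forall>u\<in>carrier S. \<exists>s\<in>W. \<exists>a\<in>carrier R. \<exists>b\<in>carrier R. s \<odot>\<^bsub>S\<^esub> u = lc S e a b) \<and>
    (\<forall>a\<in>carrier R. \<forall>b\<in>carrier R. lc S e a b = \<zero>\<^bsub>S\<^esub> \<longrightarrow>
      (\<exists>s\<in>W. s \<otimes>\<^bsub>R\<^esub> a = \<zero>\<^bsub>R\<^esub> \<and> s \<otimes>\<^bsub>R\<^esub> b = \<zero>\<^bsub>R\<^esub>))"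

lemma local_basis_mono: "local_basis R V S e \<Longrightarrow> V \<subseteq> W \<Longrightarrow> local_basis R W S e"
  unfolding local_basis_def by (meson subsetD)

locale loc_quad = quad_context R M + loc_module R M W
  for R :: "('a, 'r) ring_scheme" (structure) and M :: "('a, 'b) module" (structure) and W

sublocale loc_quad \<subseteq> loc_algebra by unfold_locales

lemma loc_quadI: "assoc_algebra R M \<Longrightarrow> mult_set R W \<Longrightarrow> loc_quad R M W"
  by (simp add: loc_quad_def quad_context_def loc_module_def assoc_algebra_def)

lemma (in mult_set) loc_quad_reg: "loc_quad R (reg R) W"
  by (rule loc_quadI[OF assoc_algebra_reg mult_set_axioms])

context loc_quad
begin

interpretation Re: loc_quad R "reg R" W
  by (rule mult_set.loc_quad_reg) unfold_locales

lemma loc_quad_context: "quad_context LR LM"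
  by (rule quad_context.intro) (rule loc_assoc_algebra)

interpretation L: quad_context LR LM by (rule loc_quad_context)

lemma lc_frac:
  assumes "e \<in> carrier M" "k \<in> W" "s \<in> W" "a \<in> carrier R" "b \<in> carrier R"
  shows "lc LM (fr e k) (rf a s) (rf b s) = fr (lc M e (k \<otimes> a) b) (k \<otimes> s)"
proof -
  have "lc LM (fr e k) (rf a s) (rf b s) = fr (a \<odot>\<^bsub>M\<^esub> \<one>\<^bsub>M\<^esub>) s \<oplus>\<^bsub>LM\<^esub> fr (b \<odot>\<^bsub>M\<^esub> e) (k \<otimes> s)"
    using assms by (simp add: lc_def one_frac smult_frac R.m_comm)
  also have "fr (a \<odot>\<^bsub>M\<^esub> \<one>\<^bsub>M\<^esub>) s = fr (k \<odot>\<^bsub>M\<^esub> (a \<odot>\<^bsub>M\<^esub> \<one>\<^bsub>M\<^esub>)) (k \<otimes> s)"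
    using assms by (simp add: frac_cancel)
  finally show ?thesis
    using assms by (simp add: add_frac_same lc_def smult_assoc1)
qed

lemma frac_lc:
  assumes "e \<in> carrier M" "k \<in> W" "s \<in> W" "a \<in> carrier R" "b \<in> carrier R"
  shows "fr (lc M e a b) s = lc LM (fr e k) (rf a s) (rf (k \<otimes> b) s)"
  using assms frac_cancel[of "lc M e a b" s k] by (simp add: lc_frac lc_smult)

text \<open>The denominator k is a unit of the localized ring, so a generator may be replaced by its
  numerator, an element of M.\<close>

lemma qbasis_frac_iff:
  assumes e: "e \<in> carrier M" "k \<in> W"
  shows "qbasis LR LM (fr e k) \<longleftrightarrow> local_basis R W M e"
proof
  assume q: "qbasis LR LM (fr e k)"
  show "local_basis R W M e"
    unfolding local_basis_def
  proof (intro conjI ballI impI)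
    fix u assume u: "u \<in> carrier M"
    then have "fr u \<one> \<in> carrier LM" by simp
    then obtain A B where AB: "A \<in> carrier LR" "B \<in> carrier LR" "fr u \<one> = lc LM (fr e k) A B"
      by (rule L.lc_cases[OF q])
    obtain a b s where a: "a \<in> carrier R" "b \<in> carrier R" "s \<in> W" "A = rf a s" "B = rf b s"
      by (rule Re.common2[OF AB(1,2)]) auto
    have "fr u \<one> = fr (lc M e (k \<otimes> a) b) (k \<otimes> s)" using AB(3) a e by (simp add: lc_frac)
    then obtain v where v: "v \<in> W" "v \<odot>\<^bsub>M\<^esub> ((k \<otimes> s) \<odot>\<^bsub>M\<^esub> u) = v \<odot>\<^bsub>M\<^esub> (\<one> \<odot>\<^bsub>M\<^esub> lc M e (k \<otimes> a) b)"
      using u e a by (subst (asm) frac_eq_iff) auto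
    then have "(v \<otimes> (k \<otimes> s)) \<odot>\<^bsub>M\<^esub> u = lc M e (v \<otimes> (k \<otimes> a)) (v \<otimes> b)"
      using u e a by (simp add: smult_assoc1 lc_smult)
    then show "\<exists>s\<in>W. \<exists>a\<in>carrier R. \<exists>b\<in>carrier R. s \<odot>\<^bsub>M\<^esub> u = lc M e a b"
      using v e a by (intro bexI[of _ "v \<otimes> (k \<otimes> s)"] bexI[of _ "v \<otimes> (k \<otimes> a)"] bexI[of _ "v \<otimes> b"]) auto
  next
    fix a b assume a: "a \<in> carrier R" "b \<in> carrier R" "lc M e a b = \<zero>\<^bsub>M\<^esub>"
    have "lc LM (fr e k) (rf a \<one>) (rf (k \<otimes> b) \<one>) = \<zero>\<^bsub>LM\<^esub>"
      using a e frac_lc[of e k \<one> a b] by (simp add: zero_frac[of \<one>])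
    then have "rf a \<one> = \<zero>\<^bsub>LR\<^esub> \<and> rf (k \<otimes> b) \<one> = \<zero>\<^bsub>LR\<^esub>"
      using q a e unfolding qbasis_def by (metis Re.frac_closed reg_simps(1) one_in_W R.m_closed W_carrier)
    then obtain u v where uv: "u \<in> W" "u \<otimes> a = \<zero>" "v \<in> W" "v \<otimes> (k \<otimes> b) = \<zero>"
      using a e by (auto simp: Re.frac_eq_zero_iff)
    \<comment> \<open>One element of W has to kill both coefficients: u kills a and vk kills b, so
      their product kills both.\<close>
    have "u \<otimes> (v \<otimes> k) \<otimes> a = (v \<otimes> k) \<otimes> (u \<otimes> a)" "u \<otimes> (v \<otimes> k) \<otimes> b = u \<otimes> (v \<otimes> (k \<otimes> b))"
      using uv(1,3) a e by (simp_all add: R.m_ac)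
    then show "\<exists>s\<in>W. s \<otimes> a = \<zero> \<and> s \<otimes> b = \<zero>"
      using uv e a by (intro bexI[of _ "u \<otimes> (v \<otimes> k)"]) auto
  qed (rule e)
next
  assume l: "local_basis R W M e"
  show "qbasis LR LM (fr e k)"
    unfolding qbasis_def
  proof (intro conjI ballI impI)
    fix X assume "X \<in> carrier LM"
    then obtain u s where u: "u \<in> carrier M" "s \<in> W" "X = fr u s" by (rule loc_cases)
    obtain v a b where v: "v \<in> W" "a \<in> carrier R" "b \<in> carrier R" "v \<odot>\<^bsub>M\<^esub> u = lc M e a b"
      using l u(1) unfolding local_basis_def by blast
    have "X = fr (lc M e a b) (v \<otimes> s)" using u v frac_cancel[of u s v] by simp
    then have "X = lc LM (fr e k) (rf a (v \<otimes> s)) (rf (k \<otimes> b) (v \<otimes> s))"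
      using u v e frac_lc[of e k "v \<otimes> s" a b] by simp
    then show "\<exists>A\<in>carrier LR. \<exists>B\<in>carrier LR. X = lc LM (fr e k) A B"
      using u v e by (intro bexI[of _ "rf a (v \<otimes> s)"] bexI[of _ "rf (k \<otimes> b) (v \<otimes> s)"]) simp_all
  next
    fix A B assume AB: "A \<in> carrier LR" "B \<in> carrier LR" "lc LM (fr e k) A B = \<zero>\<^bsub>LM\<^esub>"
    obtain a b s where a: "a \<in> carrier R" "b \<in> carrier R" "s \<in> W" "A = rf a s" "B = rf b s"
      by (rule Re.common2[OF AB(1,2)]) auto
    have "fr (lc M e (k \<otimes> a) b) (k \<otimes> s) = \<zero>\<^bsub>LM\<^esub>" using AB(3) a e by (simp add: lc_frac)
    then obtain u where u: "u \<in> W" "u \<odot>\<^bsub>M\<^esub> lc M e (k \<otimes> a) b = \<zero>\<^bsub>M\<^esub>"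
      using a e by (auto simp: frac_eq_zero_iff)
    then have "lc M e (u \<otimes> (k \<otimes> a)) (u \<otimes> b) = \<zero>\<^bsub>M\<^esub>" using a e by (simp add: lc_smult)
    moreover have "u \<otimes> (k \<otimes> a) \<in> carrier R" "u \<otimes> b \<in> carrier R" using a e u by auto
    ultimately obtain v where v: "v \<in> W" "v \<otimes> (u \<otimes> (k \<otimes> a)) = \<zero>" "v \<otimes> (u \<otimes> b) = \<zero>"
      using l unfolding local_basis_def by blast
    have "(v \<otimes> (u \<otimes> k)) \<otimes> a = \<zero>" "(v \<otimes> u) \<otimes> b = \<zero>" using v u(1) e a by (simp_all add: R.m_assoc)
    moreover have "v \<otimes> (u \<otimes> k) \<in> W" "v \<otimes> u \<in> W" using u v e by simp_all
    ultimately have "\<exists>w\<in>W. w \<otimes> a = \<zero>" "\<exists>w\<in>W. w \<otimes> b = \<zero>" by blast+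
    then show "A = \<zero>\<^bsub>LR\<^esub>" "B = \<zero>\<^bsub>LR\<^esub>"
      using a(1-3) Re.frac_eq_zero_iff[of a s] Re.frac_eq_zero_iff[of b s]
      unfolding a(4,5) by simp_all
  qed (use e in simp)
qed

lemma quad_gen_base:
  assumes "quad_gen R M x t n"
  shows "quad_gen LR LM (fr x \<one>) (rf t \<one>) (rf n \<one>)"
proof -
  have x: "x \<in> carrier M" "t \<in> carrier R" "n \<in> carrier R" and qb: "qbasis R M x"
    and xx: "x \<otimes>\<^bsub>M\<^esub> x = lc M x (\<ominus> n) t"
    using assms by (auto simp: quad_gen_iff qbasis_def)
  have "local_basis R W M x"
    using qb unfolding local_basis_def qbasis_def by (metis one_in_W smult_one R.r_null R.one_closed)
  then show ?thesis
    using x xx frac_lc[of x \<one> \<one> "\<ominus> n" t]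
    by (simp add: L.quad_gen_iff qbasis_frac_iff mult_frac Re.minus_frac
      a_inv_cong[of "reg R" R])
qed

end

lemma reg_a_inv [simp]: "a_inv (reg R) = a_inv R"
  by (rule a_inv_cong) simp_all

lemma reg_a_minus [simp]: "a_minus (reg R) = a_minus R"
  by (simp add: fun_eq_iff a_minus_def)

section \<open>Further localization\<close>

locale res_quad = quad_context R M + V: loc_quad R M V + W: loc_quad R M W
  for R :: "('a, 'r) ring_scheme" (structure) and M :: "('a, 'b) module" (structure) and V W +
  assumes VW: "V \<subseteq> W"
begin

abbreviation "res \<equiv> loc_res R W M"
abbreviation "rres \<equiv> loc_res R W (reg R)"

lemma VWD [simp]: "s \<in> V \<Longrightarrow> s \<in> W" using VW by blast

lemma res_frac [simp]:
  assumes x: "x \<in> carrier M" "s \<in> V"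
  shows "res (V.fr x s) = W.fr x s"
  unfolding loc_res_def
proof (rule V.UN_frac[OF x])
  fix y t assume y: "y \<in> carrier M" "t \<in> V" "V.fr y t = V.fr x s"
  then obtain u where "u \<in> V" "u \<odot>\<^bsub>M\<^esub> (s \<odot>\<^bsub>M\<^esub> y) = u \<odot>\<^bsub>M\<^esub> (t \<odot>\<^bsub>M\<^esub> x)"
    using x by (subst (asm) V.frac_eq_iff) auto
  then show "W.fr y t = W.fr x s"
    using x y by (subst W.frac_eq_iff) auto
qed

lemma res_closed [simp]: "X \<in> carrier V.LM \<Longrightarrow> res X \<in> carrier W.LM"
  by (auto elim!: V.loc_cases)

lemma res_add:
  assumes "X \<in> carrier V.LM" "Y \<in> carrier V.LM"
  shows "res (X \<oplus>\<^bsub>V.LM\<^esub> Y) = res X \<oplus>\<^bsub>W.LM\<^esub> res Y"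
proof -
  obtain x y s where "x \<in> carrier M" "y \<in> carrier M" "s \<in> V" "X = V.fr x s" "Y = V.fr y s"
    using assms by (rule V.common2)
  then show ?thesis by (simp add: V.add_frac_same W.add_frac_same)
qed

lemma res_minus:
  assumes "X \<in> carrier V.LM"
  shows "res (\<ominus>\<^bsub>V.LM\<^esub> X) = \<ominus>\<^bsub>W.LM\<^esub> res X"
proof -
  obtain x s where "x \<in> carrier M" "s \<in> V" "X = V.fr x s"
    using assms by (rule V.loc_cases)
  then show ?thesis by (simp add: V.minus_frac W.minus_frac)
qed

lemma res_mult:
  assumes "X \<in> carrier V.LM" "Y \<in> carrier V.LM"
  shows "res (X \<otimes>\<^bsub>V.LM\<^esub> Y) = res X \<otimes>\<^bsub>W.LM\<^esub> res Y"
proof -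
  obtain x y s where "x \<in> carrier M" "y \<in> carrier M" "s \<in> V" "X = V.fr x s" "Y = V.fr y s"
    using assms by (rule V.common2)
  then show ?thesis by (simp add: V.mult_frac W.mult_frac)
qed

lemma res_one: "res \<one>\<^bsub>V.LM\<^esub> = \<one>\<^bsub>W.LM\<^esub>"
  by (simp add: V.one_frac W.one_frac)

end

lemma (in res_quad) res_quad_reg: "res_quad R (reg R) V W"
  using V.loc_quad_reg W.loc_quad_reg VW
  by (simp add: res_quad_def res_quad_axioms_def loc_quad_def)

context res_quad
begin

interpretation Re: res_quad R "reg R" V W by (rule res_quad_reg)
interpretation LV: quad_context V.LR V.LM by (rule V.loc_quad_context)
interpretation LW: quad_context W.LR W.LM by (rule W.loc_quad_context)

lemma res_smult:
  assumes "A \<in> carrier V.LR" "X \<in> carrier V.LM"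
  shows "res (A \<odot>\<^bsub>V.LM\<^esub> X) = rres A \<odot>\<^bsub>W.LM\<^esub> res X"
proof -
  obtain x s where "x \<in> carrier M" "s \<in> V" "X = V.fr x s"
    using assms(2) by (rule V.loc_cases)
  moreover obtain a t where "a \<in> carrier R" "t \<in> V" "A = V.rf a t"
    by (rule Re.V.loc_cases[OF assms(1)]) auto
  ultimately show ?thesis by (simp add: V.smult_frac W.smult_frac)
qed

lemma res_lc:
  assumes "A \<in> carrier V.LR" "B \<in> carrier V.LR" "X \<in> carrier V.LM"
  shows "res (lc V.LM X A B) = lc W.LM (res X) (rres A) (rres B)"
  using assms by (simp add: lc_def res_add res_smult res_one)

text \<open>The basis property passes through \<open>local_basis\<close>, which is monotone in the
  multiplicative set; the equation x^2 = tx - n is carried along by the homomorphism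
  \<open>res\<close>.\<close>

lemma quad_gen_res:
  assumes "quad_gen V.LR V.LM x t n"
  shows "quad_gen W.LR W.LM (res x) (rres t) (rres n)"
proof -
  have x: "x \<in> carrier V.LM" "t \<in> carrier V.LR" "n \<in> carrier V.LR" and qb: "qbasis V.LR V.LM x"
    and xx: "x \<otimes>\<^bsub>V.LM\<^esub> x = lc V.LM x (\<ominus>\<^bsub>V.LR\<^esub> n) t"
    using assms by (auto simp: LV.quad_gen_iff qbasis_def)
  obtain e s where e: "e \<in> carrier M" "s \<in> V" "x = V.fr e s" using x(1) by (rule V.loc_cases)
  have "local_basis R V M e" using qb e by (simp add: V.qbasis_frac_iff)
  then have "local_basis R W M e" by (rule local_basis_mono) (rule VW)
  then have "qbasis W.LR W.LM (res x)" using e by (simp add: W.qbasis_frac_iff)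
  moreover have "res x \<otimes>\<^bsub>W.LM\<^esub> res x = lc W.LM (res x) (\<ominus>\<^bsub>W.LR\<^esub> rres n) (rres t)"
    unfolding res_mult[OF x(1,1), symmetric] xx using x by (simp add: res_lc Re.res_minus)
  ultimately show ?thesis using x by (simp add: LW.quad_gen_iff)
qed

end

section \<open>Principal covers\<close>

context cring
begin

lemma powers_mult_set: 
  assumes "f \<in> carrier R" shows "mult_set R (powers R f)"
proof
  show "\<one> \<in> powers R f" unfolding powers_def by (auto intro!: exI[of _ "0::nat"])
  fix s t assume "s \<in> powers R f" "t \<in> powers R f"
  then show "s \<otimes> t \<in> powers R f" unfolding powers_def using assms by (auto simp: nat_pow_mult)
qed (use assms in \<open>auto simp: powers_def\<close>)

text \<open>For V and W the powers of f and g, the products \<open>f\<^sup>ig\<^sup>j\<close> are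
  the denominators on the overlap of D(f) and D(g). Both sets lie in the product because each
  contains 1.\<close>

lemma set_mult_mult_set:
  assumes "mult_set R V" "mult_set R W"
  shows "mult_set R (V <#> W)" "V \<subseteq> V <#> W" "W \<subseteq> V <#> W"
proof -
  interpret V: mult_set R V by fact
  interpret W: mult_set R W by fact
  have I: "v \<otimes> w \<in> V <#> W" if "v \<in> V" "w \<in> W" for v w
    using that unfolding set_mult_def by blast
  show "V \<subseteq> V <#> W" using I[OF _ W.one_in_W] by force
  show "W \<subseteq> V <#> W" using I[OF V.one_in_W] by force
  show "mult_set R (V <#> W)"
  proof
    show "V <#> W \<subseteq> carrier R" unfolding set_mult_def by auto
    show "\<one> \<in> V <#> W" using I[OF V.one_in_W W.one_in_W] by simp
    fix s t assume "s \<in> V <#> W" "t \<in> V <#> W"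
    then obtain a b c d where *: "a \<in> V" "b \<in> W" "c \<in> V" "d \<in> W" "s = a \<otimes> b" "t = c \<otimes> d"
      unfolding set_mult_def by blast
    then have "s \<otimes> t = (a \<otimes> c) \<otimes> (b \<otimes> d)" by (simp add: m_ac)
    then show "s \<otimes> t \<in> V <#> W" using I[of "a \<otimes> c" "b \<otimes> d"] * by simp
  qed
qed

text \<open>Powers of generators of the unit ideal still generate it. The induction removes one f at
  a time: from 1 = j + cf one obtains 1 modulo J as a multiple of each power of f, and some power of
  f lies in I, hence in J.\<close>

lemma one_in_ideal_of_powers:
  assumes G: "finite G" "G \<subseteq> carrier R" and I: "ideal I R"
    and pow: "\<And>f. f \<in> G \<Longrightarrow> \<exists>s\<in>powers R f. s \<in> I"
    and one: "\<one> \<in> Idl (I \<union> G)"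
  shows "\<one> \<in> I"
  using G pow one
proof (induction G rule: finite_induct)
  case empty
  then show ?case using genideal_minimal[OF I, of I] by auto
next
  case (insert f G)
  have f: "f \<in> carrier R" and GR: "G \<subseteq> carrier R" and IR: "I \<subseteq> carrier R"
    using insert.prems ideal.Icarr[OF I] by auto
  define J where "J = Idl (I \<union> G)"
  have J: "ideal J R" unfolding J_def using GR IR by (intro genideal_ideal) auto
  have IJ: "I \<union> G \<subseteq> J" unfolding J_def using GR IR by (intro genideal_self) auto
  interpret J: ideal J R by (rule J)
  have "Idl (I \<union> insert f G) \<subseteq> Idl (J \<union> PIdl f)"
    using IJ cgenideal_self[OF f] ideal.Icarr[OF J] ideal.Icarr[OF cgenideal_ideal[OF f]]
    by (intro genideal_minimal genideal_ideal order_trans[OF _ genideal_self]) auto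
  then have "\<one> \<in> J <+> PIdl f" using union_genideal[OF J cgenideal_ideal[OF f]] insert.prems(3) by blast
  then obtain j c where jc: "j \<in> J" "c \<in> carrier R" "\<one> = j \<oplus> c \<otimes> f"
    unfolding set_add_def' cgenideal_def by blast
  \<comment> \<open>The equation for k is multiplied by 1 = j + cf; every term that contains j or j'
    stays in J.\<close>
  have pw: "\<exists>j\<in>J. \<exists>c\<in>carrier R. \<one> = j \<oplus> c \<otimes> f [^] k" for k :: nat
  proof (induction k)
    case 0
    then show ?case by (intro bexI[of _ \<zero>] bexI[of _ \<one>]) auto
  next
    case (Suc k)
    then obtain j' c' where *: "j' \<in> J" "c' \<in> carrier R" "\<one> = j' \<oplus> c' \<otimes> f [^] k" by blast
    define p where "p = f [^] k"
    have p: "p \<in> carrier R" using f by (simp add: p_def)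
    have "\<one> = \<one> \<otimes> \<one>" by simp
    also have "\<dots> = (j' \<oplus> c' \<otimes> p) \<otimes> (j \<oplus> c \<otimes> f)"
      by (simp only: p_def *(3)[symmetric] jc(3)[symmetric])
    also have "\<dots> = (j' \<otimes> (j \<oplus> c \<otimes> f) \<oplus> (c' \<otimes> p) \<otimes> j) \<oplus> (c' \<otimes> c) \<otimes> (p \<otimes> f)"
      using p f jc(1,2) *(1,2) J.a_Hcarr by algebra
    finally have "\<one> = (j' \<otimes> (j \<oplus> c \<otimes> f) \<oplus> (c' \<otimes> p) \<otimes> j) \<oplus> (c' \<otimes> c) \<otimes> f [^] Suc k"
      by (simp add: p_def)
    moreover have "j' \<otimes> (j \<oplus> c \<otimes> f) \<oplus> (c' \<otimes> p) \<otimes> j \<in> J"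
      using p f jc(1,2) *(1,2) J.a_Hcarr by (intro J.a_closed J.I_r_closed J.I_l_closed) auto
    ultimately show ?case using jc *(2) by blast
  qed
  obtain k :: nat where "f [^] k \<in> I" using insert.prems(2)[of f] unfolding powers_def by auto
  then have fk: "f [^] k \<in> J" using IJ by auto
  obtain j c where "j \<in> J" "c \<in> carrier R" "\<one> = j \<oplus> c \<otimes> f [^] k" using pw by blast
  then have "\<one> \<in> J" using fk by (metis J.a_closed J.I_l_closed)
  then show ?case using insert.IH insert.prems GR unfolding J_def by blast
qed

end

text \<open>The local-to-global principle behind all later arguments. The scalars that move y into H
  form an ideal, and it contains a power of each f of the cover, hence 1.\<close>

lemma (in module) principal_cover_mem:
  assumes F: "principal_cover R F" and H: "submodule H R M" and y: "y \<in> carrier M"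
    and loc: "\<And>f. f \<in> F \<Longrightarrow> \<exists>s\<in>powers R f. s \<odot>\<^bsub>M\<^esub> y \<in> H"
  shows "y \<in> H"
proof -
  define I where "I = {c \<in> carrier R. c \<odot>\<^bsub>M\<^esub> y \<in> H}"
  note E = submoduleE[OF H]
  obtain h where h: "h \<in> H" using E(2) by blast
  then have H0: "\<zero>\<^bsub>M\<^esub> \<in> H" using E(1) E(4)[OF R.zero_closed h] by auto
  have I: "ideal I R"
  proof (rule idealI[OF R.ring_axioms])
    show "subgroup I (add_monoid R)"
      by (rule R.add.subgroupI)
        (use y H0 E in \<open>auto simp: I_def smult_l_distr smult_l_minus a_inv_def[symmetric] intro!: exI[of _ \<zero>]\<close>)
  next
    fix a x assume "a \<in> I" "x \<in> carrier R"
    then show "x \<otimes> a \<in> I" using y E(4) by (simp add: I_def smult_assoc1)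
    then show "a \<otimes> x \<in> I" using \<open>a \<in> I\<close> \<open>x \<in> carrier R\<close> by (simp add: R.m_comm I_def)
  qed
  have F': "finite F" "F \<subseteq> carrier R" "Idl F = carrier R" using F by (auto simp: principal_cover_def)
  have IR: "I \<subseteq> carrier R" by (auto simp: I_def)
  have "Idl F \<subseteq> Idl (I \<union> F)" using F' IR
    by (intro R.genideal_minimal R.genideal_ideal order_trans[OF _ R.genideal_self]) auto
  then have "\<one> \<in> Idl (I \<union> F)" using F' by auto
  moreover have "\<exists>s\<in>powers R f. s \<in> I" if f: "f \<in> F" for f
  proof -
    obtain s where s: "s \<in> powers R f" "s \<odot>\<^bsub>M\<^esub> y \<in> H" using loc[OF f] by blast
    moreover have "s \<in> carrier R" using s(1) f F' by (auto simp: powers_def)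
    ultimately show ?thesis by (auto simp: I_def)
  qed
  ultimately have "\<one> \<in> I" using R.one_in_ideal_of_powers[OF F'(1,2) I] by blast
  then show ?thesis using y by (simp add: I_def)
qed

lemma (in module) zero_submodule: "submodule {\<zero>\<^bsub>M\<^esub>} R M"
  by (rule submoduleI) auto

section \<open>Gluing\<close>

context loc_quad
begin

lemma base_add: "x \<in> carrier M \<Longrightarrow> y \<in> carrier M \<Longrightarrow> fr (x \<oplus>\<^bsub>M\<^esub> y) \<one> = fr x \<one> \<oplus>\<^bsub>LM\<^esub> fr y \<one>"
  by (simp add: add_frac_same)

lemma base_smult: "a \<in> carrier R \<Longrightarrow> x \<in> carrier M \<Longrightarrow> fr (a \<odot>\<^bsub>M\<^esub> x) \<one> = rf a \<one> \<odot>\<^bsub>LM\<^esub> fr x \<one>"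
  by (simp add: smult_frac)

lemma base_mult: "x \<in> carrier M \<Longrightarrow> y \<in> carrier M \<Longrightarrow> fr (x \<otimes>\<^bsub>M\<^esub> y) \<one> = fr x \<one> \<otimes>\<^bsub>LM\<^esub> fr y \<one>"
  by (simp add: mult_frac)

lemma rf_closed: "a \<in> carrier R \<Longrightarrow> s \<in> W \<Longrightarrow> rf a s \<in> carrier LR"
  by (auto simp: loc_def)

lemma clear_denominator: "x \<in> carrier M \<Longrightarrow> k \<in> W \<Longrightarrow> rf k \<one> \<odot>\<^bsub>LM\<^esub> fr x k = fr x \<one>"
  using frac_cancel[of x \<one> k] by (simp add: smult_frac)

lemma base_eq_iff: "x \<in> carrier M \<Longrightarrow> y \<in> carrier M \<Longrightarrow>
    fr x \<one> = fr y \<one> \<longleftrightarrow> (\<exists>u\<in>W. u \<odot>\<^bsub>M\<^esub> x = u \<odot>\<^bsub>M\<^esub> y)"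
  by (simp add: frac_eq_same_iff)

end

lemma (in quad_context) loc_quad_powers: "f \<in> carrier R \<Longrightarrow> loc_quad R M (powers R f)"
  by (rule loc_quadI[OF assoc_algebra_axioms R.powers_mult_set])

lemma (in module) principal_cover_eqI:
  assumes F: "principal_cover R F" and xy: "x \<in> carrier M" "y \<in> carrier M"
    and loc: "\<And>f. f \<in> F \<Longrightarrow> \<exists>s\<in>powers R f. s \<odot>\<^bsub>M\<^esub> x = s \<odot>\<^bsub>M\<^esub> y"
  shows "x = y"
proof -
  have "x \<ominus>\<^bsub>M\<^esub> y \<in> {\<zero>\<^bsub>M\<^esub>}"
  proof (rule principal_cover_mem[OF F zero_submodule])
    fix f assume f: "f \<in> F"
    then obtain s where s: "s \<in> powers R f" "s \<odot>\<^bsub>M\<^esub> x = s \<odot>\<^bsub>M\<^esub> y" using loc by blast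
    moreover have "s \<in> carrier R" using s(1) f F by (auto simp: powers_def principal_cover_def)
    ultimately have "s \<odot>\<^bsub>M\<^esub> (x \<ominus>\<^bsub>M\<^esub> y) = \<zero>\<^bsub>M\<^esub>"
      using xy by (simp add: a_minus_def smult_r_distr smult_r_minus M.r_neg)
    then show "\<exists>s\<in>powers R f. s \<odot>\<^bsub>M\<^esub> (x \<ominus>\<^bsub>M\<^esub> y) \<in> {\<zero>\<^bsub>M\<^esub>}" using s by blast
  qed (use xy in auto)
  then show ?thesis using M.diff_eq_zero_iff[OF xy] by simp
qed

lemma (in quad_context) loc_eqI:
  assumes F: "principal_cover R F" and xy: "x \<in> carrier M" "y \<in> carrier M"
    and eq: "\<And>f. f \<in> F \<Longrightarrow> frac R (powers R f) M x \<one> = frac R (powers R f) M y \<one>"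
  shows "x = y"
proof (rule principal_cover_eqI[OF F xy])
  fix f assume f: "f \<in> F"
  then interpret L: loc_quad R M "powers R f"
    using F loc_quad_powers by (auto simp: principal_cover_def)
  show "\<exists>s\<in>powers R f. s \<odot>\<^bsub>M\<^esub> x = s \<odot>\<^bsub>M\<^esub> y" using eq[OF f] xy by (simp add: L.base_eq_iff)
qed

text \<open>Compatibility is demanded for the fractions u/1 only, since they span each localization
  over its scalars.\<close>

locale gluing = S: quad_context R S + T: quad_context R T
  for R :: "('a, 'r) ring_scheme" (structure)
    and S :: "('a, 'b) module" and T :: "('a, 'c) module" +
  fixes F :: "'a set" and \<phi> :: "'a \<Rightarrow> ('b \<times> 'a) set \<Rightarrow> ('c \<times> 'a) set"
  assumes cover: "principal_cover R F"
    and iso: "f \<in> F \<Longrightarrow> \<phi> f \<in> alg_iso (loc_ring R (powers R f))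
      (loc R (powers R f) S) (loc R (powers R f) T)"
    and compat: "f \<in> F \<Longrightarrow> g \<in> F \<Longrightarrow> u \<in> carrier S \<Longrightarrow>
      loc_res R (powers R f <#> powers R g) T (\<phi> f (frac R (powers R f) S u \<one>)) =
      loc_res R (powers R f <#> powers R g) T (\<phi> g (frac R (powers R g) S u \<one>))"
begin

text \<open>A relation rather than a function, because the existence of v is first known only
  locally: the u that have a partner form a submodule, to which \<open>principal_cover_mem\<close>
  applies.\<close>

definition glued :: "'c \<Rightarrow> 'b \<Rightarrow> bool"
  where "glued v u \<longleftrightarrow> v \<in> carrier T \<and> u \<in> carrier S \<and>
    (\<forall>g\<in>F. frac R (powers R g) T v \<one> = \<phi> g (frac R (powers R g) S u \<one>))"

lemma F_carrier: "f \<in> F \<Longrightarrow> f \<in> carrier R"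
  using cover by (auto simp: principal_cover_def)

lemma lqS: "f \<in> F \<Longrightarrow> loc_quad R S (powers R f)"
  using S.loc_quad_powers F_carrier by blast

lemma lqT: "f \<in> F \<Longrightarrow> loc_quad R T (powers R f)"
  using T.loc_quad_powers F_carrier by blast

lemma glued_unique: "glued v u \<Longrightarrow> glued v' u \<Longrightarrow> v = v'"
  unfolding glued_def by (intro T.loc_eqI[OF cover]) auto

lemma glued_add: "glued v u \<Longrightarrow> glued v' u' \<Longrightarrow> glued (v \<oplus>\<^bsub>T\<^esub> v') (u \<oplus>\<^bsub>S\<^esub> u')"
  unfolding glued_def
  by (auto simp: loc_quad.base_add[OF lqS] loc_quad.base_add[OF lqT] alg_isoD(3)[OF iso]
      loc_module.frac_closed[OF loc_quad.axioms(2)[OF lqS]] mult_set.one_in_W S.R.powers_mult_set F_carrier)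

lemma glued_mult: "glued v u \<Longrightarrow> glued v' u' \<Longrightarrow> glued (v \<otimes>\<^bsub>T\<^esub> v') (u \<otimes>\<^bsub>S\<^esub> u')"
  unfolding glued_def
  by (auto simp: loc_quad.base_mult[OF lqS] loc_quad.base_mult[OF lqT] alg_isoD(2)[OF iso]
      loc_module.frac_closed[OF loc_quad.axioms(2)[OF lqS]] mult_set.one_in_W S.R.powers_mult_set F_carrier)

lemma glued_smult: "a \<in> carrier R \<Longrightarrow> glued v u \<Longrightarrow> glued (a \<odot>\<^bsub>T\<^esub> v) (a \<odot>\<^bsub>S\<^esub> u)"
  unfolding glued_def
  by (auto simp: loc_quad.base_smult[OF lqS] loc_quad.base_smult[OF lqT] alg_isoD(4)[OF iso]
      loc_quad.rf_closed[OF lqS]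
      loc_module.frac_closed[OF loc_quad.axioms(2)[OF lqS]] mult_set.one_in_W S.R.powers_mult_set F_carrier)

lemma glued_one: "glued \<one>\<^bsub>T\<^esub> \<one>\<^bsub>S\<^esub>"
  unfolding glued_def using alg_isoD(5)[OF iso]
  by (auto simp: loc_def)

lemma glued_zero: "glued \<zero>\<^bsub>T\<^esub> \<zero>\<^bsub>S\<^esub>"
  using glued_smult[OF S.R.zero_closed glued_one] by simp

text \<open>Over D(h) the image of u is some v0/k. On an overlap with D(g) it agrees with the image
  over D(g) up to a factor cd, with c a power of h and d a power of g. The factor d is invertible
  over D(g), so c v0 is a correct partner for cku there, and finitely many g need only one
  c.\<close>

lemma glued_locally:
  assumes u: "u \<in> carrier S" and h: "h \<in> F"
  shows "\<exists>s\<in>powers R h. \<exists>v. glued v (s \<odot>\<^bsub>S\<^esub> u)"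
proof -
  interpret Sh: loc_quad R S "powers R h" by (rule lqS[OF h])
  interpret Th: loc_quad R T "powers R h" by (rule lqT[OF h])
  have "\<phi> h (Sh.fr u \<one>) \<in> carrier Th.LM" using alg_isoD(1)[OF iso[OF h]] u by simp
  then obtain v0 k where v0: "v0 \<in> carrier T" "k \<in> powers R h" "\<phi> h (Sh.fr u \<one>) = Th.fr v0 k"
    by (rule Th.loc_cases)
  have kR: "k \<in> carrier R" using v0 by simp
  \<comment> \<open>P c g expresses that c v0 is the right partner for cku over D(g); the factor k
    clears the denominator of v0/k.\<close>
  define P where "P c g \<longleftrightarrow> frac R (powers R g) T (c \<odot>\<^bsub>T\<^esub> v0) \<one> =
      \<phi> g (frac R (powers R g) S ((c \<otimes> k) \<odot>\<^bsub>S\<^esub> u) \<one>)" for c g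
  have Pmult: "P (b \<otimes> c) g" if "P c g" "b \<in> carrier R" "c \<in> carrier R" "g \<in> F" for b c g
  proof -
    interpret Sg: loc_quad R S "powers R g" by (rule lqS[OF that(4)])
    interpret Tg: loc_quad R T "powers R g" by (rule lqT[OF that(4)])
    have "Tg.fr ((b \<otimes> c) \<odot>\<^bsub>T\<^esub> v0) \<one> = Tg.rf b \<one> \<odot>\<^bsub>Tg.LM\<^esub> Tg.fr (c \<odot>\<^bsub>T\<^esub> v0) \<one>"
      using that v0 by (simp add: T.smult_assoc1 Tg.base_smult)
    also have "\<dots> = \<phi> g (Tg.rf b \<one> \<odot>\<^bsub>Sg.LM\<^esub> Sg.fr ((c \<otimes> k) \<odot>\<^bsub>S\<^esub> u) \<one>)"
      using that u kR unfolding P_def by (simp add: alg_isoD(4)[OF iso] Sg.rf_closed)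
    also have "\<dots> = \<phi> g (Sg.fr ((b \<otimes> c \<otimes> k) \<odot>\<^bsub>S\<^esub> u) \<one>)"
      using that u kR by (simp add: S.smult_assoc1 Sg.base_smult)
    finally show ?thesis unfolding P_def .
  qed
  have ex: "\<exists>c\<in>powers R h. P c g" if g: "g \<in> F" for g
  proof -
    interpret Sg: loc_quad R S "powers R g" by (rule lqS[OF g])
    interpret Tg: loc_quad R T "powers R g" by (rule lqT[OF g])
    note sm = S.R.set_mult_mult_set[OF S.R.powers_mult_set[OF F_carrier[OF h]] S.R.powers_mult_set[OF F_carrier[OF g]]]
    interpret Thg: loc_quad R T "powers R h <#> powers R g"
      by (rule loc_quadI[OF T.assoc_algebra_axioms sm(1)])
    interpret rh: res_quad R T "powers R h" "powers R h <#> powers R g" by unfold_locales (rule sm(2))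
    interpret rg: res_quad R T "powers R g" "powers R h <#> powers R g" by unfold_locales (rule sm(3))
    have "\<phi> g (Sg.fr u \<one>) \<in> carrier Tg.LM" using alg_isoD(1)[OF iso[OF g]] u by simp
    then obtain v l where v: "v \<in> carrier T" "l \<in> powers R g" "\<phi> g (Sg.fr u \<one>) = Tg.fr v l"
      by (rule Tg.loc_cases)
    have "Thg.fr v0 k = Thg.fr v l"
      using compat[OF h g u] v v0 by simp
    then obtain w where "w \<in> powers R h <#> powers R g" "w \<odot>\<^bsub>T\<^esub> (l \<odot>\<^bsub>T\<^esub> v0) = w \<odot>\<^bsub>T\<^esub> (k \<odot>\<^bsub>T\<^esub> v)"
      using v v0 by (subst (asm) Thg.frac_eq_iff) auto
    then obtain c d where cd: "c \<in> powers R h" "d \<in> powers R g"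
      "(c \<otimes> d) \<odot>\<^bsub>T\<^esub> (l \<odot>\<^bsub>T\<^esub> v0) = (c \<otimes> d) \<odot>\<^bsub>T\<^esub> (k \<odot>\<^bsub>T\<^esub> v)"
      unfolding set_mult_def by blast
    \<comment> \<open>Here d moves to the outside, where it serves as the witness from the powers of
      g in the equality of fractions over D(g); only c remains in the numerators.\<close>
    have "d \<odot>\<^bsub>T\<^esub> (l \<odot>\<^bsub>T\<^esub> (c \<odot>\<^bsub>T\<^esub> v0)) = (c \<otimes> d) \<odot>\<^bsub>T\<^esub> (l \<odot>\<^bsub>T\<^esub> v0)"
      using cd(1,2) v v0 by (simp add: T.smult_assoc1[symmetric] S.R.m_ac)
    also have "\<dots> = d \<odot>\<^bsub>T\<^esub> (\<one> \<odot>\<^bsub>T\<^esub> ((c \<otimes> k) \<odot>\<^bsub>T\<^esub> v))"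
      unfolding cd(3) using cd(1,2) v v0 by (simp add: T.smult_assoc1[symmetric] S.R.m_ac)
    finally have "Tg.fr (c \<odot>\<^bsub>T\<^esub> v0) \<one> = Tg.fr ((c \<otimes> k) \<odot>\<^bsub>T\<^esub> v) l"
      using cd v v0 by (subst Tg.frac_eq_iff) auto
    also have "\<dots> = Tg.rf (c \<otimes> k) \<one> \<odot>\<^bsub>Tg.LM\<^esub> \<phi> g (Sg.fr u \<one>)"
      using cd v v0 by (simp add: Tg.smult_frac)
    also have "\<dots> = \<phi> g (Sg.rf (c \<otimes> k) \<one> \<odot>\<^bsub>Sg.LM\<^esub> Sg.fr u \<one>)"
      using cd v0 u g by (simp add: alg_isoD(4)[OF iso] Sg.rf_closed)
    also have "\<dots> = \<phi> g (Sg.fr ((c \<otimes> k) \<odot>\<^bsub>S\<^esub> u) \<one>)"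
      using cd v0 u by (simp add: Sg.smult_frac)
    finally show ?thesis using cd(1) unfolding P_def by blast
  qed
  \<comment> \<open>The cover is finite, and P is stable under multiplying c, so the product of the
    individual powers of h works for all g at once.\<close>
  have "\<exists>c\<in>powers R h. \<forall>g\<in>G. P c g" if "finite G" "G \<subseteq> F" for G
    using that
  proof (induction rule: finite_induct)
    case empty
    then show ?case using Sh.one_in_W by blast
  next
    case (insert g G)
    then obtain c where c: "c \<in> powers R h" "\<And>g. g \<in> G \<Longrightarrow> P c g" by auto
    obtain b where b: "b \<in> powers R h" "P b g" using ex insert.prems by blast
    have "P (b \<otimes> c) g'" if "g' \<in> insert g G" for g'
    proof (cases "g' = g")
      case True
      have "P (c \<otimes> b) g" using b c insert.prems by (intro Pmult) auto
      then show ?thesis using b c True by (simp add: S.R.m_comm)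
    next
      case False
      then show ?thesis using b c insert.prems that by (intro Pmult) auto
    qed
    then show ?case using b c by (intro bexI[of _ "b \<otimes> c"]) auto
  qed
  from this[of F] obtain c where c: "c \<in> powers R h" "\<And>g. g \<in> F \<Longrightarrow> P c g"
    using cover by (auto simp: principal_cover_def)
  then have "glued (c \<odot>\<^bsub>T\<^esub> v0) ((c \<otimes> k) \<odot>\<^bsub>S\<^esub> u)"
    using v0 u unfolding glued_def P_def by auto
  then show ?thesis using c v0 by (intro bexI[of _ "c \<otimes> k"]) auto
qed

lemma glued_ex:
  assumes "u \<in> carrier S"
  shows "\<exists>v. glued v u"
proof -
  have "submodule {u \<in> carrier S. \<exists>v. glued v u} R S"
  proof (rule S.submoduleI)
    fix a assume a: "a \<in> {u \<in> carrier S. \<exists>v. glued v u}"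
    then obtain v where "glued v a" by blast
    from glued_smult[OF _ this, of "\<ominus> \<one>"] have "glued ((\<ominus> \<one>) \<odot>\<^bsub>T\<^esub> v) (\<ominus>\<^bsub>S\<^esub> a)"
      using a by (simp add: S.smult_l_minus)
    then show "\<ominus>\<^bsub>S\<^esub> a \<in> {u \<in> carrier S. \<exists>v. glued v u}" using a by auto
  qed (auto intro: glued_zero dest: glued_add glued_smult)
  from S.principal_cover_mem[OF cover this assms] glued_locally[OF assms]
  have "u \<in> {u \<in> carrier S. \<exists>v. glued v u}"
    by (metis (mono_tags, lifting) glued_def mem_Collect_eq)
  then show ?thesis by blast
qed

definition glue :: "'b \<Rightarrow> 'c" where "glue u = (THE v. glued v u)"

lemma glue: "u \<in> carrier S \<Longrightarrow> glued (glue u) u"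
  unfolding glue_def using glued_ex glued_unique by (metis theI)

lemma glue_eq: "glued v u \<Longrightarrow> glue u = v"
  using glue glued_unique glued_def by blast

lemma glue_frac:
  "u \<in> carrier S \<Longrightarrow> f \<in> F \<Longrightarrow> frac R (powers R f) T (glue u) \<one> = \<phi> f (frac R (powers R f) S u \<one>)"
  using glue unfolding glued_def by blast

lemma glue_iso: "glue \<in> alg_iso R S T"
proof (rule alg_isoI[OF S.assoc_algebra_axioms T.assoc_algebra_axioms])
  show "glue \<in> carrier S \<rightarrow> carrier T" using glue unfolding glued_def by blast
next
  fix u v assume "u \<in> carrier S" "v \<in> carrier S"
  then show "glue (u \<otimes>\<^bsub>S\<^esub> v) = glue u \<otimes>\<^bsub>T\<^esub> glue v" "glue (u \<oplus>\<^bsub>S\<^esub> v) = glue u \<oplus>\<^bsub>T\<^esub> glue v"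
    by (auto intro!: glue_eq glued_mult glued_add glue)
next
  fix a u assume "a \<in> carrier R" "u \<in> carrier S"
  then show "glue (a \<odot>\<^bsub>S\<^esub> u) = a \<odot>\<^bsub>T\<^esub> glue u" by (auto intro!: glue_eq glued_smult glue)
next
  show "glue \<one>\<^bsub>S\<^esub> = \<one>\<^bsub>T\<^esub>" by (intro glue_eq glued_one)
next
  fix u assume u: "u \<in> carrier S" "glue u = \<zero>\<^bsub>T\<^esub>"
  show "u = \<zero>\<^bsub>S\<^esub>"
  proof (rule S.loc_eqI[OF cover u(1)])
    fix f assume f: "f \<in> F"
    interpret Sf: loc_quad R S "powers R f" by (rule lqS[OF f])
    have "\<phi> f (Sf.fr u \<one>) = \<phi> f (Sf.fr \<zero>\<^bsub>S\<^esub> \<one>)"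
      using glue_frac[OF u(1) f] u(2) glue_frac[OF S.M.zero_closed f] glue_eq[OF glued_zero] by simp
    then show "Sf.fr u \<one> = Sf.fr \<zero>\<^bsub>S\<^esub> \<one>"
      using alg_isoD(6)[OF iso[OF f]] u(1) by (auto simp: bij_betw_def dest: inj_onD)
  qed simp
next
  fix y assume y: "y \<in> carrier T"
  \<comment> \<open>Surjectivity is local as well: the image is a submodule, and for each f it
    contains a multiple of y by a power of f.\<close>
  have m: "submodule (glue ` carrier S) R T"
  proof (rule T.submoduleI)
    show "glue ` carrier S \<subseteq> carrier T" using glue unfolding glued_def by blast
    show "\<zero>\<^bsub>T\<^esub> \<in> glue ` carrier S" using glue_eq[OF glued_zero] by (metis S.M.zero_closed imageI)
  next
    fix a b assume "a \<in> glue ` carrier S" "b \<in> glue ` carrier S"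
    then obtain u v where *: "u \<in> carrier S" "v \<in> carrier S" "a = glue u" "b = glue v" by blast
    then show "a \<oplus>\<^bsub>T\<^esub> b \<in> glue ` carrier S"
      using glue_eq[OF glued_add[OF glue glue], of u v] by (metis S.M.add.m_closed imageI)
  next
    fix c a assume "c \<in> carrier R" "a \<in> glue ` carrier S"
    then obtain u where *: "u \<in> carrier S" "a = glue u" "c \<in> carrier R" by blast
    then show "c \<odot>\<^bsub>T\<^esub> a \<in> glue ` carrier S"
      using glue_eq[OF glued_smult[OF *(3) glue], of u] by (metis S.smult_closed imageI)
  next
    fix a assume "a \<in> glue ` carrier S"
    then obtain u where *: "u \<in> carrier S" "a = glue u" by blast
    have "a \<in> carrier T" using glue[OF *(1)] *(2) unfolding glued_def by blast
    then have "glue ((\<ominus> \<one>) \<odot>\<^bsub>S\<^esub> u) = \<ominus>\<^bsub>T\<^esub> a"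
      using glue_eq[OF glued_smult[OF _ glue], of "\<ominus> \<one>" u] * by (simp add: T.smult_l_minus)
    then show "\<ominus>\<^bsub>T\<^esub> a \<in> glue ` carrier S" using * by (metis S.smult_closed S.R.a_inv_closed S.R.one_closed imageI)
  qed
  have "y \<in> glue ` carrier S"
  proof (rule T.principal_cover_mem[OF cover m y])
    fix f assume f: "f \<in> F"
    interpret Sf: loc_quad R S "powers R f" by (rule lqS[OF f])
    interpret Tf: loc_quad R T "powers R f" by (rule lqT[OF f])
    have "Tf.fr y \<one> \<in> \<phi> f ` carrier Sf.LM"
      using alg_isoD(6)[OF iso[OF f]] y by (simp add: bij_betw_def)
    then obtain X where X: "X \<in> carrier Sf.LM" "\<phi> f X = Tf.fr y \<one>" by auto
    obtain u k where u: "u \<in> carrier S" "k \<in> powers R f" "X = Sf.fr u k" using X(1) by (rule Sf.loc_cases)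
    have "Tf.fr (glue u) \<one> = \<phi> f (Sf.rf k \<one> \<odot>\<^bsub>Sf.LM\<^esub> X)"
      using u f by (simp add: glue_frac Sf.clear_denominator)
    also have "\<dots> = Sf.rf k \<one> \<odot>\<^bsub>Tf.LM\<^esub> Tf.fr y \<one>"
      using alg_isoD(4)[OF iso[OF f] _ X(1)] u X(2) by (simp add: Sf.rf_closed)
    also have "\<dots> = Tf.fr (k \<odot>\<^bsub>T\<^esub> y) \<one>" using u y by (simp add: Tf.base_smult)
    finally obtain c where c: "c \<in> powers R f" "c \<odot>\<^bsub>T\<^esub> glue u = c \<odot>\<^bsub>T\<^esub> (k \<odot>\<^bsub>T\<^esub> y)"
      using u y glue[OF u(1)] by (subst (asm) Tf.base_eq_iff) (auto simp: glued_def)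
    have "(c \<otimes> k) \<odot>\<^bsub>T\<^esub> y = glue (c \<odot>\<^bsub>S\<^esub> u)"
      using glue_eq[OF glued_smult[OF _ glue], of c u] c u y by (simp add: T.smult_assoc1)
    then show "\<exists>s\<in>powers R f. s \<odot>\<^bsub>T\<^esub> y \<in> glue ` carrier S"
      using c u by (intro bexI[of _ "c \<otimes> k"]) auto
  qed
  then show "\<exists>x\<in>carrier S. glue x = y" by blast
qed

end

context quad_context
begin

lemma quad_genD:
  assumes "quad_gen R M x t n"
  shows "x \<in> carrier M" "t \<in> carrier R" "n \<in> carrier R" "qbasis R M x"
    "x \<otimes>\<^bsub>M\<^esub> x = lc M x (\<ominus> n) t"
  using assms unfolding quad_gen_iff qbasis_def by blast+

end

text \<open>Matching generators of equal trace and norm gives local isomorphisms; they agree on an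
  overlap as soon as each affine relation between w f and w g also holds between z f and z g. The
  second conclusion keeps the local formula, from which properties of the glued map are read
  off.\<close>

lemma glue_generators:
  fixes R (structure) and S :: "('a, 'b) module" and T :: "('a, 'c) module"
  assumes S: "quad_context R S" and T: "quad_context R T" and F: "principal_cover R F"
    and w: "\<And>f. f \<in> F \<Longrightarrow> quad_gen (loc_ring R (powers R f)) (loc R (powers R f) S) (w f) (t f) (n f)"
    and z: "\<And>f. f \<in> F \<Longrightarrow> quad_gen (loc_ring R (powers R f)) (loc R (powers R f) T) (z f) (t f) (n f)"
    and overlap: "\<And>f g c d. f \<in> F \<Longrightarrow> g \<in> F \<Longrightarrow>
      c \<in> carrier (loc_ring R (powers R f <#> powers R g)) \<Longrightarrow>
      d \<in> carrier (loc_ring R (powers R f <#> powers R g)) \<Longrightarrow>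
      loc_res R (powers R f <#> powers R g) S (w f) =
        lc (loc R (powers R f <#> powers R g) S) (loc_res R (powers R f <#> powers R g) S (w g)) c d \<Longrightarrow>
      loc_res R (powers R f <#> powers R g) T (z f) =
        lc (loc R (powers R f <#> powers R g) T) (loc_res R (powers R f <#> powers R g) T (z g)) c d"
  obtains h where "h \<in> alg_iso R S T"
    "\<And>f u a b. f \<in> F \<Longrightarrow> u \<in> carrier S \<Longrightarrow>
      a \<in> carrier (loc_ring R (powers R f)) \<Longrightarrow> b \<in> carrier (loc_ring R (powers R f)) \<Longrightarrow>
      frac R (powers R f) S u \<one> = lc (loc R (powers R f) S) (w f) a b \<Longrightarrow>
      frac R (powers R f) T (h u) \<one> = lc (loc R (powers R f) T) (z f) a b"
proof -
  interpret S: quad_context R S by (rule S)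
  interpret T: quad_context R T by (rule T)
  have FR: "f \<in> carrier R" if "f \<in> F" for f using F that by (auto simp: principal_cover_def)
  have lS: "loc_quad R S (powers R f)" and lT: "loc_quad R T (powers R f)" if "f \<in> F" for f
    using S.loc_quad_powers T.loc_quad_powers FR that by blast+
  have "\<exists>\<phi>. \<phi> \<in> alg_iso (loc_ring R (powers R f)) (loc R (powers R f) S) (loc R (powers R f) T) \<and>
      (\<forall>a\<in>carrier (loc_ring R (powers R f)). \<forall>b\<in>carrier (loc_ring R (powers R f)).
        \<phi> (lc (loc R (powers R f) S) (w f) a b) = lc (loc R (powers R f) T) (z f) a b)"
    if f: "f \<in> F" for f
    using quad_gen_iso[OF quad_context.axioms[OF loc_quad.loc_quad_context[OF lS[OF f]]]
        quad_context.axioms[OF loc_quad.loc_quad_context[OF lT[OF f]]] w[OF f] z[OF f]] by metis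
  then obtain \<phi> where \<phi>: "\<And>f. f \<in> F \<Longrightarrow> \<phi> f \<in> alg_iso (loc_ring R (powers R f)) (loc R (powers R f) S) (loc R (powers R f) T)"
    and \<phi>_lc: "\<And>f a b. f \<in> F \<Longrightarrow> a \<in> carrier (loc_ring R (powers R f)) \<Longrightarrow> b \<in> carrier (loc_ring R (powers R f)) \<Longrightarrow>
      \<phi> f (lc (loc R (powers R f) S) (w f) a b) = lc (loc R (powers R f) T) (z f) a b"
    by metis
  interpret gluing R S T F \<phi>
  proof unfold_locales
    fix f g u assume f: "f \<in> F" and g: "g \<in> F" and u: "u \<in> carrier S"
    define W where "W = powers R f <#> powers R g"
    note sm = S.R.set_mult_mult_set[OF S.R.powers_mult_set[OF FR[OF f]] S.R.powers_mult_set[OF FR[OF g]], folded W_def]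
    interpret Sf: loc_quad R S "powers R f" by (rule lS[OF f])
    interpret Sg: loc_quad R S "powers R g" by (rule lS[OF g])
    interpret Tf: loc_quad R T "powers R f" by (rule lT[OF f])
    interpret Tg: loc_quad R T "powers R g" by (rule lT[OF g])
    interpret SW: loc_quad R S W by (rule loc_quadI[OF S.assoc_algebra_axioms sm(1)])
    interpret TW: loc_quad R T W by (rule loc_quadI[OF T.assoc_algebra_axioms sm(1)])
    interpret Srf: res_quad R S "powers R f" W by unfold_locales (rule sm(2))
    interpret Srg: res_quad R S "powers R g" W by unfold_locales (rule sm(3))
    interpret Trf: res_quad R T "powers R f" W by unfold_locales (rule sm(2))
    interpret Trg: res_quad R T "powers R g" W by unfold_locales (rule sm(3))
    interpret ref: res_quad R "reg R" "powers R f" W by (rule Srf.res_quad_reg)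
    interpret reg: res_quad R "reg R" "powers R g" W by (rule Srg.res_quad_reg)
    interpret QSW: quad_context SW.LR SW.LM by (rule SW.loc_quad_context)
    interpret QTW: quad_context SW.LR TW.LM by (rule TW.loc_quad_context)
    interpret QSf: quad_context Sf.LR Sf.LM by (rule Sf.loc_quad_context)
    interpret QSg: quad_context Sg.LR Sg.LM by (rule Sg.loc_quad_context)
    interpret QTf: quad_context Sf.LR Tf.LM by (rule Tf.loc_quad_context)
    interpret QTg: quad_context Sg.LR Tg.LM by (rule Tg.loc_quad_context)
    note wf = QSf.quad_genD[OF w[OF f]] and wg = QSg.quad_genD[OF w[OF g]]
      and zf = QTf.quad_genD[OF z[OF f]] and zg = QTg.quad_genD[OF z[OF g]]
    note wgW = QSW.quad_genD[OF Srg.quad_gen_res[OF w[OF g]]]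
    obtain a b where ab: "a \<in> carrier Sf.LR" "b \<in> carrier Sf.LR" "Sf.fr u \<one> = lc Sf.LM (w f) a b"
      by (rule QSf.lc_cases[OF wf(4), of "Sf.fr u \<one>"]) (use u in auto)
    obtain c d where cd: "c \<in> carrier Sg.LR" "d \<in> carrier Sg.LR" "Sg.fr u \<one> = lc Sg.LM (w g) c d"
      by (rule QSg.lc_cases[OF wg(4), of "Sg.fr u \<one>"]) (use u in auto)
    have "Srf.res (w f) \<in> carrier SW.LM" using wf by simp
    then obtain r v where rv: "r \<in> carrier SW.LR" "v \<in> carrier SW.LR"
      "Srf.res (w f) = lc SW.LM (Srf.res (w g)) r v" by (rule QSW.lc_cases[OF wgW(4)])
    have zr: "Trf.res (z f) = lc TW.LM (Trf.res (z g)) r v"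
      using overlap[OF f g] rv unfolding W_def by blast
    have abW: "Srf.rres a \<in> carrier SW.LR" "Srf.rres b \<in> carrier SW.LR"
      "Srf.rres c \<in> carrier SW.LR" "Srf.rres d \<in> carrier SW.LR" using ab cd by simp_all
    \<comment> \<open>The expansions of u over D(f) and over D(g) must agree in the basis given by w
      g on the overlap. The resulting relations between coordinates are then applied to the
      generators z.\<close>
    have "Srf.res (Sf.fr u \<one>) = Srf.res (Sg.fr u \<one>)" using u by simp
    then have "lc SW.LM (Srf.res (w f)) (Srf.rres a) (Srf.rres b) =
        lc SW.LM (Srf.res (w g)) (Srf.rres c) (Srf.rres d)"
      unfolding ab(3) cd(3) using ab cd wf wg by (simp add: Srf.res_lc Srg.res_lc)
    then have e: "lc SW.LM (Srf.res (w g)) (Srf.rres a \<oplus>\<^bsub>SW.LR\<^esub> Srf.rres b \<otimes>\<^bsub>SW.LR\<^esub> r) (Srf.rres b \<otimes>\<^bsub>SW.LR\<^esub> v) =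
        lc SW.LM (Srf.res (w g)) (Srf.rres c) (Srf.rres d)"
      unfolding rv(3) using abW rv wgW by (simp add: QSW.lc_lc)
    have e': "Srf.rres a \<oplus>\<^bsub>SW.LR\<^esub> Srf.rres b \<otimes>\<^bsub>SW.LR\<^esub> r = Srf.rres c" "Srf.rres b \<otimes>\<^bsub>SW.LR\<^esub> v = Srf.rres d"
      using QSW.lc_inj[OF wgW(4) _ _ abW(3,4) e] abW rv by simp_all
    have "Trf.res (z g) \<in> carrier TW.LM" using zg by simp
    then have "lc TW.LM (Trf.res (z f)) (Srf.rres a) (Srf.rres b) = lc TW.LM (Trf.res (z g)) (Srf.rres c) (Srf.rres d)"
      unfolding zr e'[symmetric] using abW rv by (simp add: QTW.lc_lc)
    then have "Trf.res (lc Tf.LM (z f) a b) = Trf.res (lc Tg.LM (z g) c d)"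
      using ab cd zf zg by (simp add: Trf.res_lc Trg.res_lc)
    then show "loc_res R (powers R f <#> powers R g) T (\<phi> f (Sf.fr u \<one>)) =
        loc_res R (powers R f <#> powers R g) T (\<phi> g (Sg.fr u \<one>))"
      unfolding W_def[symmetric] ab(3) cd(3) using \<phi>_lc[OF f ab(1,2)] \<phi>_lc[OF g cd(1,2)] by simp
  qed (use F \<phi> in auto)
  show ?thesis
  proof (rule that[OF glue_iso])
    fix f u a b assume "f \<in> F" "u \<in> carrier S" "a \<in> carrier (loc_ring R (powers R f))"
      "b \<in> carrier (loc_ring R (powers R f))"
      "frac R (powers R f) S u \<one> = lc (loc R (powers R f) S) (w f) a b"
    then show "frac R (powers R f) T (glue u) \<one> = lc (loc R (powers R f) T) (z f) a b"
      using glue_frac \<phi>_lc by simp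
  qed
qed

section \<open>The standard involution\<close>

context quad_context
begin

lemma quad_gen_unique:
  assumes "quad_gen R M x t n" "quad_gen R M x t' n'"
  shows "t = t'" "n = n'"
proof -
  have *: "qbasis R M x" "t \<in> carrier R" "n \<in> carrier R" "t' \<in> carrier R" "n' \<in> carrier R"
    "lc M x (\<ominus> n) t = lc M x (\<ominus> n') t'"
    using assms by (auto simp: quad_gen_iff)
  show "t = t'" using lc_inj(2)[OF *(1) _ _ _ _ *(6)] * by simp
  have "\<ominus> n = \<ominus> n'" using lc_inj(1)[OF *(1) _ _ _ _ *(6)] * by simp
  then show "n = n'" using * by (metis R.minus_minus)
qed

text \<open>Each generator is affine in the other; substituting one expression into the other shows
  uu' = 1, so the linear coefficient is a unit.\<close>

lemma basis_change:
  assumes "qbasis R M x" "qbasis R M y"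
  obtains r u where "r \<in> carrier R" "u \<in> Units R" "x = lc M y r u"
proof -
  have xy: "x \<in> carrier M" "y \<in> carrier M" using assms by (auto simp: qbasis_def)
  obtain r u where 1: "r \<in> carrier R" "u \<in> carrier R" "x = lc M y r u" using xy(1) by (rule lc_cases[OF assms(2)])
  obtain r' u' where 2: "r' \<in> carrier R" "u' \<in> carrier R" "y = lc M x r' u'" using xy(2) by (rule lc_cases[OF assms(1)])
  have "lc M x \<zero> \<one> = x" using xy by (simp add: lc_gen)
  also have "\<dots> = lc M (lc M x r' u') r u" unfolding 2(3)[symmetric] by (rule 1(3))
  also have "\<dots> = lc M x (r \<oplus> u \<otimes> r') (u \<otimes> u')" using 1 2 xy by (simp add: lc_lc)
  finally have e: "lc M x \<zero> \<one> = lc M x (r \<oplus> u \<otimes> r') (u \<otimes> u')" .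
  have "\<one> = u \<otimes> u'" using lc_inj(2)[OF assms(1) _ _ _ _ e] 1 2 by simp
  then have "u \<in> Units R" using 1 2 by (auto simp: Units_def intro!: bexI[of _ u'] simp: R.m_comm)
  then show ?thesis using that 1 by blast
qed

text \<open>The element t - x is the other root of \<open>X\<^sup>2 - tX + n\<close>, obtained by
  the change of generator with u = -1 and r = t.\<close>

lemma conjugate_quad_gen:
  assumes q: "quad_gen R M x t n"
  shows "quad_gen R M (lc M x t (\<ominus> \<one>)) t n"
proof -
  have t: "t \<in> carrier R" "n \<in> carrier R" using q by (auto simp: quad_gen_iff)
  have "\<ominus> \<one> \<in> Units R" by (auto simp: Units_def l_minus intro!: bexI[of _ "\<ominus> \<one>"] simp: R.l_minus)
  from quad_gen_change[OF q this t(1)]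
  have "quad_gen R M (lc M x t (\<ominus> \<one>)) (\<ominus> \<one> \<otimes> t \<oplus> (t \<oplus> t))
     (\<ominus> \<one> \<otimes> \<ominus> \<one> \<otimes> n \<oplus> \<ominus> \<one> \<otimes> t \<otimes> t \<oplus> t \<otimes> t)" .
  moreover have "\<ominus> \<one> \<otimes> t \<oplus> (t \<oplus> t) = t" using t by algebra
  moreover have "\<ominus> \<one> \<otimes> \<ominus> \<one> \<otimes> n \<oplus> \<ominus> \<one> \<otimes> t \<otimes> t \<oplus> t \<otimes> t = n" using t by algebra
  ultimately show ?thesis by simp
qed

text \<open>Conjugation does not depend on the generator: for x = uy + r the trace is t = us + 2r,
  hence t - x = u(s - y) + r. This is the overlap condition for gluing the local
  conjugations.\<close>

lemma conjugate_change:
  assumes x: "quad_gen R M x t n" and y: "quad_gen R M y s m"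
    and c: "a \<in> carrier R" "b \<in> carrier R" "c \<in> carrier R" "d \<in> carrier R"
    and eq: "lc M x a b = lc M y c d"
  shows "lc M (lc M x t (\<ominus> \<one>)) a b = lc M (lc M y s (\<ominus> \<one>)) c d"
proof -
  have qb: "qbasis R M x" "qbasis R M y" and t: "t \<in> carrier R" "s \<in> carrier R"
    and yM: "y \<in> carrier M"
    using quad_genD[OF x] quad_genD[OF y] by blast+
  obtain r u where ru: "r \<in> carrier R" "u \<in> Units R" "x = lc M y r u" by (rule basis_change[OF qb])
  have u: "u \<in> carrier R" using ru by auto
  have te: "t = u \<otimes> s \<oplus> (r \<oplus> r)"
    by (rule quad_gen_unique(1)[OF x quad_gen_change[OF y ru(2,1), folded ru(3)]])
  have e: "lc M y c d = lc M y (a \<oplus> b \<otimes> r) (b \<otimes> u)"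
    using eq[symmetric] ru(1,3) u c yM by (simp add: lc_lc)
  have cd: "c = a \<oplus> b \<otimes> r" "d = b \<otimes> u"
    using lc_inj[OF qb(2) _ _ _ _ e] c ru(1) u by simp_all
  have "a \<oplus> b \<otimes> (t \<oplus> \<ominus> \<one> \<otimes> r) = c \<oplus> d \<otimes> s"
    unfolding cd te using t c ru(1) u by algebra
  moreover have "b \<otimes> (\<ominus> \<one> \<otimes> u) = d \<otimes> (\<ominus> \<one>)"
    unfolding cd using c u by algebra
  ultimately show ?thesis
    unfolding ru(3) using t c ru(1) u yM by (simp add: lc_lc)
qed

end

section \<open>Quadratic algebras and their involution by local arguments\<close>

locale quadratic = quad_context R M for R :: "('a, 'r) ring_scheme" (structure)
  and M :: "('a, 'b) module" (structure) +
  assumes locally_free: "locally_free R M 2"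

lemma quadratic_iff: "quadratic R M \<longleftrightarrow> quadratic_algebra R M"
  by (auto simp: quadratic_def quad_context_def quadratic_axioms_def quadratic_algebra_def)

lemma (in quad_context) quadraticI:
  assumes "principal_cover R F"
    and "\<And>f. f \<in> F \<Longrightarrow> \<exists>x t n. quad_gen (loc_ring R (powers R f)) (loc R (powers R f) M) x t n"
  shows "quadratic R M"
proof
  have "free_of_rank (loc_ring R (powers R f)) (loc R (powers R f) M) 2" if f: "f \<in> F" for f
  proof -
    interpret L: loc_quad R M "powers R f"
      using assms(1) f loc_quad_powers by (auto simp: principal_cover_def)
    show ?thesis
      using quad_context.quad_gen_imp_free_of_rank_2[OF L.loc_quad_context] assms(2)[OF f] by blast
  qed
  then show "locally_free R M 2" using assms(1) unfolding locally_free_def by blast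
qed

lemma (in cring) trivial_cover: "principal_cover R {\<one>}"
  by (simp add: principal_cover_def genideal_one)

lemma (in quad_context) quad_gen_imp_quadratic:
  assumes "quad_gen R M x t n" shows "quadratic R M"
proof (rule quadraticI[OF R.trivial_cover])
  fix f assume "f \<in> {\<one>}"
  then interpret L: loc_quad R M "powers R f" using loc_quad_powers by auto
  show "\<exists>x t n. quad_gen (loc_ring R (powers R f)) (loc R (powers R f) M) x t n"
    using L.quad_gen_base[OF assms] by blast
qed

context quadratic
begin

lemma cover:
  obtains F x t n where "principal_cover R F"
    "\<And>f. f \<in> F \<Longrightarrow> quad_gen (loc_ring R (powers R f)) (loc R (powers R f) M) (x f) (t f) (n f)"
proof -
  obtain F where F: "principal_cover R F"
    and free: "\<And>f. f \<in> F \<Longrightarrow> free_of_rank (loc_ring R (powers R f)) (loc R (powers R f) M) 2"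
    using locally_free unfolding locally_free_def by blast
  have "\<exists>x t n. quad_gen (loc_ring R (powers R f)) (loc R (powers R f) M) x t n" if f: "f \<in> F" for f
  proof -
    interpret L: loc_quad R M "powers R f"
      using F f loc_quad_powers by (auto simp: principal_cover_def)
    show ?thesis
      using quad_context.free_of_rank_2_imp_quad_gen[OF L.loc_quad_context free[OF f]] by blast
  qed
  then show ?thesis using that F by metis
qed

text \<open>Commutativity is not part of the definition of a quadratic algebra; it follows because
  locally the algebra has a single generator.\<close>

lemma comm: 
  assumes "y \<in> carrier M" "z \<in> carrier M" shows "y \<otimes>\<^bsub>M\<^esub> z = z \<otimes>\<^bsub>M\<^esub> y"
proof -
  obtain F x t n where F: "principal_cover R F"
    and q: "\<And>f. f \<in> F \<Longrightarrow> quad_gen (loc_ring R (powers R f)) (loc R (powers R f) M) (x f) (t f) (n f)"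
    by (rule cover) blast
  show ?thesis
  proof (rule loc_eqI[OF F])
    fix f assume f: "f \<in> F"
    interpret L: loc_quad R M "powers R f"
      using F f loc_quad_powers by (auto simp: principal_cover_def)
    show "L.fr (y \<otimes>\<^bsub>M\<^esub> z) \<one> = L.fr (z \<otimes>\<^bsub>M\<^esub> y) \<one>"
      using quad_context.quad_gen_comm[OF L.loc_quad_context q[OF f]] assms by (simp add: L.base_mult)
  qed (use assms in auto)
qed

text \<open>The numerators of the local generators are elements of M, so arguments can stay in M and
  multiply by powers of f instead of passing to fractions.\<close>

lemma local_basis_cover:
  obtains F e where "principal_cover R F" "\<And>f. f \<in> F \<Longrightarrow> local_basis R (powers R f) M (e f)"
proof -
  obtain F x t n where F: "principal_cover R F"
    and q: "\<And>f. f \<in> F \<Longrightarrow> quad_gen (loc_ring R (powers R f)) (loc R (powers R f) M) (x f) (t f) (n f)"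
    by (rule cover) blast
  have "\<exists>e. local_basis R (powers R f) M e" if f: "f \<in> F" for f
  proof -
    interpret L: loc_quad R M "powers R f"
      using F f loc_quad_powers by (auto simp: principal_cover_def)
    interpret Q: quad_context L.LR L.LM by (rule L.loc_quad_context)
    have x: "x f \<in> carrier L.LM" "qbasis L.LR L.LM (x f)"
      using Q.quad_genD[OF q[OF f]] by blast+
    obtain e k where "e \<in> carrier M" "k \<in> powers R f" "x f = L.fr e k" using x(1) by (rule L.loc_cases)
    then show ?thesis using x(2) L.qbasis_frac_iff by auto
  qed
  then show ?thesis using that F by metis
qed

text \<open>Locally 1 belongs to a basis, so r is killed by a power of each f of a cover.\<close>

lemma one_faithful:
  assumes r: "r \<in> carrier R" "r \<odot>\<^bsub>M\<^esub> \<one>\<^bsub>M\<^esub> = \<zero>\<^bsub>M\<^esub>" shows "r = \<zero>"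
proof -
  obtain F e where F: "principal_cover R F" and e: "\<And>f. f \<in> F \<Longrightarrow> local_basis R (powers R f) M (e f)"
    by (rule local_basis_cover) blast
  interpret Re: assoc_algebra R "reg R" by (rule R.assoc_algebra_reg)
  show ?thesis
  proof (rule Re.principal_cover_eqI[OF F, simplified])
    fix f assume f: "f \<in> F"
    have "lc M (e f) r \<zero> = \<zero>\<^bsub>M\<^esub>" using e[OF f] r by (simp add: lc_const local_basis_def)
    then obtain s where "s \<in> powers R f" "s \<otimes> r = \<zero>"
      using e[OF f] r(1) unfolding local_basis_def by blast
    moreover have "s \<in> carrier R" using F f \<open>s \<in> _\<close> by (auto simp: powers_def principal_cover_def)
    ultimately show "\<exists>s\<in>powers R f. s \<otimes> r = s \<otimes> \<zero>" by (intro bexI[of _ s]) simp_all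
  qed (use r in auto)
qed

text \<open>The definition of the involution asks only for scalar norms. Polarization gives the
  trace: N(1 + u) = 1 + (u + \<sigma> u) + N(u), so u + \<sigma> u is the scalar N(1 + u) - N(u) -
  1. Multiplying \<sigma> u = \<tau> - u by u yields the quadratic equation of u.\<close>

lemma std_trace:
  assumes s: "standard_involution R M \<sigma>" and u: "u \<in> carrier M"
  obtains \<tau> \<nu> where "\<tau> \<in> carrier R" "\<nu> \<in> carrier R"
    "\<sigma> u = lc M u \<tau> (\<ominus> \<one>)" "u \<otimes>\<^bsub>M\<^esub> \<sigma> u = \<nu> \<odot>\<^bsub>M\<^esub> \<one>\<^bsub>M\<^esub>" "u \<otimes>\<^bsub>M\<^esub> u = lc M u (\<ominus> \<nu>) \<tau>"
proof -
  have h: "\<sigma> \<in> mod_hom R M M" "\<sigma> \<one>\<^bsub>M\<^esub> = \<one>\<^bsub>M\<^esub>"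
    and nm: "\<And>x. x \<in> carrier M \<Longrightarrow> \<exists>r\<in>carrier R. x \<otimes>\<^bsub>M\<^esub> \<sigma> x = r \<odot>\<^bsub>M\<^esub> \<one>\<^bsub>M\<^esub>"
    using s by (auto simp: standard_involution_def)
  have su: "\<sigma> u \<in> carrier M" using h u by (auto simp: mod_hom_def)
  obtain \<nu> where \<nu>: "\<nu> \<in> carrier R" "u \<otimes>\<^bsub>M\<^esub> \<sigma> u = \<nu> \<odot>\<^bsub>M\<^esub> \<one>\<^bsub>M\<^esub>" using nm u by blast
  obtain \<mu> where \<mu>: "\<mu> \<in> carrier R"
    "(\<one>\<^bsub>M\<^esub> \<oplus>\<^bsub>M\<^esub> u) \<otimes>\<^bsub>M\<^esub> \<sigma> (\<one>\<^bsub>M\<^esub> \<oplus>\<^bsub>M\<^esub> u) = \<mu> \<odot>\<^bsub>M\<^esub> \<one>\<^bsub>M\<^esub>"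
    using nm[of "\<one>\<^bsub>M\<^esub> \<oplus>\<^bsub>M\<^esub> u"] u by auto
  have "\<sigma> (\<one>\<^bsub>M\<^esub> \<oplus>\<^bsub>M\<^esub> u) = \<one>\<^bsub>M\<^esub> \<oplus>\<^bsub>M\<^esub> \<sigma> u" using h u by (auto simp: mod_hom_def)
  then have "\<mu> \<odot>\<^bsub>M\<^esub> \<one>\<^bsub>M\<^esub> = \<one>\<^bsub>M\<^esub> \<oplus>\<^bsub>M\<^esub> \<sigma> u \<oplus>\<^bsub>M\<^esub> (u \<oplus>\<^bsub>M\<^esub> \<nu> \<odot>\<^bsub>M\<^esub> \<one>\<^bsub>M\<^esub>)"
    using \<mu>(2) \<nu> u su by (simp add: l_distr r_distr M.a_ac)
  moreover have "\<sigma> u = (\<one>\<^bsub>M\<^esub> \<oplus>\<^bsub>M\<^esub> \<sigma> u \<oplus>\<^bsub>M\<^esub> (u \<oplus>\<^bsub>M\<^esub> \<nu> \<odot>\<^bsub>M\<^esub> \<one>\<^bsub>M\<^esub>)) \<ominus>\<^bsub>M\<^esub> \<nu> \<odot>\<^bsub>M\<^esub> \<one>\<^bsub>M\<^esub> \<ominus>\<^bsub>M\<^esub> \<one>\<^bsub>M\<^esub> \<ominus>\<^bsub>M\<^esub> u"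
  proof -
    have "\<nu> \<odot>\<^bsub>M\<^esub> \<one>\<^bsub>M\<^esub> \<in> carrier M" using \<nu> by simp
    then show ?thesis using u su one_closed by algebra
  qed
  ultimately have "\<sigma> u = lc M u \<mu> \<zero> \<ominus>\<^bsub>M\<^esub> lc M u \<nu> \<zero> \<ominus>\<^bsub>M\<^esub> lc M u \<one> \<zero> \<ominus>\<^bsub>M\<^esub> lc M u \<zero> \<one>"
    using u \<mu>(1) \<nu>(1) by (simp add: lc_const lc_lin)
  then have \<sigma>: "\<sigma> u = lc M u (\<mu> \<ominus> \<nu> \<ominus> \<one>) (\<ominus> \<one>)"
    using u \<mu>(1) \<nu>(1) by (simp add: lc_diff) (simp add: a_minus_def)
  define \<tau> where "\<tau> = \<mu> \<ominus> \<nu> \<ominus> \<one>"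
  have \<tau>: "\<tau> \<in> carrier R" using \<mu> \<nu> by (simp add: \<tau>_def)
  have "u \<otimes>\<^bsub>M\<^esub> u = lc M u (\<ominus> \<nu>) \<tau>"
  proof -
    have "\<nu> \<odot>\<^bsub>M\<^esub> \<one>\<^bsub>M\<^esub> = \<tau> \<odot>\<^bsub>M\<^esub> u \<oplus>\<^bsub>M\<^esub> \<ominus>\<^bsub>M\<^esub> (u \<otimes>\<^bsub>M\<^esub> u)"
      using \<nu>(2) u \<tau> unfolding \<sigma> \<tau>_def[symmetric] lc_def
      by (simp add: r_distr r_minus smult_mult_right smult_l_minus)
    moreover have "u \<otimes>\<^bsub>M\<^esub> u = \<ominus>\<^bsub>M\<^esub> (\<tau> \<odot>\<^bsub>M\<^esub> u \<oplus>\<^bsub>M\<^esub> \<ominus>\<^bsub>M\<^esub> (u \<otimes>\<^bsub>M\<^esub> u)) \<oplus>\<^bsub>M\<^esub> \<tau> \<odot>\<^bsub>M\<^esub> u"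
    proof -
      have "\<tau> \<odot>\<^bsub>M\<^esub> u \<in> carrier M" "u \<otimes>\<^bsub>M\<^esub> u \<in> carrier M" using \<tau> u by auto
      then show ?thesis by algebra
    qed
    ultimately show ?thesis using \<nu>(1) u \<tau> by (simp add: lc_def smult_l_minus)
  qed
  then show ?thesis using that \<tau> \<nu> \<sigma> unfolding \<tau>_def by blast
qed

text \<open>Both involutions send a local generator x to \<tau> - x with a coefficient \<tau> of x^2
  = \<tau>x - \<nu>, and these coefficients agree after multiplication by a power of f.\<close>

lemma std_unique:
  assumes s: "standard_involution R M \<sigma>" and s': "standard_involution R M \<sigma>'" and u: "u \<in> carrier M"
  shows "\<sigma> u = \<sigma>' u"
proof -
  obtain F e where F: "principal_cover R F" and e: "\<And>f. f \<in> F \<Longrightarrow> local_basis R (powers R f) M (e f)"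
    by (rule local_basis_cover) blast
  have lin: "\<rho> (lc M x a b) = lc M (\<rho> x) a b" "c \<in> carrier R \<Longrightarrow> \<rho> (c \<odot>\<^bsub>M\<^esub> x) = c \<odot>\<^bsub>M\<^esub> \<rho> x"
    "\<rho> x \<in> carrier M"
    if "standard_involution R M \<rho>" "x \<in> carrier M" "a \<in> carrier R" "b \<in> carrier R" for \<rho> x a b c
    using that by (auto simp: standard_involution_def mod_hom_def lc_def)
  show ?thesis
  proof (rule principal_cover_eqI[OF F])
    fix f assume f: "f \<in> F"
    have fR: "f \<in> carrier R" using F f by (auto simp: principal_cover_def)
    interpret W: mult_set R "powers R f" by (rule R.powers_mult_set[OF fR])
    define x where "x = e f"
    have x: "x \<in> carrier M" using e[OF f] by (simp add: local_basis_def x_def)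
    obtain \<tau> \<nu> where 1: "\<tau> \<in> carrier R" "\<nu> \<in> carrier R" "\<sigma> x = lc M x \<tau> (\<ominus> \<one>)"
      "x \<otimes>\<^bsub>M\<^esub> x = lc M x (\<ominus> \<nu>) \<tau>" by (rule std_trace[OF s x])
    obtain \<tau>' \<nu>' where 2: "\<tau>' \<in> carrier R" "\<nu>' \<in> carrier R" "\<sigma>' x = lc M x \<tau>' (\<ominus> \<one>)"
      "x \<otimes>\<^bsub>M\<^esub> x = lc M x (\<ominus> \<nu>') \<tau>'" by (rule std_trace[OF s' x])
    have "lc M x (\<ominus> \<nu>) \<tau> \<ominus>\<^bsub>M\<^esub> lc M x (\<ominus> \<nu>') \<tau>' = \<zero>\<^bsub>M\<^esub>"
      unfolding 1(4)[symmetric] 2(4)[symmetric] using x by (simp add: a_minus_def M.r_neg)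
    then have "lc M x (\<ominus> \<nu> \<ominus> \<ominus> \<nu>') (\<tau> \<ominus> \<tau>') = \<zero>\<^bsub>M\<^esub>" using 1 2 x by (simp add: lc_diff)
    moreover have "\<ominus> \<nu> \<ominus> \<ominus> \<nu>' \<in> carrier R" "\<tau> \<ominus> \<tau>' \<in> carrier R" using 1 2 by auto
    ultimately obtain s where st: "s \<in> powers R f" "s \<otimes> (\<tau> \<ominus> \<tau>') = \<zero>"
      using e[OF f] unfolding local_basis_def x_def by blast
    have sR: "s \<in> carrier R" using st by simp
    have "s \<otimes> \<tau> \<ominus> s \<otimes> \<tau>' = \<zero>" using st(2) sR 1 2 by (simp add: R.r_distr R.r_minus a_minus_def)
    then have "s \<otimes> \<tau> = s \<otimes> \<tau>'" using sR 1 2 R.diff_eq_zero_iff by blast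
    then have sx: "s \<odot>\<^bsub>M\<^esub> \<sigma> x = s \<odot>\<^bsub>M\<^esub> \<sigma>' x" using 1 2 sR x by (simp add: lc_smult)
    obtain r a b where r: "r \<in> powers R f" "a \<in> carrier R" "b \<in> carrier R" "r \<odot>\<^bsub>M\<^esub> u = lc M x a b"
      using e[OF f] u unfolding local_basis_def x_def by blast
    \<comment> \<open>The right side depends on the involution only through s times its value at x,
      and there the two involutions agree.\<close>
    have *: "(s \<otimes> r) \<odot>\<^bsub>M\<^esub> \<rho> u = s \<odot>\<^bsub>M\<^esub> (a \<odot>\<^bsub>M\<^esub> \<one>\<^bsub>M\<^esub>) \<oplus>\<^bsub>M\<^esub> b \<odot>\<^bsub>M\<^esub> (s \<odot>\<^bsub>M\<^esub> \<rho> x)"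
      if \<rho>: "standard_involution R M \<rho>" for \<rho>
    proof -
      have "(s \<otimes> r) \<odot>\<^bsub>M\<^esub> \<rho> u = s \<odot>\<^bsub>M\<^esub> \<rho> (r \<odot>\<^bsub>M\<^esub> u)"
        using lin(2)[OF \<rho> u, of \<zero> \<zero> r] lin(3)[OF \<rho> u, of \<zero> \<zero>] r(1) sR by (simp add: smult_assoc1)
      also have "\<dots> = s \<odot>\<^bsub>M\<^esub> lc M (\<rho> x) a b" unfolding r(4) using lin(1)[OF \<rho> x r(2,3)] by simp
      finally show ?thesis
        using lin(3)[OF \<rho> x r(2,3)] sR r
        by (simp add: lc_def smult_r_distr smult_assoc1[symmetric] R.m_comm)
    qed
    show "\<exists>s\<in>powers R f. s \<odot>\<^bsub>M\<^esub> \<sigma> u = s \<odot>\<^bsub>M\<^esub> \<sigma>' u"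
      using *[OF s] *[OF s'] sx st r by (intro bexI[of _ "s \<otimes> r"]) auto
  qed (use lin(3)[OF s u R.zero_closed R.zero_closed] lin(3)[OF s' u R.zero_closed R.zero_closed] in auto)
qed

lemma std_exists: "\<exists>\<sigma>. standard_involution R M \<sigma>"
proof -
  obtain F x t n where F: "principal_cover R F"
    and q: "\<And>f. f \<in> F \<Longrightarrow> quad_gen (loc_ring R (powers R f)) (loc R (powers R f) M) (x f) (t f) (n f)"
    by (rule cover) blast
  define A where "A f = loc_ring R (powers R f)" for f
  define N where "N f = loc R (powers R f) M" for f
  have lq: "loc_quad R M (powers R f)" if "f \<in> F" for f
    using F that loc_quad_powers by (auto simp: principal_cover_def)
  have qc: "quad_context (A f) (N f)" if "f \<in> F" for f
    unfolding A_def N_def by (rule loc_quad.loc_quad_context[OF lq[OF that]])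
  have q: "quad_gen (A f) (N f) (x f) (t f) (n f)" if "f \<in> F" for f
    using q[OF that] by (simp add: A_def N_def)
  \<comment> \<open>The conjugates t - x of the local generators. They have the same trace and norm,
    so matching x with its conjugate is a local automorphism, and these automorphisms are
    glued.\<close>
  define y where "y f = lc (N f) (x f) (t f) (\<ominus>\<^bsub>A f\<^esub> \<one>\<^bsub>A f\<^esub>)" for f
  have yq: "quad_gen (A f) (N f) (y f) (t f) (n f)" if "f \<in> F" for f
    unfolding y_def by (rule quad_context.conjugate_quad_gen[OF qc q]) fact+
  obtain glue where glue_iso: "glue \<in> alg_iso R M M"
    and glue_lc: "\<And>f u a b. f \<in> F \<Longrightarrow> u \<in> carrier M \<Longrightarrow> a \<in> carrier (A f) \<Longrightarrow> b \<in> carrier (A f) \<Longrightarrow>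
      frac R (powers R f) M u \<one> = lc (N f) (x f) a b \<Longrightarrow>
      frac R (powers R f) M (glue u) \<one> = lc (N f) (y f) a b"
  proof (rule glue_generators[OF quad_context_axioms quad_context_axioms F, of x t n y, folded A_def N_def])
    show "quad_gen (A f) (N f) (x f) (t f) (n f)" "quad_gen (A f) (N f) (y f) (t f) (n f)"
      if "f \<in> F" for f using q yq that by blast+
    fix f g c d assume f: "f \<in> F" and g: "g \<in> F"
    have fg: "f \<in> carrier R" "g \<in> carrier R" using F f g by (auto simp: principal_cover_def)
    define W where "W = powers R f <#> powers R g"
    interpret Lf: loc_quad R M "powers R f" by (rule lq[OF f])
    interpret Lg: loc_quad R M "powers R g" by (rule lq[OF g])
    note sm = R.set_mult_mult_set[OF R.powers_mult_set[OF fg(1)] R.powers_mult_set[OF fg(2)], folded W_def]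
    interpret LW: loc_quad R M W by (rule loc_quadI[OF assoc_algebra_axioms sm(1)])
    interpret rf: res_quad R M "powers R f" W by unfold_locales (rule sm(2))
    interpret rg: res_quad R M "powers R g" W by unfold_locales (rule sm(3))
    interpret ref: res_quad R "reg R" "powers R f" W by (rule rf.res_quad_reg)
    interpret reg: res_quad R "reg R" "powers R g" W by (rule rg.res_quad_reg)
    interpret Q: quad_context LW.LR LW.LM by (rule LW.loc_quad_context)
    interpret Qf: quad_context Lf.LR Lf.LM by (rule Lf.loc_quad_context)
    interpret Qg: quad_context Lg.LR Lg.LM by (rule Lg.loc_quad_context)
    note qf = q[OF f, unfolded A_def N_def] and qg = q[OF g, unfolded A_def N_def]
    have xf: "x f \<in> carrier Lf.LM" "t f \<in> carrier Lf.LR" and xg: "x g \<in> carrier Lg.LM" "t g \<in> carrier Lg.LR"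
      using Qf.quad_genD[OF qf] Qg.quad_genD[OF qg] by blast+
    have yf: "rf.res (y f) = lc LW.LM (rf.res (x f)) (rf.rres (t f)) (\<ominus>\<^bsub>LW.LR\<^esub> \<one>\<^bsub>LW.LR\<^esub>)"
      unfolding y_def A_def N_def using xf by (simp add: rf.res_lc ref.res_minus ref.res_one)
    have yg: "rf.res (y g) = lc LW.LM (rf.res (x g)) (rf.rres (t g)) (\<ominus>\<^bsub>LW.LR\<^esub> \<one>\<^bsub>LW.LR\<^esub>)"
      unfolding y_def A_def N_def using xg by (simp add: rg.res_lc reg.res_minus reg.res_one)
    assume cd: "c \<in> carrier LW.LR" "d \<in> carrier LW.LR"
      "rf.res (x f) = lc LW.LM (rf.res (x g)) c d"
    have "rf.res (x f) \<in> carrier LW.LM" "rf.res (y f) \<in> carrier LW.LM"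
      using xf unfolding yf by simp_all
    then show "rf.res (y f) = lc LW.LM (rf.res (y g)) c d"
      using Q.conjugate_change[OF rf.quad_gen_res[OF qf] rg.quad_gen_res[OF qg]
          Q.R.zero_closed Q.R.one_closed cd(1,2), folded yf yg] cd(3)
      by (simp add: Q.lc_gen)
  qed blast
  note gl = alg_isoD[OF glue_iso]
  \<comment> \<open>Locally the glued map sends a + bx to (a + bt) - bx, on which the remaining
    axioms are checked.\<close>
  have loc_formula: "\<exists>a\<in>carrier (A f). \<exists>b\<in>carrier (A f).
      frac R (powers R f) M u \<one> = lc (N f) (x f) a b \<and>
      frac R (powers R f) M (glue u) \<one> = lc (N f) (x f) (a \<oplus>\<^bsub>A f\<^esub> b \<otimes>\<^bsub>A f\<^esub> t f) (\<ominus>\<^bsub>A f\<^esub> b)"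
    if f: "f \<in> F" and u: "u \<in> carrier M" for f u
  proof -
    interpret Lf: loc_quad R M "powers R f" by (rule lq[OF f])
    interpret Q: quad_context "A f" "N f" by (rule qc[OF f])
    have x: "x f \<in> carrier (N f)" "t f \<in> carrier (A f)" "qbasis (A f) (N f) (x f)"
      using Q.quad_genD[OF q[OF f]] by blast+
    have "Lf.fr u \<one> \<in> carrier (N f)" using u by (simp add: N_def)
    then obtain a b where ab: "a \<in> carrier (A f)" "b \<in> carrier (A f)" "Lf.fr u \<one> = lc (N f) (x f) a b"
      by (rule Q.lc_cases[OF x(3)])
    have "b \<otimes>\<^bsub>A f\<^esub> \<ominus>\<^bsub>A f\<^esub> \<one>\<^bsub>A f\<^esub> = \<ominus>\<^bsub>A f\<^esub> b" using ab by (simp add: Q.R.r_minus)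
    then show ?thesis
      using ab x glue_lc[OF f u ab]
      by (intro bexI[of _ a] bexI[of _ b]) (simp_all add: y_def Q.lc_lc)
  qed
  have "standard_involution R M glue"
    unfolding standard_involution_def
  proof (intro conjI ballI)
    show "glue \<in> mod_hom R M M" using gl by (auto simp: mod_hom_def)
    show "glue \<one>\<^bsub>M\<^esub> = \<one>\<^bsub>M\<^esub>" by (rule gl)
    show "glue (u \<otimes>\<^bsub>M\<^esub> v) = glue v \<otimes>\<^bsub>M\<^esub> glue u" if "u \<in> carrier M" "v \<in> carrier M" for u v
      using that gl(1,2) comm by simp
  next
    fix u assume u: "u \<in> carrier M"
    show "glue (glue u) = u"
    proof (rule loc_eqI[OF F])
      fix f assume f: "f \<in> F"
      interpret Q: quad_context "A f" "N f" by (rule qc[OF f])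
      have x: "x f \<in> carrier (N f)" "t f \<in> carrier (A f)" and qb: "qbasis (A f) (N f) (x f)"
        using Q.quad_genD[OF q[OF f]] by blast+
      obtain a b where 1: "a \<in> carrier (A f)" "b \<in> carrier (A f)"
        "frac R (powers R f) M u \<one> = lc (N f) (x f) a b"
        "frac R (powers R f) M (glue u) \<one> = lc (N f) (x f) (a \<oplus>\<^bsub>A f\<^esub> b \<otimes>\<^bsub>A f\<^esub> t f) (\<ominus>\<^bsub>A f\<^esub> b)"
        using loc_formula[OF f u] by blast
      obtain c d where 2: "c \<in> carrier (A f)" "d \<in> carrier (A f)"
        "frac R (powers R f) M (glue u) \<one> = lc (N f) (x f) c d"
        "frac R (powers R f) M (glue (glue u)) \<one> = lc (N f) (x f) (c \<oplus>\<^bsub>A f\<^esub> d \<otimes>\<^bsub>A f\<^esub> t f) (\<ominus>\<^bsub>A f\<^esub> d)"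
        using loc_formula[OF f gl(1)[OF u]] by blast
      have e: "lc (N f) (x f) c d = lc (N f) (x f) (a \<oplus>\<^bsub>A f\<^esub> b \<otimes>\<^bsub>A f\<^esub> t f) (\<ominus>\<^bsub>A f\<^esub> b)"
        using 1(4) 2(3) by simp
      have cd: "c = a \<oplus>\<^bsub>A f\<^esub> b \<otimes>\<^bsub>A f\<^esub> t f" "d = \<ominus>\<^bsub>A f\<^esub> b"
        using Q.lc_inj[OF qb 2(1,2) _ _ e] 1(1,2) x(2) by simp_all
      have "c \<oplus>\<^bsub>A f\<^esub> d \<otimes>\<^bsub>A f\<^esub> t f = a" "\<ominus>\<^bsub>A f\<^esub> d = b"
        unfolding cd using 1(1,2) x(2) by algebra+
      then show "frac R (powers R f) M (glue (glue u)) \<one> = frac R (powers R f) M u \<one>"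
        using 1(3) 2(4) by simp
    qed (use u gl(1) in auto)
  next
    fix u assume u: "u \<in> carrier M"
    \<comment> \<open>The scalar multiples of 1 form a submodule, so it can be checked locally that
      the norm is a scalar.\<close>
    have sub: "submodule {r \<odot>\<^bsub>M\<^esub> \<one>\<^bsub>M\<^esub> | r. r \<in> carrier R} R M"
    proof (rule submoduleI)
      show "\<zero>\<^bsub>M\<^esub> \<in> {r \<odot>\<^bsub>M\<^esub> \<one>\<^bsub>M\<^esub> | r. r \<in> carrier R}"
        by (auto intro!: exI[of _ \<zero>])
    next
      fix a assume "a \<in> {r \<odot>\<^bsub>M\<^esub> \<one>\<^bsub>M\<^esub> | r. r \<in> carrier R}"
      then obtain r where "r \<in> carrier R" "a = r \<odot>\<^bsub>M\<^esub> \<one>\<^bsub>M\<^esub>" by blast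
      then have "\<ominus>\<^bsub>M\<^esub> a = (\<ominus> r) \<odot>\<^bsub>M\<^esub> \<one>\<^bsub>M\<^esub>" "\<ominus> r \<in> carrier R" by (simp_all add: smult_l_minus)
      then show "\<ominus>\<^bsub>M\<^esub> a \<in> {r \<odot>\<^bsub>M\<^esub> \<one>\<^bsub>M\<^esub> | r. r \<in> carrier R}" by blast
    next
      fix a b assume "a \<in> {r \<odot>\<^bsub>M\<^esub> \<one>\<^bsub>M\<^esub> | r. r \<in> carrier R}" "b \<in> {r \<odot>\<^bsub>M\<^esub> \<one>\<^bsub>M\<^esub> | r. r \<in> carrier R}"
      then obtain r s where *: "r \<in> carrier R" "a = r \<odot>\<^bsub>M\<^esub> \<one>\<^bsub>M\<^esub>" "s \<in> carrier R" "b = s \<odot>\<^bsub>M\<^esub> \<one>\<^bsub>M\<^esub>" by blast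
      then have "a \<oplus>\<^bsub>M\<^esub> b = (r \<oplus> s) \<odot>\<^bsub>M\<^esub> \<one>\<^bsub>M\<^esub>" by (simp add: smult_l_distr)
      then show "a \<oplus>\<^bsub>M\<^esub> b \<in> {r \<odot>\<^bsub>M\<^esub> \<one>\<^bsub>M\<^esub> | r. r \<in> carrier R}" using * by blast
    next
      fix c a assume c: "c \<in> carrier R" and "a \<in> {r \<odot>\<^bsub>M\<^esub> \<one>\<^bsub>M\<^esub> | r. r \<in> carrier R}"
      then obtain r where "r \<in> carrier R" "a = r \<odot>\<^bsub>M\<^esub> \<one>\<^bsub>M\<^esub>" by blast
      then have "c \<odot>\<^bsub>M\<^esub> a = (c \<otimes> r) \<odot>\<^bsub>M\<^esub> \<one>\<^bsub>M\<^esub>" "c \<otimes> r \<in> carrier R"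
        using c by (simp_all add: smult_assoc1)
      then show "c \<odot>\<^bsub>M\<^esub> a \<in> {r \<odot>\<^bsub>M\<^esub> \<one>\<^bsub>M\<^esub> | r. r \<in> carrier R}" by blast
    qed auto
    have "u \<otimes>\<^bsub>M\<^esub> glue u \<in> {r \<odot>\<^bsub>M\<^esub> \<one>\<^bsub>M\<^esub> | r. r \<in> carrier R}"
    proof (rule principal_cover_mem[OF F sub])
      fix f assume f: "f \<in> F"
      interpret Lf: loc_quad R M "powers R f" by (rule lq[OF f])
      interpret Re: loc_quad R "reg R" "powers R f" by (rule Lf.loc_quad_reg)
      interpret Q: quad_context "A f" "N f" by (rule qc[OF f])
      have x: "x f \<in> carrier (N f)" "t f \<in> carrier (A f)" "n f \<in> carrier (A f)"
        and xx: "x f \<otimes>\<^bsub>N f\<^esub> x f = lc (N f) (x f) (\<ominus>\<^bsub>A f\<^esub> n f) (t f)"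
        using Q.quad_genD[OF q[OF f]] by blast+
      obtain a b where 1: "a \<in> carrier (A f)" "b \<in> carrier (A f)"
        "Lf.fr u \<one> = lc (N f) (x f) a b"
        "Lf.fr (glue u) \<one> = lc (N f) (x f) (a \<oplus>\<^bsub>A f\<^esub> b \<otimes>\<^bsub>A f\<^esub> t f) (\<ominus>\<^bsub>A f\<^esub> b)"
        using loc_formula[OF f u] by blast
      define c where "c = a \<otimes>\<^bsub>A f\<^esub> (a \<oplus>\<^bsub>A f\<^esub> b \<otimes>\<^bsub>A f\<^esub> t f) \<ominus>\<^bsub>A f\<^esub> b \<otimes>\<^bsub>A f\<^esub> (\<ominus>\<^bsub>A f\<^esub> b) \<otimes>\<^bsub>A f\<^esub> n f"
      have cA: "c \<in> carrier (A f)" using 1 x by (simp add: c_def)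
      \<comment> \<open>The coefficient of x in (a + bx)(a + bt - bx).\<close>
      have 0: "a \<otimes>\<^bsub>A f\<^esub> (\<ominus>\<^bsub>A f\<^esub> b) \<oplus>\<^bsub>A f\<^esub> b \<otimes>\<^bsub>A f\<^esub> (a \<oplus>\<^bsub>A f\<^esub> b \<otimes>\<^bsub>A f\<^esub> t f) \<oplus>\<^bsub>A f\<^esub> b \<otimes>\<^bsub>A f\<^esub> (\<ominus>\<^bsub>A f\<^esub> b) \<otimes>\<^bsub>A f\<^esub> t f = \<zero>\<^bsub>A f\<^esub>"
        using 1(1,2) x by algebra
      have "Lf.fr (u \<otimes>\<^bsub>M\<^esub> glue u) \<one> = Lf.fr u \<one> \<otimes>\<^bsub>N f\<^esub> Lf.fr (glue u) \<one>"
        using u gl(1)[OF u] by (simp add: N_def Lf.base_mult)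
      also have "\<dots> = lc (N f) (x f) c \<zero>\<^bsub>A f\<^esub>"
        unfolding 1(3,4) c_def 0[symmetric] by (rule Q.lc_mult[OF x xx]) (use 1 x in auto)
      also have "\<dots> = c \<odot>\<^bsub>N f\<^esub> \<one>\<^bsub>N f\<^esub>" using cA x by (simp add: Q.lc_const)
      finally have e: "Lf.fr (u \<otimes>\<^bsub>M\<^esub> glue u) \<one> = c \<odot>\<^bsub>N f\<^esub> \<one>\<^bsub>N f\<^esub>" .
      obtain r k where r: "r \<in> carrier R" "k \<in> powers R f" "c = Lf.rf r k"
        by (rule Re.loc_cases[of c]) (use cA in \<open>auto simp: A_def\<close>)
      have "Lf.fr (u \<otimes>\<^bsub>M\<^esub> glue u) \<one> = Lf.fr (r \<odot>\<^bsub>M\<^esub> \<one>\<^bsub>M\<^esub>) k"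
        unfolding e using r by (simp add: N_def Lf.one_frac Lf.smult_frac)
      then obtain v where v: "v \<in> powers R f" "v \<odot>\<^bsub>M\<^esub> (k \<odot>\<^bsub>M\<^esub> (u \<otimes>\<^bsub>M\<^esub> glue u)) = v \<odot>\<^bsub>M\<^esub> (\<one> \<odot>\<^bsub>M\<^esub> (r \<odot>\<^bsub>M\<^esub> \<one>\<^bsub>M\<^esub>))"
        using u gl(1)[OF u] r by (subst (asm) Lf.frac_eq_iff) auto
      then have "(v \<otimes> k) \<odot>\<^bsub>M\<^esub> (u \<otimes>\<^bsub>M\<^esub> glue u) = (v \<otimes> r) \<odot>\<^bsub>M\<^esub> \<one>\<^bsub>M\<^esub>"
        using u gl(1)[OF u] r by (simp add: smult_assoc1)
      then show "\<exists>s\<in>powers R f. s \<odot>\<^bsub>M\<^esub> (u \<otimes>\<^bsub>M\<^esub> glue u) \<in> {r \<odot>\<^bsub>M\<^esub> \<one>\<^bsub>M\<^esub> | r. r \<in> carrier R}"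
        using v r by (intro bexI[of _ "v \<otimes> k"]) auto
    qed (use u gl(1) in auto)
    then show "\<exists>r\<in>carrier R. u \<otimes>\<^bsub>M\<^esub> glue u = r \<odot>\<^bsub>M\<^esub> \<one>\<^bsub>M\<^esub>" by blast
  qed
  then show ?thesis by blast
qed

lemma standard_involution_cong:
  assumes "\<And>u. u \<in> carrier M \<Longrightarrow> \<sigma> u = \<sigma>' u"
  shows "standard_involution R M \<sigma> \<longleftrightarrow> standard_involution R M \<sigma>'"
proof -
  have "standard_involution R M \<sigma>'"
    if "standard_involution R M \<sigma>" and e: "\<And>u. u \<in> carrier M \<Longrightarrow> \<sigma>' u = \<sigma> u" for \<sigma> \<sigma>'
  proof -
    have "\<sigma> u \<in> carrier M" if "u \<in> carrier M" for u
      using \<open>standard_involution R M \<sigma>\<close> that by (auto simp: standard_involution_def mod_hom_def)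
    then show ?thesis
      using that by (simp add: standard_involution_def mod_hom_def Pi_iff)
  qed
  then show ?thesis using assms by metis
qed

text \<open>Truncating an involution to the carrier makes it unique as a function, as the
  \<open>THE\<close> in \<open>std_inv\<close> requires.\<close>

lemma std_inv: "standard_involution R M (std_inv R M)" "std_inv R M \<in> extensional (carrier M)"
proof -
  obtain \<sigma> where s: "standard_involution R M \<sigma>" using std_exists by blast
  define \<sigma>' where "\<sigma>' = restrict \<sigma> (carrier M)"
  have s': "\<sigma>' \<in> extensional (carrier M)" "standard_involution R M \<sigma>'"
    using s standard_involution_cong[of \<sigma>' \<sigma>] by (auto simp: \<sigma>'_def)
  have "std_inv R M = \<sigma>'"
    unfolding std_inv_def
  proof (rule the_equality)
    fix \<rho> assume "\<rho> \<in> extensional (carrier M) \<and> standard_involution R M \<rho>"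
    then show "\<rho> = \<sigma>'" using std_unique[of \<rho> \<sigma>'] s' by (intro extensionalityI) auto
  qed (use s' in simp)
  then show "standard_involution R M (std_inv R M)" "std_inv R M \<in> extensional (carrier M)"
    using s' by simp_all
qed

lemma std_inv_eq:
  assumes "standard_involution R M \<sigma>" "u \<in> carrier M" shows "std_inv R M u = \<sigma> u"
  using std_unique[OF std_inv(1) assms] .

end

section \<open>Twisting by 4-torsion\<close>

text \<open>\<open>S\<close> twisted by \<open>n\<close> is the product of \<open>S\<close> with \<open>R[y]/(y\<^sup>2 - y + n)\<close>, realized on the module
  underlying \<open>S\<close>: if \<open>x\<^sup>2 = tx - m\<close> locally, then \<open>x - \<sigma> x = 2x - t\<close> has square \<open>t\<^sup>2 - 4m\<close>, so the
  norm of \<open>x\<close> becomes \<open>m + nt\<^sup>2\<close>.\<close>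

definition twist :: "('a, 'r) ring_scheme \<Rightarrow> ('a, 'b) module \<Rightarrow> 'a \<Rightarrow> ('a, 'b) module"
  where "twist R S n = S\<lparr>mult := (\<lambda>u v. if u \<in> carrier S \<and> v \<in> carrier S
    then u \<otimes>\<^bsub>S\<^esub> v \<ominus>\<^bsub>S\<^esub> n \<odot>\<^bsub>S\<^esub> ((u \<ominus>\<^bsub>S\<^esub> std_inv R S u) \<otimes>\<^bsub>S\<^esub> (v \<ominus>\<^bsub>S\<^esub> std_inv R S v))
    else u \<otimes>\<^bsub>S\<^esub> v)\<rparr>"

lemma twist_simps [simp]:
  "carrier (twist R S n) = carrier S" "one (twist R S n) = one S" "zero (twist R S n) = zero S"
  "add (twist R S n) = add S" "smult (twist R S n) = smult S"
  by (simp_all add: twist_def)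

lemma twist_a_inv [simp]: "a_inv (twist R S n) = a_inv S"
  by (rule a_inv_cong) simp_all

lemma twist_a_minus [simp]: "a_minus (twist R S n) = a_minus S"
  by (simp add: fun_eq_iff a_minus_def)

text \<open>Fractions, restriction maps and bases see only the module structure, which a twist
  shares with the original algebra. In its localizations nothing but the product changes.\<close>

lemma twist_frac [simp]: "frac R W (twist R S n) = frac R W S"
  by (simp add: fun_eq_iff frac_def)

lemma twist_loc_res [simp]: "loc_res R W (twist R S n) = loc_res R W S"
  by (simp add: fun_eq_iff loc_res_def)

lemma twist_loc [simp]:
  "carrier (loc R W (twist R S n)) = carrier (loc R W S)"
  "one (loc R W (twist R S n)) = one (loc R W S)"
  "zero (loc R W (twist R S n)) = zero (loc R W S)"
  "add (loc R W (twist R S n)) = add (loc R W S)"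
  "smult (loc R W (twist R S n)) = smult (loc R W S)"
  by (simp_all add: loc_def)

lemma twist_loc_lc [simp]: "lc (loc R W (twist R S n)) = lc (loc R W S)"
  by (simp add: fun_eq_iff lc_def)

lemma twist_loc_qbasis [simp]: "qbasis A (loc R W (twist R S n)) = qbasis A (loc R W S)"
  by (simp add: fun_eq_iff qbasis_def)

lemma free_of_rank_cong:
  fixes M N :: "('a, 'b) module"
  assumes "carrier M = carrier N" "add M = add N" "zero M = zero N" "smult M = smult N"
  shows "free_of_rank R M k \<longleftrightarrow> free_of_rank R N k"
  unfolding free_of_rank_def finsum_def using assms by simp

lemma locally_free_twist: "locally_free R (twist R S n) k \<longleftrightarrow> locally_free R S k"
  unfolding locally_free_def by (simp add: free_of_rank_cong[of "loc R W (twist R S n)" "loc R W S" for W])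

text \<open>The multiple 4n as a sum of four terms can be split off from polynomial identities and
  then replaced by zero.\<close>

lemma (in cring) torsion4_iff: "n \<in> torsion4 R \<longleftrightarrow> n \<in> carrier R \<and> n \<oplus> n \<oplus> n \<oplus> n = \<zero>"
  unfolding torsion4_def by (auto simp: numeral_eq_Suc add.nat_pow_Suc)

context quadratic
begin

abbreviation "\<sigma> \<equiv> std_inv R M"

lemma M_cring: "cring M"
  by unfold_locales (rule comm)

lemma \<sigma>_simps:
  shows \<sigma>_closed [simp]: "u \<in> carrier M \<Longrightarrow> \<sigma> u \<in> carrier M"
    and \<sigma>_add: "u \<in> carrier M \<Longrightarrow> v \<in> carrier M \<Longrightarrow> \<sigma> (u \<oplus>\<^bsub>M\<^esub> v) = \<sigma> u \<oplus>\<^bsub>M\<^esub> \<sigma> v"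
    and \<sigma>_smult: "a \<in> carrier R \<Longrightarrow> u \<in> carrier M \<Longrightarrow> \<sigma> (a \<odot>\<^bsub>M\<^esub> u) = a \<odot>\<^bsub>M\<^esub> \<sigma> u"
    and \<sigma>_one: "\<sigma> \<one>\<^bsub>M\<^esub> = \<one>\<^bsub>M\<^esub>"
    and \<sigma>_mult: "u \<in> carrier M \<Longrightarrow> v \<in> carrier M \<Longrightarrow> \<sigma> (u \<otimes>\<^bsub>M\<^esub> v) = \<sigma> u \<otimes>\<^bsub>M\<^esub> \<sigma> v"
    and \<sigma>_\<sigma>: "u \<in> carrier M \<Longrightarrow> \<sigma> (\<sigma> u) = u"
    and \<sigma>_norm: "u \<in> carrier M \<Longrightarrow> \<exists>r\<in>carrier R. u \<otimes>\<^bsub>M\<^esub> \<sigma> u = r \<odot>\<^bsub>M\<^esub> \<one>\<^bsub>M\<^esub>"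
proof -
  note s = std_inv(1)[unfolded standard_involution_def mod_hom_def]
  show c: "u \<in> carrier M \<Longrightarrow> \<sigma> u \<in> carrier M" for u using s by auto
  show "u \<in> carrier M \<Longrightarrow> v \<in> carrier M \<Longrightarrow> \<sigma> (u \<otimes>\<^bsub>M\<^esub> v) = \<sigma> u \<otimes>\<^bsub>M\<^esub> \<sigma> v"
    using s c comm by simp
qed (use std_inv(1)[unfolded standard_involution_def mod_hom_def] in auto)

lemma \<sigma>_minus: "u \<in> carrier M \<Longrightarrow> \<sigma> (\<ominus>\<^bsub>M\<^esub> u) = \<ominus>\<^bsub>M\<^esub> \<sigma> u"
  using \<sigma>_smult[of "\<ominus> \<one>" u] by (simp add: smult_l_minus)

lemma \<sigma>_diff: "u \<in> carrier M \<Longrightarrow> v \<in> carrier M \<Longrightarrow> \<sigma> (u \<ominus>\<^bsub>M\<^esub> v) = \<sigma> u \<ominus>\<^bsub>M\<^esub> \<sigma> v"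
  by (simp add: a_minus_def \<sigma>_add \<sigma>_minus)

text \<open>The scalar n is moved into the algebra as the element n 1, so that statements on the
  twist become polynomial identities in the commutative ring M.\<close>

lemma twist_mult:
  assumes "u \<in> carrier M" "v \<in> carrier M" "n \<in> carrier R"
  shows "u \<otimes>\<^bsub>twist R M n\<^esub> v =
    u \<otimes>\<^bsub>M\<^esub> v \<ominus>\<^bsub>M\<^esub> (n \<odot>\<^bsub>M\<^esub> \<one>\<^bsub>M\<^esub>) \<otimes>\<^bsub>M\<^esub> ((u \<ominus>\<^bsub>M\<^esub> \<sigma> u) \<otimes>\<^bsub>M\<^esub> (v \<ominus>\<^bsub>M\<^esub> \<sigma> v))"
  using assms by (simp add: twist_def smult_mult_left)

text \<open>Associativity rests on a Leibniz rule for u \<mapsto> u - \<sigma> u that reads the same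
  for the old and the new product. Expanding a triple product with it gives an expression that
  treats the outer factors alike.\<close>

lemma twist_assoc_algebra:
  assumes n: "n \<in> carrier R"
  shows "assoc_algebra R (twist R M n)"
proof -
  interpret CM: cring M by (rule M_cring)
  define N where "N = n \<odot>\<^bsub>M\<^esub> \<one>\<^bsub>M\<^esub>"
  have N: "N \<in> carrier M" "\<sigma> N = N" using n by (simp_all add: N_def \<sigma>_smult \<sigma>_one)
  note tm = twist_mult[OF _ _ n, folded N_def]
  have cl: "u \<otimes>\<^bsub>twist R M n\<^esub> v \<in> carrier M" if "u \<in> carrier M" "v \<in> carrier M" for u v
    using that N by (simp add: tm)
  have st: "\<sigma> (u \<otimes>\<^bsub>twist R M n\<^esub> v) = \<sigma> u \<otimes>\<^bsub>M\<^esub> \<sigma> v \<ominus>\<^bsub>M\<^esub> N \<otimes>\<^bsub>M\<^esub> ((\<sigma> u \<ominus>\<^bsub>M\<^esub> u) \<otimes>\<^bsub>M\<^esub> (\<sigma> v \<ominus>\<^bsub>M\<^esub> v))"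
    if "u \<in> carrier M" "v \<in> carrier M" for u v
    using that N by (simp add: tm \<sigma>_diff \<sigma>_mult \<sigma>_\<sigma>)
  \<comment> \<open>With p = u - \<sigma> u and q = v - \<sigma> v, the correction Npq is fixed by
    \<sigma>, as both p and q change sign. It drops out, and uv - (u - p)(v - q) remains.\<close>
  have df: "u \<otimes>\<^bsub>twist R M n\<^esub> v \<ominus>\<^bsub>M\<^esub> \<sigma> (u \<otimes>\<^bsub>twist R M n\<^esub> v) =
      u \<otimes>\<^bsub>M\<^esub> (v \<ominus>\<^bsub>M\<^esub> \<sigma> v) \<oplus>\<^bsub>M\<^esub> (u \<ominus>\<^bsub>M\<^esub> \<sigma> u) \<otimes>\<^bsub>M\<^esub> v \<ominus>\<^bsub>M\<^esub> (u \<ominus>\<^bsub>M\<^esub> \<sigma> u) \<otimes>\<^bsub>M\<^esub> (v \<ominus>\<^bsub>M\<^esub> \<sigma> v)"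
    if u: "u \<in> carrier M" and v: "v \<in> carrier M" for u v
    unfolding st[OF u v] unfolding tm[OF u v]
    using u v \<sigma>_closed[OF u] \<sigma>_closed[OF v] N(1) by algebra
  have ab: "abelian_group (twist R M n)"
    by (rule abelian_groupI) (auto simp: M.a_ac intro!: bexI[of _ "\<ominus>\<^bsub>M\<^esub> x" for x] M.l_neg)
  have comm': "u \<otimes>\<^bsub>twist R M n\<^esub> v = v \<otimes>\<^bsub>twist R M n\<^esub> u" if "u \<in> carrier M" "v \<in> carrier M" for u v
    using that N by (simp add: tm comm)
  have assoc: "(u \<otimes>\<^bsub>twist R M n\<^esub> v) \<otimes>\<^bsub>twist R M n\<^esub> w = u \<otimes>\<^bsub>twist R M n\<^esub> (v \<otimes>\<^bsub>twist R M n\<^esub> w)"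
    if u: "u \<in> carrier M" and v: "v \<in> carrier M" and w: "w \<in> carrier M" for u v w
  proof -
    define p q z where "p = u \<ominus>\<^bsub>M\<^esub> \<sigma> u" and "q = v \<ominus>\<^bsub>M\<^esub> \<sigma> v" and "z = w \<ominus>\<^bsub>M\<^esub> \<sigma> w"
    have pqz: "p \<in> carrier M" "q \<in> carrier M" "z \<in> carrier M"
      using u v w by (simp_all add: p_def q_def z_def)
    have "(u \<otimes>\<^bsub>twist R M n\<^esub> v) \<otimes>\<^bsub>twist R M n\<^esub> w =
        (u \<otimes>\<^bsub>M\<^esub> v \<ominus>\<^bsub>M\<^esub> N \<otimes>\<^bsub>M\<^esub> (p \<otimes>\<^bsub>M\<^esub> q)) \<otimes>\<^bsub>M\<^esub> w \<ominus>\<^bsub>M\<^esub>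
        N \<otimes>\<^bsub>M\<^esub> ((u \<otimes>\<^bsub>M\<^esub> q \<oplus>\<^bsub>M\<^esub> p \<otimes>\<^bsub>M\<^esub> v \<ominus>\<^bsub>M\<^esub> p \<otimes>\<^bsub>M\<^esub> q) \<otimes>\<^bsub>M\<^esub> z)"
      unfolding tm[OF cl[OF u v] w] df[OF u v] unfolding tm[OF u v] p_def q_def z_def ..
    also have "\<dots> = u \<otimes>\<^bsub>M\<^esub> (v \<otimes>\<^bsub>M\<^esub> w \<ominus>\<^bsub>M\<^esub> N \<otimes>\<^bsub>M\<^esub> (q \<otimes>\<^bsub>M\<^esub> z)) \<ominus>\<^bsub>M\<^esub>
        N \<otimes>\<^bsub>M\<^esub> (p \<otimes>\<^bsub>M\<^esub> (v \<otimes>\<^bsub>M\<^esub> z \<oplus>\<^bsub>M\<^esub> q \<otimes>\<^bsub>M\<^esub> w \<ominus>\<^bsub>M\<^esub> q \<otimes>\<^bsub>M\<^esub> z))"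
      using u v w pqz N(1) by algebra
    also have "\<dots> = u \<otimes>\<^bsub>twist R M n\<^esub> (v \<otimes>\<^bsub>twist R M n\<^esub> w)"
      unfolding tm[OF u cl[OF v w]] df[OF v w] unfolding tm[OF v w] p_def q_def z_def ..
    finally show ?thesis .
  qed
  have ldist: "(u \<oplus>\<^bsub>M\<^esub> v) \<otimes>\<^bsub>twist R M n\<^esub> w = u \<otimes>\<^bsub>twist R M n\<^esub> w \<oplus>\<^bsub>M\<^esub> v \<otimes>\<^bsub>twist R M n\<^esub> w"
    if u: "u \<in> carrier M" and v: "v \<in> carrier M" and w: "w \<in> carrier M" for u v w
  proof -
    define p q z where "p = u \<ominus>\<^bsub>M\<^esub> \<sigma> u" and "q = v \<ominus>\<^bsub>M\<^esub> \<sigma> v" and "z = w \<ominus>\<^bsub>M\<^esub> \<sigma> w"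
    have pqz: "p \<in> carrier M" "q \<in> carrier M" "z \<in> carrier M"
      using u v w by (simp_all add: p_def q_def z_def)
    have "u \<oplus>\<^bsub>M\<^esub> v \<ominus>\<^bsub>M\<^esub> \<sigma> (u \<oplus>\<^bsub>M\<^esub> v) = p \<oplus>\<^bsub>M\<^esub> q"
      using u v by (simp add: \<sigma>_add p_def q_def a_minus_def M.minus_add M.a_ac)
    then have "(u \<oplus>\<^bsub>M\<^esub> v) \<otimes>\<^bsub>twist R M n\<^esub> w =
        (u \<oplus>\<^bsub>M\<^esub> v) \<otimes>\<^bsub>M\<^esub> w \<ominus>\<^bsub>M\<^esub> N \<otimes>\<^bsub>M\<^esub> ((p \<oplus>\<^bsub>M\<^esub> q) \<otimes>\<^bsub>M\<^esub> z)"
      using u v w by (simp add: tm z_def)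
    also have "\<dots> = (u \<otimes>\<^bsub>M\<^esub> w \<ominus>\<^bsub>M\<^esub> N \<otimes>\<^bsub>M\<^esub> (p \<otimes>\<^bsub>M\<^esub> z)) \<oplus>\<^bsub>M\<^esub> (v \<otimes>\<^bsub>M\<^esub> w \<ominus>\<^bsub>M\<^esub> N \<otimes>\<^bsub>M\<^esub> (q \<otimes>\<^bsub>M\<^esub> z))"
      using u v w pqz N(1) by algebra
    finally show ?thesis using u v w by (simp add: tm p_def q_def z_def)
  qed
  have one: "\<one>\<^bsub>M\<^esub> \<otimes>\<^bsub>twist R M n\<^esub> u = u" if "u \<in> carrier M" for u
    using that N by (simp add: tm \<sigma>_one a_minus_def M.r_neg)
  have sm: "(a \<odot>\<^bsub>M\<^esub> u) \<otimes>\<^bsub>twist R M n\<^esub> v = a \<odot>\<^bsub>M\<^esub> (u \<otimes>\<^bsub>twist R M n\<^esub> v)"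
    if "a \<in> carrier R" "u \<in> carrier M" "v \<in> carrier M" for a u v
    using that N
    by (simp add: tm \<sigma>_smult a_minus_def smult_r_minus[symmetric] smult_r_distr[symmetric]
        smult_mult_left smult_mult_right)
  have rdist: "w \<otimes>\<^bsub>twist R M n\<^esub> (u \<oplus>\<^bsub>M\<^esub> v) = w \<otimes>\<^bsub>twist R M n\<^esub> u \<oplus>\<^bsub>M\<^esub> w \<otimes>\<^bsub>twist R M n\<^esub> v"
    if "u \<in> carrier M" "v \<in> carrier M" "w \<in> carrier M" for u v w
    using ldist[OF that] comm'[OF that(3,1)] comm'[OF that(3,2)] comm'[of w "u \<oplus>\<^bsub>M\<^esub> v"] that by simp
  have smr: "u \<otimes>\<^bsub>twist R M n\<^esub> (a \<odot>\<^bsub>M\<^esub> v) = a \<odot>\<^bsub>M\<^esub> (u \<otimes>\<^bsub>twist R M n\<^esub> v)"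
    if "a \<in> carrier R" "u \<in> carrier M" "v \<in> carrier M" for a u v
    using sm[OF that(1,3,2)] comm'[OF that(2,3)] comm'[of u "a \<odot>\<^bsub>M\<^esub> v"] that by simp
  show ?thesis
  proof (intro assoc_algebra.intro assoc_algebra_axioms.intro)
    show "module R (twist R M n)"
      by (rule moduleI[OF R.is_cring ab]) (simp_all add: smult_l_distr smult_r_distr smult_assoc1)
    show "ring (twist R M n)"
    proof (rule ringI[OF ab])
      show "Group.monoid (twist R M n)"
        by (rule monoidI) (simp_all add: cl assoc one comm'[of _ "\<one>\<^bsub>M\<^esub>"])
    qed (simp_all add: ldist rdist)
  next
    fix a u v assume "a \<in> carrier R" "u \<in> carrier (twist R M n)" "v \<in> carrier (twist R M n)"
    then show "a \<odot>\<^bsub>twist R M n\<^esub> u \<otimes>\<^bsub>twist R M n\<^esub> v = a \<odot>\<^bsub>twist R M n\<^esub> (u \<otimes>\<^bsub>twist R M n\<^esub> v)"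
      "u \<otimes>\<^bsub>twist R M n\<^esub> (a \<odot>\<^bsub>twist R M n\<^esub> v) = a \<odot>\<^bsub>twist R M n\<^esub> (u \<otimes>\<^bsub>twist R M n\<^esub> v)"
      by (simp_all add: sm smr)
  qed
qed

lemma twist_quadratic: "n \<in> carrier R \<Longrightarrow> quadratic R (twist R M n)"
  by (simp add: quadratic_def quad_context_def quadratic_axioms_def twist_assoc_algebra
      locally_free_twist locally_free)

text \<open>The norm of u becomes N(u) - n N(u - \<sigma> u), which is again a scalar.\<close>

lemma twist_standard_involution:
  assumes n: "n \<in> carrier R"
  shows "standard_involution R (twist R M n) \<sigma>"
proof -
  interpret CM: cring M by (rule M_cring)
  define N where "N = n \<odot>\<^bsub>M\<^esub> \<one>\<^bsub>M\<^esub>"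
  have N: "N \<in> carrier M" "\<sigma> N = N" using n by (simp_all add: N_def \<sigma>_smult \<sigma>_one)
  note tm = twist_mult[OF _ _ n, folded N_def]
  have 1: "\<sigma> (u \<otimes>\<^bsub>twist R M n\<^esub> v) = \<sigma> v \<otimes>\<^bsub>twist R M n\<^esub> \<sigma> u" if u: "u \<in> carrier M" and v: "v \<in> carrier M" for u v
  proof -
    define U V where "U = \<sigma> u" and "V = \<sigma> v"
    have UV: "U \<in> carrier M" "V \<in> carrier M" using u v by (simp_all add: U_def V_def)
    have "\<sigma> (u \<otimes>\<^bsub>twist R M n\<^esub> v) = U \<otimes>\<^bsub>M\<^esub> V \<ominus>\<^bsub>M\<^esub> N \<otimes>\<^bsub>M\<^esub> ((U \<ominus>\<^bsub>M\<^esub> u) \<otimes>\<^bsub>M\<^esub> (V \<ominus>\<^bsub>M\<^esub> v))"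
      using u v N by (simp add: tm \<sigma>_diff \<sigma>_mult \<sigma>_\<sigma> U_def V_def)
    also have "\<dots> = V \<otimes>\<^bsub>M\<^esub> U \<ominus>\<^bsub>M\<^esub> N \<otimes>\<^bsub>M\<^esub> ((V \<ominus>\<^bsub>M\<^esub> v) \<otimes>\<^bsub>M\<^esub> (U \<ominus>\<^bsub>M\<^esub> u))"
      using u v UV N(1) by algebra
    also have "\<dots> = \<sigma> v \<otimes>\<^bsub>twist R M n\<^esub> \<sigma> u" using u v by (simp add: tm U_def V_def \<sigma>_\<sigma>)
    finally show ?thesis .
  qed
  have 2: "\<exists>r\<in>carrier R. u \<otimes>\<^bsub>twist R M n\<^esub> \<sigma> u = r \<odot>\<^bsub>M\<^esub> \<one>\<^bsub>M\<^esub>" if u: "u \<in> carrier M" for u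
  proof -
    define U where "U = \<sigma> u"
    have U: "U \<in> carrier M" "\<sigma> U = u" using u by (simp_all add: U_def \<sigma>_\<sigma>)
    obtain r where r: "r \<in> carrier R" "u \<otimes>\<^bsub>M\<^esub> U = r \<odot>\<^bsub>M\<^esub> \<one>\<^bsub>M\<^esub>" using \<sigma>_norm[OF u] by (auto simp: U_def)
    obtain s where s: "s \<in> carrier R" "(u \<ominus>\<^bsub>M\<^esub> U) \<otimes>\<^bsub>M\<^esub> (U \<ominus>\<^bsub>M\<^esub> u) = s \<odot>\<^bsub>M\<^esub> \<one>\<^bsub>M\<^esub>"
      using \<sigma>_norm[of "u \<ominus>\<^bsub>M\<^esub> U"] u U \<sigma>_diff[OF u U(1)] by (auto simp: U_def)
    have "u \<otimes>\<^bsub>twist R M n\<^esub> \<sigma> u = r \<odot>\<^bsub>M\<^esub> \<one>\<^bsub>M\<^esub> \<ominus>\<^bsub>M\<^esub> (n \<otimes> s) \<odot>\<^bsub>M\<^esub> \<one>\<^bsub>M\<^esub>"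
      using tm[OF u U(1)] U r s n by (simp add: U_def[symmetric] N_def smult_mult_left smult_assoc1)
    also have "\<dots> = (r \<ominus> n \<otimes> s) \<odot>\<^bsub>M\<^esub> \<one>\<^bsub>M\<^esub>" using r s n by (simp add: a_minus_def smult_l_distr smult_l_minus)
    finally show ?thesis using r s n by blast
  qed
  show ?thesis
    unfolding standard_involution_def mod_hom_def
    using 1 2 by (simp add: \<sigma>_add \<sigma>_smult \<sigma>_one \<sigma>_\<sigma>)
qed

text \<open>Uniqueness of the standard involution; iterated twists are therefore taken with respect
  to one and the same \<sigma>.\<close>

lemma twist_std_inv [simp]:
  assumes n: "n \<in> carrier R" shows "std_inv R (twist R M n) = \<sigma>"
proof -
  interpret T: quadratic R "twist R M n" by (rule twist_quadratic[OF n])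
  show ?thesis
    using T.std_inv(2) std_inv(2) T.std_inv_eq[OF twist_standard_involution[OF n]]
    by (intro extensionalityI) auto
qed

lemma twist_zero: "twist R M \<zero> = M"
proof -
  interpret CM: cring M by (rule M_cring)
  have "mult (twist R M \<zero>) = mult M"
    by (auto simp: twist_def fun_eq_iff a_minus_def)
  then show ?thesis by (simp add: twist_def)
qed

lemma torsion_scalar:
  assumes n: "n \<in> torsion4 R"
  defines "N \<equiv> n \<odot>\<^bsub>M\<^esub> \<one>\<^bsub>M\<^esub>"
  shows "N \<in> carrier M" "N \<oplus>\<^bsub>M\<^esub> N \<oplus>\<^bsub>M\<^esub> N \<oplus>\<^bsub>M\<^esub> N = \<zero>\<^bsub>M\<^esub>"
  using n by (simp_all add: N_def R.torsion4_iff smult_l_distr[symmetric])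

text \<open>Since \<sigma> p = -p and \<sigma> q = -q, the correction is n(2p)(2q) = 4npq =
  0.\<close>

lemma conj_diff_sq:
  assumes n: "n \<in> torsion4 R" and u: "u \<in> carrier M" and v: "v \<in> carrier M"
  defines "p \<equiv> u \<ominus>\<^bsub>M\<^esub> \<sigma> u" and "q \<equiv> v \<ominus>\<^bsub>M\<^esub> \<sigma> v"
  shows "p \<otimes>\<^bsub>twist R M n\<^esub> q = p \<otimes>\<^bsub>M\<^esub> q"
proof -
  interpret CM: cring M by (rule M_cring)
  define N where "N = n \<odot>\<^bsub>M\<^esub> \<one>\<^bsub>M\<^esub>"
  note N = torsion_scalar[OF n, folded N_def]
  have nR: "n \<in> carrier R" using n by (simp add: R.torsion4_iff)
  have p: "p \<in> carrier M" "\<sigma> p = \<ominus>\<^bsub>M\<^esub> p" "q \<in> carrier M" "\<sigma> q = \<ominus>\<^bsub>M\<^esub> q"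
    using u v by (simp_all add: p_def q_def \<sigma>_add \<sigma>_minus \<sigma>_\<sigma> a_minus_def M.minus_add M.a_comm)
  have "p \<otimes>\<^bsub>twist R M n\<^esub> q = p \<otimes>\<^bsub>M\<^esub> q \<ominus>\<^bsub>M\<^esub> N \<otimes>\<^bsub>M\<^esub> ((p \<ominus>\<^bsub>M\<^esub> (\<ominus>\<^bsub>M\<^esub> p)) \<otimes>\<^bsub>M\<^esub> (q \<ominus>\<^bsub>M\<^esub> (\<ominus>\<^bsub>M\<^esub> q)))"
    using p nR by (simp add: twist_mult N_def)
  also have "\<dots> = p \<otimes>\<^bsub>M\<^esub> q \<ominus>\<^bsub>M\<^esub> (N \<oplus>\<^bsub>M\<^esub> N \<oplus>\<^bsub>M\<^esub> N \<oplus>\<^bsub>M\<^esub> N) \<otimes>\<^bsub>M\<^esub> (p \<otimes>\<^bsub>M\<^esub> q)"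
    using p(1,3) N(1) by algebra
  also have "\<dots> = p \<otimes>\<^bsub>M\<^esub> q" unfolding N(2) using p by (simp add: a_minus_def)
  finally show ?thesis .
qed

text \<open>By \<open>conj_diff_sq\<close> the first twist does not alter the correction term of the
  second, so the two corrections add up. Off the carrier \<open>twist\<close> keeps the product of
  M, which makes this an equality of records and not only of products on the carrier.\<close>

lemma twist_twist:
  assumes n: "n \<in> torsion4 R" and m: "m \<in> torsion4 R"
  shows "twist R (twist R M n) m = twist R M (n \<oplus> m)"
proof -
  interpret CM: cring M by (rule M_cring)
  have c: "n \<in> carrier R" "m \<in> carrier R" using n m by (simp_all add: R.torsion4_iff)
  have "mult (twist R (twist R M n) m) u v = mult (twist R M (n \<oplus> m)) u v" for u v
  proof (cases "u \<in> carrier M \<and> v \<in> carrier M")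
    case True
    then have u: "u \<in> carrier M" and v: "v \<in> carrier M" by auto
    define q where "q = (u \<ominus>\<^bsub>M\<^esub> \<sigma> u) \<otimes>\<^bsub>M\<^esub> (v \<ominus>\<^bsub>M\<^esub> \<sigma> v)"
    have q: "q \<in> carrier M" using u v by (simp add: q_def)
    have "mult (twist R (twist R M n) m) u v = u \<otimes>\<^bsub>M\<^esub> v \<ominus>\<^bsub>M\<^esub> n \<odot>\<^bsub>M\<^esub> q \<ominus>\<^bsub>M\<^esub> m \<odot>\<^bsub>M\<^esub> q"
      unfolding twist_def[of R "twist R M n" m]
      using u v c conj_diff_sq[OF n u v] by (simp add: q_def) (simp add: twist_def)
    also have "\<dots> = u \<otimes>\<^bsub>M\<^esub> v \<ominus>\<^bsub>M\<^esub> (n \<oplus> m) \<odot>\<^bsub>M\<^esub> q"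
      using u v c q by (simp add: a_minus_def smult_l_distr M.minus_add M.a_ac)
    also have "\<dots> = mult (twist R M (n \<oplus> m)) u v"
      using u v by (simp add: twist_def q_def)
    finally show ?thesis .
  qed (auto simp: twist_def)
  then have "mult (twist R (twist R M n) m) = mult (twist R M (n \<oplus> m))" by blast
  then show ?thesis by (simp add: twist_def)
qed

end

text \<open>The involution of M carried over by f is a standard involution of T, hence the one of
  T.\<close>

lemma (in quadratic) std_inv_transport:
  assumes "quadratic R T" and f: "f \<in> alg_iso R M T" and u: "u \<in> carrier M"
  shows "std_inv R T (f u) = f (\<sigma> u)"
proof -
  interpret T: quadratic R T by fact
  note fd = alg_isoD[OF f]
  define g where "g = inv_into (carrier M) f"
  have fg: "g y \<in> carrier M" "f (g y) = y" if "y \<in> carrier T" for y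
    using that fd(6) by (auto simp: g_def bij_betw_def inv_into_into f_inv_into_f)
  have gf: "g (f x) = x" if "x \<in> carrier M" for x
    using that fd(6) by (auto simp: g_def bij_betw_def)
  have gh: "g (y \<oplus>\<^bsub>T\<^esub> z) = g y \<oplus>\<^bsub>M\<^esub> g z" "g (y \<otimes>\<^bsub>T\<^esub> z) = g y \<otimes>\<^bsub>M\<^esub> g z"
    if "y \<in> carrier T" "z \<in> carrier T" for y z
    using gf[of "g y \<oplus>\<^bsub>M\<^esub> g z"] gf[of "g y \<otimes>\<^bsub>M\<^esub> g z"] fg that by (simp_all add: fd)
  have gs: "g (a \<odot>\<^bsub>T\<^esub> y) = a \<odot>\<^bsub>M\<^esub> g y" if "a \<in> carrier R" "y \<in> carrier T" for a y
    using gf[of "a \<odot>\<^bsub>M\<^esub> g y"] fg that by (simp add: fd)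
  have g1: "g \<one>\<^bsub>T\<^esub> = \<one>\<^bsub>M\<^esub>" using gf[of "\<one>\<^bsub>M\<^esub>"] by (simp add: fd(5))
  have "standard_involution R T (\<lambda>y. f (\<sigma> (g y)))"
    unfolding standard_involution_def mod_hom_def
  proof (intro conjI ballI CollectI)
    fix y assume y: "y \<in> carrier T"
    obtain r where r: "r \<in> carrier R" "g y \<otimes>\<^bsub>M\<^esub> \<sigma> (g y) = r \<odot>\<^bsub>M\<^esub> \<one>\<^bsub>M\<^esub>" using \<sigma>_norm fg[OF y] by blast
    then have "y \<otimes>\<^bsub>T\<^esub> f (\<sigma> (g y)) = f (r \<odot>\<^bsub>M\<^esub> \<one>\<^bsub>M\<^esub>)"
      using fd(2)[of "g y" "\<sigma> (g y)"] fg[OF y] by simp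
    then show "\<exists>r\<in>carrier R. y \<otimes>\<^bsub>T\<^esub> f (\<sigma> (g y)) = r \<odot>\<^bsub>T\<^esub> \<one>\<^bsub>T\<^esub>" using r by (auto simp: fd)
  next
    fix y z assume "y \<in> carrier T" "z \<in> carrier T"
    then show "f (\<sigma> (g (y \<otimes>\<^bsub>T\<^esub> z))) = f (\<sigma> (g z)) \<otimes>\<^bsub>T\<^esub> f (\<sigma> (g y))"
      by (simp add: gh fg fd(1) \<sigma>_mult fd(2) T.comm)
  qed (simp_all add: gh gs g1 fg gf fd(1) fd(3-5) \<sigma>_add \<sigma>_smult \<sigma>_one \<sigma>_\<sigma>)
  then show ?thesis using T.std_inv_eq[of _ "f u"] fd(1)[OF u] gf[OF u] by simp
qed

text \<open>The twisted product is built from the product, the scalars and \<sigma>, all of which f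
  respects. Twisting therefore descends to isomorphism classes.\<close>

lemma (in quadratic) twist_iso:
  assumes T: "quadratic R T" and f: "f \<in> alg_iso R M T" and n: "n \<in> carrier R"
  shows "f \<in> alg_iso R (twist R M n) (twist R T n)"
proof -
  interpret T: quadratic R T by fact
  note fd = alg_isoD[OF f]
  have fm: "f (\<ominus>\<^bsub>M\<^esub> u) = \<ominus>\<^bsub>T\<^esub> f u" if "u \<in> carrier M" for u
    using fd(4)[of "\<ominus> \<one>" u] that by (simp add: smult_l_minus T.smult_l_minus fd(1))
  have "f (u \<otimes>\<^bsub>twist R M n\<^esub> v) = f u \<otimes>\<^bsub>twist R T n\<^esub> f v" if "u \<in> carrier M" "v \<in> carrier M" for u v
    using that n by (simp add: twist_def std_inv_transport[OF T f] a_minus_def fd(1-4) fm)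
  then show ?thesis
    using f by (auto simp: alg_iso_def ring_iso_def ring_hom_def mod_hom_def)
qed

section \<open>The product with an Artin--Schreier algebra\<close>

lemma (in cring) star_norm_torsion:
  assumes "n \<in> torsion4 R" "t \<in> carrier R" "s \<in> carrier R" "m \<in> carrier R"
  shows "star_norm R t n s m = m \<otimes> (t \<otimes> t) \<oplus> n \<otimes> (s \<otimes> s)"
proof -
  have n: "n \<in> carrier R" "n \<oplus> n \<oplus> n \<oplus> n = \<zero>" using assms(1) by (simp_all add: torsion4_iff)
  have "[(4::nat)] \<cdot> (n \<otimes> m) = n \<otimes> m \<oplus> n \<otimes> m \<oplus> n \<otimes> m \<oplus> n \<otimes> m"
    using n assms by (simp add: numeral_eq_Suc add.nat_pow_Suc)
  also have "\<dots> = (n \<oplus> n \<oplus> n \<oplus> n) \<otimes> m" using n(1) assms(4) by algebra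
  also have "\<dots> = \<zero>" unfolding n(2) using assms by simp
  finally show ?thesis using assms n by (simp add: star_norm_def a_minus_def)
qed

text \<open>For y^2 = y - n the element k + ly has trace l + 2k and norm
  \<open>l\<^sup>2n + lk + k\<^sup>2\<close>, the arguments on the left. The right side is the norm
  of ks + lz for a generator z of trace s and norm \<open>m + ns\<^sup>2\<close>. So the product
  computed with an arbitrary generator of the first factor has the norm of an explicit generator of
  the twist.\<close>

lemma (in cring) star_norm_change:
  assumes n: "n \<in> torsion4 R" and c: "l \<in> carrier R" "k \<in> carrier R" "s \<in> carrier R" "m \<in> carrier R"
  shows "star_norm R (l \<oplus> (k \<oplus> k)) (l \<otimes> l \<otimes> n \<oplus> l \<otimes> k \<oplus> k \<otimes> k) s m =
    l \<otimes> l \<otimes> (m \<oplus> n \<otimes> (s \<otimes> s)) \<oplus> l \<otimes> (k \<otimes> s) \<otimes> s \<oplus> k \<otimes> s \<otimes> (k \<otimes> s)"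
proof -
  have n: "n \<in> carrier R" "n \<oplus> n \<oplus> n \<oplus> n = \<zero>" using n by (simp_all add: torsion4_iff)
  define P e Q where "P = l \<otimes> l \<otimes> n" and "e = l \<otimes> k \<oplus> k \<otimes> k" and "Q = e \<oplus> e \<oplus> e \<oplus> e"
  have cl: "P \<in> carrier R" "e \<in> carrier R" "Q \<in> carrier R" using n c by (simp_all add: P_def e_def Q_def)
  have p: "l \<otimes> l \<otimes> n \<oplus> l \<otimes> k \<oplus> k \<otimes> k = P \<oplus> e" using n c by (simp add: P_def e_def a_assoc)
  \<comment> \<open>The squared trace is \<open>l\<^sup>2 + 4e\<close>. In \<open>star_norm\<close>
    the summand 4em cancels against its counterpart in the last term, and what is left there is 4Pm,
    which vanishes with 4n.\<close>
  have T: "(l \<oplus> (k \<oplus> k)) \<otimes> (l \<oplus> (k \<oplus> k)) = l \<otimes> l \<oplus> Q"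
    unfolding Q_def e_def using c by algebra
  have "P \<oplus> P \<oplus> P \<oplus> P = (n \<oplus> n \<oplus> n \<oplus> n) \<otimes> (l \<otimes> l)"
    unfolding P_def using n(1) c by algebra
  then have P4: "P \<oplus> P \<oplus> P \<oplus> P = \<zero>" unfolding n(2) using c by simp
  have "[(4::nat)] \<cdot> ((P \<oplus> e) \<otimes> m) = (P \<oplus> e) \<otimes> m \<oplus> (P \<oplus> e) \<otimes> m \<oplus> (P \<oplus> e) \<otimes> m \<oplus> (P \<oplus> e) \<otimes> m"
    using cl c by (simp add: numeral_eq_Suc add.nat_pow_Suc)
  also have "\<dots> = (P \<oplus> P \<oplus> P \<oplus> P) \<otimes> m \<oplus> Q \<otimes> m"
    unfolding Q_def using cl(1,2) c by algebra
  finally have 4: "[(4::nat)] \<cdot> ((P \<oplus> e) \<otimes> m) = Q \<otimes> m" unfolding P4 using cl c by simp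
  have "star_norm R (l \<oplus> (k \<oplus> k)) (P \<oplus> e) s m = m \<otimes> (l \<otimes> l) \<oplus> (P \<oplus> e) \<otimes> (s \<otimes> s)"
    unfolding star_norm_def T 4 using cl c by algebra
  also have "\<dots> = l \<otimes> l \<otimes> (m \<oplus> n \<otimes> (s \<otimes> s)) \<oplus> l \<otimes> (k \<otimes> s) \<otimes> s \<oplus> k \<otimes> s \<otimes> (k \<otimes> s)"
    unfolding P_def e_def using n(1) c by algebra
  finally show ?thesis unfolding p .
qed

text \<open>Compatibility of the generators \<open>k s + l y\<close> of the twisted algebra on overlaps; it is the
  cocycle condition for the isomorphisms \<open>\<phi> * \<psi>\<close>.\<close>

lemma (in cring) star_overlap:
  assumes c: "a \<in> carrier R" "r \<in> carrier R" "b \<in> carrier R" "q \<in> carrier R"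
      "l' \<in> carrier R" "k' \<in> carrier R" "s' \<in> carrier R"
    and l: "l = a \<otimes> l'" and k: "k = r \<oplus> a \<otimes> k'" and s: "s = b \<otimes> s' \<oplus> (q \<oplus> q)"
    and t: "t = l \<oplus> (k \<oplus> k)"
  shows "k \<otimes> s \<oplus> l \<otimes> q =
    (q \<otimes> t \<oplus> r \<otimes> s \<ominus> (q \<otimes> r \<oplus> q \<otimes> r)) \<oplus> (a \<otimes> b) \<otimes> (k' \<otimes> s')"
    "l \<otimes> b = (a \<otimes> b) \<otimes> l'"
  unfolding t l k s using c by algebra+

lemma is_star_quadratic: "is_star R S T U \<Longrightarrow> quadratic R U"
  unfolding is_star_def quadratic_iff by (erule conjunct1)

context quadratic
begin

text \<open>The generator is a fraction x = e/k, and e has a trace \<tau> and a norm \<nu> over R by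
  \<open>std_trace\<close>. So the twisted square of e is computed inside M and divided by
  \<open>k\<^sup>2\<close> afterwards.\<close>

lemma twist_local_gen:
  assumes n: "n \<in> torsion4 R" and W: "mult_set R W"
    and q: "quad_gen (loc_ring R W) (loc R W M) x t m"
  shows "quad_gen (loc_ring R W) (loc R W (twist R M n)) x t
    (m \<oplus>\<^bsub>loc_ring R W\<^esub> frac R W (reg R) n \<one> \<otimes>\<^bsub>loc_ring R W\<^esub> (t \<otimes>\<^bsub>loc_ring R W\<^esub> t))"
proof -
  interpret W: mult_set R W by fact
  have n': "n \<in> carrier R" "n \<oplus> n \<oplus> n \<oplus> n = \<zero>" using n by (simp_all add: R.torsion4_iff)
  interpret L: loc_quad R M W by (rule loc_quadI[OF assoc_algebra_axioms W])
  interpret LT: loc_quad R "twist R M n" W by (rule loc_quadI[OF twist_assoc_algebra[OF n'(1)] W])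
  interpret Re: loc_quad R "reg R" W by (rule W.loc_quad_reg)
  interpret Q: quad_context L.LR L.LM by (rule L.loc_quad_context)
  interpret QT: quad_context L.LR LT.LM by (rule LT.loc_quad_context)
  note x = Q.quad_genD[OF q]
  obtain e k where e: "e \<in> carrier M" "k \<in> W" "x = L.fr e k" using x(1) by (rule L.loc_cases)
  obtain \<tau> \<nu> where tn: "\<tau> \<in> carrier R" "\<nu> \<in> carrier R" "\<sigma> e = lc M e \<tau> (\<ominus> \<one>)"
    "e \<otimes>\<^bsub>M\<^esub> e = lc M e (\<ominus> \<nu>) \<tau>"
    by (rule std_trace[OF std_inv(1) e(1)])
  define p where "p = e \<ominus>\<^bsub>M\<^esub> \<sigma> e"
  have "p = lc M e \<zero> \<one> \<ominus>\<^bsub>M\<^esub> lc M e \<tau> (\<ominus> \<one>)" using e tn by (simp add: p_def lc_gen)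
  then have p: "p = lc M e (\<ominus> \<tau>) (\<one> \<oplus> \<one>)" using e tn by (simp add: lc_diff) (simp add: a_minus_def)
  have "p \<otimes>\<^bsub>M\<^esub> p = lc M e (\<ominus> \<tau> \<otimes> \<ominus> \<tau> \<ominus> (\<one> \<oplus> \<one>) \<otimes> (\<one> \<oplus> \<one>) \<otimes> \<nu>)
      (\<ominus> \<tau> \<otimes> (\<one> \<oplus> \<one>) \<oplus> (\<one> \<oplus> \<one>) \<otimes> \<ominus> \<tau> \<oplus> (\<one> \<oplus> \<one>) \<otimes> (\<one> \<oplus> \<one>) \<otimes> \<tau>)"
    unfolding p using e tn by (intro lc_mult) simp_all
  then have "n \<odot>\<^bsub>M\<^esub> (p \<otimes>\<^bsub>M\<^esub> p) = lc M e (n \<otimes> (\<ominus> \<tau> \<otimes> \<ominus> \<tau> \<ominus> (\<one> \<oplus> \<one>) \<otimes> (\<one> \<oplus> \<one>) \<otimes> \<nu>))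
      (n \<otimes> (\<ominus> \<tau> \<otimes> (\<one> \<oplus> \<one>) \<oplus> (\<one> \<oplus> \<one>) \<otimes> \<ominus> \<tau> \<oplus> (\<one> \<oplus> \<one>) \<otimes> (\<one> \<oplus> \<one>) \<otimes> \<tau>))"
    using e tn n' by (simp add: lc_smult)
  \<comment> \<open>In the square of p = 2e - \<tau> the coefficient -4\<tau> + 4\<tau> of e
    cancels; the constant term is \<open>\<tau>\<^sup>2 - 4\<nu>\<close>, and n kills
    4\<nu>.\<close>
  moreover have "n \<otimes> (\<ominus> \<tau> \<otimes> (\<one> \<oplus> \<one>) \<oplus> (\<one> \<oplus> \<one>) \<otimes> \<ominus> \<tau> \<oplus> (\<one> \<oplus> \<one>) \<otimes> (\<one> \<oplus> \<one>) \<otimes> \<tau>) = \<zero>"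
    using n'(1) tn(1) by algebra
  moreover have "n \<otimes> (\<ominus> \<tau> \<otimes> \<ominus> \<tau> \<ominus> (\<one> \<oplus> \<one>) \<otimes> (\<one> \<oplus> \<one>) \<otimes> \<nu>) =
      n \<otimes> (\<tau> \<otimes> \<tau>) \<ominus> (n \<oplus> n \<oplus> n \<oplus> n) \<otimes> \<nu>"
    using n'(1) tn(1,2) by algebra
  ultimately have np: "n \<odot>\<^bsub>M\<^esub> (p \<otimes>\<^bsub>M\<^esub> p) = lc M e (n \<otimes> (\<tau> \<otimes> \<tau>)) \<zero>"
    using tn n' by (simp add: a_minus_def)
  have ee: "e \<otimes>\<^bsub>twist R M n\<^esub> e = lc M e (\<ominus> \<nu> \<ominus> n \<otimes> (\<tau> \<otimes> \<tau>)) \<tau>"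
  proof -
    have "e \<otimes>\<^bsub>twist R M n\<^esub> e = lc M e (\<ominus> \<nu>) \<tau> \<ominus>\<^bsub>M\<^esub> lc M e (n \<otimes> (\<tau> \<otimes> \<tau>)) \<zero>"
      using e tn np by (simp add: twist_def p_def)
    then show ?thesis using e tn n' by (simp add: lc_diff) (simp add: a_minus_def)
  qed
  have sq: "lc L.LM x (L.rf a (k \<otimes> k)) (L.rf (k \<otimes> \<tau>) (k \<otimes> k)) = L.fr (lc M e a \<tau>) (k \<otimes> k)" if "a \<in> carrier R" for a
    using L.frac_lc[of e k "k \<otimes> k" a \<tau>] e tn that by simp
  have "x \<otimes>\<^bsub>L.LM\<^esub> x = lc L.LM x (L.rf (\<ominus> \<nu>) (k \<otimes> k)) (L.rf (k \<otimes> \<tau>) (k \<otimes> k))"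
    unfolding sq[OF R.a_inv_closed[OF tn(2)]] using e tn(4) by (simp add: L.mult_frac)
  then have l: "lc L.LM x (\<ominus>\<^bsub>L.LR\<^esub> m) t = lc L.LM x (L.rf (\<ominus> \<nu>) (k \<otimes> k)) (L.rf (k \<otimes> \<tau>) (k \<otimes> k))"
    using x(5) by simp
  \<comment> \<open>Uniqueness of coordinates identifies the given local trace and norm with those
    of e, up to the denominators.\<close>
  have mt: "\<ominus>\<^bsub>L.LR\<^esub> m = L.rf (\<ominus> \<nu>) (k \<otimes> k)" "t = L.rf (k \<otimes> \<tau>) (k \<otimes> k)"
    using Q.lc_inj[OF x(4) _ _ _ _ l] x e tn by (simp_all add: L.rf_closed)
  have t: "t = L.rf \<tau> k" unfolding mt(2) using Re.frac_cancel[of \<tau> k k] e tn by simp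
  have "\<ominus>\<^bsub>L.LR\<^esub> (m \<oplus>\<^bsub>L.LR\<^esub> L.rf n \<one> \<otimes>\<^bsub>L.LR\<^esub> (t \<otimes>\<^bsub>L.LR\<^esub> t)) =
      \<ominus>\<^bsub>L.LR\<^esub> m \<ominus>\<^bsub>L.LR\<^esub> L.rf n \<one> \<otimes>\<^bsub>L.LR\<^esub> (t \<otimes>\<^bsub>L.LR\<^esub> t)"
    using x n' by (simp add: L.rf_closed Q.R.minus_add a_minus_def)
  also have "\<dots> = L.rf (\<ominus> \<nu> \<ominus> n \<otimes> (\<tau> \<otimes> \<tau>)) (k \<otimes> k)"
    unfolding mt(1) unfolding t using e tn n' by (simp add: Re.mult_frac Re.diff_frac_same)
  finally have fin: "\<ominus>\<^bsub>L.LR\<^esub> (m \<oplus>\<^bsub>L.LR\<^esub> L.rf n \<one> \<otimes>\<^bsub>L.LR\<^esub> (t \<otimes>\<^bsub>L.LR\<^esub> t)) = \<dots>" .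
  have "\<ominus> \<nu> \<ominus> n \<otimes> (\<tau> \<otimes> \<tau>) \<in> carrier R" using tn n' by simp
  note sq = sq[OF this, folded fin mt(2)]
  have "x \<otimes>\<^bsub>LT.LM\<^esub> x = lc L.LM x (\<ominus>\<^bsub>L.LR\<^esub> (m \<oplus>\<^bsub>L.LR\<^esub> L.rf n \<one> \<otimes>\<^bsub>L.LR\<^esub> (t \<otimes>\<^bsub>L.LR\<^esub> t))) t"
    unfolding sq using LT.mult_frac[of e k e k] e by (simp add: ee)
  then show ?thesis
    using x n' by (simp add: QT.quad_gen_iff L.rf_closed)
qed

end

lemma (in mult_set) torsion4_frac:
  assumes "n \<in> torsion4 R" shows "frac R W (reg R) n \<one> \<in> torsion4 (loc_ring R W)"
proof -
  interpret Re: loc_quad R "reg R" W by (rule loc_quad_reg)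
  interpret A: cring "loc_ring R W" by (rule loc_ring_cring)
  show ?thesis
    using assms unfolding A.torsion4_iff torsion4_iff
    by (simp add: Re.rf_closed Re.add_frac_same Re.zero_frac[of \<one>])
qed

text \<open>E has the global generator y, so its transitions are trivial and the local generators x
  f of M also serve as the generators w f of the twist: same trace, and the norm required by
  \<open>star_norm\<close>.\<close>

lemma (in quadratic) star_twist:
  fixes E :: "('a, 'c) module"
  assumes E: "assoc_algebra R E" "quad_gen R E y \<one> n" and n: "n \<in> torsion4 R"
  shows "is_star R E M (twist R M n)"
proof -
  interpret E: quad_context R E by (rule quad_context.intro) (rule E)
  note yE = E.quad_genD[OF E(2)]
  interpret T: quadratic R "twist R M n" by (rule twist_quadratic[OF yE(3)])
  obtain F x t m where F: "principal_cover R F"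
    and q: "\<And>f. f \<in> F \<Longrightarrow> quad_gen (loc_ring R (powers R f)) (loc R (powers R f) M) (x f) (t f) (m f)"
    by (rule cover) blast
  define Y where "Y f = frac R (powers R f) E y \<one>" for f
  define N where "N f = frac R (powers R f) (reg R) n \<one>" for f
  define I where "I f = frac R (powers R f) (reg R) \<one> \<one>" for f
  have FR: "f \<in> carrier R" if "f \<in> F" for f using F that by (auto simp: principal_cover_def)
  have gens: "quad_gen (loc_ring R W) (loc R W E) (Y f) (I f) (N f) \<and>
      quad_gen (loc_ring R W) (loc R W M) (x f) (t f) (m f) \<and>
      quad_gen (loc_ring R W) (loc R W (twist R M n)) (x f) (t f \<otimes>\<^bsub>loc_ring R W\<^esub> I f)
        (star_norm (loc_ring R W) (I f) (N f) (t f) (m f))"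
    if f: "f \<in> F" and W: "W = powers R f" for f W
  proof -
    interpret W: mult_set R W unfolding W by (rule R.powers_mult_set[OF FR[OF f]])
    interpret LE: loc_quad R E W by (rule loc_quadI[OF E(1) W.mult_set_axioms])
    interpret L: loc_quad R M W by (rule loc_quadI[OF assoc_algebra_axioms W.mult_set_axioms])
    interpret Re: loc_quad R "reg R" W by (rule W.loc_quad_reg)
    interpret Q: quad_context L.LR L.LM by (rule L.loc_quad_context)
    note xq = q[OF f, folded W]
    note xd = Q.quad_genD[OF xq]
    have I1: "I f = \<one>\<^bsub>L.LR\<^esub>" unfolding I_def W[symmetric] by (simp add: Re.one_frac)
    have N4: "N f \<in> torsion4 L.LR" unfolding N_def W[symmetric] by (rule W.torsion4_frac[OF n])
    then have Nc: "N f \<in> carrier L.LR" by (simp add: Q.R.torsion4_iff)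
    have "star_norm L.LR (I f) (N f) (t f) (m f) = m f \<oplus>\<^bsub>L.LR\<^esub> N f \<otimes>\<^bsub>L.LR\<^esub> (t f \<otimes>\<^bsub>L.LR\<^esub> t f)"
      using N4 xd unfolding I1 by (simp add: Q.R.star_norm_torsion)
    moreover have "t f \<otimes>\<^bsub>L.LR\<^esub> I f = t f" using xd unfolding I1 by simp
    ultimately show ?thesis
      using xq LE.quad_gen_base[OF E(2)] twist_local_gen[OF n W.mult_set_axioms xq]
      by (simp add: Y_def I_def N_def W)
  qed
  show ?thesis
    unfolding is_star_def
  proof (rule conjI[rotated], rule exI[of _ F], rule exI[of _ Y], rule exI[of _ I], rule exI[of _ N],
      rule exI[of _ x], rule exI[of _ t], rule exI[of _ m], rule exI[of _ x], intro conjI ballI)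
    show "quadratic_algebra R (twist R M n)" using T.quadratic_axioms by (simp add: quadratic_iff)
    show "principal_cover R F" by fact
    show "let W = powers R f; A = loc_ring R W in
        quad_gen A (loc R W E) (Y f) (I f) (N f) \<and>
        quad_gen A (loc R W M) (x f) (t f) (m f) \<and>
        quad_gen A (loc R W (twist R M n)) (x f) (t f \<otimes>\<^bsub>A\<^esub> I f) (star_norm A (I f) (N f) (t f) (m f))"
      if "f \<in> F" for f using gens[OF that refl] by (simp add: Let_def)
  next
    fix f g assume f: "f \<in> F" and g: "g \<in> F"
    define W where "W = powers R f <#> powers R g"
    note sm = R.set_mult_mult_set[OF R.powers_mult_set[OF FR[OF f]] R.powers_mult_set[OF FR[OF g]], folded W_def]
    interpret W: mult_set R W by (rule sm(1))
    interpret LE: loc_quad R E W by (rule loc_quadI[OF E(1) W.mult_set_axioms])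
    interpret L: loc_quad R M W by (rule loc_quadI[OF assoc_algebra_axioms W.mult_set_axioms])
    interpret Re: loc_quad R "reg R" W by (rule W.loc_quad_reg)
    interpret Lf: loc_quad R M "powers R f" by (rule loc_quad_powers[OF FR[OF f]])
    interpret Lg: loc_quad R M "powers R g" by (rule loc_quad_powers[OF FR[OF g]])
    interpret Ef: loc_quad R E "powers R f" by (rule E.loc_quad_powers[OF FR[OF f]])
    interpret Eg: loc_quad R E "powers R g" by (rule E.loc_quad_powers[OF FR[OF g]])
    interpret rf: res_quad R M "powers R f" W by unfold_locales (rule sm(2))
    interpret rg: res_quad R M "powers R g" W by unfold_locales (rule sm(3))
    interpret rEf: res_quad R E "powers R f" W by unfold_locales (rule sm(2))
    interpret rEg: res_quad R E "powers R g" W by unfold_locales (rule sm(3))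
    interpret rrf: res_quad R "reg R" "powers R f" W by (rule rf.res_quad_reg)
    interpret Q: quad_context L.LR L.LM by (rule L.loc_quad_context)
    interpret QE: quad_context L.LR LE.LM by (rule LE.loc_quad_context)
    interpret Qf: quad_context Lf.LR Lf.LM by (rule Lf.loc_quad_context)
    interpret Qg: quad_context Lg.LR Lg.LM by (rule Lg.loc_quad_context)
    note yW = QE.quad_genD[OF LE.quad_gen_base[OF E(2)]]
    have Yr: "rEf.res (Y f) = LE.fr y \<one>" "rEf.res (Y g) = LE.fr y \<one>"
      unfolding Y_def using yE by simp_all
    have Ir: "rf.rres (I f) = \<one>\<^bsub>L.LR\<^esub>" by (simp add: I_def Re.one_frac)
    note xf = Qf.quad_genD[OF q[OF f]] and xg = Qg.quad_genD[OF q[OF g]]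
    have *: "rf.res (x f) = (a \<otimes>\<^bsub>L.LR\<^esub> b) \<odot>\<^bsub>L.LM\<^esub> rf.res (x g) \<oplus>\<^bsub>L.LM\<^esub>
        ((p \<otimes>\<^bsub>L.LR\<^esub> rf.rres (I f) \<oplus>\<^bsub>L.LR\<^esub> r \<otimes>\<^bsub>L.LR\<^esub> rf.rres (t f)) \<ominus>\<^bsub>L.LR\<^esub>
          [(2::nat)] \<cdot>\<^bsub>L.LR\<^esub> (p \<otimes>\<^bsub>L.LR\<^esub> r)) \<odot>\<^bsub>L.LM\<^esub> \<one>\<^bsub>L.LM\<^esub>"
      if ab: "a \<in> carrier L.LR" "r \<in> carrier L.LR" "b \<in> carrier L.LR" "p \<in> carrier L.LR"
        and e1: "rEf.res (Y f) = a \<odot>\<^bsub>LE.LM\<^esub> rEf.res (Y g) \<oplus>\<^bsub>LE.LM\<^esub> r \<odot>\<^bsub>LE.LM\<^esub> \<one>\<^bsub>LE.LM\<^esub>"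
        and e2: "rf.res (x f) = b \<odot>\<^bsub>L.LM\<^esub> rf.res (x g) \<oplus>\<^bsub>L.LM\<^esub> p \<odot>\<^bsub>L.LM\<^esub> \<one>\<^bsub>L.LM\<^esub>"
      for a r b p
    proof -
      \<comment> \<open>The generator y is the same over D(f) and D(g), which leaves a = 1 and r = 0
        as the only transition. The transition prescribed for w f is then that of x f.\<close>
      have "lc LE.LM (LE.fr y \<one>) \<zero>\<^bsub>L.LR\<^esub> \<one>\<^bsub>L.LR\<^esub> = lc LE.LM (LE.fr y \<one>) r a"
        using e1 ab yW(1) unfolding Yr by (simp add: QE.lc_gen) (simp add: lc_def QE.M.a_comm)
      from QE.lc_inj[OF yW(4) _ _ _ _ this] ab have ra: "r = \<zero>\<^bsub>L.LR\<^esub>" "a = \<one>\<^bsub>L.LR\<^esub>" by simp_all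
      have "rf.rres (t f) \<in> carrier L.LR" using xf by simp
      then show ?thesis
        using e2 ab unfolding ra Ir by (simp add: a_minus_def)
    qed
    show "let W = powers R f <#> powers R g; A = loc_ring R W;
          S' = loc R W E; T' = loc R W M; U' = loc R W (twist R M n);
          t' = loc_res R W (reg R) (I f); s' = loc_res R W (reg R) (t f) in
        \<forall>a\<in>carrier A. \<forall>r\<in>carrier A. \<forall>b\<in>carrier A. \<forall>q\<in>carrier A.
          loc_res R W E (Y f) = a \<odot>\<^bsub>S'\<^esub> loc_res R W E (Y g) \<oplus>\<^bsub>S'\<^esub> r \<odot>\<^bsub>S'\<^esub> \<one>\<^bsub>S'\<^esub> \<longrightarrow>
          loc_res R W M (x f) = b \<odot>\<^bsub>T'\<^esub> loc_res R W M (x g) \<oplus>\<^bsub>T'\<^esub> q \<odot>\<^bsub>T'\<^esub> \<one>\<^bsub>T'\<^esub> \<longrightarrow>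
          loc_res R W (twist R M n) (x f) = (a \<otimes>\<^bsub>A\<^esub> b) \<odot>\<^bsub>U'\<^esub> loc_res R W (twist R M n) (x g) \<oplus>\<^bsub>U'\<^esub>
            ((q \<otimes>\<^bsub>A\<^esub> t' \<oplus>\<^bsub>A\<^esub> r \<otimes>\<^bsub>A\<^esub> s') \<ominus>\<^bsub>A\<^esub> [(2::nat)] \<cdot>\<^bsub>A\<^esub> (q \<otimes>\<^bsub>A\<^esub> r)) \<odot>\<^bsub>U'\<^esub> \<one>\<^bsub>U'\<^esub>"
      unfolding Let_def W_def[symmetric] twist_loc twist_loc_res using * by blast
  qed
qed

text \<open>A given product comes with its own cover and with arbitrary generators x f of E. Writing
  x f = c f + d f y reveals which generator of the twist corresponds to w f: it has the same trace
  and norm by \<open>star_norm_change\<close> and the same transitions by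
  \<open>star_overlap\<close>, so \<open>glue_generators\<close> applies.\<close>

lemma (in quadratic) star_unique:
  fixes E :: "('a, 'c) module" and U :: "('a, 'd) module"
  assumes E: "assoc_algebra R E" "quad_gen R E y \<one> n" and n: "n \<in> torsion4 R"
    and star: "is_star R E M U"
  shows "alg_iso R U (twist R M n) \<noteq> {}"
proof -
  interpret E: quad_context R E by (rule quad_context.intro) (rule E)
  note yE = E.quad_genD[OF E(2)]
  interpret T: quadratic R "twist R M n" by (rule twist_quadratic[OF yE(3)])
  interpret U: quadratic R U using star by (rule is_star_quadratic)
  obtain F x t k z s m w where F: "principal_cover R F"
    and gens: "\<And>f. f \<in> F \<Longrightarrow> let W = powers R f; A = loc_ring R W in
        quad_gen A (loc R W E) (x f) (t f) (k f) \<and>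
        quad_gen A (loc R W M) (z f) (s f) (m f) \<and>
        quad_gen A (loc R W U) (w f) (s f \<otimes>\<^bsub>A\<^esub> t f) (star_norm A (t f) (k f) (s f) (m f))"
    and overlap: "\<And>f g. f \<in> F \<Longrightarrow> g \<in> F \<Longrightarrow>
        let W = powers R f <#> powers R g; A = loc_ring R W;
          S' = loc R W E; T' = loc R W M; U' = loc R W U;
          t' = loc_res R W (reg R) (t f); s' = loc_res R W (reg R) (s f) in
        \<forall>a\<in>carrier A. \<forall>r\<in>carrier A. \<forall>b\<in>carrier A. \<forall>q\<in>carrier A.
          loc_res R W E (x f) = a \<odot>\<^bsub>S'\<^esub> loc_res R W E (x g) \<oplus>\<^bsub>S'\<^esub> r \<odot>\<^bsub>S'\<^esub> \<one>\<^bsub>S'\<^esub> \<longrightarrow>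
          loc_res R W M (z f) = b \<odot>\<^bsub>T'\<^esub> loc_res R W M (z g) \<oplus>\<^bsub>T'\<^esub> q \<odot>\<^bsub>T'\<^esub> \<one>\<^bsub>T'\<^esub> \<longrightarrow>
          loc_res R W U (w f) = (a \<otimes>\<^bsub>A\<^esub> b) \<odot>\<^bsub>U'\<^esub> loc_res R W U (w g) \<oplus>\<^bsub>U'\<^esub>
            ((q \<otimes>\<^bsub>A\<^esub> t' \<oplus>\<^bsub>A\<^esub> r \<otimes>\<^bsub>A\<^esub> s') \<ominus>\<^bsub>A\<^esub> [(2::nat)] \<cdot>\<^bsub>A\<^esub> (q \<otimes>\<^bsub>A\<^esub> r)) \<odot>\<^bsub>U'\<^esub> \<one>\<^bsub>U'\<^esub>"
    using star unfolding is_star_def by (elim conjE exE) blast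
  define A where "A f = loc_ring R (powers R f)" for f
  define N where "N f = frac R (powers R f) (reg R) n \<one>" for f
  define Y where "Y f = frac R (powers R f) E y \<one>" for f
  have FR: "f \<in> carrier R" if "f \<in> F" for f using F that by (auto simp: principal_cover_def)
  have gE: "quad_gen (A f) (loc R (powers R f) E) (x f) (t f) (k f)"
    and gM: "quad_gen (A f) (loc R (powers R f) M) (z f) (s f) (m f)"
    and gU: "quad_gen (A f) (loc R (powers R f) U) (w f) (s f \<otimes>\<^bsub>A f\<^esub> t f)
      (star_norm (A f) (t f) (k f) (s f) (m f))"
    if "f \<in> F" for f using gens[OF that] by (simp_all add: A_def Let_def)
  have "\<exists>c d. c \<in> carrier (A f) \<and> d \<in> Units (A f) \<and> x f = lc (loc R (powers R f) E) (Y f) c d"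
    if f: "f \<in> F" for f
  proof -
    interpret LE: loc_quad R E "powers R f" by (rule E.loc_quad_powers[OF FR[OF f]])
    interpret QE: quad_context "A f" LE.LM unfolding A_def by (rule LE.loc_quad_context)
    have "qbasis (A f) LE.LM (x f)" "qbasis (A f) LE.LM (Y f)"
      using QE.quad_genD(4)[OF gE[OF f]] QE.quad_genD(4)[OF LE.quad_gen_base[OF E(2), folded A_def Y_def]] by blast+
    then show ?thesis by (rule QE.basis_change) blast
  qed
  then obtain c d where cd: "\<And>f. f \<in> F \<Longrightarrow> c f \<in> carrier (A f)" "\<And>f. f \<in> F \<Longrightarrow> d f \<in> Units (A f)"
    "\<And>f. f \<in> F \<Longrightarrow> x f = lc (loc R (powers R f) E) (Y f) (c f) (d f)"
    by metis
  \<comment> \<open>The isomorphism induced by x = dy + c on E and the identity on M sends w to dw'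
    + cs; in the twist the role of w' is played by z.\<close>
  define v where "v f = lc (loc R (powers R f) M) (z f) (c f \<otimes>\<^bsub>A f\<^esub> s f) (d f)" for f
  have dA: "d f \<in> carrier (A f)" if "f \<in> F" for f using cd(2)[OF that] by (auto simp: Units_def)
  have tk: "t f = d f \<oplus>\<^bsub>A f\<^esub> (c f \<oplus>\<^bsub>A f\<^esub> c f)"
    and gT: "quad_gen (A f) (loc R (powers R f) (twist R M n)) (v f) (s f \<otimes>\<^bsub>A f\<^esub> t f)
      (star_norm (A f) (t f) (k f) (s f) (m f))"
    if f: "f \<in> F" for f
  proof -
    interpret W: mult_set R "powers R f" by (rule R.powers_mult_set[OF FR[OF f]])
    interpret LE: loc_quad R E "powers R f" by (rule E.loc_quad_powers[OF FR[OF f]])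
    interpret LM: loc_quad R M "powers R f" by (rule loc_quad_powers[OF FR[OF f]])
    interpret LT: loc_quad R "twist R M n" "powers R f" by (rule T.loc_quad_powers[OF FR[OF f]])
    interpret QE: quad_context "A f" LE.LM unfolding A_def by (rule LE.loc_quad_context)
    interpret QM: quad_context "A f" LM.LM unfolding A_def by (rule LM.loc_quad_context)
    interpret QT: quad_context "A f" LT.LM unfolding A_def by (rule LT.loc_quad_context)
    interpret Re: loc_quad R "reg R" "powers R f" by (rule W.loc_quad_reg)
    note zD = QM.quad_genD[OF gM[OF f]]
    have N4: "N f \<in> torsion4 (A f)" unfolding N_def A_def by (rule W.torsion4_frac[OF n])
    then have Nc: "N f \<in> carrier (A f)" by (simp add: QE.R.torsion4_iff)
    note c = cd(1)[OF f] and d = dA[OF f]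
    have "quad_gen (A f) LE.LM (Y f) \<one>\<^bsub>A f\<^esub> (N f)"
      using LE.quad_gen_base[OF E(2)] by (simp add: A_def Y_def N_def Re.one_frac)
    from QE.quad_gen_change[OF this cd(2,1)[OF f], folded cd(3)[OF f]]
    have xq: "quad_gen (A f) LE.LM (x f) (d f \<oplus>\<^bsub>A f\<^esub> (c f \<oplus>\<^bsub>A f\<^esub> c f))
      (d f \<otimes>\<^bsub>A f\<^esub> d f \<otimes>\<^bsub>A f\<^esub> N f \<oplus>\<^bsub>A f\<^esub> d f \<otimes>\<^bsub>A f\<^esub> c f \<oplus>\<^bsub>A f\<^esub> c f \<otimes>\<^bsub>A f\<^esub> c f)"
      using c d by simp
    show t: "t f = d f \<oplus>\<^bsub>A f\<^esub> (c f \<oplus>\<^bsub>A f\<^esub> c f)" by (rule QE.quad_gen_unique(1)[OF gE[OF f] xq])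
    have k: "k f = d f \<otimes>\<^bsub>A f\<^esub> d f \<otimes>\<^bsub>A f\<^esub> N f \<oplus>\<^bsub>A f\<^esub> d f \<otimes>\<^bsub>A f\<^esub> c f \<oplus>\<^bsub>A f\<^esub> c f \<otimes>\<^bsub>A f\<^esub> c f"
      by (rule QE.quad_gen_unique(2)[OF gE[OF f] xq])
    have "quad_gen (A f) LT.LM (z f) (s f) (m f \<oplus>\<^bsub>A f\<^esub> N f \<otimes>\<^bsub>A f\<^esub> (s f \<otimes>\<^bsub>A f\<^esub> s f))"
      using twist_local_gen[OF n W.mult_set_axioms gM[OF f, unfolded A_def]] by (simp add: A_def N_def)
    from QT.quad_gen_change[OF this cd(2)[OF f], of "c f \<otimes>\<^bsub>A f\<^esub> s f"] c zD
    have "quad_gen (A f) LT.LM (v f) (d f \<otimes>\<^bsub>A f\<^esub> s f \<oplus>\<^bsub>A f\<^esub> (c f \<otimes>\<^bsub>A f\<^esub> s f \<oplus>\<^bsub>A f\<^esub> c f \<otimes>\<^bsub>A f\<^esub> s f))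
      (d f \<otimes>\<^bsub>A f\<^esub> d f \<otimes>\<^bsub>A f\<^esub> (m f \<oplus>\<^bsub>A f\<^esub> N f \<otimes>\<^bsub>A f\<^esub> (s f \<otimes>\<^bsub>A f\<^esub> s f)) \<oplus>\<^bsub>A f\<^esub>
       d f \<otimes>\<^bsub>A f\<^esub> (c f \<otimes>\<^bsub>A f\<^esub> s f) \<otimes>\<^bsub>A f\<^esub> s f \<oplus>\<^bsub>A f\<^esub> c f \<otimes>\<^bsub>A f\<^esub> s f \<otimes>\<^bsub>A f\<^esub> (c f \<otimes>\<^bsub>A f\<^esub> s f))"
      by (simp add: v_def)
    moreover have "d f \<otimes>\<^bsub>A f\<^esub> s f \<oplus>\<^bsub>A f\<^esub> (c f \<otimes>\<^bsub>A f\<^esub> s f \<oplus>\<^bsub>A f\<^esub> c f \<otimes>\<^bsub>A f\<^esub> s f) = s f \<otimes>\<^bsub>A f\<^esub> t f"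
      unfolding t using c d zD(2) by algebra
    ultimately show "quad_gen (A f) LT.LM (v f) (s f \<otimes>\<^bsub>A f\<^esub> t f)
        (star_norm (A f) (t f) (k f) (s f) (m f))"
      using QE.R.star_norm_change[OF N4 d c zD(2,3)] by (simp add: t k)
  qed
  obtain h where "h \<in> alg_iso R U (twist R M n)"
  proof (rule glue_generators[OF U.quad_context_axioms T.quad_context_axioms F gU[unfolded A_def] gT[unfolded A_def]])
    fix f g c0 a0 assume f: "f \<in> F" and g: "g \<in> F"
    define W where "W = powers R f <#> powers R g"
    note sm = R.set_mult_mult_set[OF R.powers_mult_set[OF FR[OF f]] R.powers_mult_set[OF FR[OF g]], folded W_def]
    interpret W: mult_set R W by (rule sm(1))
    interpret LE: loc_quad R E W by (rule loc_quadI[OF E(1) W.mult_set_axioms])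
    interpret L: loc_quad R M W by (rule loc_quadI[OF assoc_algebra_axioms W.mult_set_axioms])
    interpret LU: loc_quad R U W by (rule loc_quadI[OF U.assoc_algebra_axioms W.mult_set_axioms])
    interpret Lf: loc_quad R M "powers R f" by (rule loc_quad_powers[OF FR[OF f]])
    interpret Lg: loc_quad R M "powers R g" by (rule loc_quad_powers[OF FR[OF g]])
    interpret Ef: loc_quad R E "powers R f" by (rule E.loc_quad_powers[OF FR[OF f]])
    interpret Eg: loc_quad R E "powers R g" by (rule E.loc_quad_powers[OF FR[OF g]])
    interpret Uf: loc_quad R U "powers R f" by (rule U.loc_quad_powers[OF FR[OF f]])
    interpret Ug: loc_quad R U "powers R g" by (rule U.loc_quad_powers[OF FR[OF g]])
    interpret rf: res_quad R M "powers R f" W by unfold_locales (rule sm(2))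
    interpret rg: res_quad R M "powers R g" W by unfold_locales (rule sm(3))
    interpret rEf: res_quad R E "powers R f" W by unfold_locales (rule sm(2))
    interpret rEg: res_quad R E "powers R g" W by unfold_locales (rule sm(3))
    interpret rUg: res_quad R U "powers R g" W by unfold_locales (rule sm(3))
    interpret rrf: res_quad R "reg R" "powers R f" W by (rule rf.res_quad_reg)
    interpret rrg: res_quad R "reg R" "powers R g" W by (rule rg.res_quad_reg)
    interpret Q: quad_context L.LR L.LM by (rule L.loc_quad_context)
    interpret QE: quad_context L.LR LE.LM by (rule LE.loc_quad_context)
    interpret QU: quad_context L.LR LU.LM by (rule LU.loc_quad_context)
    interpret Qf: quad_context Lf.LR Lf.LM by (rule Lf.loc_quad_context)
    interpret Qg: quad_context Lg.LR Lg.LM by (rule Lg.loc_quad_context)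
    interpret QEf: quad_context Lf.LR Ef.LM by (rule Ef.loc_quad_context)
    interpret QEg: quad_context Lg.LR Eg.LM by (rule Eg.loc_quad_context)
    note zf = Qf.quad_genD[OF gM[OF f, unfolded A_def]] and zg = Qg.quad_genD[OF gM[OF g, unfolded A_def]]
    note xf = QEf.quad_genD[OF gE[OF f, unfolded A_def]] and xg = QEg.quad_genD[OF gE[OF g, unfolded A_def]]
    note zfq = rf.quad_gen_res[OF gM[OF f, unfolded A_def]] and zgq = rg.quad_gen_res[OF gM[OF g, unfolded A_def]]
    note zgW = Q.quad_genD[OF zgq] and zfW = Q.quad_genD[OF zfq]
    note xgW = QE.quad_genD[OF rEg.quad_gen_res[OF gE[OF g, unfolded A_def]]]
      and xfW = QE.quad_genD[OF rEf.quad_gen_res[OF gE[OF f, unfolded A_def]]]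
    note wgW = QU.quad_genD[OF rUg.quad_gen_res[OF gU[OF g, unfolded A_def]]]
    note yW = QE.quad_genD[OF LE.quad_gen_base[OF E(2)]]
    note ca = cd(1)[OF f, unfolded A_def] cd(1)[OF g, unfolded A_def]
      dA[OF f, unfolded A_def] dA[OF g, unfolded A_def]
    obtain r a where ra: "r \<in> carrier L.LR" "a \<in> carrier L.LR"
      "rEf.res (x f) = lc LE.LM (rEf.res (x g)) r a" using xfW(1) by (rule QE.lc_cases[OF xgW(4)])
    obtain q b where qb: "q \<in> carrier L.LR" "b \<in> Units L.LR"
      "rf.res (z f) = lc L.LM (rf.res (z g)) q b" by (rule Q.basis_change[OF zfW(4) zgW(4)])
    have bc: "b \<in> carrier L.LR" using qb(2) by (auto simp: Units_def)
    let ?C = "\<lambda>h. rf.rres (c h)" and ?D = "\<lambda>h. rf.rres (d h)" and ?s = "\<lambda>h. rf.rres (s h)"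
      and ?t = "\<lambda>h. rf.rres (t h)"
    have cl: "?C f \<in> carrier L.LR" "?C g \<in> carrier L.LR" "?D f \<in> carrier L.LR" "?D g \<in> carrier L.LR"
      "?s f \<in> carrier L.LR" "?s g \<in> carrier L.LR" "?t f \<in> carrier L.LR"
      using ca zf zg xf by simp_all
    have Yr: "rEf.res (Y f) = LE.fr y \<one>" "rEf.res (Y g) = LE.fr y \<one>"
      unfolding Y_def using yE by simp_all
    have Yc: "Y f \<in> carrier Ef.LM" "Y g \<in> carrier Eg.LM" unfolding Y_def using yE by simp_all
    have xfr: "rEf.res (x f) = lc LE.LM (LE.fr y \<one>) (?C f) (?D f)"
      unfolding cd(3)[OF f] Yr(1)[symmetric] using Yc ca by (simp add: rEf.res_lc)
    have xgr: "rEf.res (x g) = lc LE.LM (LE.fr y \<one>) (?C g) (?D g)"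
      unfolding cd(3)[OF g] Yr(2)[symmetric] using Yc ca by (simp add: rEg.res_lc)
    have "lc LE.LM (LE.fr y \<one>) (?C f) (?D f) =
        lc LE.LM (LE.fr y \<one>) (r \<oplus>\<^bsub>L.LR\<^esub> a \<otimes>\<^bsub>L.LR\<^esub> ?C g) (a \<otimes>\<^bsub>L.LR\<^esub> ?D g)"
      using ra(3) unfolding xfr xgr using ra cl yW by (simp add: QE.lc_lc)
    from QE.lc_inj[OF yW(4) _ _ _ _ this] cl ra
    \<comment> \<open>Both x f and x g are expanded in the common generator y, which ties the
      transition of E to the coefficients c and d.\<close>
    have CD: "?C f = r \<oplus>\<^bsub>L.LR\<^esub> a \<otimes>\<^bsub>L.LR\<^esub> ?C g" "?D f = a \<otimes>\<^bsub>L.LR\<^esub> ?D g" by simp_all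
    have sf: "?s f = b \<otimes>\<^bsub>L.LR\<^esub> ?s g \<oplus>\<^bsub>L.LR\<^esub> (q \<oplus>\<^bsub>L.LR\<^esub> q)"
      by (rule Q.quad_gen_unique(1)[OF zfq Q.quad_gen_change[OF zgq qb(2,1), folded qb(3)]])
    have tf: "?t f = ?D f \<oplus>\<^bsub>L.LR\<^esub> (?C f \<oplus>\<^bsub>L.LR\<^esub> ?C f)"
      unfolding tk[OF f] A_def using ca by (simp add: rrf.res_add)
    note so = Q.R.star_overlap[OF ra(2,1) bc qb(1) cl(4,2,6) CD(2,1) sf tf]
    assume ca0: "c0 \<in> carrier (loc_ring R (powers R f <#> powers R g))"
        "a0 \<in> carrier (loc_ring R (powers R f <#> powers R g))"
      and "loc_res R (powers R f <#> powers R g) U (w f) =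
        lc (loc R (powers R f <#> powers R g) U) (loc_res R (powers R f <#> powers R g) U (w g)) c0 a0"
    then have ca0: "c0 \<in> carrier L.LR" "a0 \<in> carrier L.LR"
      and w0: "loc_res R W U (w f) = lc LU.LM (loc_res R W U (w g)) c0 a0"
      by (simp_all add: W_def)
    have w1: "loc_res R W U (w f) = lc LU.LM (loc_res R W U (w g))
        ((q \<otimes>\<^bsub>L.LR\<^esub> ?t f \<oplus>\<^bsub>L.LR\<^esub> r \<otimes>\<^bsub>L.LR\<^esub> ?s f) \<ominus>\<^bsub>L.LR\<^esub> (q \<otimes>\<^bsub>L.LR\<^esub> r \<oplus>\<^bsub>L.LR\<^esub> q \<otimes>\<^bsub>L.LR\<^esub> r)) (a \<otimes>\<^bsub>L.LR\<^esub> b)"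
    proof -
      have two: "[(2::nat)] \<cdot>\<^bsub>L.LR\<^esub> (q \<otimes>\<^bsub>L.LR\<^esub> r) = q \<otimes>\<^bsub>L.LR\<^esub> r \<oplus>\<^bsub>L.LR\<^esub> q \<otimes>\<^bsub>L.LR\<^esub> r"
        using qb ra by (simp add: numeral_eq_Suc Q.R.add.nat_pow_Suc)
      have "rEf.res (x f) = a \<odot>\<^bsub>LE.LM\<^esub> rEf.res (x g) \<oplus>\<^bsub>LE.LM\<^esub> r \<odot>\<^bsub>LE.LM\<^esub> \<one>\<^bsub>LE.LM\<^esub>"
        unfolding ra(3) lc_def using ra xgW by (simp add: QE.M.a_comm)
      moreover have "rf.res (z f) = b \<odot>\<^bsub>L.LM\<^esub> rf.res (z g) \<oplus>\<^bsub>L.LM\<^esub> q \<odot>\<^bsub>L.LM\<^esub> \<one>\<^bsub>L.LM\<^esub>"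
        unfolding qb(3) lc_def using qb bc zgW by (simp add: Q.M.a_comm)
      ultimately have "loc_res R W U (w f) = (a \<otimes>\<^bsub>L.LR\<^esub> b) \<odot>\<^bsub>LU.LM\<^esub> loc_res R W U (w g) \<oplus>\<^bsub>LU.LM\<^esub>
            ((q \<otimes>\<^bsub>L.LR\<^esub> ?t f \<oplus>\<^bsub>L.LR\<^esub> r \<otimes>\<^bsub>L.LR\<^esub> ?s f) \<ominus>\<^bsub>L.LR\<^esub> [(2::nat)] \<cdot>\<^bsub>L.LR\<^esub> (q \<otimes>\<^bsub>L.LR\<^esub> r)) \<odot>\<^bsub>LU.LM\<^esub> \<one>\<^bsub>LU.LM\<^esub>"
        using overlap[OF f g, unfolded Let_def, folded W_def] ra(1,2) qb(1) bc by blast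
      then show ?thesis
        unfolding two lc_def using ra qb bc cl wgW by (simp add: QU.M.a_comm)
    qed
    \<comment> \<open>Coordinates of w f relative to w g are unique, so the assumed ones are those
      that \<open>is_star\<close> prescribes for this transition.\<close>
    have c0a0: "c0 = (q \<otimes>\<^bsub>L.LR\<^esub> ?t f \<oplus>\<^bsub>L.LR\<^esub> r \<otimes>\<^bsub>L.LR\<^esub> ?s f) \<ominus>\<^bsub>L.LR\<^esub> (q \<otimes>\<^bsub>L.LR\<^esub> r \<oplus>\<^bsub>L.LR\<^esub> q \<otimes>\<^bsub>L.LR\<^esub> r)"
      "a0 = a \<otimes>\<^bsub>L.LR\<^esub> b"
      using QU.lc_inj[OF wgW(4) ca0 _ _ trans[OF w0[symmetric] w1]] ra qb bc cl by simp_all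
    have vf: "rf.res (v f) = lc L.LM (rf.res (z f)) (?C f \<otimes>\<^bsub>L.LR\<^esub> ?s f) (?D f)"
      unfolding v_def A_def using zf ca by (simp add: rf.res_lc rrf.res_mult)
    have vg: "rf.res (v g) = lc L.LM (rf.res (z g)) (?C g \<otimes>\<^bsub>L.LR\<^esub> ?s g) (?D g)"
      unfolding v_def A_def using zg ca by (simp add: rg.res_lc rrg.res_mult)
    have "rf.res (v f) = lc L.LM (rf.res (v g)) c0 a0"
      unfolding vf vg qb(3) using zgW cl qb(1) bc ca0 so[folded c0a0] by (simp add: Q.lc_lc)
    then show "loc_res R (powers R f <#> powers R g) (twist R M n) (v f) =
        lc (loc R (powers R f <#> powers R g) (twist R M n))
          (loc_res R (powers R f <#> powers R g) (twist R M n) (v g)) c0 a0"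
      by (simp add: W_def)
  qed blast+
  then show ?thesis by blast
qed

section \<open>Quotient modules\<close>

text \<open>Serves all quotients formed with \<open>quot\<close>: tensor products, exterior squares,
  reduction modulo 2 and 4, and the algebras R[x]/(x^2 - x + n).\<close>

locale quot_module = module R M for R (structure) and M (structure) +
  fixes H
  assumes sub: "submodule H R M"
begin

abbreviation "QM \<equiv> quot M H"

lemma H_sub: "abelian_subgroup H M"
  by (intro abelian_subgroupI3 additive_subgroup.intro submodule.axioms(1)[OF sub] M.abelian_group_axioms)

lemmas HE = submoduleE[OF sub]

lemma zero_in_H: "\<zero>\<^bsub>M\<^esub> \<in> H"
proof -
  obtain h where "h \<in> H" using HE(2) by blast
  then show ?thesis using HE(4)[OF R.zero_closed, of h] HE(1) by auto
qed

lemma coset_eq_iff: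
  assumes "x \<in> carrier M" "y \<in> carrier M"
  shows "H +>\<^bsub>M\<^esub> x = H +>\<^bsub>M\<^esub> y \<longleftrightarrow> x \<ominus>\<^bsub>M\<^esub> y \<in> H"
proof -
  interpret abelian_subgroup H M by (rule H_sub)
  have "x \<in> H +>\<^bsub>M\<^esub> y \<longleftrightarrow> x \<ominus>\<^bsub>M\<^esub> y \<in> H"
    using a_rcos_module[OF assms(2,1)] by (simp add: a_minus_def)
  moreover have "H +>\<^bsub>M\<^esub> x = H +>\<^bsub>M\<^esub> y \<longleftrightarrow> x \<in> H +>\<^bsub>M\<^esub> y"
    using a_rcos_self[OF assms(1)] M.a_repr_independence[of x H y] assms a_subgroup by auto
  ultimately show ?thesis by simp
qed

lemma coset_eq_zero_iff:
  assumes "x \<in> carrier M" shows "H +>\<^bsub>M\<^esub> x = H \<longleftrightarrow> x \<in> H"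
proof -
  interpret abelian_subgroup H M by (rule H_sub)
  have "H +>\<^bsub>M\<^esub> \<zero>\<^bsub>M\<^esub> = H" using a_subset M.a_coset_add_zero by blast
  moreover have "x \<ominus>\<^bsub>M\<^esub> \<zero>\<^bsub>M\<^esub> = x"
  proof -
    have "\<ominus>\<^bsub>M\<^esub> \<zero>\<^bsub>M\<^esub> = \<zero>\<^bsub>M\<^esub>" by (rule M.minus_equality) simp_all
    then show ?thesis unfolding a_minus_def using assms by (simp only: M.r_zero)
  qed
  ultimately show ?thesis using coset_eq_iff[OF assms M.zero_closed] by simp
qed

lemma quot_carrier: "carrier QM = {H +>\<^bsub>M\<^esub> x | x. x \<in> carrier M}"
  by (auto simp: quot_def A_RCOSETS_defs a_r_coset_def)

lemma quot_closed [simp]: "x \<in> carrier M \<Longrightarrow> H +>\<^bsub>M\<^esub> x \<in> carrier QM"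
  by (auto simp: quot_carrier)

lemma quot_cases:
  assumes "X \<in> carrier QM" obtains x where "x \<in> carrier M" "X = H +>\<^bsub>M\<^esub> x"
  using assms by (auto simp: quot_carrier)

lemma quot_zero: "\<zero>\<^bsub>QM\<^esub> = H +>\<^bsub>M\<^esub> \<zero>\<^bsub>M\<^esub>"
  using coset_eq_zero_iff[OF M.zero_closed] zero_in_H by (simp add: quot_def)

lemma quot_add:
  assumes "x \<in> carrier M" "y \<in> carrier M"
  shows "(H +>\<^bsub>M\<^esub> x) \<oplus>\<^bsub>QM\<^esub> (H +>\<^bsub>M\<^esub> y) = H +>\<^bsub>M\<^esub> (x \<oplus>\<^bsub>M\<^esub> y)"
  using abelian_subgroup.a_rcos_sum[OF H_sub assms] by (simp add: quot_def)

lemma coset_mem: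
  assumes "x \<in> carrier M" "y \<in> H +>\<^bsub>M\<^esub> x"
  shows "y \<in> carrier M" "H +>\<^bsub>M\<^esub> y = H +>\<^bsub>M\<^esub> x"
proof -
  interpret abelian_subgroup H M by (rule H_sub)
  show "y \<in> carrier M" using assms a_elemrcos_carrier M.abelian_group_axioms by blast
  show "H +>\<^bsub>M\<^esub> y = H +>\<^bsub>M\<^esub> x"
    using M.a_repr_independence[of y H x] assms a_subgroup by auto
qed

lemma coset_self: "x \<in> carrier M \<Longrightarrow> x \<in> H +>\<^bsub>M\<^esub> x"
  using abelian_subgroup.a_rcos_self[OF H_sub] .

lemma quot_smult:
  assumes "a \<in> carrier R" "x \<in> carrier M"
  shows "a \<odot>\<^bsub>QM\<^esub> (H +>\<^bsub>M\<^esub> x) = H +>\<^bsub>M\<^esub> (a \<odot>\<^bsub>M\<^esub> x)"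
proof -
  have "H +>\<^bsub>M\<^esub> (a \<odot>\<^bsub>M\<^esub> y) = H +>\<^bsub>M\<^esub> (a \<odot>\<^bsub>M\<^esub> x)" if y: "y \<in> H +>\<^bsub>M\<^esub> x" for y
  proof -
    note c = coset_mem[OF assms(2) y]
    have "y \<ominus>\<^bsub>M\<^esub> x \<in> H" using c coset_eq_iff[OF c(1) assms(2)] by simp
    then have "a \<odot>\<^bsub>M\<^esub> (y \<ominus>\<^bsub>M\<^esub> x) \<in> H" using HE(4) assms by blast
    then show ?thesis using c assms
      by (subst coset_eq_iff) (simp_all add: a_minus_def smult_r_distr smult_r_minus)
  qed
  then have "(\<Union>y\<in>H +>\<^bsub>M\<^esub> x. H +>\<^bsub>M\<^esub> (a \<odot>\<^bsub>M\<^esub> y)) = H +>\<^bsub>M\<^esub> (a \<odot>\<^bsub>M\<^esub> x)"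
    using coset_self[OF assms(2)] by blast
  then show ?thesis by (simp add: quot_def)
qed

lemma quot_is_module: "module R QM"
proof (rule moduleI[OF R.is_cring])
  show "abelian_group QM"
  proof (rule abelian_groupI)
    fix X assume "X \<in> carrier QM"
    then obtain x where x: "x \<in> carrier M" "X = H +>\<^bsub>M\<^esub> x" by (rule quot_cases)
    then show "\<exists>Y\<in>carrier QM. Y \<oplus>\<^bsub>QM\<^esub> X = \<zero>\<^bsub>QM\<^esub>"
      by (intro bexI[of _ "H +>\<^bsub>M\<^esub> (\<ominus>\<^bsub>M\<^esub> x)"]) (simp_all add: quot_add quot_zero M.l_neg)
  qed (auto elim!: quot_cases simp: quot_add quot_zero M.a_ac)
qed (auto elim!: quot_cases simp: quot_add quot_smult smult_l_distr smult_r_distr smult_assoc1)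

lemma quot_minus:
  assumes "x \<in> carrier M" shows "\<ominus>\<^bsub>QM\<^esub> (H +>\<^bsub>M\<^esub> x) = H +>\<^bsub>M\<^esub> (\<ominus>\<^bsub>M\<^esub> x)"
proof -
  interpret Q: module R QM by (rule quot_is_module)
  show ?thesis using assms
    by (intro Q.M.minus_equality) (simp_all add: quot_add quot_zero M.l_neg)
qed

end

section \<open>Artin--Schreier algebras\<close>

text \<open>Carries the ring axioms from \<open>FactRing\<close> to \<open>quot\<close>, which has
  the same ring operations and adds a scalar multiplication.\<close>

lemma ring_cong:
  assumes "ring S" "carrier T = carrier S" "mult T = mult S" "one T = one S" "zero T = zero S" "add T = add S"
  shows "ring T"
proof -
  interpret S: ring S by fact
  show ?thesis
  proof (rule ringI)
    show "abelian_group T"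
    proof (rule abelian_groupI)
      fix x assume "x \<in> carrier T"
      then show "\<exists>y\<in>carrier T. y \<oplus>\<^bsub>T\<^esub> x = \<zero>\<^bsub>T\<^esub>"
        unfolding assms(2-) by (intro bexI[of _ "\<ominus>\<^bsub>S\<^esub> x"]) (simp_all add: S.l_neg)
    qed (simp_all add: assms(2-) S.a_ac)
    show "Group.monoid T" by (rule monoidI) (simp_all add: assms(2-) S.m_assoc)
  qed (simp_all add: assms(2-) S.l_distr S.r_distr)
qed

text \<open>The free quadratic algebra with basis \<open>1, y\<close> and \<open>y\<^sup>2 = y - n\<close>, with \<open>a + by\<close> as \<open>[a, b]\<close>.\<close>

definition as_list :: "('a, 'r) ring_scheme \<Rightarrow> 'a \<Rightarrow> ('a, 'a list) module"
  where "as_list R n = \<lparr>carrier = {[a, b] | a b. a \<in> carrier R \<and> b \<in> carrier R},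
    mult = (\<lambda>X Y. [X ! 0 \<otimes>\<^bsub>R\<^esub> Y ! 0 \<ominus>\<^bsub>R\<^esub> X ! 1 \<otimes>\<^bsub>R\<^esub> Y ! 1 \<otimes>\<^bsub>R\<^esub> n,
      X ! 0 \<otimes>\<^bsub>R\<^esub> Y ! 1 \<oplus>\<^bsub>R\<^esub> X ! 1 \<otimes>\<^bsub>R\<^esub> Y ! 0 \<oplus>\<^bsub>R\<^esub> X ! 1 \<otimes>\<^bsub>R\<^esub> Y ! 1]),
    one = [\<one>\<^bsub>R\<^esub>, \<zero>\<^bsub>R\<^esub>], zero = [\<zero>\<^bsub>R\<^esub>, \<zero>\<^bsub>R\<^esub>],
    add = (\<lambda>X Y. [X ! 0 \<oplus>\<^bsub>R\<^esub> Y ! 0, X ! 1 \<oplus>\<^bsub>R\<^esub> Y ! 1]),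
    smult = (\<lambda>a X. [a \<otimes>\<^bsub>R\<^esub> X ! 0, a \<otimes>\<^bsub>R\<^esub> X ! 1])\<rparr>"

context cring
begin

lemma as_list_cring: 
  assumes n: "n \<in> carrier R" shows "cring (as_list R n)" "assoc_algebra R (as_list R n)"
proof -
  let ?E = "as_list R n"
  have ab: "abelian_group ?E"
  proof (rule abelian_groupI)
    fix X assume "X \<in> carrier ?E"
    then obtain a b where "a \<in> carrier R" "b \<in> carrier R" "X = [a, b]" by (auto simp: as_list_def)
    then show "\<exists>Y\<in>carrier ?E. Y \<oplus>\<^bsub>?E\<^esub> X = \<zero>\<^bsub>?E\<^esub>"
      by (intro bexI[of _ "[\<ominus> a, \<ominus> b]"]) (auto simp: as_list_def l_neg)
  qed (auto simp: as_list_def a_ac)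
  show cr: "cring ?E"
  proof (rule cringI[OF ab])
    show "comm_monoid ?E"
    proof (rule comm_monoidI)
      fix X Y Z assume "X \<in> carrier ?E" "Y \<in> carrier ?E" "Z \<in> carrier ?E"
      then obtain a b c d e f where *: "a \<in> carrier R" "b \<in> carrier R" "X = [a, b]"
        "c \<in> carrier R" "d \<in> carrier R" "Y = [c, d]" "e \<in> carrier R" "f \<in> carrier R" "Z = [e, f]"
        unfolding as_list_def by auto
      have "(a \<otimes> c \<ominus> b \<otimes> d \<otimes> n) \<otimes> e \<ominus> (a \<otimes> d \<oplus> b \<otimes> c \<oplus> b \<otimes> d) \<otimes> f \<otimes> n =
          a \<otimes> (c \<otimes> e \<ominus> d \<otimes> f \<otimes> n) \<ominus> b \<otimes> (c \<otimes> f \<oplus> d \<otimes> e \<oplus> d \<otimes> f) \<otimes> n"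
        "(a \<otimes> c \<ominus> b \<otimes> d \<otimes> n) \<otimes> f \<oplus> (a \<otimes> d \<oplus> b \<otimes> c \<oplus> b \<otimes> d) \<otimes> e \<oplus> (a \<otimes> d \<oplus> b \<otimes> c \<oplus> b \<otimes> d) \<otimes> f =
          a \<otimes> (c \<otimes> f \<oplus> d \<otimes> e \<oplus> d \<otimes> f) \<oplus> b \<otimes> (c \<otimes> e \<ominus> d \<otimes> f \<otimes> n) \<oplus> b \<otimes> (c \<otimes> f \<oplus> d \<otimes> e \<oplus> d \<otimes> f)"
        using *(1,2,4,5,7,8) n by algebra+
      then show "X \<otimes>\<^bsub>?E\<^esub> Y \<otimes>\<^bsub>?E\<^esub> Z = X \<otimes>\<^bsub>?E\<^esub> (Y \<otimes>\<^bsub>?E\<^esub> Z)"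
        unfolding *(3,6,9) by (simp add: as_list_def)
    qed (use n in \<open>auto simp: as_list_def m_comm a_ac a_minus_def\<close>)
    fix X Y Z assume "X \<in> carrier ?E" "Y \<in> carrier ?E" "Z \<in> carrier ?E"
    then obtain a b c d e f where *: "a \<in> carrier R" "b \<in> carrier R" "X = [a, b]"
        "c \<in> carrier R" "d \<in> carrier R" "Y = [c, d]" "e \<in> carrier R" "f \<in> carrier R" "Z = [e, f]"
      unfolding as_list_def by auto
    have "(a \<oplus> c) \<otimes> e \<ominus> (b \<oplus> d) \<otimes> f \<otimes> n = (a \<otimes> e \<ominus> b \<otimes> f \<otimes> n) \<oplus> (c \<otimes> e \<ominus> d \<otimes> f \<otimes> n)"
      "(a \<oplus> c) \<otimes> f \<oplus> (b \<oplus> d) \<otimes> e \<oplus> (b \<oplus> d) \<otimes> f =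
        (a \<otimes> f \<oplus> b \<otimes> e \<oplus> b \<otimes> f) \<oplus> (c \<otimes> f \<oplus> d \<otimes> e \<oplus> d \<otimes> f)"
      using *(1,2,4,5,7,8) n by algebra+
    then show "(X \<oplus>\<^bsub>?E\<^esub> Y) \<otimes>\<^bsub>?E\<^esub> Z = X \<otimes>\<^bsub>?E\<^esub> Z \<oplus>\<^bsub>?E\<^esub> Y \<otimes>\<^bsub>?E\<^esub> Z"
      unfolding *(3,6,9) by (simp add: as_list_def)
  qed
  interpret E: cring ?E by (rule cr)
  show "assoc_algebra R ?E"
  proof (intro assoc_algebra.intro assoc_algebra_axioms.intro E.ring_axioms)
    show "module R ?E"
      by (rule moduleI[OF is_cring ab]) (auto simp: as_list_def l_distr r_distr m_assoc)
    fix r X Y assume r: "r \<in> carrier R" and XY: "X \<in> carrier ?E" "Y \<in> carrier ?E"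
    have l: "(r \<odot>\<^bsub>?E\<^esub> X) \<otimes>\<^bsub>?E\<^esub> Y = r \<odot>\<^bsub>?E\<^esub> (X \<otimes>\<^bsub>?E\<^esub> Y)" if XY: "X \<in> carrier ?E" "Y \<in> carrier ?E" for X Y
    proof -
      obtain a b c d where *: "a \<in> carrier R" "b \<in> carrier R" "X = [a, b]"
        "c \<in> carrier R" "d \<in> carrier R" "Y = [c, d]" using XY unfolding as_list_def by auto
      have "r \<otimes> a \<otimes> c \<ominus> r \<otimes> b \<otimes> d \<otimes> n = r \<otimes> (a \<otimes> c \<ominus> b \<otimes> d \<otimes> n)"
        "r \<otimes> a \<otimes> d \<oplus> r \<otimes> b \<otimes> c \<oplus> r \<otimes> b \<otimes> d = r \<otimes> (a \<otimes> d \<oplus> b \<otimes> c \<oplus> b \<otimes> d)"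
        using *(1,2,4,5) n r by algebra+
      then show ?thesis unfolding *(3,6) by (simp add: as_list_def)
    qed
    then show "(r \<odot>\<^bsub>?E\<^esub> X) \<otimes>\<^bsub>?E\<^esub> Y = r \<odot>\<^bsub>?E\<^esub> (X \<otimes>\<^bsub>?E\<^esub> Y)" using XY by blast
    have "r \<odot>\<^bsub>?E\<^esub> Y \<in> carrier ?E" using r XY(2) by (auto simp: as_list_def)
    then show "X \<otimes>\<^bsub>?E\<^esub> (r \<odot>\<^bsub>?E\<^esub> Y) = r \<odot>\<^bsub>?E\<^esub> (X \<otimes>\<^bsub>?E\<^esub> Y)"
      using l[OF XY(2,1)] XY E.m_comm[of X Y] E.m_comm[of X "r \<odot>\<^bsub>?E\<^esub> Y"] by simp
  qed
qed

lemma as_list_gen: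
  assumes n: "n \<in> carrier R" shows "quad_gen R (as_list R n) [\<zero>, \<one>] \<one> n"
proof -
  interpret E: quad_context R "as_list R n" by (rule quad_context.intro) (rule as_list_cring[OF n])
  have l: "lc (as_list R n) [\<zero>, \<one>] a b = [a, b]" if "a \<in> carrier R" "b \<in> carrier R" for a b
    using that by (simp add: lc_def as_list_def)
  have "qbasis R (as_list R n) [\<zero>, \<one>]"
    unfolding qbasis_def using l by (auto simp: as_list_def)
  moreover have "[\<zero>, \<one>] \<otimes>\<^bsub>as_list R n\<^esub> [\<zero>, \<one>] = [\<ominus> n, \<one>]"
    using n by (simp add: as_list_def a_minus_def)
  ultimately show ?thesis using n l by (simp add: E.quad_gen_iff)
qed

text \<open>Reducing x^2 to x - n shows that 1, x span the quotient. Independence is seen from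
  outside: evaluation at the generator y of \<open>as_list R n\<close> kills x^2 - x + n, and 1, y
  are independent there.\<close>

lemma as_algebra_gen:
  assumes n: "n \<in> carrier R"
  shows "assoc_algebra R (as_algebra R n)" "\<exists>x. quad_gen R (as_algebra R n) x \<one> n"
proof -
  define P where "P = UP R"
  interpret P: UP_cring R P by (rule UP_cring.intro[OF is_cring]) (simp add: P_def)
  define x where "x = monom P \<one> 1"
  have x: "x \<in> carrier P" by (simp add: x_def)
  define g where "g = x \<otimes>\<^bsub>P\<^esub> x \<ominus>\<^bsub>P\<^esub> x \<oplus>\<^bsub>P\<^esub> monom P n 0"
  have g: "g \<in> carrier P" using x n by (simp add: g_def)
  define I where "I = PIdl\<^bsub>P\<^esub> g"
  interpret I: ideal I P unfolding I_def by (rule P.P.cgenideal_ideal[OF g])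
  have Adef: "as_algebra R n = quot P I"
    by (simp add: as_algebra_def I_def g_def x_def P_def Let_def)
  have Pm: "module R P" by (rule P.module)
  have sub: "submodule I R P"
  proof (rule module.submoduleI[OF Pm])
    fix a p assume a: "a \<in> carrier R" "p \<in> I"
    then have "monom P a 0 \<otimes>\<^bsub>P\<^esub> p \<in> I" by (intro I.I_l_closed) simp_all
    then show "a \<odot>\<^bsub>P\<^esub> p \<in> I" using a by (simp add: P.monom_mult_is_smult)
  qed auto
  interpret Q: quot_module R P I by (rule quot_module.intro[OF Pm]) (rule quot_module_axioms.intro[OF sub])
  have qm: "(I +>\<^bsub>P\<^esub> p) \<otimes>\<^bsub>Q.QM\<^esub> (I +>\<^bsub>P\<^esub> q) = I +>\<^bsub>P\<^esub> (p \<otimes>\<^bsub>P\<^esub> q)" if "p \<in> carrier P" "q \<in> carrier P" for p q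
    using I.rcoset_mult_add[OF that] by (simp add: quot_def)
  have q1: "\<one>\<^bsub>Q.QM\<^esub> = I +>\<^bsub>P\<^esub> \<one>\<^bsub>P\<^esub>" by (simp add: quot_def)
  have rg: "ring Q.QM"
    by (rule ring_cong[OF I.quotient_is_ring]) (simp_all add: quot_def FactRing_def)
  have aa: "assoc_algebra R Q.QM"
  proof (intro assoc_algebra.intro assoc_algebra_axioms.intro rg Q.quot_is_module)
    fix a X Y assume a: "a \<in> carrier R" and "X \<in> carrier Q.QM" "Y \<in> carrier Q.QM"
    then obtain p q where pq: "p \<in> carrier P" "X = I +>\<^bsub>P\<^esub> p" "q \<in> carrier P" "Y = I +>\<^bsub>P\<^esub> q"
      by (auto elim!: Q.quot_cases)
    have "p \<otimes>\<^bsub>P\<^esub> (a \<odot>\<^bsub>P\<^esub> q) = a \<odot>\<^bsub>P\<^esub> (p \<otimes>\<^bsub>P\<^esub> q)"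
      using a pq P.smult_assoc2[of a q p] P.P.m_comm[of p q] P.P.m_comm[of p "a \<odot>\<^bsub>P\<^esub> q"] by simp
    then show "a \<odot>\<^bsub>Q.QM\<^esub> X \<otimes>\<^bsub>Q.QM\<^esub> Y = a \<odot>\<^bsub>Q.QM\<^esub> (X \<otimes>\<^bsub>Q.QM\<^esub> Y)"
      "X \<otimes>\<^bsub>Q.QM\<^esub> (a \<odot>\<^bsub>Q.QM\<^esub> Y) = a \<odot>\<^bsub>Q.QM\<^esub> (X \<otimes>\<^bsub>Q.QM\<^esub> Y)"
      using a pq by (simp_all add: Q.quot_smult qm P.smult_assoc2)
  qed
  then show "assoc_algebra R (as_algebra R n)" by (simp add: Adef)
  interpret A: quad_context R Q.QM by (rule quad_context.intro[OF aa])
  define X where "X = I +>\<^bsub>P\<^esub> x"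
  have X: "X \<in> carrier Q.QM" using x by (simp add: X_def)
  have lX: "lc Q.QM X a b = I +>\<^bsub>P\<^esub> (monom P a 0 \<oplus>\<^bsub>P\<^esub> b \<odot>\<^bsub>P\<^esub> x)"
    if "a \<in> carrier R" "b \<in> carrier R" for a b
    using that x P.monom_mult_is_smult[of a "\<one>\<^bsub>P\<^esub>"]
    by (simp add: lc_def X_def q1 Q.quot_smult Q.quot_add)
  have XX: "X \<otimes>\<^bsub>Q.QM\<^esub> X = lc Q.QM X (\<ominus> n) \<one>"
  proof -
    have "x \<otimes>\<^bsub>P\<^esub> x \<ominus>\<^bsub>P\<^esub> (monom P (\<ominus> n) 0 \<oplus>\<^bsub>P\<^esub> x) = g"
      unfolding g_def using x n by (simp add: a_minus_def P.P.minus_add P.monom_a_inv P.P.a_ac)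
    moreover have "g \<in> I" unfolding I_def by (rule P.P.cgenideal_self[OF g])
    ultimately show ?thesis using x n unfolding X_def[symmetric] lX[OF a_inv_closed[OF n] one_closed]
      by (simp add: X_def qm Q.coset_eq_iff)
  qed
  \<comment> \<open>The span of 1 and x is closed under multiplication by x, so it contains every
    power.\<close>
  have pw: "\<exists>a\<in>carrier R. \<exists>b\<in>carrier R. I +>\<^bsub>P\<^esub> monom P \<one> k = lc Q.QM X a b" for k
  proof (induction k)
    case 0
    have "I +>\<^bsub>P\<^esub> monom P \<one> 0 = lc Q.QM X \<one> \<zero>" using x by (simp add: lX)
    then show ?case by blast
  next
    case (Suc k)
    then obtain a b where ab: "a \<in> carrier R" "b \<in> carrier R" "I +>\<^bsub>P\<^esub> monom P \<one> k = lc Q.QM X a b" by blast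
    have "monom P \<one> (Suc k) = monom P \<one> k \<otimes>\<^bsub>P\<^esub> x"
      using P.monom_mult[of \<one> \<one> k 1] by (simp add: x_def)
    then have "I +>\<^bsub>P\<^esub> monom P \<one> (Suc k) = lc Q.QM X a b \<otimes>\<^bsub>Q.QM\<^esub> lc Q.QM X \<zero> \<one>"
      using x by (simp add: qm[symmetric] ab(3) A.lc_gen X X_def[symmetric])
    also have "\<dots> = lc Q.QM X (a \<otimes> \<zero> \<ominus> b \<otimes> \<one> \<otimes> n) (a \<otimes> \<one> \<oplus> b \<otimes> \<zero> \<oplus> b \<otimes> \<one> \<otimes> \<one>)"
      using ab n by (intro A.lc_mult[OF X _ _ XX]) auto
    finally show ?case using ab n by blast
  qed
  have span: "\<exists>a\<in>carrier R. \<exists>b\<in>carrier R. I +>\<^bsub>P\<^esub> p = lc Q.QM X a b" if p: "p \<in> carrier P" for p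
  proof -
    have cl: "UnivPoly.coeff P p i \<in> carrier R" for i using p by simp
    have mono: "\<exists>a\<in>carrier R. \<exists>b\<in>carrier R. I +>\<^bsub>P\<^esub> monom P c k = lc Q.QM X a b" if c: "c \<in> carrier R" for c k
    proof -
      obtain a b where ab: "a \<in> carrier R" "b \<in> carrier R" "I +>\<^bsub>P\<^esub> monom P \<one> k = lc Q.QM X a b" using pw by blast
      have "I +>\<^bsub>P\<^esub> monom P c k = c \<odot>\<^bsub>Q.QM\<^esub> (I +>\<^bsub>P\<^esub> monom P \<one> k)"
        using c P.monom_mult_smult[of c \<one> k] by (simp add: Q.quot_smult)
      also have "\<dots> = lc Q.QM X (c \<otimes> a) (c \<otimes> b)" unfolding ab(3) using ab c X by (simp add: A.lc_smult)
      finally show ?thesis using ab c by blast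
    qed
    have "\<exists>a\<in>carrier R. \<exists>b\<in>carrier R.
        I +>\<^bsub>P\<^esub> (\<Oplus>\<^bsub>P\<^esub>i\<in>{..k}. monom P (UnivPoly.coeff P p i) i) = lc Q.QM X a b" for k :: nat
    proof (induction k)
      case 0
      then show ?case using mono[OF cl] cl by simp
    next
      case (Suc k)
      obtain a b where ab: "a \<in> carrier R" "b \<in> carrier R"
        "I +>\<^bsub>P\<^esub> (\<Oplus>\<^bsub>P\<^esub>i\<in>{..k}. monom P (UnivPoly.coeff P p i) i) = lc Q.QM X a b" using Suc by blast
      obtain c d where cd: "c \<in> carrier R" "d \<in> carrier R"
        "I +>\<^bsub>P\<^esub> monom P (UnivPoly.coeff P p (Suc k)) (Suc k) = lc Q.QM X c d" using mono[OF cl] by blast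
      have "I +>\<^bsub>P\<^esub> (\<Oplus>\<^bsub>P\<^esub>i\<in>{..Suc k}. monom P (UnivPoly.coeff P p i) i) =
          (I +>\<^bsub>P\<^esub> monom P (UnivPoly.coeff P p (Suc k)) (Suc k)) \<oplus>\<^bsub>Q.QM\<^esub>
          (I +>\<^bsub>P\<^esub> (\<Oplus>\<^bsub>P\<^esub>i\<in>{..k}. monom P (UnivPoly.coeff P p i) i))"
        using cl by (subst Q.quot_add) (auto simp: Pi_def intro!: P.P.finsum_closed)
      also have "\<dots> = lc Q.QM X (c \<oplus> a) (d \<oplus> b)"
        unfolding ab(3) cd(3) using ab cd X by (simp add: A.lc_add)
      finally show ?case using ab cd by blast
    qed
    from this[of "deg R p"] show ?thesis using P.up_repr[OF p] by simp
  qed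
  have indep: "a = \<zero> \<and> b = \<zero>"
    if ab: "a \<in> carrier R" "b \<in> carrier R" "lc Q.QM X a b = \<zero>\<^bsub>Q.QM\<^esub>" for a b
  proof -
    let ?E = "as_list R n"
    interpret E: quad_context R ?E by (rule quad_context.intro) (rule as_list_cring[OF n])
    interpret Ec: cring ?E by (rule as_list_cring[OF n])
    note y = E.quad_genD[OF as_list_gen[OF n]]
    \<comment> \<open>The structure map of \<open>as_list R n\<close>, along which polynomials are
      evaluated at y.\<close>
    define h where "h r = r \<odot>\<^bsub>?E\<^esub> \<one>\<^bsub>?E\<^esub>" for r
    have h: "ring_hom_cring R ?E h"
      by (rule ring_hom_cringI[OF is_cring Ec.is_cring])
        (auto intro!: ring_hom_memI simp: h_def E.smult_l_distr E.smult_mult_left E.smult_assoc1)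
    interpret U: UP_univ_prop R ?E h P "[\<zero>, \<one>]" "eval R ?E h [\<zero>, \<one>]"
      by (intro UP_univ_prop.intro UP_pre_univ_prop.intro h P.UP_cring_axioms
          UP_univ_prop_axioms.intro y(1)) (simp_all add: P_def)
    let ?ev = "eval R ?E h [\<zero>, \<one>]"
    have evx: "?ev x = [\<zero>, \<one>]" unfolding x_def by (rule U.eval_monom1[OF y(1)])
    have evc: "?ev (monom P r 0) = h r" if "r \<in> carrier R" for r by (rule U.eval_const[OF y(1) that])
    have hm: "h r \<in> carrier ?E" if "r \<in> carrier R" for r using that by (simp add: h_def)
    have "?ev g = [\<zero>, \<one>] \<otimes>\<^bsub>?E\<^esub> [\<zero>, \<one>] \<ominus>\<^bsub>?E\<^esub> [\<zero>, \<one>] \<oplus>\<^bsub>?E\<^esub> h n"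
      unfolding g_def using x n by (simp add: evx evc a_minus_def)
    also have "\<dots> = \<zero>\<^bsub>?E\<^esub>"
    proof -
      have "lc ?E [\<zero>, \<one>] (\<ominus> n) \<one> = \<ominus>\<^bsub>?E\<^esub> h n \<oplus>\<^bsub>?E\<^esub> [\<zero>, \<one>]"
        using n y(1) by (simp add: lc_def h_def E.smult_l_minus)
      then show ?thesis unfolding y(5) using hm[OF n] y(1) by (simp add: a_minus_def E.M.a_ac E.M.r_neg E.M.r_neg2 E.M.l_neg)
    qed
    finally have evg: "?ev g = \<zero>\<^bsub>?E\<^esub>" .
    \<comment> \<open>A relation between 1 and x in the quotient is a multiple of g, and evaluation
      turns it into a relation between 1 and y.\<close>
    have "monom P a 0 \<oplus>\<^bsub>P\<^esub> b \<odot>\<^bsub>P\<^esub> x \<in> I"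
      using ab x unfolding lX[OF ab(1,2)] by (simp add: quot_def Q.coset_eq_zero_iff[simplified])
    then obtain p where p: "p \<in> carrier P" "monom P a 0 \<oplus>\<^bsub>P\<^esub> b \<odot>\<^bsub>P\<^esub> x = p \<otimes>\<^bsub>P\<^esub> g"
      unfolding I_def cgenideal_def by blast
    have "?ev (p \<otimes>\<^bsub>P\<^esub> g) = \<zero>\<^bsub>?E\<^esub>" using p(1) g by (simp add: evg)
    moreover have "?ev (monom P a 0 \<oplus>\<^bsub>P\<^esub> b \<odot>\<^bsub>P\<^esub> x) = lc ?E [\<zero>, \<one>] a b"
      using ab x y(1) by (simp add: evc U.Eval_smult evx lc_def h_def E.smult_mult_left)
    ultimately have "lc ?E [\<zero>, \<one>] a b = \<zero>\<^bsub>?E\<^esub>" using p(2) by simp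
    then show ?thesis using y(4) ab unfolding qbasis_def by blast
  qed
  have "qbasis R Q.QM X"
    unfolding qbasis_def using X span indep by (auto elim!: Q.quot_cases)
  then have "quad_gen R Q.QM X \<one> n" using n XX by (simp add: A.quad_gen_iff)
  then show "\<exists>x. quad_gen R (as_algebra R n) x \<one> n" unfolding Adef by blast
qed

end

section \<open>Isomorphism classes\<close>

lemma alg_iso_id: "assoc_algebra R S \<Longrightarrow> id \<in> alg_iso R S S"
  by (auto simp: alg_iso_def ring_iso_def ring_hom_def mod_hom_def)

lemma alg_iso_comp:
  assumes f: "f \<in> alg_iso R S T" and g: "g \<in> alg_iso R T U" shows "g \<circ> f \<in> alg_iso R S U"
  using alg_isoD[OF f] alg_isoD[OF g] bij_betw_trans[OF alg_isoD(6)[OF f] alg_isoD(6)[OF g]]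
  by (auto simp: alg_iso_def ring_iso_def ring_hom_def mod_hom_def)

lemma alg_iso_inv:
  assumes "assoc_algebra R S" and f: "f \<in> alg_iso R S T"
  shows "inv_into (carrier S) f \<in> alg_iso R T S"
proof -
  interpret S: assoc_algebra R S by fact
  note fd = alg_isoD[OF f]
  define g where "g = inv_into (carrier S) f"
  have fg: "g y \<in> carrier S" "f (g y) = y" if "y \<in> carrier T" for y
    using that fd(6) by (auto simp: g_def bij_betw_def inv_into_into f_inv_into_f)
  have gf: "g (f x) = x" if "x \<in> carrier S" for x
    using that fd(6) by (auto simp: g_def bij_betw_def)
  have 1: "g (y \<oplus>\<^bsub>T\<^esub> z) = g y \<oplus>\<^bsub>S\<^esub> g z" "g (y \<otimes>\<^bsub>T\<^esub> z) = g y \<otimes>\<^bsub>S\<^esub> g z"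
    if "y \<in> carrier T" "z \<in> carrier T" for y z
    using gf[of "g y \<oplus>\<^bsub>S\<^esub> g z"] gf[of "g y \<otimes>\<^bsub>S\<^esub> g z"] fg that by (simp_all add: fd)
  have 2: "g (a \<odot>\<^bsub>T\<^esub> y) = a \<odot>\<^bsub>S\<^esub> g y" if "a \<in> carrier R" "y \<in> carrier T" for a y
    using gf[of "a \<odot>\<^bsub>S\<^esub> g y"] fg that by (simp add: fd)
  have 3: "g \<one>\<^bsub>T\<^esub> = \<one>\<^bsub>S\<^esub>" using gf[of "\<one>\<^bsub>S\<^esub>"] by (simp add: fd(5))
  have 4: "bij_betw g (carrier T) (carrier S)" unfolding g_def by (rule bij_betw_inv_into[OF fd(6)])
  show ?thesis
    unfolding g_def[symmetric] using 1 2 3 4 fg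
    by (auto simp: alg_iso_def ring_iso_def ring_hom_def mod_hom_def)
qed

lemma quad_gen_transport:
  assumes S: "assoc_algebra R S" and T: "assoc_algebra R T" and f: "f \<in> alg_iso R S T"
    and q: "quad_gen R S x t n"
  shows "quad_gen R T (f x) t n"
proof -
  interpret S: quad_context R S by (rule quad_context.intro[OF S])
  interpret T: quad_context R T by (rule quad_context.intro[OF T])
  note fd = alg_isoD[OF f] and x = S.quad_genD[OF q]
  have lc: "f (lc S x a b) = lc T (f x) a b" if "a \<in> carrier R" "b \<in> carrier R" for a b
    using that x(1) by (simp add: lc_def fd)
  have f0: "f \<zero>\<^bsub>S\<^esub> = \<zero>\<^bsub>T\<^esub>" using lc[of "\<zero>\<^bsub>R\<^esub>" "\<zero>\<^bsub>R\<^esub>"] x(1) fd(1) by (simp add: S.lc_zero T.lc_zero)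
  have "qbasis R T (f x)"
    unfolding qbasis_def
  proof (intro conjI ballI impI)
    fix y assume "y \<in> carrier T"
    then obtain z where z: "z \<in> carrier S" "y = f z" using fd(6) by (auto simp: bij_betw_def)
    obtain a b where "a \<in> carrier R" "b \<in> carrier R" "z = lc S x a b" using z(1) by (rule S.lc_cases[OF x(4)])
    then show "\<exists>a\<in>carrier R. \<exists>b\<in>carrier R. y = lc T (f x) a b" using z lc by blast
  next
    fix a b assume ab: "a \<in> carrier R" "b \<in> carrier R" "lc T (f x) a b = \<zero>\<^bsub>T\<^esub>"
    have "f (lc S x a b) = f \<zero>\<^bsub>S\<^esub>" using ab lc f0 by simp
    then have "lc S x a b = \<zero>\<^bsub>S\<^esub>"
      using fd(6) ab x(1) by (auto simp: bij_betw_def dest: inj_onD)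
    then have "a = \<zero>\<^bsub>R\<^esub> \<and> b = \<zero>\<^bsub>R\<^esub>" using x(4) ab unfolding qbasis_def by blast
    then show "a = \<zero>\<^bsub>R\<^esub>" "b = \<zero>\<^bsub>R\<^esub>" by simp_all
  qed (use x(1) fd(1) in simp)
  moreover have "f x \<otimes>\<^bsub>T\<^esub> f x = lc T (f x) (\<ominus>\<^bsub>R\<^esub> n) t"
    using fd(2)[OF x(1,1)] x(5) lc[of "\<ominus>\<^bsub>R\<^esub> n" t] x(2,3) by simp
  ultimately show ?thesis using x by (simp add: T.quad_gen_iff)
qed

lemma mem_quad_class: "T \<in> quad_class R S \<longleftrightarrow> quadratic R T \<and> alg_iso R S T \<noteq> {}"
  by (simp add: quad_class_def quadratic_iff)

lemma quadratic_assoc: "quadratic R S \<Longrightarrow> assoc_algebra R S"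
  by (simp add: quadratic_def quad_context_def)

lemma quad_class_self: "quadratic R S \<Longrightarrow> S \<in> quad_class R S"
  using alg_iso_id[OF quadratic_assoc] by (auto simp: mem_quad_class)

lemma quad_class_eq:
  assumes S: "assoc_algebra R S" and f: "f \<in> alg_iso R S T"
  shows "quad_class R S = quad_class R T"
  using alg_iso_comp[OF f] alg_iso_comp[OF alg_iso_inv[OF S f]]
  unfolding set_eq_iff mem_quad_class by blast

lemma Quad_cases:
  assumes "P \<in> Quad R" obtains T where "quadratic R T" "T \<in> P" "P = quad_class R T"
  using assms unfolding Quad_def quadratic_iff[symmetric] using quad_class_self by blast

lemma Quad_mem:
  fixes R :: "('a, 'r) ring_scheme"
  assumes "P \<in> Quad R" "T \<in> P" shows "quadratic R T" "P = quad_class R T"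
proof -
  obtain S :: "('a, 'a list) module" where S: "quadratic R S" "P = quad_class R S"
    using assms(1) by (rule Quad_cases)
  then have T: "quadratic R T" "alg_iso R S T \<noteq> {}" using assms(2) by (auto simp: mem_quad_class)
  then show "quadratic R T" "P = quad_class R T"
    using S quad_class_eq[OF quadratic_assoc[OF S(1)]] by blast+
qed

section \<open>The Artin--Schreier group\<close>

context cring
begin

lemma torsion4_subgroup: "subgroup (torsion4 R) (add_monoid R)"
proof (rule add.subgroupI)
  have "\<zero> \<in> torsion4 R" by (simp add: torsion4_iff)
  then show "torsion4 R \<noteq> {}" by blast
next
  fix a assume "a \<in> torsion4 R"
  then have a: "a \<in> carrier R" "a \<oplus> a \<oplus> a \<oplus> a = \<zero>" by (simp_all add: torsion4_iff)
  have "\<ominus> a \<oplus> \<ominus> a \<oplus> \<ominus> a \<oplus> \<ominus> a = \<ominus> (a \<oplus> a \<oplus> a \<oplus> a)" using a(1) by algebra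
  then show "\<ominus> a \<in> torsion4 R" using a by (simp add: torsion4_iff)
next
  fix a b assume "a \<in> torsion4 R" "b \<in> torsion4 R"
  then have a: "a \<in> carrier R" "a \<oplus> a \<oplus> a \<oplus> a = \<zero>" "b \<in> carrier R" "b \<oplus> b \<oplus> b \<oplus> b = \<zero>"
    by (simp_all add: torsion4_iff)
  have "(a \<oplus> b) \<oplus> (a \<oplus> b) \<oplus> (a \<oplus> b) \<oplus> (a \<oplus> b) = (a \<oplus> a \<oplus> a \<oplus> a) \<oplus> (b \<oplus> b \<oplus> b \<oplus> b)"
    using a(1,3) by algebra
  then show "a \<oplus> b \<in> torsion4 R" using a by (simp add: torsion4_iff)
qed (auto simp: torsion4_iff)

lemma torsion4_closed:
  shows "a \<in> torsion4 R \<Longrightarrow> a \<in> carrier R"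
    and "a \<in> torsion4 R \<Longrightarrow> b \<in> torsion4 R \<Longrightarrow> a \<oplus> b \<in> torsion4 R"
    and "a \<in> torsion4 R \<Longrightarrow> \<ominus> a \<in> torsion4 R"
    and "\<zero> \<in> torsion4 R"
proof -
  interpret T: subgroup "torsion4 R" "add_monoid R" by (rule torsion4_subgroup)
  show "a \<in> torsion4 R \<Longrightarrow> a \<in> carrier R" by (simp add: torsion4_iff)
  show "a \<in> torsion4 R \<Longrightarrow> b \<in> torsion4 R \<Longrightarrow> a \<oplus> b \<in> torsion4 R" using T.m_closed by simp
  show "a \<in> torsion4 R \<Longrightarrow> \<ominus> a \<in> torsion4 R" using T.m_inv_closed by (simp add: a_inv_def)
  show "\<zero> \<in> torsion4 R" using T.one_closed by simp
qed

text \<open>\<open>r\<close> corresponds to the automorphism \<open>y \<mapsto> (1 + 2r)y - r\<close>, where \<open>(1 + 2r)\<^sup>2 = 1\<close>; composing two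
  of them gives the sum and solving \<open>r + s + 2rs = 0\<close> the inverse.\<close>

lemma wp4_add:
  assumes "r \<in> carrier R" "s \<in> carrier R" "r \<oplus> r \<otimes> r \<in> torsion4 R"
  shows "(r \<oplus> s \<oplus> (r \<otimes> s \<oplus> r \<otimes> s)) \<oplus> (r \<oplus> s \<oplus> (r \<otimes> s \<oplus> r \<otimes> s)) \<otimes> (r \<oplus> s \<oplus> (r \<otimes> s \<oplus> r \<otimes> s)) =
    (r \<oplus> r \<otimes> r) \<oplus> (s \<oplus> s \<otimes> s)"
proof -
  define e where "e = r \<otimes> s"
  have e: "e \<in> carrier R" using assms by (simp add: e_def)
  have four: "(r \<oplus> r \<otimes> r) \<oplus> (r \<oplus> r \<otimes> r) \<oplus> (r \<oplus> r \<otimes> r) \<oplus> (r \<oplus> r \<otimes> r) = \<zero>"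
    using assms(3) by (simp add: torsion4_iff)
  define p where "p = r \<oplus> s"
  define X where "X = p \<otimes> e"
  define Y where "Y = e \<otimes> e"
  define c where "c = r \<oplus> r \<otimes> r"
  define d where "d = s \<oplus> s \<otimes> s"
  have cl: "p \<in> carrier R" "X \<in> carrier R" "Y \<in> carrier R" "c \<in> carrier R" "d \<in> carrier R"
    using e assms by (simp_all add: p_def X_def Y_def c_def d_def)
  have pp: "p \<otimes> p = r \<otimes> r \<oplus> s \<otimes> s \<oplus> (e \<oplus> e)"
    unfolding p_def e_def using assms(1,2) by (simp add: l_distr r_distr a_ac m_ac)
  have sq: "(p \<oplus> (e \<oplus> e)) \<otimes> (p \<oplus> (e \<oplus> e)) = p \<otimes> p \<oplus> (X \<oplus> X \<oplus> X \<oplus> X) \<oplus> (Y \<oplus> Y \<oplus> Y \<oplus> Y)"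
    unfolding X_def Y_def using e cl(1) by (simp add: l_distr r_distr a_ac m_ac)
  \<comment> \<open>This is rs(1 + r + s + rs) = r(1 + r)s(1 + s). All surplus terms together are
    four times this product, which vanishes because its factor c is killed by 4.\<close>
  have w: "e \<oplus> X \<oplus> Y = c \<otimes> d"
    unfolding X_def Y_def p_def e_def c_def d_def using assms(1,2) by (simp add: l_distr r_distr a_ac m_ac)
  have "(p \<oplus> (e \<oplus> e)) \<oplus> (p \<oplus> (e \<oplus> e)) \<otimes> (p \<oplus> (e \<oplus> e)) =
      c \<oplus> d \<oplus> ((e \<oplus> X \<oplus> Y) \<oplus> (e \<oplus> X \<oplus> Y) \<oplus> (e \<oplus> X \<oplus> Y) \<oplus> (e \<oplus> X \<oplus> Y))"
    unfolding sq pp c_def d_def using e cl(2,3) assms(1,2) by (simp add: p_def a_ac)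
  also have "\<dots> = c \<oplus> d \<oplus> (c \<oplus> c \<oplus> c \<oplus> c) \<otimes> d" unfolding w using cl(4,5) by (simp add: l_distr a_ac)
  also have "\<dots> = c \<oplus> d" using four cl(4,5) by (simp add: c_def[symmetric])
  finally show ?thesis by (simp add: p_def e_def c_def d_def)
qed

text \<open>The witness is -r/(1 + 2r): the denominator is its own inverse, since (1 + 2r)^2 = 1 +
  4(r + r^2) = 1.\<close>

lemma wp4_neg:
  assumes "r \<in> carrier R" "r \<oplus> r \<otimes> r \<in> torsion4 R"
  shows "\<ominus> (r \<oplus> (r \<otimes> r \<oplus> r \<otimes> r)) \<oplus> \<ominus> (r \<oplus> (r \<otimes> r \<oplus> r \<otimes> r)) \<otimes> \<ominus> (r \<oplus> (r \<otimes> r \<oplus> r \<otimes> r)) =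
    \<ominus> (r \<oplus> r \<otimes> r)"
proof -
  define c where "c = r \<oplus> r \<otimes> r"
  have c: "c \<in> carrier R" "c \<oplus> c \<oplus> c \<oplus> c = \<zero>" using assms(2) by (simp_all add: torsion4_iff c_def)
  have 1: "r \<oplus> (r \<otimes> r \<oplus> r \<otimes> r) = c \<oplus> r \<otimes> r" unfolding c_def using assms(1) by algebra
  have "\<ominus> (c \<oplus> r \<otimes> r) \<oplus> \<ominus> (c \<oplus> r \<otimes> r) \<otimes> \<ominus> (c \<oplus> r \<otimes> r) =
      \<ominus> c \<oplus> ((c \<oplus> r \<otimes> r) \<otimes> (c \<oplus> r \<otimes> r) \<ominus> r \<otimes> r)"
    using c(1) assms(1) by algebra
  also have "(c \<oplus> r \<otimes> r) \<otimes> (c \<oplus> r \<otimes> r) = r \<otimes> r \<oplus> (c \<oplus> c \<oplus> c \<oplus> c) \<otimes> (r \<otimes> r)"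
    unfolding c_def using assms(1) by (simp add: l_distr r_distr a_ac m_ac)
  also have "\<dots> \<ominus> r \<otimes> r = (c \<oplus> c \<oplus> c \<oplus> c) \<otimes> (r \<otimes> r)"
    unfolding c(2) using assms(1) by (simp add: a_minus_def r_neg)
  finally show ?thesis unfolding 1 c(2) c_def[symmetric] using c(1) assms(1) by simp
qed

abbreviation "T4 \<equiv> (add_monoid R)\<lparr>carrier := torsion4 R\<rparr>"

lemma T4_comm_group: "comm_group T4"
  by (intro group.group_comm_groupI add.subgroup_imp_group torsion4_subgroup)
    (auto simp: a_comm torsion4_closed(1))

lemma T4_inv: "a \<in> torsion4 R \<Longrightarrow> inv\<^bsub>T4\<^esub> a = \<ominus> a"
  using add.m_inv_consistent[OF torsion4_subgroup] by (simp add: a_inv_def)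

lemma wp4_normal: "wp4 R \<lhd> T4"
proof (rule comm_group.subgroup_imp_normal[OF T4_comm_group])
  interpret T: comm_group T4 by (rule T4_comm_group)
  show "subgroup (wp4 R) T4"
  proof (rule T.subgroupI)
    have "\<zero> = \<zero> \<oplus> \<zero> \<otimes> \<zero>" by simp
    then have "\<zero> \<in> wp4 R" using torsion4_closed(4) unfolding wp4_def by blast
    then show "wp4 R \<noteq> {}" by blast
  next
    fix a assume "a \<in> wp4 R"
    then obtain r where r: "r \<in> carrier R" "a = r \<oplus> r \<otimes> r" "a \<in> torsion4 R" by (auto simp: wp4_def)
    have "\<ominus> a \<in> wp4 R"
      unfolding wp4_def using torsion4_closed(3)[OF r(3)] wp4_neg[of r] r
      by (auto intro!: exI[of _ "\<ominus> (r \<oplus> (r \<otimes> r \<oplus> r \<otimes> r))"])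
    then show "inv\<^bsub>T4\<^esub> a \<in> wp4 R" using T4_inv r by simp
  next
    fix a b assume "a \<in> wp4 R" "b \<in> wp4 R"
    then obtain r s where r: "r \<in> carrier R" "a = r \<oplus> r \<otimes> r" "a \<in> torsion4 R"
      and s: "s \<in> carrier R" "b = s \<oplus> s \<otimes> s" "b \<in> torsion4 R" by (auto simp: wp4_def)
    then have "a \<oplus> b \<in> wp4 R"
      unfolding wp4_def using torsion4_closed(2)[OF r(3) s(3)] wp4_add[of r s]
      by (auto intro!: exI[of _ "r \<oplus> s \<oplus> (r \<otimes> s \<oplus> r \<otimes> s)"])
    then show "a \<otimes>\<^bsub>T4\<^esub> b \<in> wp4 R" by simp
  qed (auto simp: wp4_def)
qed

lemma AS_group: "group (AS R)"
  unfolding AS_def by (rule normal.factorgroup_is_group[OF wp4_normal])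

lemma AS_carrier: "carrier (AS R) = {wp4 R +> a | a. a \<in> torsion4 R}"
  by (auto simp: AS_def FactGroup_def RCOSETS_def r_coset_def a_r_coset_def)

lemma AS_coset: "wp4 R +> a = {h \<oplus> a | h. h \<in> wp4 R}"
  by (auto simp: a_r_coset_def r_coset_def)

lemma AS_self: "a \<in> torsion4 R \<Longrightarrow> a \<in> wp4 R +> a"
proof -
  assume a: "a \<in> torsion4 R"
  have "\<zero> \<in> wp4 R" using subgroup.one_closed[OF normal_imp_subgroup[OF wp4_normal]] by simp
  then show ?thesis using a torsion4_closed(1)[OF a] unfolding AS_coset by force
qed

lemma AS_nonempty: "A \<in> carrier (AS R) \<Longrightarrow> \<exists>n. n \<in> A"
  using AS_self by (auto simp: AS_carrier)

lemma AS_mem: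
  assumes "A \<in> carrier (AS R)" "n \<in> A" shows "n \<in> torsion4 R"
proof -
  obtain a h where "a \<in> torsion4 R" "h \<in> wp4 R" "n = h \<oplus> a"
    using assms by (auto simp: AS_carrier AS_coset)
  then show ?thesis using torsion4_closed(2) by (auto simp: wp4_def)
qed

lemma AS_diff:
  assumes "A \<in> carrier (AS R)" "n \<in> A" "m \<in> A" shows "\<exists>h\<in>wp4 R. m = h \<oplus> n"
proof -
  interpret W: subgroup "wp4 R" T4 by (rule normal_imp_subgroup[OF wp4_normal])
  obtain a h k where *: "a \<in> torsion4 R" "h \<in> wp4 R" "k \<in> wp4 R" "n = h \<oplus> a" "m = k \<oplus> a"
    using assms by (auto simp: AS_carrier AS_coset)
  have t: "h \<in> torsion4 R" "k \<in> torsion4 R" using *(2,3) by (auto simp: wp4_def)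
  have "k \<oplus> \<ominus> h \<in> wp4 R" using W.m_closed[OF *(3) W.m_inv_closed[OF *(2)]] T4_inv[OF t(1)] by simp
  moreover have "m = (k \<oplus> \<ominus> h) \<oplus> n"
    unfolding *(4,5) using torsion4_closed(1)[OF *(1)] torsion4_closed(1)[OF t(1)] torsion4_closed(1)[OF t(2)] by algebra
  ultimately show ?thesis by blast
qed

lemma AS_mult_mem: "n \<in> A \<Longrightarrow> m \<in> B \<Longrightarrow> n \<oplus> m \<in> A \<otimes>\<^bsub>AS R\<^esub> B"
  by (auto simp: AS_def FactGroup_def set_mult_def)

lemma AS_one_mem: "\<zero> \<in> \<one>\<^bsub>AS R\<^esub>"
  using subgroup.one_closed[OF normal_imp_subgroup[OF wp4_normal]] by (simp add: AS_def FactGroup_def)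

end

section \<open>The action on classes\<close>

text \<open>Makes the choice of a representative harmless: a member of \<open>as_incl R A\<close>
  comes from some m in A, but has generators with norm n for every n in A.\<close>

lemma (in cring) as_incl_gen:
  assumes A: "A \<in> carrier (AS R)" and n: "n \<in> A" and S: "S \<in> as_incl R A"
  shows "assoc_algebra R S" "\<exists>y. quad_gen R S y \<one> n"
proof -
  obtain m where m: "m \<in> A" "S \<in> quad_class R (as_algebra R m)" using S by (auto simp: as_incl_def)
  then obtain f where f: "f \<in> alg_iso R (as_algebra R m) S" and Sq: "quadratic R S"
    by (auto simp: mem_quad_class)
  show Sa: "assoc_algebra R S" by (rule quadratic_assoc[OF Sq])
  interpret S: quad_context R S by (rule quad_context.intro[OF Sa])
  have mR: "m \<in> carrier R" and nR: "n \<in> carrier R" using AS_mem[OF A] m n torsion4_closed(1) by blast+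
  obtain x where "quad_gen R (as_algebra R m) x \<one> m" using as_algebra_gen(2)[OF mR] by blast
  from quad_gen_transport[OF as_algebra_gen(1)[OF mR] Sa f this]
  have q: "quad_gen R S (f x) \<one> m" .
  obtain h where h: "h \<in> wp4 R" "m = h \<oplus> n" using AS_diff[OF A n m(1)] by blast
  obtain r where r: "r \<in> carrier R" "h = r \<oplus> r \<otimes> r" "h \<in> torsion4 R" using h(1) by (auto simp: wp4_def)
  have hc: "h \<in> carrier R" "h \<oplus> h \<oplus> h \<oplus> h = \<zero>" using r(3) by (simp_all add: torsion4_iff)
  \<comment> \<open>With m - n = r + r^2, the generator ux - r has trace u - 2r = 1 and, as u^2 = 1,
    norm m - ur + r^2 = m - (r + r^2) = n.\<close>
  define u where "u = \<one> \<oplus> (r \<oplus> r)"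
  have u: "u \<in> carrier R" using r by (simp add: u_def)
  have "u \<otimes> u = \<one> \<oplus> (h \<oplus> h \<oplus> h \<oplus> h)" unfolding u_def r(2) using r(1) by algebra
  then have uu: "u \<otimes> u = \<one>" unfolding hc(2) by simp
  then have "u \<in> Units R" using u by (auto simp: Units_def)
  from S.quad_gen_change[OF q this a_inv_closed[OF r(1)]]
  have "quad_gen R S (lc S (f x) (\<ominus> r) u) (u \<otimes> \<one> \<oplus> (\<ominus> r \<oplus> \<ominus> r))
    (u \<otimes> u \<otimes> m \<oplus> u \<otimes> \<ominus> r \<otimes> \<one> \<oplus> \<ominus> r \<otimes> \<ominus> r)" .
  moreover have "u \<otimes> \<one> \<oplus> (\<ominus> r \<oplus> \<ominus> r) = \<one>" unfolding u_def using r(1) by algebra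
  moreover have "u \<otimes> u \<otimes> m \<oplus> u \<otimes> \<ominus> r \<otimes> \<one> \<oplus> \<ominus> r \<otimes> \<ominus> r = n"
    unfolding uu unfolding u_def h(2) r(2) using r(1) nR by algebra
  ultimately show "\<exists>y. quad_gen R S y \<one> n" by auto
qed

text \<open>Classes consist of algebras on lists, whereas \<open>as_algebra R n\<close> lives on
  cosets of polynomials. This provides an actual member of the class.\<close>

lemma (in cring) as_list_mem:
  assumes "n \<in> A" "n \<in> carrier R" shows "as_list R n \<in> as_incl R A"
proof -
  interpret E: quad_context R "as_list R n" by (rule quad_context.intro[OF as_list_cring(2)[OF assms(2)]])
  obtain x where x: "quad_gen R (as_algebra R n) x \<one> n" using as_algebra_gen(2)[OF assms(2)] by blast
  have "alg_iso R (as_algebra R n) (as_list R n) \<noteq> {}"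
    using quad_gen_iso[OF as_algebra_gen(1)[OF assms(2)] as_list_cring(2)[OF assms(2)] x as_list_gen[OF assms(2)]]
    by blast
  moreover have "quadratic R (as_list R n)" by (rule E.quad_gen_imp_quadratic[OF as_list_gen[OF assms(2)]])
  ultimately show ?thesis using assms(1) by (auto simp: as_incl_def mem_quad_class)
qed

text \<open>The left side mentions neither n nor T, so the class on the right does not depend on
  them. One inclusion is \<open>star_unique\<close>. For the other, an algebra that is merely
  isomorphic to the twist has to be exhibited as a product itself.\<close>

lemma (in cring) quad_star_eq:
  assumes A: "A \<in> carrier (AS R)" and n: "n \<in> A" and P: "P \<in> Quad R" and T: "T \<in> P"
  shows "quad_star R (as_incl R A) P = quad_class R (twist R T n)"
proof -
  have n4: "n \<in> torsion4 R" by (rule AS_mem[OF A n])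
  note nc = torsion4_closed(1)[OF n4] torsion4_closed(3)[OF n4] torsion4_closed(1)[OF torsion4_closed(3)[OF n4]]
  interpret T: quadratic R T by (rule Quad_mem(1)[OF P T])
  interpret Tn: quadratic R "twist R T n" by (rule T.twist_quadratic[OF nc(1)])
  have PT: "P = quad_class R T" by (rule Quad_mem(2)[OF P T])
  show ?thesis
  proof (intro subset_antisym subsetI)
    fix U assume "U \<in> quad_star R (as_incl R A) P"
    then obtain S T' where S: "S \<in> as_incl R A" and T': "T' \<in> P" and st: "is_star R S T' U"
      by (auto simp: quad_star_def)
    interpret T': quadratic R T' by (rule Quad_mem(1)[OF P T'])
    obtain y where "quad_gen R S y \<one> n" using as_incl_gen(2)[OF A n S] by blast
    then obtain f where f: "f \<in> alg_iso R U (twist R T' n)"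
      using T'.star_unique[OF as_incl_gen(1)[OF A n S] _ n4 st] by blast
    obtain g where g: "g \<in> alg_iso R T T'" using T' by (auto simp: PT mem_quad_class)
    have U: "quadratic R U" using st by (rule is_star_quadratic)
    have "inv_into (carrier U) f \<circ> g \<in> alg_iso R (twist R T n) U"
      by (rule alg_iso_comp[OF T.twist_iso[OF T'.quadratic_axioms g nc(1)] alg_iso_inv[OF quadratic_assoc[OF U] f]])
    then show "U \<in> quad_class R (twist R T n)" using U by (auto simp: mem_quad_class)
  next
    fix U assume "U \<in> quad_class R (twist R T n)"
    then obtain f where f: "f \<in> alg_iso R (twist R T n) U" and "quadratic R U" by (auto simp: mem_quad_class)
    then interpret U: quadratic R U by simp
    \<comment> \<open>Twisting back by -n: T' is isomorphic to T through the same map f, and its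
      twist by n is U on the nose, so \<open>star_twist\<close> presents U as a product.\<close>
    define T' where "T' = twist R U (\<ominus> n)"
    interpret T': quadratic R T' unfolding T'_def by (rule U.twist_quadratic[OF nc(3)])
    have "f \<in> alg_iso R (twist R (twist R T n) (\<ominus> n)) T'"
      unfolding T'_def by (rule Tn.twist_iso[OF U.quadratic_axioms f nc(3)])
    then have "f \<in> alg_iso R T T'" using nc by (simp add: T.twist_twist[OF n4 nc(2)] r_neg T.twist_zero)
    then have "T' \<in> P" using T'.quadratic_axioms by (auto simp: PT mem_quad_class)
    moreover have "twist R T' n = U"
      unfolding T'_def using nc by (simp add: U.twist_twist[OF nc(2) n4] l_neg U.twist_zero)
    then have "is_star R (as_list R n) T' U"
      using T'.star_twist[OF as_list_cring(2)[OF nc(1)] as_list_gen[OF nc(1)] n4] by simp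
    ultimately show "U \<in> quad_star R (as_incl R A) P"
      using as_list_mem[OF n nc(1)] by (auto simp: quad_star_def)
  qed
qed

section \<open>Discriminants of twists\<close>

lemma twist_tensor [simp]:
  "tensor R (twist R S n) (twist R S n) = tensor R S S"
  "pure_tensor R (twist R S n) (twist R S n) = pure_tensor R S S"
  by (simp_all add: tensor_def tensor_kernel_def tensor_rels_def pure_tensor_def fun_eq_iff)

lemma twist_ext2 [simp]: "ext2 R (twist R S n) = ext2 R S" "wedge R (twist R S n) = wedge R S"
  by (simp_all add: ext2_def ext2_kernel_def wedge_def fun_eq_iff)

text \<open>The predicates under the two \<open>THE\<close> coincide. The two correction terms in x
  \<sigma> y - (\<sigma> x) y cancel, this element has the form w - \<sigma> w for w = x \<sigma> y,
  and products of two such elements are unchanged by \<open>conj_diff_sq\<close>.\<close>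

lemma (in quadratic) twist_disc_elem:
  assumes n: "n \<in> torsion4 R"
  shows "disc_elem R (twist R M n) = disc_elem R M"
proof -
  interpret CM: cring M by (rule M_cring)
  have nR: "n \<in> carrier R" using n by (simp add: R.torsion4_iff)
  define N where "N = n \<odot>\<^bsub>M\<^esub> \<one>\<^bsub>M\<^esub>"
  have N: "N \<in> carrier M" using nR by (simp add: N_def)
  have 1: "x \<otimes>\<^bsub>twist R M n\<^esub> \<sigma> y \<ominus>\<^bsub>M\<^esub> \<sigma> x \<otimes>\<^bsub>twist R M n\<^esub> y = x \<otimes>\<^bsub>M\<^esub> \<sigma> y \<ominus>\<^bsub>M\<^esub> \<sigma> (x \<otimes>\<^bsub>M\<^esub> \<sigma> y)"
    if x: "x \<in> carrier M" and y: "y \<in> carrier M" for x y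
  proof -
    define X Y where "X = \<sigma> x" and "Y = \<sigma> y"
    have XY: "X \<in> carrier M" "Y \<in> carrier M" using x y by (simp_all add: X_def Y_def)
    have "x \<otimes>\<^bsub>twist R M n\<^esub> \<sigma> y \<ominus>\<^bsub>M\<^esub> \<sigma> x \<otimes>\<^bsub>twist R M n\<^esub> y =
      (x \<otimes>\<^bsub>M\<^esub> Y \<ominus>\<^bsub>M\<^esub> N \<otimes>\<^bsub>M\<^esub> ((x \<ominus>\<^bsub>M\<^esub> X) \<otimes>\<^bsub>M\<^esub> (Y \<ominus>\<^bsub>M\<^esub> y))) \<ominus>\<^bsub>M\<^esub>
      (X \<otimes>\<^bsub>M\<^esub> y \<ominus>\<^bsub>M\<^esub> N \<otimes>\<^bsub>M\<^esub> ((X \<ominus>\<^bsub>M\<^esub> x) \<otimes>\<^bsub>M\<^esub> (y \<ominus>\<^bsub>M\<^esub> Y)))"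
      using x y nR by (simp add: twist_mult N_def X_def Y_def \<sigma>_\<sigma>)
    also have "\<dots> = x \<otimes>\<^bsub>M\<^esub> Y \<ominus>\<^bsub>M\<^esub> X \<otimes>\<^bsub>M\<^esub> y" using x y XY N by algebra
    also have "\<dots> = x \<otimes>\<^bsub>M\<^esub> \<sigma> y \<ominus>\<^bsub>M\<^esub> \<sigma> (x \<otimes>\<^bsub>M\<^esub> \<sigma> y)" using x y by (simp add: X_def Y_def \<sigma>_mult \<sigma>_\<sigma>)
    finally show ?thesis .
  qed
  have 2: "(x \<otimes>\<^bsub>twist R M n\<^esub> \<sigma> y \<ominus>\<^bsub>M\<^esub> \<sigma> x \<otimes>\<^bsub>twist R M n\<^esub> y) \<otimes>\<^bsub>twist R M n\<^esub>
      (z \<otimes>\<^bsub>twist R M n\<^esub> \<sigma> w \<ominus>\<^bsub>M\<^esub> \<sigma> z \<otimes>\<^bsub>twist R M n\<^esub> w) =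
      (x \<otimes>\<^bsub>M\<^esub> \<sigma> y \<ominus>\<^bsub>M\<^esub> \<sigma> x \<otimes>\<^bsub>M\<^esub> y) \<otimes>\<^bsub>M\<^esub> (z \<otimes>\<^bsub>M\<^esub> \<sigma> w \<ominus>\<^bsub>M\<^esub> \<sigma> z \<otimes>\<^bsub>M\<^esub> w)"
    if "x \<in> carrier M" "y \<in> carrier M" "z \<in> carrier M" "w \<in> carrier M" for x y z w
    unfolding 1[OF that(1,2)] 1[OF that(3,4)]
    using that conj_diff_sq[OF n, of "x \<otimes>\<^bsub>M\<^esub> \<sigma> y" "z \<otimes>\<^bsub>M\<^esub> \<sigma> w"] by (simp add: \<sigma>_mult \<sigma>_\<sigma>)
  show ?thesis
    unfolding disc_elem_def Let_def twist_std_inv[OF nR] twist_ext2 twist_simps twist_a_minus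
    using 2 by (intro arg_cong[of _ _ The] ext conj_cong refl ball_cong) simp
qed

text \<open>Each S in the class of the twist is matched with its own twist by -n. That algebra lies
  in the class of T and has the same exterior square and the same discriminant form, so the unions
  in \<open>disc\<close> are compared term by term.\<close>

lemma (in cring) disc_twist_subset:
  assumes T: "quadratic R T" and n: "n \<in> torsion4 R"
  shows "disc R (quad_class R (twist R T n)) \<subseteq> disc R (quad_class R T)"
proof -
  interpret T: quadratic R T by fact
  note nc = torsion4_closed(1)[OF n] torsion4_closed(3)[OF n] torsion4_closed(1)[OF torsion4_closed(3)[OF n]]
  interpret Tn: quadratic R "twist R T n" by (rule T.twist_quadratic[OF nc(1)])
  have "disc_class R (disc_elem R S) (ext2 R S) \<subseteq> disc R (quad_class R T)"
    if "S \<in> quad_class R (twist R T n)" for S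
  proof -
    obtain f where f: "f \<in> alg_iso R (twist R T n) S" and "quadratic R S" using \<open>S \<in> _\<close> by (auto simp: mem_quad_class)
    then interpret S: quadratic R S by simp
    define S' where "S' = twist R S (\<ominus> n)"
    have "f \<in> alg_iso R (twist R (twist R T n) (\<ominus> n)) S'"
      unfolding S'_def by (rule Tn.twist_iso[OF S.quadratic_axioms f nc(3)])
    then have "f \<in> alg_iso R T S'" using nc by (simp add: T.twist_twist[OF n nc(2)] r_neg T.twist_zero)
    moreover have "quadratic R S'" unfolding S'_def by (rule S.twist_quadratic[OF nc(3)])
    ultimately have "S' \<in> quad_class R T" by (auto simp: mem_quad_class)
    then have "disc_class R (disc_elem R S') (ext2 R S') \<subseteq> disc R (quad_class R T)"
      unfolding disc_def by (rule UN_upper)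
    moreover have "disc_elem R S' = disc_elem R S" "ext2 R S' = ext2 R S"
      unfolding S'_def by (simp_all add: S.twist_disc_elem[OF nc(2)])
    ultimately show ?thesis by (simp only:)
  qed
  then show ?thesis unfolding disc_def[of R "quad_class R (twist R T n)"] by blast
qed

lemma (in cring) disc_twist:
  assumes T: "quadratic R T" and n: "n \<in> torsion4 R"
  shows "disc R (quad_class R (twist R T n)) = disc R (quad_class R T)"
proof
  show "disc R (quad_class R (twist R T n)) \<subseteq> disc R (quad_class R T)" by (rule disc_twist_subset[OF assms])
  interpret T: quadratic R T by fact
  note nc = torsion4_closed(1)[OF n] torsion4_closed(3)[OF n]
  have "twist R (twist R T n) (\<ominus> n) = T" using nc by (simp add: T.twist_twist[OF n nc(2)] r_neg T.twist_zero)
  then show "disc R (quad_class R T) \<subseteq> disc R (quad_class R (twist R T n))"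
    using disc_twist_subset[OF T.twist_quadratic[OF nc(1)] nc(2)] by simp
qed

lemma (in cring) quad_star_fiber:
  assumes A: "A \<in> carrier (AS R)" and P: "P \<in> disc_fiber R D"
  shows "quad_star R (as_incl R A) P \<in> disc_fiber R D"
proof -
  have PQ: "P \<in> Quad R" and PD: "disc R P = D" using P by (auto simp: disc_fiber_def)
  obtain T where T: "quadratic R T" "T \<in> P" "P = quad_class R T" using PQ by (rule Quad_cases)
  obtain n where n: "n \<in> A" using AS_nonempty[OF A] by blast
  have n4: "n \<in> torsion4 R" by (rule AS_mem[OF A n])
  have "quadratic R (twist R T n)" by (rule quadratic.twist_quadratic[OF T(1) torsion4_closed(1)[OF n4]])
  then have "quad_class R (twist R T n) \<in> Quad R" by (auto simp: Quad_def quadratic_iff)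
  then show ?thesis
    unfolding quad_star_eq[OF A n PQ T(2)]
    using disc_twist[OF T(1) n4] PD T(3) by (simp add: disc_fiber_def)
qed

section \<open>The group action and its uniqueness\<close>

lemma (in cring) quad_star_mult:
  assumes A: "A \<in> carrier (AS R)" and B: "B \<in> carrier (AS R)" and P: "P \<in> Quad R"
  shows "quad_star R (as_incl R (A \<otimes>\<^bsub>AS R\<^esub> B)) P = quad_star R (as_incl R A) (quad_star R (as_incl R B) P)"
proof -
  interpret G: group "AS R" by (rule AS_group)
  obtain T where T: "quadratic R T" "T \<in> P" using P by (rule Quad_cases)
  obtain n m where n: "n \<in> A" and m: "m \<in> B" using AS_nonempty A B by blast
  note t = AS_mem[OF A n] AS_mem[OF B m]
  interpret T: quadratic R T by (rule T)
  have q: "quadratic R (twist R T m)" by (rule T.twist_quadratic[OF torsion4_closed(1)[OF t(2)]])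
  \<comment> \<open>All three products are evaluated on the representatives n, m and T, where the
    law is \<open>twist_twist\<close>.\<close>
  have "quad_star R (as_incl R (A \<otimes>\<^bsub>AS R\<^esub> B)) P = quad_class R (twist R T (n \<oplus> m))"
    using A B by (intro quad_star_eq AS_mult_mem n m P T G.m_closed)
  moreover have "quad_star R (as_incl R B) P = quad_class R (twist R T m)" by (rule quad_star_eq[OF B m P T(2)])
  moreover have "quad_star R (as_incl R A) (quad_class R (twist R T m)) = quad_class R (twist R (twist R T m) n)"
    using q by (intro quad_star_eq[OF A n] quad_class_self) (auto simp: Quad_def quadratic_iff)
  ultimately show ?thesis
    using t by (simp add: T.twist_twist a_comm[of n m] torsion4_closed(1))
qed

lemma (in cring) quad_star_one:
  assumes P: "P \<in> Quad R" shows "quad_star R (as_incl R \<one>\<^bsub>AS R\<^esub>) P = P"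
proof -
  interpret G: group "AS R" by (rule AS_group)
  obtain T where T: "quadratic R T" "T \<in> P" "P = quad_class R T" using P by (rule Quad_cases)
  show ?thesis
    unfolding quad_star_eq[OF G.one_closed AS_one_mem P T(2)] quadratic.twist_zero[OF T(1)] by (rule T(3)[symmetric])
qed

text \<open>The restriction to the fiber is demanded by \<open>Bij\<close>; the restriction to the
  group fixes the action as a function.\<close>

lemma (in cring) compatible_action_exists:
  "compatible_action R D (\<lambda>A\<in>carrier (AS R). \<lambda>P\<in>disc_fiber R D. quad_star R (as_incl R A) P)"
proof -
  interpret G: group "AS R" by (rule AS_group)
  define E where "E = disc_fiber R D"
  define \<rho> where "\<rho> = (\<lambda>A\<in>carrier (AS R). \<lambda>P\<in>E. quad_star R (as_incl R A) P)"
  have EQ: "P \<in> Quad R" if "P \<in> E" for P using that by (simp add: E_def disc_fiber_def)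
  have cl: "quad_star R (as_incl R A) P \<in> E" if "A \<in> carrier (AS R)" "P \<in> E" for A P
    using that quad_star_fiber by (simp add: E_def)
  have inv: "quad_star R (as_incl R A) (quad_star R (as_incl R (inv\<^bsub>AS R\<^esub> A)) P) = P"
    "quad_star R (as_incl R (inv\<^bsub>AS R\<^esub> A)) (quad_star R (as_incl R A) P) = P"
    if "A \<in> carrier (AS R)" "P \<in> E" for A P
    using that quad_star_mult[of A "inv\<^bsub>AS R\<^esub> A" P] quad_star_mult[of "inv\<^bsub>AS R\<^esub> A" A P] quad_star_one[OF EQ] EQ
    by simp_all
  have bij: "\<rho> A \<in> Bij E" if A: "A \<in> carrier (AS R)" for A
  proof -
    have "bij_betw (\<rho> A) E E"
      using A cl inv by (intro bij_betw_byWitness[of _ "\<rho> (inv\<^bsub>AS R\<^esub> A)"]) (auto simp: \<rho>_def)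
    then show ?thesis using A by (simp add: Bij_def \<rho>_def)
  qed
  have "\<rho> \<in> hom (AS R) (BijGroup E)"
  proof (rule homI)
    fix A B assume AB: "A \<in> carrier (AS R)" "B \<in> carrier (AS R)"
    have "\<rho> (A \<otimes>\<^bsub>AS R\<^esub> B) = compose E (\<rho> A) (\<rho> B)"
      using AB cl quad_star_mult EQ by (auto simp: \<rho>_def compose_def fun_eq_iff)
    then show "\<rho> (A \<otimes>\<^bsub>AS R\<^esub> B) = \<rho> A \<otimes>\<^bsub>BijGroup E\<^esub> \<rho> B"
      using bij AB by (simp add: BijGroup_def)
  qed (simp add: bij BijGroup_def)
  then have "group_action (AS R) E \<rho>"
    by (intro group_action.intro group_hom.intro G.is_group group_BijGroup group_hom_axioms.intro)
  then show ?thesis by (simp add: compatible_action_def \<rho>_def E_def)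
qed

text \<open>Compatibility fixes all values on the fiber, and elements of \<open>Bij\<close> are
  extensional outside it.\<close>

lemma compatible_action_unique:
  assumes "\<rho> \<in> extensional (carrier (AS R))" "compatible_action R D \<rho>"
    and "\<rho>' \<in> extensional (carrier (AS R))" "compatible_action R D \<rho>'"
  shows "\<rho> = \<rho>'"
proof (rule extensionalityI[OF assms(1,3)])
  fix A assume A: "A \<in> carrier (AS R)"
  have "\<rho> A \<in> Bij (disc_fiber R D)" "\<rho>' A \<in> Bij (disc_fiber R D)"
    using assms A by (auto simp: compatible_action_def intro: group_action.bij_prop0)
  then show "\<rho> A = \<rho>' A"
    using assms A by (intro extensionalityI[of _ "disc_fiber R D"]) (auto simp: compatible_action_def Bij_def)
qed

section \<open>Tensor products\<close>

context module
begin

lemma mspan: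
  assumes "K \<subseteq> carrier M"
  shows mspan_submodule: "submodule (mspan R M K) R M"
    and mspan_superset: "K \<subseteq> mspan R M K"
    and mspan_minimal: "submodule H R M \<Longrightarrow> K \<subseteq> H \<Longrightarrow> mspan R M K \<subseteq> H"
proof -
  show "K \<subseteq> mspan R M K" "submodule H R M \<Longrightarrow> K \<subseteq> H \<Longrightarrow> mspan R M K \<subseteq> H"
    unfolding mspan_def by blast+
  have c: "mspan R M K \<subseteq> carrier M"
    unfolding mspan_def using carrier_is_submodule assms by blast
  show "submodule (mspan R M K) R M"
  proof (rule submoduleI[OF c])
    have "\<zero>\<^bsub>M\<^esub> \<in> H" if H: "submodule H R M" for H
    proof -
      obtain h where "h \<in> H" using submoduleE(2)[OF H] by blast
      then show ?thesis using submoduleE(4)[OF H R.zero_closed, of h] submoduleE(1)[OF H] by auto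
    qed
    then show "\<zero>\<^bsub>M\<^esub> \<in> mspan R M K" unfolding mspan_def by blast
  qed (use submoduleE in \<open>auto simp: mspan_def\<close>)
qed

text \<open>The multiple kx equals (k 1)x, so closure under the module operations follows from
  linearity of a scalar action.\<close>

lemma multiples_submodule: "submodule (multiples M k) R M"
proof -
  have 1: "[k] \<cdot>\<^bsub>M\<^esub> x = ([k] \<cdot> \<one>) \<odot>\<^bsub>M\<^esub> x" if "x \<in> carrier M" for x
    using that by (induction k) (simp_all add: smult_l_distr M.add.nat_pow_Suc R.add.nat_pow_Suc)
  then have e: "multiples M k = {([k] \<cdot> \<one>) \<odot>\<^bsub>M\<^esub> x | x. x \<in> carrier M}"
    unfolding multiples_def by force
  have c: "[k] \<cdot> \<one> \<in> carrier R" by simp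
  show ?thesis
    unfolding e
  proof (rule submoduleI)
    show "\<zero>\<^bsub>M\<^esub> \<in> {([k] \<cdot> \<one>) \<odot>\<^bsub>M\<^esub> x | x. x \<in> carrier M}"
      using c by (auto intro!: exI[of _ "\<zero>\<^bsub>M\<^esub>"])
  next
    fix a assume "a \<in> {([k] \<cdot> \<one>) \<odot>\<^bsub>M\<^esub> x | x. x \<in> carrier M}"
    then obtain x where "x \<in> carrier M" "a = ([k] \<cdot> \<one>) \<odot>\<^bsub>M\<^esub> x" by blast
    then have "\<ominus>\<^bsub>M\<^esub> a = ([k] \<cdot> \<one>) \<odot>\<^bsub>M\<^esub> (\<ominus>\<^bsub>M\<^esub> x)" "\<ominus>\<^bsub>M\<^esub> x \<in> carrier M"
      using c by (simp_all add: smult_r_minus)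
    then show "\<ominus>\<^bsub>M\<^esub> a \<in> {([k] \<cdot> \<one>) \<odot>\<^bsub>M\<^esub> x | x. x \<in> carrier M}" by blast
  next
    fix a b assume "a \<in> {([k] \<cdot> \<one>) \<odot>\<^bsub>M\<^esub> x | x. x \<in> carrier M}" "b \<in> {([k] \<cdot> \<one>) \<odot>\<^bsub>M\<^esub> x | x. x \<in> carrier M}"
    then obtain x y where *: "x \<in> carrier M" "a = ([k] \<cdot> \<one>) \<odot>\<^bsub>M\<^esub> x" "y \<in> carrier M" "b = ([k] \<cdot> \<one>) \<odot>\<^bsub>M\<^esub> y" by blast
    then have "a \<oplus>\<^bsub>M\<^esub> b = ([k] \<cdot> \<one>) \<odot>\<^bsub>M\<^esub> (x \<oplus>\<^bsub>M\<^esub> y)" using c by (simp add: smult_r_distr)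
    then show "a \<oplus>\<^bsub>M\<^esub> b \<in> {([k] \<cdot> \<one>) \<odot>\<^bsub>M\<^esub> x | x. x \<in> carrier M}" using * by blast
  next
    fix a b assume a: "a \<in> carrier R" and "b \<in> {([k] \<cdot> \<one>) \<odot>\<^bsub>M\<^esub> x | x. x \<in> carrier M}"
    then obtain x where *: "x \<in> carrier M" "b = ([k] \<cdot> \<one>) \<odot>\<^bsub>M\<^esub> x" by blast
    then have "a \<odot>\<^bsub>M\<^esub> b = ([k] \<cdot> \<one>) \<odot>\<^bsub>M\<^esub> (a \<odot>\<^bsub>M\<^esub> x)" using c a
      by (simp add: smult_assoc1[symmetric] R.m_comm)
    then show "a \<odot>\<^bsub>M\<^esub> b \<in> {([k] \<cdot> \<one>) \<odot>\<^bsub>M\<^esub> x | x. x \<in> carrier M}" using * a by blast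
  qed (use c in auto)
qed

end

context cring
begin

lemma free_mod_module: "module R (free_mod R B)"
proof -
  have fin: "finite {b. c b \<oplus> e b \<noteq> \<zero>}" if "finite {b. c b \<noteq> \<zero>}" "finite {b. e b \<noteq> \<zero>}" for c e :: "'c \<Rightarrow> 'a"
    by (rule finite_subset[OF _ finite_UnI[OF that]]) auto
  have fin2: "finite {b. h (c b) \<noteq> \<zero>}" if "finite {b. c b \<noteq> \<zero>}" "h \<zero> = \<zero>" for c :: "'c \<Rightarrow> 'a" and h
    by (rule finite_subset[OF _ that(1)]) (use that(2) in auto)
  show ?thesis
  proof (rule moduleI[OF is_cring])
    show "abelian_group (free_mod R B)"
    proof (rule abelian_groupI)
      fix c assume "c \<in> carrier (free_mod R B)"
      then show "\<exists>e\<in>carrier (free_mod R B). e \<oplus>\<^bsub>free_mod R B\<^esub> c = \<zero>\<^bsub>free_mod R B\<^esub>"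
        by (intro bexI[of _ "\<lambda>b. \<ominus> c b"]) (auto simp: free_mod_def l_neg intro: fin2[where h = "a_inv R"])
    qed (auto simp: free_mod_def a_ac fun_eq_iff intro: fin)
  qed (auto simp: free_mod_def fun_eq_iff l_distr r_distr m_assoc
      intro: fin2[where h = "\<lambda>x. a \<otimes> x" for a])
qed

lemma free_gen_closed: "b \<in> B \<Longrightarrow> free_gen R b \<in> carrier (free_mod R B)"
  by (auto simp: free_mod_def free_gen_def)

end

locale two_modules = M: module R M + N: module R N
  for R (structure) and M :: "('a, 'b, 'm) module_scheme" and N :: "('a, 'c, 'n) module_scheme"
begin

abbreviation "F \<equiv> free_mod R (carrier M \<times> carrier N)"
abbreviation "E \<equiv> tensor R M N"
abbreviation "pt \<equiv> pure_tensor R M N"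
abbreviation "K \<equiv> tensor_kernel R M N"
abbreviation "gn x y \<equiv> free_gen R (x, y)"

sublocale F: module R F by (rule M.R.free_mod_module)

lemma gen_closed [simp]: "x \<in> carrier M \<Longrightarrow> y \<in> carrier N \<Longrightarrow> gn x y \<in> carrier F"
  by (rule M.R.free_gen_closed) simp

lemma F_val: "c \<in> carrier F \<Longrightarrow> c p \<in> carrier R"
  by (cases p) (simp add: free_mod_def)

lemma F_supp: "c \<in> carrier F \<Longrightarrow> c p \<noteq> \<zero> \<Longrightarrow> p \<in> carrier M \<times> carrier N"
  by (cases p) (auto simp: free_mod_def)

lemma F_I: "(\<And>p. c p \<in> carrier R) \<Longrightarrow> finite {p. c p \<noteq> \<zero>} \<Longrightarrow>
    {p. c p \<noteq> \<zero>} \<subseteq> carrier M \<times> carrier N \<Longrightarrow> c \<in> carrier F"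
  unfolding free_mod_def by auto

lemma rels_subset: "tensor_rels R M N \<subseteq> carrier F"
  unfolding tensor_rels_def Let_def by (auto intro!: F.M.minus_closed)

lemma K_submodule: "submodule K R F"
  unfolding tensor_kernel_def by (rule F.mspan_submodule[OF rels_subset])

sublocale T: quot_module R F K by (rule quot_module.intro[OF F.module_axioms]) (rule quot_module_axioms.intro[OF K_submodule])

sublocale E: module R E unfolding tensor_def by (rule T.quot_is_module)

lemma pt_eq: "pt x y = K +>\<^bsub>F\<^esub> gn x y"
  by (simp add: pure_tensor_def)

lemma pt_closed [simp]: "x \<in> carrier M \<Longrightarrow> y \<in> carrier N \<Longrightarrow> pt x y \<in> carrier E"
  by (simp add: pt_eq tensor_def)

lemma rels_K: "k \<in> tensor_rels R M N \<Longrightarrow> k \<in> K"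
  unfolding tensor_kernel_def using F.mspan_superset[OF rels_subset] by blast

lemma pt_add_l:
  assumes "x \<in> carrier M" "x' \<in> carrier M" "y \<in> carrier N"
  shows "pt (x \<oplus>\<^bsub>M\<^esub> x') y = pt x y \<oplus>\<^bsub>E\<^esub> pt x' y"
proof -
  have "gn (x \<oplus>\<^bsub>M\<^esub> x') y \<ominus>\<^bsub>F\<^esub> (gn x y \<oplus>\<^bsub>F\<^esub> gn x' y) \<in> K"
    using assms by (intro rels_K) (auto simp: tensor_rels_def Let_def)
  then have "pt (x \<oplus>\<^bsub>M\<^esub> x') y = K +>\<^bsub>F\<^esub> (gn x y \<oplus>\<^bsub>F\<^esub> gn x' y)"
    using assms by (simp add: pt_eq T.coset_eq_iff)
  then show ?thesis using assms by (simp add: pt_eq tensor_def T.quot_add)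
qed

lemma pt_add_r:
  assumes "x \<in> carrier M" "y \<in> carrier N" "y' \<in> carrier N"
  shows "pt x (y \<oplus>\<^bsub>N\<^esub> y') = pt x y \<oplus>\<^bsub>E\<^esub> pt x y'"
proof -
  have "gn x (y \<oplus>\<^bsub>N\<^esub> y') \<ominus>\<^bsub>F\<^esub> (gn x y \<oplus>\<^bsub>F\<^esub> gn x y') \<in> K"
    using assms by (intro rels_K) (auto simp: tensor_rels_def Let_def)
  then have "pt x (y \<oplus>\<^bsub>N\<^esub> y') = K +>\<^bsub>F\<^esub> (gn x y \<oplus>\<^bsub>F\<^esub> gn x y')"
    using assms by (simp add: pt_eq T.coset_eq_iff)
  then show ?thesis using assms by (simp add: pt_eq tensor_def T.quot_add)
qed

lemma pt_smult_l:
  assumes "a \<in> carrier R" "x \<in> carrier M" "y \<in> carrier N"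
  shows "pt (a \<odot>\<^bsub>M\<^esub> x) y = a \<odot>\<^bsub>E\<^esub> pt x y"
proof -
  have "gn (a \<odot>\<^bsub>M\<^esub> x) y \<ominus>\<^bsub>F\<^esub> a \<odot>\<^bsub>F\<^esub> gn x y \<in> K"
    using assms by (intro rels_K) (auto simp: tensor_rels_def Let_def)
  then have "pt (a \<odot>\<^bsub>M\<^esub> x) y = K +>\<^bsub>F\<^esub> (a \<odot>\<^bsub>F\<^esub> gn x y)"
    using assms by (simp add: pt_eq T.coset_eq_iff)
  then show ?thesis using assms by (simp add: pt_eq tensor_def T.quot_smult)
qed

lemma pt_smult_r:
  assumes "a \<in> carrier R" "x \<in> carrier M" "y \<in> carrier N"
  shows "pt x (a \<odot>\<^bsub>N\<^esub> y) = a \<odot>\<^bsub>E\<^esub> pt x y"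
proof -
  have "gn x (a \<odot>\<^bsub>N\<^esub> y) \<ominus>\<^bsub>F\<^esub> a \<odot>\<^bsub>F\<^esub> gn x y \<in> K"
    using assms by (intro rels_K) (auto simp: tensor_rels_def Let_def)
  then have "pt x (a \<odot>\<^bsub>N\<^esub> y) = K +>\<^bsub>F\<^esub> (a \<odot>\<^bsub>F\<^esub> gn x y)"
    using assms by (simp add: pt_eq T.coset_eq_iff)
  then show ?thesis using assms by (simp add: pt_eq tensor_def T.quot_smult)
qed

text \<open>Pure tensors generate the tensor product. The induction runs over a finite set
  containing the support of a representative in the free module and splits off one basis element at
  a time.\<close>

lemma tensor_induct:
  assumes H: "submodule H R E" and pt: "\<And>x y. x \<in> carrier M \<Longrightarrow> y \<in> carrier N \<Longrightarrow> pt x y \<in> H"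
    and X: "X \<in> carrier E"
  shows "X \<in> H"
proof -
  note HE = E.submoduleE[OF H]
  have "K +>\<^bsub>F\<^esub> c \<in> H" if "finite S" "c \<in> carrier F" "{p. c p \<noteq> \<zero>} \<subseteq> S" for S c
    using that
  proof (induction S arbitrary: c rule: finite_induct)
    case empty
    then have "c = \<zero>\<^bsub>F\<^esub>" by (auto simp: free_mod_def)
    obtain h where "h \<in> H" using HE(2) by blast
    then have "\<zero>\<^bsub>E\<^esub> \<in> H" using HE(4)[OF M.R.zero_closed, of h] HE(1) by auto
    then show ?case unfolding \<open>c = _\<close> by (simp add: tensor_def T.quot_zero)
  next
    case (insert p S)
    show ?case
    proof (cases "c p = \<zero>")
      case True
      then show ?thesis using insert.prems by (intro insert.IH) auto
    next
      case False
      then have p: "p \<in> carrier M \<times> carrier N" "c p \<in> carrier R"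
        using F_supp F_val insert.prems(1) by blast+
      \<comment> \<open>The representative with its coefficient at p removed; its support lies in
        the smaller set.\<close>
      define e where "e = c(p := \<zero>)"
      have cF: "c \<in> carrier F" by (rule insert.prems(1))
      have es: "{q. e q \<noteq> \<zero>} \<subseteq> {q. c q \<noteq> \<zero>}" by (auto simp: e_def)
      have e: "e \<in> carrier F"
      proof (rule F_I)
        show "e q \<in> carrier R" for q using F_val[OF cF] by (simp add: e_def)
        have "finite {q. c q \<noteq> \<zero>}" using cF by (simp add: free_mod_def)
        then show "finite {q. e q \<noteq> \<zero>}" by (rule finite_subset[OF es])
        show "{q. e q \<noteq> \<zero>} \<subseteq> carrier M \<times> carrier N" using es F_supp[OF cF] by blast
      qed
      have g: "gn (fst p) (snd p) \<in> carrier F" using p(1) by auto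
      have "c = c p \<odot>\<^bsub>F\<^esub> gn (fst p) (snd p) \<oplus>\<^bsub>F\<^esub> e"
      proof
        fix q
        have "(c p \<odot>\<^bsub>F\<^esub> gn (fst p) (snd p) \<oplus>\<^bsub>F\<^esub> e) q = c p \<otimes> (if q = p then \<one> else \<zero>) \<oplus> e q"
          by (simp add: free_mod_def free_gen_def)
        also have "\<dots> = c q" using F_val[OF cF] p(2) by (simp add: e_def)
        finally show "c q = (c p \<odot>\<^bsub>F\<^esub> gn (fst p) (snd p) \<oplus>\<^bsub>F\<^esub> e) q" ..
      qed
      then have "K +>\<^bsub>F\<^esub> c = c p \<odot>\<^bsub>E\<^esub> pt (fst p) (snd p) \<oplus>\<^bsub>E\<^esub> (K +>\<^bsub>F\<^esub> e)"
        using p(2) g e by (metis T.quot_add T.quot_smult F.smult_closed pt_eq tensor_def)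
      moreover have "K +>\<^bsub>F\<^esub> e \<in> H"
        by (rule insert.IH[OF e]) (use insert.prems(2) in \<open>auto simp: e_def\<close>)
      moreover have "pt (fst p) (snd p) \<in> H" using p(1) by (intro pt) auto
      ultimately show ?thesis using HE(4,5) p(2) by simp
    qed
  qed
  moreover obtain c where "c \<in> carrier F" "X = K +>\<^bsub>F\<^esub> c"
    using X unfolding tensor_def by (rule T.quot_cases)
  moreover from this have "finite {p. c p \<noteq> \<zero>}" by (auto simp: free_mod_def)
  ultimately show ?thesis by blast
qed

end

locale bilinear_map = two_modules R M N + Q: module R Q
  for R (structure) and M :: "('a, 'b, 'm) module_scheme" and N :: "('a, 'c, 'n) module_scheme"
    and Q :: "('a, 'd, 'q) module_scheme" +
  fixes \<beta>
  assumes \<beta>_closed: "x \<in> carrier M \<Longrightarrow> y \<in> carrier N \<Longrightarrow> \<beta> x y \<in> carrier Q"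
    and \<beta>_add_l: "x \<in> carrier M \<Longrightarrow> x' \<in> carrier M \<Longrightarrow> y \<in> carrier N \<Longrightarrow> \<beta> (x \<oplus>\<^bsub>M\<^esub> x') y = \<beta> x y \<oplus>\<^bsub>Q\<^esub> \<beta> x' y"
    and \<beta>_add_r: "x \<in> carrier M \<Longrightarrow> y \<in> carrier N \<Longrightarrow> y' \<in> carrier N \<Longrightarrow> \<beta> x (y \<oplus>\<^bsub>N\<^esub> y') = \<beta> x y \<oplus>\<^bsub>Q\<^esub> \<beta> x y'"
    and \<beta>_smult_l: "a \<in> carrier R \<Longrightarrow> x \<in> carrier M \<Longrightarrow> y \<in> carrier N \<Longrightarrow> \<beta> (a \<odot>\<^bsub>M\<^esub> x) y = a \<odot>\<^bsub>Q\<^esub> \<beta> x y"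
    and \<beta>_smult_r: "a \<in> carrier R \<Longrightarrow> x \<in> carrier M \<Longrightarrow> y \<in> carrier N \<Longrightarrow> \<beta> x (a \<odot>\<^bsub>N\<^esub> y) = a \<odot>\<^bsub>Q\<^esub> \<beta> x y"
begin

text \<open>The linear extension to the free module; \<open>tensor_lift\<close> takes its single
  value on a coset.\<close>

definition ext :: "('b \<times> 'c \<Rightarrow> 'a) \<Rightarrow> 'd"
  where "ext c = (\<Oplus>\<^bsub>Q\<^esub>p \<in> {p. c p \<noteq> \<zero>}. c p \<odot>\<^bsub>Q\<^esub> \<beta> (fst p) (snd p))"

text \<open>The support changes under addition, so sums are compared over a common finite
  superset.\<close>

lemma ext_on:
  assumes "c \<in> carrier F" "finite S" "{p. c p \<noteq> \<zero>} \<subseteq> S" "S \<subseteq> carrier M \<times> carrier N"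
  shows "ext c = (\<Oplus>\<^bsub>Q\<^esub>p \<in> S. c p \<odot>\<^bsub>Q\<^esub> \<beta> (fst p) (snd p))"
proof -
  have c: "c p \<in> carrier R" for p using F_val[OF assms(1)] .
  have b: "\<beta> (fst p) (snd p) \<in> carrier Q" if "p \<in> S" for p using that assms(4) by (auto intro!: \<beta>_closed)
  show ?thesis
    unfolding ext_def
    by (rule Q.M.add.finprod_mono_neutral_cong_left[OF assms(2,3)]) (use b c in auto)
qed

lemma supp: "c \<in> carrier F \<Longrightarrow> finite {p. c p \<noteq> \<zero>}" "c \<in> carrier F \<Longrightarrow> {p. c p \<noteq> \<zero>} \<subseteq> carrier M \<times> carrier N"
  by (auto simp: free_mod_def)

lemma ext_closed: "c \<in> carrier F \<Longrightarrow> ext c \<in> carrier Q"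
proof -
  assume c: "c \<in> carrier F"
  have "\<beta> (fst p) (snd p) \<in> carrier Q" if "c p \<noteq> \<zero>" for p
    using F_supp[OF c that] by (auto intro!: \<beta>_closed)
  then show ?thesis unfolding ext_def using F_val[OF c] by (intro Q.M.finsum_closed) auto
qed

lemma ext_add:
  assumes c: "c \<in> carrier F" and e: "e \<in> carrier F"
  shows "ext (c \<oplus>\<^bsub>F\<^esub> e) = ext c \<oplus>\<^bsub>Q\<^esub> ext e"
proof -
  define S where "S = {p. c p \<noteq> \<zero>} \<union> {p. e p \<noteq> \<zero>}"
  have S: "finite S" "S \<subseteq> carrier M \<times> carrier N" using supp[OF c] supp[OF e] by (auto simp: S_def)
  have cp: "c p \<in> carrier R" "e p \<in> carrier R" for p using F_val c e by blast+
  have b: "\<beta> (fst p) (snd p) \<in> carrier Q" if "p \<in> S" for p using that S by (auto intro!: \<beta>_closed)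
  have v: "(c \<oplus>\<^bsub>F\<^esub> e) p = c p \<oplus> e p" for p by (simp add: free_mod_def)
  have sub: "{p. c p \<noteq> \<zero>} \<subseteq> S" "{p. e p \<noteq> \<zero>} \<subseteq> S" "{p. (c \<oplus>\<^bsub>F\<^esub> e) p \<noteq> \<zero>} \<subseteq> S"
    by (auto simp: S_def v)
  have "ext (c \<oplus>\<^bsub>F\<^esub> e) = (\<Oplus>\<^bsub>Q\<^esub>p \<in> S. (c p \<oplus> e p) \<odot>\<^bsub>Q\<^esub> \<beta> (fst p) (snd p))"
    unfolding v[symmetric] by (rule ext_on[OF F.M.a_closed[OF c e] S(1) sub(3) S(2)])
  also have "\<dots> = (\<Oplus>\<^bsub>Q\<^esub>p \<in> S. c p \<odot>\<^bsub>Q\<^esub> \<beta> (fst p) (snd p) \<oplus>\<^bsub>Q\<^esub> e p \<odot>\<^bsub>Q\<^esub> \<beta> (fst p) (snd p))"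
    using b cp by (intro Q.M.finsum_cong') (auto simp: Q.smult_l_distr)
  also have "\<dots> = ext c \<oplus>\<^bsub>Q\<^esub> ext e"
    unfolding ext_on[OF c S(1) sub(1) S(2)] ext_on[OF e S(1) sub(2) S(2)]
    using b cp by (intro Q.M.finsum_addf) auto
  finally show ?thesis .
qed

lemma ext_smult:
  assumes c: "c \<in> carrier F" and a: "a \<in> carrier R"
  shows "ext (a \<odot>\<^bsub>F\<^esub> c) = a \<odot>\<^bsub>Q\<^esub> ext c"
proof -
  define S where "S = {p. c p \<noteq> \<zero>}"
  have S: "finite S" "S \<subseteq> carrier M \<times> carrier N" using supp[OF c] by (auto simp: S_def)
  have cp: "c p \<in> carrier R" for p using F_val[OF c] .
  have b: "\<beta> (fst p) (snd p) \<in> carrier Q" if "p \<in> S" for p using that S by (auto intro!: \<beta>_closed)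
  have v: "(a \<odot>\<^bsub>F\<^esub> c) p = a \<otimes> c p" for p by (simp add: free_mod_def)
  have "{p. (a \<odot>\<^bsub>F\<^esub> c) p \<noteq> \<zero>} \<subseteq> S" using a by (auto simp: v S_def)
  then have "ext (a \<odot>\<^bsub>F\<^esub> c) = (\<Oplus>\<^bsub>Q\<^esub>p \<in> S. (a \<odot>\<^bsub>F\<^esub> c) p \<odot>\<^bsub>Q\<^esub> \<beta> (fst p) (snd p))"
    using c a S by (intro ext_on) simp_all
  also have "\<dots> = (\<Oplus>\<^bsub>Q\<^esub>p \<in> S. a \<odot>\<^bsub>Q\<^esub> (c p \<odot>\<^bsub>Q\<^esub> \<beta> (fst p) (snd p)))"
    using b cp a by (intro Q.M.finsum_cong') (auto simp: Q.smult_assoc1 v)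
  also have "\<dots> = a \<odot>\<^bsub>Q\<^esub> ext c"
    using b cp a S unfolding ext_def S_def[symmetric] by (intro Q.finsum_smult_ldistr[symmetric]) auto
  finally show ?thesis .
qed

lemma ext_gen:
  assumes "x \<in> carrier M" "y \<in> carrier N" shows "ext (gn x y) = \<beta> x y"
proof -
  have "ext (gn x y) = (\<Oplus>\<^bsub>Q\<^esub>p \<in> {(x, y)}. gn x y p \<odot>\<^bsub>Q\<^esub> \<beta> (fst p) (snd p))"
    by (rule ext_on[OF gen_closed[OF assms]]) (use assms in \<open>auto simp: free_gen_def\<close>)
  then show ?thesis using assms by (simp add: free_gen_def \<beta>_closed)
qed

lemma ext_minus: "c \<in> carrier F \<Longrightarrow> ext (\<ominus>\<^bsub>F\<^esub> c) = \<ominus>\<^bsub>Q\<^esub> ext c"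
  using ext_smult[of c "\<ominus> \<one>"] by (simp add: F.smult_l_minus Q.smult_l_minus ext_closed)

lemma ext_diff: "c \<in> carrier F \<Longrightarrow> e \<in> carrier F \<Longrightarrow> ext (c \<ominus>\<^bsub>F\<^esub> e) = ext c \<ominus>\<^bsub>Q\<^esub> ext e"
  by (simp add: a_minus_def ext_add ext_minus)

text \<open>Bilinearity puts every defining relation into the kernel of \<open>ext\<close>, a
  submodule, and hence also the span of the relations.\<close>

lemma ext_K: "k \<in> K \<Longrightarrow> ext k = \<zero>\<^bsub>Q\<^esub>"
proof -
  have z: "ext \<zero>\<^bsub>F\<^esub> = \<zero>\<^bsub>Q\<^esub>" using ext_smult[of "\<zero>\<^bsub>F\<^esub>" \<zero>] by (simp add: ext_closed)
  have mz: "\<ominus>\<^bsub>Q\<^esub> \<zero>\<^bsub>Q\<^esub> = \<zero>\<^bsub>Q\<^esub>" by (rule Q.M.minus_equality) simp_all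
  have "submodule {c \<in> carrier F. ext c = \<zero>\<^bsub>Q\<^esub>} R F"
    by (rule F.submoduleI) (auto simp: ext_add ext_smult ext_minus z mz)
  moreover have d0: "c \<ominus>\<^bsub>F\<^esub> e \<in> {c \<in> carrier F. ext c = \<zero>\<^bsub>Q\<^esub>}"
    if "c \<in> carrier F" "e \<in> carrier F" "ext c = ext e" for c e
    using that ext_diff[OF that(1,2)] Q.M.diff_eq_zero_iff ext_closed by simp
  have "tensor_rels R M N \<subseteq> {c \<in> carrier F. ext c = \<zero>\<^bsub>Q\<^esub>}"
    unfolding tensor_rels_def Let_def
    by (intro Un_least subsetI; elim CollectE exE conjE; hypsubst; rule d0;
        simp add: ext_add ext_smult ext_gen \<beta>_add_l \<beta>_add_r \<beta>_smult_l \<beta>_smult_r)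
  ultimately have "K \<subseteq> {c \<in> carrier F. ext c = \<zero>\<^bsub>Q\<^esub>}"
    unfolding tensor_kernel_def by (rule F.mspan_minimal[OF rels_subset])
  then show "k \<in> K \<Longrightarrow> ext k = \<zero>\<^bsub>Q\<^esub>" by blast
qed

lemma lift_coset:
  assumes c: "c \<in> carrier F" shows "tensor_lift R Q \<beta> (K +>\<^bsub>F\<^esub> c) = ext c"
proof -
  have "ext e = ext c" if "e \<in> K +>\<^bsub>F\<^esub> c" for e
  proof -
    note m = T.coset_mem[OF c that]
    have "e \<ominus>\<^bsub>F\<^esub> c \<in> K" using m T.coset_eq_iff[OF m(1) c] by simp
    then have "ext e \<ominus>\<^bsub>Q\<^esub> ext c = \<zero>\<^bsub>Q\<^esub>" using ext_K ext_diff[OF m(1) c] by simp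
    then show ?thesis using Q.M.diff_eq_zero_iff ext_closed m(1) c by blast
  qed
  then have "ext ` (K +>\<^bsub>F\<^esub> c) = {ext c}" using T.coset_self[OF c] by blast
  then show ?thesis unfolding tensor_lift_def ext_def[abs_def] by simp
qed

lemma lift_closed: "X \<in> carrier E \<Longrightarrow> tensor_lift R Q \<beta> X \<in> carrier Q"
  unfolding tensor_def by (auto elim!: T.quot_cases simp: lift_coset ext_closed)

lemma lift_add: "X \<in> carrier E \<Longrightarrow> Y \<in> carrier E \<Longrightarrow>
    tensor_lift R Q \<beta> (X \<oplus>\<^bsub>E\<^esub> Y) = tensor_lift R Q \<beta> X \<oplus>\<^bsub>Q\<^esub> tensor_lift R Q \<beta> Y"
  unfolding tensor_def by (auto elim!: T.quot_cases simp: T.quot_add lift_coset ext_add)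

lemma lift_smult: "X \<in> carrier E \<Longrightarrow> a \<in> carrier R \<Longrightarrow>
    tensor_lift R Q \<beta> (a \<odot>\<^bsub>E\<^esub> X) = a \<odot>\<^bsub>Q\<^esub> tensor_lift R Q \<beta> X"
  unfolding tensor_def by (auto elim!: T.quot_cases simp: T.quot_smult lift_coset ext_smult)

lemma lift_pt: "x \<in> carrier M \<Longrightarrow> y \<in> carrier N \<Longrightarrow> tensor_lift R Q \<beta> (pt x y) = \<beta> x y"
  by (simp add: pt_eq lift_coset ext_gen)

end

section \<open>Exterior squares\<close>

locale ext_square = module R M for R (structure) and M :: "('a, 'b, 'm) module_scheme"
begin

sublocale MM: two_modules R M M by (rule two_modules.intro) (rule module_axioms)+

abbreviation "V \<equiv> ext2 R M"
abbreviation "wd \<equiv> wedge R M"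

lemma diag_subset: "{pure_tensor R M M x x | x. x \<in> carrier M} \<subseteq> carrier MM.E"
  by auto

lemma ext2_kernel_submodule: "submodule (ext2_kernel R M) R MM.E"
  unfolding ext2_kernel_def by (rule MM.E.mspan_submodule[OF diag_subset])

sublocale W: quot_module R MM.E "ext2_kernel R M"
  by (rule quot_module.intro[OF MM.E.module_axioms]) (rule quot_module_axioms.intro[OF ext2_kernel_submodule])

sublocale V: module R V unfolding ext2_def by (rule W.quot_is_module)

lemma wd_eq: "wd x y = ext2_kernel R M +>\<^bsub>MM.E\<^esub> MM.pt x y"
  by (simp add: wedge_def)

lemma wd_closed [simp]: "x \<in> carrier M \<Longrightarrow> y \<in> carrier M \<Longrightarrow> wd x y \<in> carrier V"
  by (simp add: wd_eq ext2_def)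

text \<open>The preimage of H in the tensor square is a submodule, which reduces the claim to
  \<open>tensor_induct\<close>.\<close>

lemma wd_induct:
  assumes H: "submodule H R V" and wd: "\<And>x y. x \<in> carrier M \<Longrightarrow> y \<in> carrier M \<Longrightarrow> wd x y \<in> H"
    and X: "X \<in> carrier V"
  shows "X \<in> H"
proof -
  note HE = V.submoduleE[OF H]
  obtain h where "h \<in> H" using HE(2) by blast
  then have zH: "\<zero>\<^bsub>V\<^esub> \<in> H" using HE(4)[OF R.zero_closed, of h] HE(1) by auto
  define G where "G = {Y \<in> carrier MM.E. ext2_kernel R M +>\<^bsub>MM.E\<^esub> Y \<in> H}"
  have "submodule G R MM.E"
  proof (rule MM.E.submoduleI)
    show "\<zero>\<^bsub>MM.E\<^esub> \<in> G" using zH by (simp add: G_def ext2_def W.quot_zero)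
  next
    fix a assume a: "a \<in> G"
    then have "\<ominus>\<^bsub>V\<^esub> (ext2_kernel R M +>\<^bsub>MM.E\<^esub> a) \<in> H" using HE(3) by (simp add: G_def)
    then show "\<ominus>\<^bsub>MM.E\<^esub> a \<in> G" using a by (simp add: G_def ext2_def W.quot_minus)
  next
    fix a b assume ab: "a \<in> G" "b \<in> G"
    then have "(ext2_kernel R M +>\<^bsub>MM.E\<^esub> a) \<oplus>\<^bsub>V\<^esub> (ext2_kernel R M +>\<^bsub>MM.E\<^esub> b) \<in> H" using HE(5) by (simp add: G_def)
    then show "a \<oplus>\<^bsub>MM.E\<^esub> b \<in> G" using ab by (simp add: G_def ext2_def W.quot_add)
  next
    fix c a assume ca: "c \<in> carrier R" "a \<in> G"
    then have "c \<odot>\<^bsub>V\<^esub> (ext2_kernel R M +>\<^bsub>MM.E\<^esub> a) \<in> H" using HE(4) by (simp add: G_def)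
    then show "c \<odot>\<^bsub>MM.E\<^esub> a \<in> G" using ca by (simp add: G_def ext2_def W.quot_smult)
  qed (auto simp: G_def)
  moreover have "MM.pt x y \<in> G" if "x \<in> carrier M" "y \<in> carrier M" for x y
    using that wd by (simp add: G_def wd_eq[symmetric])
  moreover obtain Y where "Y \<in> carrier MM.E" "X = ext2_kernel R M +>\<^bsub>MM.E\<^esub> Y"
    using X unfolding ext2_def by (rule W.quot_cases)
  ultimately show ?thesis using MM.tensor_induct[of G Y] by (simp add: G_def)
qed

end

lemma (in bilinear_map) lift_minus: "X \<in> carrier E \<Longrightarrow>
    tensor_lift R Q \<beta> (\<ominus>\<^bsub>E\<^esub> X) = \<ominus>\<^bsub>Q\<^esub> tensor_lift R Q \<beta> X"
  using lift_smult[of X "\<ominus> \<one>"] by (simp add: E.smult_l_minus Q.smult_l_minus lift_closed)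

locale alternating_map = ext_square R M + bilinear_map R M M Q \<beta>
  for R (structure) and M :: "('a, 'b, 'm) module_scheme" and Q :: "('a, 'd, 'q) module_scheme" and \<beta> +
  assumes alt: "x \<in> carrier M \<Longrightarrow> \<beta> x x = \<zero>\<^bsub>Q\<^esub>"
begin

text \<open>The same device as \<open>tensor_lift\<close>, one quotient further:
  \<open>tensor_lift\<close> is constant on cosets of the diagonal submodule because the form is
  alternating.\<close>

definition wlift :: "('b \<times> 'b \<Rightarrow> 'a) set set \<Rightarrow> 'd"
  where "wlift X = the_elem (tensor_lift R Q \<beta> ` X)"

lemma lift_kernel: "k \<in> ext2_kernel R M \<Longrightarrow> tensor_lift R Q \<beta> k = \<zero>\<^bsub>Q\<^esub>"
proof -
  have z: "tensor_lift R Q \<beta> \<zero>\<^bsub>MM.E\<^esub> = \<zero>\<^bsub>Q\<^esub>" using lift_smult[of "\<zero>\<^bsub>MM.E\<^esub>" \<zero>] by (simp add: lift_closed)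
  have mz: "\<ominus>\<^bsub>Q\<^esub> \<zero>\<^bsub>Q\<^esub> = \<zero>\<^bsub>Q\<^esub>" by (rule Q.M.minus_equality) simp_all
  have "submodule {X \<in> carrier MM.E. tensor_lift R Q \<beta> X = \<zero>\<^bsub>Q\<^esub>} R MM.E"
    by (rule MM.E.submoduleI) (auto simp: lift_add lift_smult lift_minus z mz)
  moreover have "{pure_tensor R M M x x | x. x \<in> carrier M} \<subseteq> {X \<in> carrier MM.E. tensor_lift R Q \<beta> X = \<zero>\<^bsub>Q\<^esub>}"
    by (auto simp: lift_pt alt)
  ultimately have "ext2_kernel R M \<subseteq> {X \<in> carrier MM.E. tensor_lift R Q \<beta> X = \<zero>\<^bsub>Q\<^esub>}"
    unfolding ext2_kernel_def by (rule MM.E.mspan_minimal[OF diag_subset])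
  then show "k \<in> ext2_kernel R M \<Longrightarrow> tensor_lift R Q \<beta> k = \<zero>\<^bsub>Q\<^esub>" by blast
qed

lemma wlift_coset:
  assumes c: "c \<in> carrier MM.E" shows "wlift (ext2_kernel R M +>\<^bsub>MM.E\<^esub> c) = tensor_lift R Q \<beta> c"
proof -
  have "tensor_lift R Q \<beta> e = tensor_lift R Q \<beta> c" if "e \<in> ext2_kernel R M +>\<^bsub>MM.E\<^esub> c" for e
  proof -
    note m = W.coset_mem[OF c that]
    have "e \<ominus>\<^bsub>MM.E\<^esub> c \<in> ext2_kernel R M" using m W.coset_eq_iff[OF m(1) c] by simp
    then have "tensor_lift R Q \<beta> e \<ominus>\<^bsub>Q\<^esub> tensor_lift R Q \<beta> c = \<zero>\<^bsub>Q\<^esub>"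
      using lift_kernel[of "e \<ominus>\<^bsub>MM.E\<^esub> c"] m(1) c by (simp add: a_minus_def lift_add lift_minus)
    then show ?thesis using Q.M.diff_eq_zero_iff lift_closed m(1) c by blast
  qed
  then have "tensor_lift R Q \<beta> ` (ext2_kernel R M +>\<^bsub>MM.E\<^esub> c) = {tensor_lift R Q \<beta> c}" using W.coset_self[OF c] by blast
  then show ?thesis unfolding wlift_def by simp
qed

lemma wlift_closed: "X \<in> carrier V \<Longrightarrow> wlift X \<in> carrier Q"
  unfolding ext2_def by (auto elim!: W.quot_cases simp: wlift_coset lift_closed)

lemma wlift_add: "X \<in> carrier V \<Longrightarrow> Y \<in> carrier V \<Longrightarrow> wlift (X \<oplus>\<^bsub>V\<^esub> Y) = wlift X \<oplus>\<^bsub>Q\<^esub> wlift Y"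
  unfolding ext2_def by (auto elim!: W.quot_cases simp: W.quot_add wlift_coset lift_add)

lemma wlift_smult: "X \<in> carrier V \<Longrightarrow> a \<in> carrier R \<Longrightarrow> wlift (a \<odot>\<^bsub>V\<^esub> X) = a \<odot>\<^bsub>Q\<^esub> wlift X"
  unfolding ext2_def by (auto elim!: W.quot_cases simp: W.quot_smult wlift_coset lift_smult)

lemma wlift_wd: "x \<in> carrier M \<Longrightarrow> y \<in> carrier M \<Longrightarrow> wlift (wd x y) = \<beta> x y"
  by (simp add: wd_eq wlift_coset lift_pt)

end

section \<open>Duals of free modules of rank one\<close>

context module
begin

abbreviation "DM \<equiv> dual R M"

lemma dualD:
  assumes "\<phi> \<in> carrier DM"
  shows "x \<in> carrier M \<Longrightarrow> \<phi> x \<in> carrier R"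
    "x \<in> carrier M \<Longrightarrow> y \<in> carrier M \<Longrightarrow> \<phi> (x \<oplus>\<^bsub>M\<^esub> y) = \<phi> x \<oplus> \<phi> y"
    "a \<in> carrier R \<Longrightarrow> x \<in> carrier M \<Longrightarrow> \<phi> (a \<odot>\<^bsub>M\<^esub> x) = a \<otimes> \<phi> x"
    "\<phi> \<in> extensional (carrier M)"
  using assms by (auto simp: dual_def mod_hom_def)

lemma dualI:
  assumes "\<And>x. x \<in> carrier M \<Longrightarrow> \<phi> x \<in> carrier R"
    "\<And>x y. x \<in> carrier M \<Longrightarrow> y \<in> carrier M \<Longrightarrow> \<phi> (x \<oplus>\<^bsub>M\<^esub> y) = \<phi> x \<oplus> \<phi> y"
    "\<And>a x. a \<in> carrier R \<Longrightarrow> x \<in> carrier M \<Longrightarrow> \<phi> (a \<odot>\<^bsub>M\<^esub> x) = a \<otimes> \<phi> x"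
    "\<phi> \<in> extensional (carrier M)"
  shows "\<phi> \<in> carrier DM"
  using assms by (auto simp: dual_def mod_hom_def)

lemma dual_eqI:
  assumes "\<phi> \<in> carrier DM" "\<psi> \<in> carrier DM" "\<And>x. x \<in> carrier M \<Longrightarrow> \<phi> x = \<psi> x"
  shows "\<phi> = \<psi>"
  using extensionalityI[OF dualD(4)[OF assms(1)] dualD(4)[OF assms(2)]] assms(3) by blast

lemma dual_ops:
  "x \<in> carrier M \<Longrightarrow> (\<phi> \<oplus>\<^bsub>DM\<^esub> \<psi>) x = \<phi> x \<oplus> \<psi> x"
  "x \<in> carrier M \<Longrightarrow> (a \<odot>\<^bsub>DM\<^esub> \<phi>) x = a \<otimes> \<phi> x"
  "x \<in> carrier M \<Longrightarrow> \<zero>\<^bsub>DM\<^esub> x = \<zero>"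
  by (simp_all add: dual_def)

lemma dual_closed:
  shows "\<phi> \<in> carrier DM \<Longrightarrow> \<psi> \<in> carrier DM \<Longrightarrow> \<phi> \<oplus>\<^bsub>DM\<^esub> \<psi> \<in> carrier DM"
    and "a \<in> carrier R \<Longrightarrow> \<phi> \<in> carrier DM \<Longrightarrow> a \<odot>\<^bsub>DM\<^esub> \<phi> \<in> carrier DM"
    and "\<zero>\<^bsub>DM\<^esub> \<in> carrier DM"
proof -
  show "\<phi> \<oplus>\<^bsub>DM\<^esub> \<psi> \<in> carrier DM" if "\<phi> \<in> carrier DM" "\<psi> \<in> carrier DM"
    by (rule dualI) (use dualD[OF that(1)] dualD[OF that(2)] in
      \<open>simp_all add: dual_ops R.r_distr R.a_ac\<close>, simp add: dual_def)
  show "a \<odot>\<^bsub>DM\<^esub> \<phi> \<in> carrier DM" if "a \<in> carrier R" "\<phi> \<in> carrier DM"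
    by (rule dualI) (use that(1) dualD[OF that(2)] in
      \<open>simp_all add: dual_ops R.r_distr R.m_ac\<close>, simp add: dual_def)
  show "\<zero>\<^bsub>DM\<^esub> \<in> carrier DM"
    by (rule dualI) (simp_all add: dual_ops, simp add: dual_def)
qed

lemma dual_module: "module R DM"
proof -
  have ab: "abelian_group DM"
  proof (rule abelian_groupI)
    fix \<phi> assume p: "\<phi> \<in> carrier DM"
    then have n: "(\<ominus> \<one>) \<odot>\<^bsub>DM\<^esub> \<phi> \<in> carrier DM" by (intro dual_closed) auto
    show "\<exists>\<psi>\<in>carrier DM. \<psi> \<oplus>\<^bsub>DM\<^esub> \<phi> = \<zero>\<^bsub>DM\<^esub>"
    proof (intro bexI[OF _ n] dual_eqI)
      fix x assume "x \<in> carrier M"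
      then show "((\<ominus> \<one>) \<odot>\<^bsub>DM\<^esub> \<phi> \<oplus>\<^bsub>DM\<^esub> \<phi>) x = \<zero>\<^bsub>DM\<^esub> x"
        using dualD(1)[OF p] by (simp add: dual_ops R.l_minus R.l_neg)
    qed (use p n in \<open>auto intro: dual_closed\<close>)
  next
    fix \<phi> \<psi> \<chi> assume p: "\<phi> \<in> carrier DM" "\<psi> \<in> carrier DM" "\<chi> \<in> carrier DM"
    show "\<phi> \<oplus>\<^bsub>DM\<^esub> \<psi> \<oplus>\<^bsub>DM\<^esub> \<chi> = \<phi> \<oplus>\<^bsub>DM\<^esub> (\<psi> \<oplus>\<^bsub>DM\<^esub> \<chi>)"
      by (rule dual_eqI) (use p dualD(1) in \<open>auto intro!: dual_closed simp: dual_ops R.a_assoc\<close>)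
  next
    fix \<phi> \<psi> assume p: "\<phi> \<in> carrier DM" "\<psi> \<in> carrier DM"
    show "\<phi> \<oplus>\<^bsub>DM\<^esub> \<psi> = \<psi> \<oplus>\<^bsub>DM\<^esub> \<phi>"
      by (rule dual_eqI) (use p dualD(1) in \<open>auto intro!: dual_closed simp: dual_ops R.a_comm\<close>)
  next
    fix \<phi> assume p: "\<phi> \<in> carrier DM"
    show "\<zero>\<^bsub>DM\<^esub> \<oplus>\<^bsub>DM\<^esub> \<phi> = \<phi>"
      by (rule dual_eqI) (use p dualD(1) in \<open>auto intro!: dual_closed simp: dual_ops\<close>)
  qed (auto intro: dual_closed)
  show ?thesis
  proof (rule moduleI[OF R.is_cring ab])
    fix a b \<phi> assume p: "a \<in> carrier R" "b \<in> carrier R" "\<phi> \<in> carrier DM"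
    show "(a \<oplus> b) \<odot>\<^bsub>DM\<^esub> \<phi> = a \<odot>\<^bsub>DM\<^esub> \<phi> \<oplus>\<^bsub>DM\<^esub> b \<odot>\<^bsub>DM\<^esub> \<phi>"
      by (rule dual_eqI) (use p dualD(1) in \<open>auto intro!: dual_closed simp: dual_ops R.l_distr\<close>)
    show "a \<otimes> b \<odot>\<^bsub>DM\<^esub> \<phi> = a \<odot>\<^bsub>DM\<^esub> (b \<odot>\<^bsub>DM\<^esub> \<phi>)"
      by (rule dual_eqI) (use p dualD(1) in \<open>auto intro!: dual_closed simp: dual_ops R.m_assoc\<close>)
  next
    fix a \<phi> \<psi> assume p: "a \<in> carrier R" "\<phi> \<in> carrier DM" "\<psi> \<in> carrier DM"
    show "a \<odot>\<^bsub>DM\<^esub> (\<phi> \<oplus>\<^bsub>DM\<^esub> \<psi>) = a \<odot>\<^bsub>DM\<^esub> \<phi> \<oplus>\<^bsub>DM\<^esub> a \<odot>\<^bsub>DM\<^esub> \<psi>"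
      by (rule dual_eqI) (use p dualD(1) in \<open>auto intro!: dual_closed simp: dual_ops R.r_distr\<close>)
  next
    fix \<phi> assume p: "\<phi> \<in> carrier DM"
    show "\<one> \<odot>\<^bsub>DM\<^esub> \<phi> = \<phi>"
      by (rule dual_eqI) (use p dualD(1) in \<open>auto intro!: dual_closed simp: dual_ops\<close>)
  qed (auto intro: dual_closed)
qed

lemma dual_two_modules: "two_modules R DM DM"
  by (rule two_modules.intro) (rule dual_module)+

lemma dual_eval_bilinear:
  assumes "x \<in> carrier M" "y \<in> carrier M"
  shows "bilinear_map R DM DM (reg R) (\<lambda>\<phi> \<psi>. \<phi> x \<otimes> \<psi> y)"
proof (intro bilinear_map.intro dual_two_modules bilinear_map_axioms.intro)
  show "module R (reg R)" using R.assoc_algebra_reg by (simp add: assoc_algebra_def)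
qed (use assms in \<open>simp_all add: dual_ops dualD(1) R.l_distr R.r_distr R.m_ac\<close>)

end

locale module_map = L: module R L + L': module R L'
  for R (structure) and L :: "('a, 'b) module" and L' :: "('a, 'c) module" +
  fixes f assumes f: "f \<in> mod_hom R L L'"
begin

lemma f_closed [simp]: "x \<in> carrier L \<Longrightarrow> f x \<in> carrier L'"
  using f by (auto simp: mod_hom_def)

lemma dual_map_closed:
  assumes "\<phi> \<in> carrier L'.DM" shows "dual_map L f \<phi> \<in> carrier L.DM"
  by (rule L.dualI) (use L'.dualD[OF assms] f in \<open>auto simp: dual_map_def mod_hom_def\<close>)

lemma dual_map_add:
  assumes "\<phi> \<in> carrier L'.DM" "\<psi> \<in> carrier L'.DM"
  shows "dual_map L f (\<phi> \<oplus>\<^bsub>L'.DM\<^esub> \<psi>) = dual_map L f \<phi> \<oplus>\<^bsub>L.DM\<^esub> dual_map L f \<psi>"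
  by (rule L.dual_eqI)
    (use assms in \<open>auto intro!: dual_map_closed L.dual_closed L'.dual_closed simp: L.dual_ops\<close>,
      simp add: dual_map_def L'.dual_ops)

lemma dual_map_smult:
  assumes "a \<in> carrier R" "\<phi> \<in> carrier L'.DM"
  shows "dual_map L f (a \<odot>\<^bsub>L'.DM\<^esub> \<phi>) = a \<odot>\<^bsub>L.DM\<^esub> dual_map L f \<phi>"
  by (rule L.dual_eqI)
    (use assms in \<open>auto intro!: dual_map_closed L.dual_closed L'.dual_closed simp: L.dual_ops\<close>,
      simp add: dual_map_def L'.dual_ops)

text \<open>Serves to pull back a discriminant that is given as a scalar times a pure tensor, such
  as \<open>line_disc\<close>.\<close>

lemma dual_sq_map_pure:
  assumes "c \<in> carrier R" "\<phi> \<in> carrier L'.DM" "\<psi> \<in> carrier L'.DM"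
  shows "dual_sq_map R L f (c \<odot>\<^bsub>tensor R L'.DM L'.DM\<^esub> pure_tensor R L'.DM L'.DM \<phi> \<psi>) =
    c \<odot>\<^bsub>tensor R L.DM L.DM\<^esub> pure_tensor R L.DM L.DM (dual_map L f \<phi>) (dual_map L f \<psi>)"
proof -
  interpret T: two_modules R L.DM L.DM by (rule L.dual_two_modules)
  interpret T': two_modules R L'.DM L'.DM by (rule L'.dual_two_modules)
  interpret B: bilinear_map R L'.DM L'.DM T.E "\<lambda>\<phi> \<psi>. T.pt (dual_map L f \<phi>) (dual_map L f \<psi>)"
    by (intro bilinear_map.intro L'.dual_two_modules T.E.module_axioms bilinear_map_axioms.intro)
      (simp_all add: dual_map_closed dual_map_add dual_map_smult T.pt_add_l T.pt_add_r T.pt_smult_l T.pt_smult_r)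
  show ?thesis unfolding dual_sq_map_def using assms by (simp add: B.lift_smult B.lift_pt)
qed

end

text \<open>A free module of rank one with basis vector l0 and coordinate g. In this form the
  exterior square inherits its basis from R along an isomorphism of discriminants.\<close>

locale line = module R L for R (structure) and L :: "('a, 'b) module" +
  fixes g l0
  assumes g: "g \<in> carrier DM" and l0: "l0 \<in> carrier L" "g l0 = \<one>"
    and span: "l \<in> carrier L \<Longrightarrow> l = g l \<odot>\<^bsub>L\<^esub> l0"
begin

sublocale D: two_modules R DM DM by (rule dual_two_modules)

lemma dual_gen: "\<phi> \<in> carrier DM \<Longrightarrow> \<phi> = \<phi> l0 \<odot>\<^bsub>DM\<^esub> g"
proof (rule dual_eqI)
  fix l assume p: "\<phi> \<in> carrier DM" and l: "l \<in> carrier L"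
  have "\<phi> l = \<phi> (g l \<odot>\<^bsub>L\<^esub> l0)" using span[OF l] by simp
  also have "\<dots> = g l \<otimes> \<phi> l0" using dualD[OF p] dualD[OF g] l l0 by simp
  finally show "\<phi> l = (\<phi> l0 \<odot>\<^bsub>DM\<^esub> g) l" using dualD[OF p] dualD[OF g] l l0 by (simp add: dual_ops R.m_comm)
qed (use l0 dualD g dual_closed in auto)

text \<open>Each functional is its value at l0 times g, so a pure tensor of two functionals is a
  scalar multiple of the square of g.\<close>

lemma dual_sq_gen:
  assumes "\<delta> \<in> carrier D.E"
  obtains c where "c \<in> carrier R" "\<delta> = c \<odot>\<^bsub>D.E\<^esub> D.pt g g"
proof -
  define H where "H = {c \<odot>\<^bsub>D.E\<^esub> D.pt g g | c. c \<in> carrier R}"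
  have gg: "D.pt g g \<in> carrier D.E" using g by simp
  have I: "c \<odot>\<^bsub>D.E\<^esub> D.pt g g \<in> H" if "c \<in> carrier R" for c using that by (auto simp: H_def)
  have "submodule H R D.E"
  proof (rule D.E.submoduleI)
    show "H \<subseteq> carrier D.E" using gg by (auto simp: H_def)
    show "\<zero>\<^bsub>D.E\<^esub> \<in> H" using I[of \<zero>] gg by simp
  next
    fix a assume "a \<in> H"
    then obtain c where "c \<in> carrier R" "a = c \<odot>\<^bsub>D.E\<^esub> D.pt g g" by (auto simp: H_def)
    then show "\<ominus>\<^bsub>D.E\<^esub> a \<in> H" using I[of "\<ominus> c"] gg by (simp add: D.E.smult_l_minus)
  next
    fix a b assume "a \<in> H" "b \<in> H"
    then obtain c d where "c \<in> carrier R" "a = c \<odot>\<^bsub>D.E\<^esub> D.pt g g" "d \<in> carrier R" "b = d \<odot>\<^bsub>D.E\<^esub> D.pt g g"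
      by (auto simp: H_def)
    then show "a \<oplus>\<^bsub>D.E\<^esub> b \<in> H" using I[of "c \<oplus> d"] gg by (simp add: D.E.smult_l_distr)
  next
    fix a b assume "a \<in> carrier R" "b \<in> H"
    then obtain c where "c \<in> carrier R" "b = c \<odot>\<^bsub>D.E\<^esub> D.pt g g" by (auto simp: H_def)
    then show "a \<odot>\<^bsub>D.E\<^esub> b \<in> H" using I[of "a \<otimes> c"] gg \<open>a \<in> carrier R\<close> by (simp add: D.E.smult_assoc1)
  qed
  moreover have "D.pt \<phi> \<psi> \<in> H" if "\<phi> \<in> carrier DM" "\<psi> \<in> carrier DM" for \<phi> \<psi>
  proof -
    have c: "\<phi> l0 \<in> carrier R" "\<psi> l0 \<in> carrier R" using that l0 dualD(1) by blast+
    have "D.pt \<phi> \<psi> = D.pt (\<phi> l0 \<odot>\<^bsub>DM\<^esub> g) (\<psi> l0 \<odot>\<^bsub>DM\<^esub> g)"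
      using dual_gen[OF that(1)] dual_gen[OF that(2)] by simp
    also have "\<dots> = (\<phi> l0 \<otimes> \<psi> l0) \<odot>\<^bsub>D.E\<^esub> D.pt g g"
      using c g dual_closed(2) gg
      by (simp add: D.pt_smult_l D.pt_smult_r D.E.smult_assoc1[symmetric] R.m_comm)
    finally show ?thesis using I c by simp
  qed
  ultimately have "\<delta> \<in> H" using D.tensor_induct assms by blast
  then show ?thesis using that by (auto simp: H_def)
qed

lemma dual_sq_eval_gen:
  assumes "c \<in> carrier R" "x \<in> carrier L" "y \<in> carrier L"
  shows "dual_sq_eval R (c \<odot>\<^bsub>D.E\<^esub> D.pt g g) x y = c \<otimes> (g x \<otimes> g y)"
proof -
  interpret B: bilinear_map R DM DM "reg R" "\<lambda>\<phi> \<psi>. \<phi> x \<otimes> \<psi> y"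
    by (rule dual_eval_bilinear[OF assms(2,3)])
  show ?thesis unfolding dual_sq_eval_def using assms g by (simp add: B.lift_smult B.lift_pt)
qed

end

section \<open>The discriminant form\<close>

text \<open>The product in question is the value of the discriminant form at the pair of wedges of 1
  with u and of 1 with v, so it is d times a product of coordinates. To read this off
  \<open>disc_elem\<close>, the \<open>THE\<close> in its definition has to be justified: a
  candidate must exist and be unique.\<close>

lemma (in quadratic) disc_elem_line:
  assumes line: "line R (ext2 R M) g l0" and d: "d \<in> carrier R"
    and de: "disc_elem R M = d \<odot>\<^bsub>tensor R (dual R (ext2 R M)) (dual R (ext2 R M))\<^esub>
      pure_tensor R (dual R (ext2 R M)) (dual R (ext2 R M)) g g"
    and u: "u \<in> carrier M" and v: "v \<in> carrier M"
  obtains c where "c \<in> carrier R" "(u \<ominus>\<^bsub>M\<^esub> \<sigma> u) \<otimes>\<^bsub>M\<^esub> (v \<ominus>\<^bsub>M\<^esub> \<sigma> v) = (d \<otimes> c) \<odot>\<^bsub>M\<^esub> \<one>\<^bsub>M\<^esub>"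
proof -
  interpret CM: cring M by (rule M_cring)
  interpret X: ext_square R M by (rule ext_square.intro) (rule module_axioms)
  interpret V: line R X.V g l0 by (rule line)
  define b where "b x y = x \<otimes>\<^bsub>M\<^esub> \<sigma> y \<ominus>\<^bsub>M\<^esub> \<sigma> x \<otimes>\<^bsub>M\<^esub> y" for x y
  have bc: "b x y \<in> carrier M" if "x \<in> carrier M" "y \<in> carrier M" for x y using that by (simp add: b_def)
  interpret A: alternating_map R M M b
  proof (intro alternating_map.intro bilinear_map.intro two_modules.intro X.ext_square_axioms module_axioms
      bilinear_map_axioms.intro alternating_map_axioms.intro)
    fix x x' y assume x: "x \<in> carrier M" "x' \<in> carrier M" "y \<in> carrier M"
    show "b (x \<oplus>\<^bsub>M\<^esub> x') y = b x y \<oplus>\<^bsub>M\<^esub> b x' y"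
      using x by (simp add: b_def \<sigma>_add a_minus_def l_distr M.minus_add M.a_ac)
    show "b y (x \<oplus>\<^bsub>M\<^esub> x') = b y x \<oplus>\<^bsub>M\<^esub> b y x'"
      using x by (simp add: b_def \<sigma>_add a_minus_def r_distr M.minus_add M.a_ac)
  next
    fix a x y assume x: "a \<in> carrier R" "x \<in> carrier M" "y \<in> carrier M"
    show "b (a \<odot>\<^bsub>M\<^esub> x) y = a \<odot>\<^bsub>M\<^esub> b x y" "b x (a \<odot>\<^bsub>M\<^esub> y) = a \<odot>\<^bsub>M\<^esub> b x y"
      using x by (simp_all add: b_def \<sigma>_smult a_minus_def smult_mult_left smult_mult_right
          smult_r_distr smult_r_minus)
  qed (simp_all add: b_def comm a_minus_def M.r_neg)
  \<comment> \<open>The form b factors through the exterior square, a line, so it is the coordinate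
    g times its value e at l0.\<close>
  define e where "e = A.wlift l0"
  have e: "e \<in> carrier M" using V.l0 A.wlift_closed by (simp add: e_def)
  have be: "b x y = g (X.wd x y) \<odot>\<^bsub>M\<^esub> e" if "x \<in> carrier M" "y \<in> carrier M" for x y
  proof -
    have w: "X.wd x y \<in> carrier X.V" using that by simp
    have "b x y = A.wlift (g (X.wd x y) \<odot>\<^bsub>X.V\<^esub> l0)"
      using A.wlift_wd[OF that] V.span[OF w] by simp
    then show ?thesis using X.V.dualD(1)[OF V.g w] V.l0 by (simp add: A.wlift_smult e_def)
  qed
  have gc: "g (X.wd x y) \<in> carrier R" if "x \<in> carrier M" "y \<in> carrier M" for x y
    using that X.V.dualD(1)[OF V.g] by simp
  \<comment> \<open>The values of b change sign under \<sigma>. Hence \<sigma> e = -e, and e^2 =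
    -N(e) is a scalar: it is the coefficient of the discriminant form.\<close>
  have sw: "\<sigma> (A.wlift l) = \<ominus>\<^bsub>M\<^esub> A.wlift l" if "l \<in> carrier X.V" for l
  proof -
    have z: "A.wlift \<zero>\<^bsub>X.V\<^esub> = \<zero>\<^bsub>M\<^esub>" using A.wlift_smult[of "\<zero>\<^bsub>X.V\<^esub>" \<zero>] by (simp add: A.wlift_closed)
    have mi: "A.wlift (\<ominus>\<^bsub>X.V\<^esub> a) = \<ominus>\<^bsub>M\<^esub> A.wlift a" if "a \<in> carrier X.V" for a
      using A.wlift_smult[of a "\<ominus> \<one>"] that by (simp add: X.V.smult_l_minus smult_l_minus A.wlift_closed)
    have s0: "\<sigma> \<zero>\<^bsub>M\<^esub> = \<zero>\<^bsub>M\<^esub>" using \<sigma>_smult[of \<zero> "\<zero>\<^bsub>M\<^esub>"] by simp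
    have "submodule {l \<in> carrier X.V. \<sigma> (A.wlift l) = \<ominus>\<^bsub>M\<^esub> A.wlift l} R X.V"
      by (rule X.V.submoduleI)
        (auto simp: z mi s0 A.wlift_add A.wlift_smult A.wlift_closed \<sigma>_add \<sigma>_smult \<sigma>_minus M.minus_add M.a_comm smult_r_minus)
    moreover have "X.wd x y \<in> {l \<in> carrier X.V. \<sigma> (A.wlift l) = \<ominus>\<^bsub>M\<^esub> A.wlift l}"
      if "x \<in> carrier M" "y \<in> carrier M" for x y
      using that by (simp add: A.wlift_wd b_def \<sigma>_diff \<sigma>_mult \<sigma>_\<sigma>) (simp add: a_minus_def M.minus_add M.a_comm)
    ultimately show ?thesis using X.wd_induct that by blast
  qed
  obtain r where r: "r \<in> carrier R" "e \<otimes>\<^bsub>M\<^esub> \<sigma> e = r \<odot>\<^bsub>M\<^esub> \<one>\<^bsub>M\<^esub>" using \<sigma>_norm[OF e] by blast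
  have ee: "e \<otimes>\<^bsub>M\<^esub> e = (\<ominus> r) \<odot>\<^bsub>M\<^esub> \<one>\<^bsub>M\<^esub>"
  proof -
    have "\<ominus>\<^bsub>M\<^esub> (e \<otimes>\<^bsub>M\<^esub> e) = r \<odot>\<^bsub>M\<^esub> \<one>\<^bsub>M\<^esub>"
      using r(2) sw[OF V.l0(1)] e by (simp add: e_def[symmetric] r_minus)
    then have "e \<otimes>\<^bsub>M\<^esub> e = \<ominus>\<^bsub>M\<^esub> (r \<odot>\<^bsub>M\<^esub> \<one>\<^bsub>M\<^esub>)"
      using e M.minus_minus[of "e \<otimes>\<^bsub>M\<^esub> e"] by simp
    then show ?thesis using r by (simp add: smult_l_minus)
  qed
  define P where "P \<delta> \<longleftrightarrow> \<delta> \<in> carrier V.D.E \<and>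
      (\<forall>x\<in>carrier M. \<forall>y\<in>carrier M. \<forall>z\<in>carrier M. \<forall>w\<in>carrier M.
        dual_sq_eval R \<delta> (X.wd x y) (X.wd z w) \<odot>\<^bsub>M\<^esub> \<one>\<^bsub>M\<^esub> = b x y \<otimes>\<^bsub>M\<^esub> b z w)" for \<delta>
  have dP: "disc_elem R M = (THE \<delta>. P \<delta>)"
    unfolding disc_elem_def Let_def P_def b_def ..
  have gg: "V.D.pt g g \<in> carrier V.D.E" using V.g by simp
  have P1: "P ((\<ominus> r) \<odot>\<^bsub>V.D.E\<^esub> V.D.pt g g)"
    unfolding P_def
  proof (intro conjI ballI)
    fix x y z w assume x: "x \<in> carrier M" "y \<in> carrier M" "z \<in> carrier M" "w \<in> carrier M"
    have "b x y \<otimes>\<^bsub>M\<^esub> b z w = (g (X.wd x y) \<otimes> g (X.wd z w)) \<odot>\<^bsub>M\<^esub> (e \<otimes>\<^bsub>M\<^esub> e)"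
      using be[OF x(1,2)] be[OF x(3,4)] gc[OF x(1,2)] gc[OF x(3,4)] e
      by (simp add: smult_mult_left smult_mult_right smult_assoc1[symmetric] R.m_comm)
    also have "\<dots> = (\<ominus> r \<otimes> (g (X.wd x y) \<otimes> g (X.wd z w))) \<odot>\<^bsub>M\<^esub> \<one>\<^bsub>M\<^esub>"
      unfolding ee using gc[OF x(1,2)] gc[OF x(3,4)] r by (simp add: smult_assoc1[symmetric] R.m_ac)
    finally show "dual_sq_eval R ((\<ominus> r) \<odot>\<^bsub>V.D.E\<^esub> V.D.pt g g) (X.wd x y) (X.wd z w) \<odot>\<^bsub>M\<^esub> \<one>\<^bsub>M\<^esub> = b x y \<otimes>\<^bsub>M\<^esub> b z w"
      using x r by (simp add: V.dual_sq_eval_gen)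
  qed (use r gg in simp)
  \<comment> \<open>Two candidates differ by a multiple a of the square of g that vanishes on all
    pairs of wedges. Wedges span and g takes the value 1 at l0; using this once in each argument
    gives a = 0.\<close>
  have P2: "\<delta> = \<delta>'" if "P \<delta>" "P \<delta>'" for \<delta> \<delta>'
  proof -
    obtain c where c: "c \<in> carrier R" "\<delta> = c \<odot>\<^bsub>V.D.E\<^esub> V.D.pt g g" using V.dual_sq_gen[of \<delta>] \<open>P \<delta>\<close> unfolding P_def by blast
    obtain c' where c': "c' \<in> carrier R" "\<delta>' = c' \<odot>\<^bsub>V.D.E\<^esub> V.D.pt g g" using V.dual_sq_gen[of \<delta>'] \<open>P \<delta>'\<close> unfolding P_def by blast
    define a where "a = c \<ominus> c'"
    have a: "a \<in> carrier R" using c c' by (simp add: a_def)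
    have 0: "a \<otimes> (g (X.wd x y) \<otimes> g (X.wd z w)) = \<zero>"
      if x: "x \<in> carrier M" "y \<in> carrier M" "z \<in> carrier M" "w \<in> carrier M" for x y z w
    proof (rule one_faithful)
      define q where "q = g (X.wd x y) \<otimes> g (X.wd z w)"
      have q: "q \<in> carrier R" using gc x by (simp add: q_def)
      have "(c \<otimes> q) \<odot>\<^bsub>M\<^esub> \<one>\<^bsub>M\<^esub> = (c' \<otimes> q) \<odot>\<^bsub>M\<^esub> \<one>\<^bsub>M\<^esub>"
        using \<open>P \<delta>\<close> \<open>P \<delta>'\<close> x c c' unfolding P_def by (simp add: V.dual_sq_eval_gen q_def)
      then have "(a \<otimes> q) \<odot>\<^bsub>M\<^esub> \<one>\<^bsub>M\<^esub> = \<zero>\<^bsub>M\<^esub>"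
        using c c' q by (simp add: a_def a_minus_def R.l_distr R.l_minus smult_l_distr smult_l_minus M.r_neg)
      then show "(a \<otimes> (g (X.wd x y) \<otimes> g (X.wd z w))) \<odot>\<^bsub>M\<^esub> \<one>\<^bsub>M\<^esub> = \<zero>\<^bsub>M\<^esub>" by (simp add: q_def)
    qed (use a gc x in auto)
    \<comment> \<open>The vectors l with k g(l) = 0 form a submodule, so it is enough to test
      wedges.\<close>
    have gk: "k \<otimes> g l = \<zero>" if k: "k \<in> carrier R" and kw: "\<And>x y. x \<in> carrier M \<Longrightarrow> y \<in> carrier M \<Longrightarrow> k \<otimes> g (X.wd x y) = \<zero>"
      and l: "l \<in> carrier X.V" for k l
    proof -
      note gd = X.V.dualD[OF V.g]
      have gz: "g \<zero>\<^bsub>X.V\<^esub> = \<zero>" using gd(1)[of "\<zero>\<^bsub>X.V\<^esub>"] gd(3)[of \<zero> "\<zero>\<^bsub>X.V\<^esub>"] by simp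
      have gm: "g (\<ominus>\<^bsub>X.V\<^esub> a) = \<ominus> g a" if "a \<in> carrier X.V" for a
        using gd(3)[of "\<ominus> \<one>" a] gd(1)[OF that] that by (simp add: X.V.smult_l_minus R.l_minus)
      have "submodule {l \<in> carrier X.V. k \<otimes> g l = \<zero>} R X.V"
      proof (rule X.V.submoduleI)
        fix a x assume "a \<in> carrier R" "x \<in> {l \<in> carrier X.V. k \<otimes> g l = \<zero>}"
        moreover from this have "k \<otimes> (a \<otimes> g x) = a \<otimes> (k \<otimes> g x)" using k gd(1) by (simp add: R.m_ac)
        ultimately show "a \<odot>\<^bsub>X.V\<^esub> x \<in> {l \<in> carrier X.V. k \<otimes> g l = \<zero>}" by (simp add: gd)
      qed (use k in \<open>auto simp: gz gm gd R.r_distr R.r_minus\<close>)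
      moreover have "X.wd x y \<in> {l \<in> carrier X.V. k \<otimes> g l = \<zero>}" if "x \<in> carrier M" "y \<in> carrier M" for x y
        using that kw by simp
      ultimately show ?thesis using X.wd_induct l by blast
    qed
    have 1: "a \<otimes> g (X.wd x y) = \<zero>" if x: "x \<in> carrier M" "y \<in> carrier M" for x y
    proof -
      have "(a \<otimes> g (X.wd x y)) \<otimes> g l0 = \<zero>"
      proof (rule gk)
        fix z w assume z: "z \<in> carrier M" "w \<in> carrier M"
        show "(a \<otimes> g (X.wd x y)) \<otimes> g (X.wd z w) = \<zero>" using 0[OF x z] a gc[OF x] gc[OF z] by (simp add: R.m_assoc)
      qed (use a gc[OF x] V.l0(1) in simp_all)
      then show ?thesis using a gc[OF x] V.l0(2) by simp
    qed
    have "a \<otimes> g l0 = \<zero>" by (rule gk[OF a 1 V.l0(1)])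
    then have "a = \<zero>" using a V.l0(2) by simp
    then have "c = c'" using R.diff_eq_zero_iff[OF c(1) c'(1)] by (simp add: a_def)
    then show ?thesis using c c' by simp
  qed
  have "P (disc_elem R M)" unfolding dP by (rule theI[of P, OF P1]) (rule P2[OF _ P1])
  \<comment> \<open>Evaluation at wedges with first factor 1, where b(1, u) = \<sigma> u -
    u.\<close>
  then have "dual_sq_eval R (d \<odot>\<^bsub>V.D.E\<^esub> V.D.pt g g) (X.wd \<one>\<^bsub>M\<^esub> u) (X.wd \<one>\<^bsub>M\<^esub> v) \<odot>\<^bsub>M\<^esub> \<one>\<^bsub>M\<^esub> =
      b \<one>\<^bsub>M\<^esub> u \<otimes>\<^bsub>M\<^esub> b \<one>\<^bsub>M\<^esub> v"
    using u v unfolding de P_def by simp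
  then have "(d \<otimes> (g (X.wd \<one>\<^bsub>M\<^esub> u) \<otimes> g (X.wd \<one>\<^bsub>M\<^esub> v))) \<odot>\<^bsub>M\<^esub> \<one>\<^bsub>M\<^esub> = (\<sigma> u \<ominus>\<^bsub>M\<^esub> u) \<otimes>\<^bsub>M\<^esub> (\<sigma> v \<ominus>\<^bsub>M\<^esub> v)"
    using u v d by (simp add: V.dual_sq_eval_gen b_def \<sigma>_one)
  also have "\<dots> = (u \<ominus>\<^bsub>M\<^esub> \<sigma> u) \<otimes>\<^bsub>M\<^esub> (v \<ominus>\<^bsub>M\<^esub> \<sigma> v)"
  proof -
    define U Y where "U = \<sigma> u" and "Y = \<sigma> v"
    have UY: "U \<in> carrier M" "Y \<in> carrier M" using u v by (simp_all add: U_def Y_def)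
    show ?thesis unfolding U_def[symmetric] Y_def[symmetric] using u v UY by algebra
  qed
  finally show ?thesis using that[of "g (X.wd \<one>\<^bsub>M\<^esub> u) \<otimes> g (X.wd \<one>\<^bsub>M\<^esub> v)"] gc u v by simp
qed

text \<open>\<open>R\<close> itself, with carrier in \<^typ>\<open>'a list\<close>; it represents the class \<open>dR\<^sup>\<times>\<^sup>2\<close>.\<close>

definition line_list :: "('a, 'r) ring_scheme \<Rightarrow> ('a, 'a list) module"
  where "line_list R = \<lparr>carrier = {[r] | r. r \<in> carrier R}, mult = undefined, one = undefined,
    zero = [\<zero>\<^bsub>R\<^esub>], add = (\<lambda>X Y. [X ! 0 \<oplus>\<^bsub>R\<^esub> Y ! 0]), smult = (\<lambda>a X. [a \<otimes>\<^bsub>R\<^esub> X ! 0])\<rparr>"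

context cring
begin

lemma line_list_simps:
  "carrier (line_list R) = {[r] | r. r \<in> carrier R}" "\<zero>\<^bsub>line_list R\<^esub> = [\<zero>]"
  "[a] \<oplus>\<^bsub>line_list R\<^esub> [b] = [a \<oplus> b]" "c \<odot>\<^bsub>line_list R\<^esub> [a] = [c \<otimes> a]"
  by (simp_all add: line_list_def)

lemma line_list_module: "module R (line_list R)"
proof (rule moduleI[OF is_cring])
  show "abelian_group (line_list R)"
  proof (rule abelian_groupI)
    fix x assume "x \<in> carrier (line_list R)"
    then obtain r where "r \<in> carrier R" "x = [r]" by (auto simp: line_list_simps)
    then show "\<exists>y\<in>carrier (line_list R). y \<oplus>\<^bsub>line_list R\<^esub> x = \<zero>\<^bsub>line_list R\<^esub>"
      by (intro bexI[of _ "[\<ominus> r]"]) (auto simp: line_list_simps l_neg)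
  qed (auto simp: line_list_simps a_ac)
qed (auto simp: line_list_simps l_distr r_distr m_assoc)

definition line_coord :: "'a list \<Rightarrow> 'a" where "line_coord = (\<lambda>x\<in>carrier (line_list R). x ! 0)"

lemma line_coord_dual: "line_coord \<in> carrier (dual R (line_list R))"
proof -
  interpret L: module R "line_list R" by (rule line_list_module)
  show ?thesis
    by (rule L.dualI) (auto simp: line_coord_def line_list_simps)
qed

text \<open>\<open>locally_free\<close> looks at localizations only, so even this free module is
  treated through fractions, with denominators the powers of 1.\<close>

lemma line_list_locally_free: "locally_free R (line_list R) 1"
  unfolding locally_free_def
proof (intro exI[of _ "{\<one>}"] conjI trivial_cover ballI)
  fix f assume "f \<in> {\<one>}"
  define W where "W = powers R f"
  interpret L: module R "line_list R" by (rule line_list_module)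
  interpret W: mult_set R W unfolding W_def using \<open>f \<in> {\<one>}\<close> by (intro powers_mult_set) auto
  interpret LL: loc_module R "line_list R" W
    by (intro loc_module.intro L.module_axioms W.mult_set_axioms)
  interpret Re: loc_quad R "reg R" W by (rule W.loc_quad_reg)
  interpret LM: module LL.LR LL.LM by (rule LL.loc_is_module)
  have e: "LL.fr [\<one>] \<one> \<in> carrier LL.LM" by (rule LL.frac_closed) (auto simp: line_list_simps)
  have one: "{..<1::nat} = {0}" by auto
  have sum: "(\<Oplus>\<^bsub>LL.LM\<^esub>i \<in> {..<1}. c i \<odot>\<^bsub>LL.LM\<^esub> LL.fr [\<one>] \<one>) = c 0 \<odot>\<^bsub>LL.LM\<^esub> LL.fr [\<one>] \<one>"
    if "c (0::nat) \<in> carrier LL.LR" for c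
    unfolding one using that e by simp
  have sc: "LL.rf r s \<odot>\<^bsub>LL.LM\<^esub> LL.fr [\<one>] \<one> = LL.fr [r] s" if "r \<in> carrier R" "s \<in> W" for r s
    using that LL.smult_frac[of r s "[\<one>]" \<one>] by (simp add: line_list_simps)
  show "free_of_rank (loc_ring R (powers R f)) (loc R (powers R f) (line_list R)) 1"
    unfolding W_def[symmetric] free_of_rank_def
  proof (intro bexI[of _ "\<lambda>_. LL.fr [\<one>] \<one>"] ballI)
    fix X assume "X \<in> carrier LL.LM"
    then obtain x s where x: "x \<in> carrier (line_list R)" "s \<in> W" "X = LL.fr x s" by (rule LL.loc_cases)
    then obtain r where r: "r \<in> carrier R" "x = [r]" by (auto simp: line_list_simps)
    have rc: "LL.rf r s \<in> carrier LL.LR" using r x by (simp add: Re.rf_closed)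
    show "\<exists>!c. c \<in> {..<1::nat} \<rightarrow>\<^sub>E carrier LL.LR \<and> X = (\<Oplus>\<^bsub>LL.LM\<^esub>i \<in> {..<1}. c i \<odot>\<^bsub>LL.LM\<^esub> LL.fr [\<one>] \<one>)"
    proof (rule ex1I[of _ "\<lambda>i\<in>{..<1::nat}. LL.rf r s"])
      show "(\<lambda>i\<in>{..<1::nat}. LL.rf r s) \<in> {..<1} \<rightarrow>\<^sub>E carrier LL.LR \<and>
          X = (\<Oplus>\<^bsub>LL.LM\<^esub>i \<in> {..<1}. (\<lambda>i\<in>{..<1::nat}. LL.rf r s) i \<odot>\<^bsub>LL.LM\<^esub> LL.fr [\<one>] \<one>)"
        using rc x r by (subst sum) (auto simp: sc)
    next
      fix c assume c: "c \<in> {..<1::nat} \<rightarrow>\<^sub>E carrier LL.LR \<and> X = (\<Oplus>\<^bsub>LL.LM\<^esub>i \<in> {..<1}. c i \<odot>\<^bsub>LL.LM\<^esub> LL.fr [\<one>] \<one>)"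
      then have c0: "c 0 \<in> carrier LL.LR" using PiE_mem[of c "{..<1}" "\<lambda>_. carrier LL.LR" 0] by simp
      then obtain a t where a: "a \<in> carrier R" "t \<in> W" "c 0 = LL.rf a t"
        by (rule Re.loc_cases) auto
      have "LL.fr [r] s = LL.fr [a] t" using c sum[of c, OF c0] x r a sc[OF a(1,2)] by simp
      then obtain u where u: "u \<in> W" "u \<odot>\<^bsub>line_list R\<^esub> (t \<odot>\<^bsub>line_list R\<^esub> [r]) = u \<odot>\<^bsub>line_list R\<^esub> (s \<odot>\<^bsub>line_list R\<^esub> [a])"
        using r x a by (subst (asm) LL.frac_eq_iff) (auto simp: line_list_simps)
      then have "u \<otimes> (t \<otimes> r) = u \<otimes> (s \<otimes> a)" by (simp add: line_list_simps)
      then have "LL.rf r s = LL.rf a t" using r x a u(1) Re.frac_eq_iff[of r s a t] by auto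
      then have c0s: "c 0 = LL.rf r s" using a by simp
      show "c = (\<lambda>i\<in>{..<1::nat}. LL.rf r s)"
      proof (rule extensionalityI)
        show "c \<in> extensional {..<1}" using c by (auto simp: PiE_def)
      qed (use c0s in auto)
    qed
  qed (use e in auto)
qed

definition line_disc :: "'a \<Rightarrow> ('a, 'a list) dual_sq"
  where "line_disc d = d \<odot>\<^bsub>tensor R (dual R (line_list R)) (dual R (line_list R))\<^esub>
    pure_tensor R (dual R (line_list R)) (dual R (line_list R)) line_coord line_coord"

text \<open>A class of discriminants, being a set of pairs on lists, gives information about a fiber
  only through a member. This member later yields an algebra S in the fiber together with an
  isomorphism of its discriminant onto (d, R).\<close>

lemma line_disc_mem:
  assumes "square_mod_4 R d"
  shows "(line_disc d, line_list R) \<in> scalar_disc_class R d"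
proof -
  obtain t r where tr: "t \<in> carrier R" "r \<in> carrier R" "d = t \<otimes> t \<oplus> [(4::nat)] \<cdot> r" and d: "d \<in> carrier R"
    using assms unfolding square_mod_4_def by blast
  interpret L: module R "line_list R" by (rule line_list_module)
  interpret D: two_modules R L.DM L.DM by (rule L.dual_two_modules)
  interpret re: module R "reg R" using assoc_algebra_reg by (simp add: assoc_algebra_def)
  note lc = line_coord_dual
  let ?p = "D.pt line_coord line_coord"
  have p: "?p \<in> carrier D.E" using lc by simp
  have dE: "line_disc d \<in> carrier D.E" unfolding line_disc_def using p d by simp
  have "discriminant R (line_disc d) (line_list R)"
    unfolding discriminant_def Let_def
  proof (intro conjI L.module_axioms line_list_locally_free dE)
    \<comment> \<open>With d = t^2 + 4r, the functional t times the coordinate is a square root of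
      the discriminant modulo 4.\<close>
    let ?t = "t \<odot>\<^bsub>L.DM\<^esub> line_coord"
    interpret Q2: quot_module R L.DM "multiples L.DM 2"
      by (intro quot_module.intro quot_module_axioms.intro L.dual_module module.multiples_submodule)
    interpret Q4: quot_module R D.E "multiples D.E 4"
      by (intro quot_module.intro quot_module_axioms.intro D.E.module_axioms D.E.multiples_submodule)
    have t: "?t \<in> carrier L.DM" using L.dual_closed(2) tr lc by blast
    have tt: "D.pt ?t ?t = (t \<otimes> t) \<odot>\<^bsub>D.E\<^esub> ?p"
      using tr lc t p by (simp add: D.pt_smult_l D.pt_smult_r D.E.smult_assoc1)
    have 4: "[(4::nat)] \<cdot> r = r \<oplus> r \<oplus> r \<oplus> r" using tr by (simp add: numeral_eq_Suc add.nat_pow_Suc)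
    \<comment> \<open>From t^2 - d = -4r: this is the tensor whose fourfold is the
      difference.\<close>
    define m where "m = \<ominus>\<^bsub>D.E\<^esub> (r \<odot>\<^bsub>D.E\<^esub> ?p)"
    have m: "m \<in> carrier D.E" using tr p by (simp add: m_def)
    have "D.pt ?t ?t \<ominus>\<^bsub>D.E\<^esub> line_disc d = [(4::nat)] \<cdot>\<^bsub>D.E\<^esub> m"
    proof -
      have "[(4::nat)] \<cdot>\<^bsub>D.E\<^esub> m = m \<oplus>\<^bsub>D.E\<^esub> m \<oplus>\<^bsub>D.E\<^esub> m \<oplus>\<^bsub>D.E\<^esub> m"
        using m by (simp add: numeral_eq_Suc D.E.M.add.nat_pow_Suc)
      also have "\<dots> = (t \<otimes> t \<ominus> d) \<odot>\<^bsub>D.E\<^esub> ?p"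
      proof -
        have "t \<otimes> t \<ominus> d = \<ominus> r \<oplus> \<ominus> r \<oplus> \<ominus> r \<oplus> \<ominus> r"
        proof -
          have "t \<otimes> t \<ominus> (t \<otimes> t \<oplus> (r \<oplus> r \<oplus> r \<oplus> r)) = \<ominus> r \<oplus> \<ominus> r \<oplus> \<ominus> r \<oplus> \<ominus> r"
            using tr(1,2) by algebra
          then show ?thesis by (simp only: tr(3) 4)
        qed
        moreover have "m = (\<ominus> r) \<odot>\<^bsub>D.E\<^esub> ?p" using tr p by (simp add: m_def D.E.smult_l_minus)
        ultimately show ?thesis using tr p by (simp add: D.E.smult_l_distr)
      qed
      finally show ?thesis
        unfolding tt line_disc_def using tr d p by (simp add: a_minus_def D.E.smult_l_distr D.E.smult_l_minus)
    qed
    then have "D.pt ?t ?t \<ominus>\<^bsub>D.E\<^esub> line_disc d \<in> multiples D.E 4" using m by (auto simp: multiples_def)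
    then have "multiples D.E 4 +>\<^bsub>D.E\<^esub> D.pt ?t ?t = multiples D.E 4 +>\<^bsub>D.E\<^esub> line_disc d"
      using t dE by (simp add: Q4.coset_eq_iff)
    then show "\<exists>X\<in>carrier (quot L.DM (multiples L.DM 2)). \<exists>t\<in>X.
        multiples D.E 4 +>\<^bsub>D.E\<^esub> D.pt t t = multiples D.E 4 +>\<^bsub>D.E\<^esub> line_disc d"
      using Q2.quot_closed[OF t] Q2.coset_self[OF t] by blast
  qed
  moreover have "(\<lambda>r. [r]) \<in> disc_iso R (d \<odot>\<^bsub>tensor R (dual R (reg R)) (dual R (reg R))\<^esub>
      pure_tensor R (dual R (reg R)) (dual R (reg R)) (\<lambda>x\<in>carrier R. x) (\<lambda>x\<in>carrier R. x))
      (reg R) (line_disc d) (line_list R)"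
  proof -
    have f: "(\<lambda>r. [r]) \<in> mod_hom R (reg R) (line_list R)" by (auto simp: mod_hom_def line_list_simps)
    interpret m: module_map R "reg R" "line_list R" "\<lambda>r. [r]"
      by (intro module_map.intro module_map_axioms.intro re.module_axioms L.module_axioms f)
    have "bij_betw (\<lambda>r. [r]) (carrier (reg R)) (carrier (line_list R))"
      by (auto simp: bij_betw_def inj_on_def line_list_simps)
    moreover have "dual_map (reg R) (\<lambda>r. [r]) line_coord = (\<lambda>x\<in>carrier R. x)"
      by (auto simp: dual_map_def line_coord_def line_list_simps fun_eq_iff restrict_def)
    ultimately show ?thesis
      unfolding disc_iso_def mod_iso_def line_disc_def using f m.dual_sq_map_pure[OF d lc lc] by simp
  qed
  ultimately show ?thesis unfolding scalar_disc_class_def disc_class_def Let_def by blast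
qed

text \<open>An element of the fiber is a class, and one representative that does not change suffices
  to fix it. The representative is an S whose discriminant is isomorphic to the scalar one: there
  every correction term has the form a d c 1, and da = 0.\<close>

lemma ann4_twist:
  assumes d: "square_mod_4 R d" and P: "P \<in> disc_fiber R (scalar_disc_class R d)" and a: "a \<in> ann4 R d"
  shows "\<exists>S\<in>P. twist R S a = S"
proof -
  have dc: "d \<in> carrier R" using d by (simp add: square_mod_4_def)
  have ac: "a \<in> carrier R" "d \<otimes> a = \<zero>" using a by (auto simp: ann4_def torsion4_iff)
  have PQ: "P \<in> Quad R" and PD: "disc R P = scalar_disc_class R d" using P by (auto simp: disc_fiber_def)
  obtain S where S: "S \<in> P" "(line_disc d, line_list R) \<in> disc_class R (disc_elem R S) (ext2 R S)"
    using line_disc_mem[OF d] unfolding PD[symmetric] disc_def by blast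
  interpret S: quadratic R S by (rule Quad_mem(1)[OF PQ S(1)])
  interpret X: ext_square R S by (rule ext_square.intro) (rule S.module_axioms)
  interpret L: module R "line_list R" by (rule line_list_module)
  obtain h where h: "h \<in> mod_hom R X.V (line_list R)" "bij_betw h (carrier X.V) (carrier (line_list R))"
    and hd: "dual_sq_map R X.V h (line_disc d) = disc_elem R S"
    using S(2) unfolding disc_class_def disc_iso_def mod_iso_def by blast
  interpret h: module_map R X.V "line_list R" h
    by (intro module_map.intro module_map_axioms.intro X.V.module_axioms L.module_axioms h(1))
  \<comment> \<open>The coordinate of R pulled back along h; in it the discriminant form of S is d
    times a square, which is the form required by \<open>disc_elem_line\<close>.\<close>
  define g where "g = dual_map X.V h line_coord"
  have de: "disc_elem R S = d \<odot>\<^bsub>tensor R (dual R X.V) (dual R X.V)\<^esub> pure_tensor R (dual R X.V) (dual R X.V) g g"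
    unfolding hd[symmetric] line_disc_def g_def by (rule h.dual_sq_map_pure[OF dc line_coord_dual line_coord_dual])
  have gv: "h l = [g l]" "g l \<in> carrier R" if "l \<in> carrier X.V" for l
    using h.f_closed[OF that] that by (auto simp: g_def dual_map_def line_coord_def line_list_simps)
  have "[\<one>] \<in> h ` carrier X.V" using h(2) by (auto simp: bij_betw_def line_list_simps)
  then obtain l0 where l0: "l0 \<in> carrier X.V" "h l0 = [\<one>]" by force
  have "line R X.V g l0"
  proof (intro line.intro X.V.module_axioms line_axioms.intro)
    show "g \<in> carrier (dual R X.V)" unfolding g_def by (rule h.dual_map_closed[OF line_coord_dual])
    show "g l0 = \<one>" using gv(1)[OF l0(1)] l0(2) by simp
    fix l assume l: "l \<in> carrier X.V"
    have "h (g l \<odot>\<^bsub>X.V\<^esub> l0) = h l"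
      using h(1) gv[OF l] l0 l by (auto simp: mod_hom_def line_list_simps)
    then show "l = g l \<odot>\<^bsub>X.V\<^esub> l0"
      using h(2) l l0 gv(2)[OF l] by (auto simp: bij_betw_def dest: inj_onD)
  qed (rule l0)
  note key = S.disc_elem_line[OF this dc de]
  have "mult (twist R S a) u v = mult S u v" for u v
  proof (cases "u \<in> carrier S \<and> v \<in> carrier S")
    case True
    obtain c where c: "c \<in> carrier R" "(u \<ominus>\<^bsub>S\<^esub> S.\<sigma> u) \<otimes>\<^bsub>S\<^esub> (v \<ominus>\<^bsub>S\<^esub> S.\<sigma> v) = (d \<otimes> c) \<odot>\<^bsub>S\<^esub> \<one>\<^bsub>S\<^esub>"
      by (rule key[of u v]) (use True in auto)
    have "a \<otimes> (d \<otimes> c) = (d \<otimes> a) \<otimes> c" using ac(1) dc c(1) by (simp only: m_ac m_closed)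
    then have "a \<odot>\<^bsub>S\<^esub> ((d \<otimes> c) \<odot>\<^bsub>S\<^esub> \<one>\<^bsub>S\<^esub>) = \<zero>\<^bsub>S\<^esub>" using ac dc c by (simp add: S.smult_assoc1[symmetric])
    then show ?thesis using True c ac by (simp add: twist_def a_minus_def)
  qed (auto simp: twist_def)
  then have "mult (twist R S a) = mult S" by blast
  then have "twist R S a = S" by (simp add: twist_def)
  then show ?thesis using S(1) by blast
qed

end

theorem theoremC:
  fixes R :: "('a, 'r) ring_scheme"
  assumes "cring R"
  shows "(\<forall>D\<in>Disc R. \<exists>!\<rho>. \<rho> \<in> extensional (carrier (AS R)) \<and> compatible_action R D \<rho>) \<and>
    (\<forall>d \<rho>. square_mod_4 R d \<longrightarrow> compatible_action R (scalar_disc_class R d) \<rho> \<longrightarrow>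
      (\<lambda>a. wp4 R +>\<^bsub>R\<^esub> a) ` ann4 R d
        \<subseteq> kernel (AS R) (BijGroup (disc_fiber R (scalar_disc_class R d))) \<rho>)"
proof -
  interpret cring R by fact
  have "\<exists>!\<rho>. \<rho> \<in> extensional (carrier (AS R)) \<and> compatible_action R D \<rho>" for D
  proof (rule ex_ex1I)
    show "\<exists>\<rho>. \<rho> \<in> extensional (carrier (AS R)) \<and> compatible_action R D \<rho>"
      by (rule exI, rule conjI[OF restrict_extensional compatible_action_exists])
  qed (blast intro: compatible_action_unique)
  moreover have "wp4 R +>\<^bsub>R\<^esub> a \<in> kernel (AS R) (BijGroup (disc_fiber R (scalar_disc_class R d))) \<rho>"
    if d: "square_mod_4 R d" and \<rho>: "compatible_action R (scalar_disc_class R d) \<rho>" and a: "a \<in> ann4 R d"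
    for d \<rho> a
  proof -
    define E where "E = disc_fiber R (scalar_disc_class R d)"
    define A where "A = wp4 R +>\<^bsub>R\<^esub> a"
    have a4: "a \<in> torsion4 R" using a by (simp add: ann4_def)
    have A: "A \<in> carrier (AS R)" "a \<in> A" using a4 AS_self by (auto simp: A_def AS_carrier)
    have ga: "group_action (AS R) E \<rho>" and eq: "\<And>P. P \<in> E \<Longrightarrow> \<rho> A P = quad_star R (as_incl R A) P"
      using \<rho> A(1) by (auto simp: compatible_action_def E_def)
    \<comment> \<open>The neutral element of \<open>BijGroup E\<close> is the identity restricted to
      E. Each P is fixed because its representative S from \<open>ann4_twist\<close> equals its own
      twist by a.\<close>
    have "\<rho> A = (\<lambda>P\<in>E. P)"
    proof (rule extensionalityI[of _ E])
      show "\<rho> A \<in> extensional E" using group_action.bij_prop0[OF ga A(1)] by (rule Bij_imp_extensional)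
      fix P assume P: "P \<in> E"
      then have PQ: "P \<in> Quad R" by (simp add: E_def disc_fiber_def)
      obtain S where S: "S \<in> P" "twist R S a = S" using ann4_twist[OF d P[unfolded E_def] a] by blast
      have "\<rho> A P = quad_class R (twist R S a)" using eq[OF P] quad_star_eq[OF A PQ S(1)] by simp
      then show "\<rho> A P = (\<lambda>P\<in>E. P) P" using S P Quad_mem(2)[OF PQ S(1)] by simp
    qed simp
    then show ?thesis using A(1) by (simp add: kernel_def BijGroup_def A_def[symmetric] E_def)
  qed
  ultimately show ?thesis by blast
qed

end
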